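(* Let $A$ be a reduced local ring of dimension one with maximal ideal $\mathfrak m$ and residue field $k(\mathfrak m)=A/\mathfrak m$, let $K$ be the algebraic closure of $k(\mathfrak m)$, and let the embedding dimension of $A$ be $\operatorname{emdim}(A)=\dim_{k(\mathfrak m)}(\mathfrak m/\mathfrak m^2)=r+1$. If the closed point of $\operatorname{Spec}(A)$ is ordinary and the geometric tangents of $\operatorname{Spec}(A)$ at its closed point are in generic position in $\mathbb A^{r+1}$, then the rings $G(A)\otimes_{k(\mathfrak m)}K$ and $G(A)$ are reduced.
   Context: All rings are commutative, with identity and noetherian. $G(A)=\bigoplus_{n\ge 0}\mathfrak m^n/\mathfrak m^{n+1}$ is the associated graded ring with respect to $\mathfrak m$, and $(\cdot)_{red}$ denotes the quotient by the nilradical. The closed point of $\operatorname{Spec}(A)$ is ordinary if the scheme $\operatorname{Proj}(G(A)\otimes_{k(\mathfrak m)}K)$ is reduced. $G(A)\otimes_{k(\mathfrak m)}K$ is a one-dimensional standard graded $K$-algebra of embedding dimension $r+1$, so $\operatorname{Spec}((G(A)\otimes_{k(\mathfrak m)}K)_{red})\subset\mathbb A^{r+1}_K$ is a finite union of lines through the origin, each corresponding to a point of $\operatorname{Proj}(G(A)\otimes_{k(\mathfrak m)}K)\subset\mathbb P^r_K$. These lines are the geometric tangents of $\operatorname{Spec}(A)$ at its closed point. Generic position: a set of $s$ points in $\mathbb P^r_K$, with (reduced) homogeneous coordinate ring $R=\bigoplus_n R_n$, is in generic position in $\mathbb P^r$ if $\dim_K R_n=\min\{s,\binom{n+r}{r}\}$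 for all $n\in\mathbb N$. A set of lines through the origin in $\mathbb A^{r+1}_K$ is in generic position in $\mathbb A^{r+1}$ if the corresponding set of points of $\mathbb P^r_K$ is in generic position in $\mathbb P^r$. *)

theory Defs
  imports "HOL-Algebra.Algebraic_Closure" "HOL-Algebra.Ideal_Product"
    "HOL-Algebra.Ring_Divisibility" "HOL-Algebra.IntRing" "HOL-Library.Extended_Nat"
begin

section \<open>Commutative algebra\<close>

definition reduced_ring :: "('a, 'c) ring_scheme \<Rightarrow> bool" where
  "reduced_ring R \<longleftrightarrow>
     (\<forall>x\<in>carrier R. \<forall>n::nat. x [^]\<^bsub>R\<^esub> n = \<zero>\<^bsub>R\<^esub> \<longrightarrow> x = \<zero>\<^bsub>R\<^esub>)"

definition nilradical :: "('a, 'c) ring_scheme \<Rightarrow> 'a set" where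
  "nilradical R = {x \<in> carrier R. \<exists>n::nat. x [^]\<^bsub>R\<^esub> n = \<zero>\<^bsub>R\<^esub>}"

definition red :: "('a, 'c) ring_scheme \<Rightarrow> 'a set ring" where
  "red R = R Quot nilradical R"

definition noetherian_local_ring :: "('a, 'c) ring_scheme \<Rightarrow> 'a set \<Rightarrow> bool" where
  "noetherian_local_ring A \<mm> \<longleftrightarrow>
     cring A \<and> noetherian_ring A \<and> maximalideal \<mm> A \<and> (\<forall>J. maximalideal J A \<longrightarrow> J = \<mm>)"

definition krull_dim :: "('a, 'c) ring_scheme \<Rightarrow> enat" where
  "krull_dim R = Sup {enat n | n. \<exists>P :: nat \<Rightarrow> 'a set.
     (\<forall>i\<le>n. primeideal (P i) R) \<and> (\<forall>i<n. P i \<subset> P (Suc i))}"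

primrec ideal_power :: "('a, 'c) ring_scheme \<Rightarrow> 'a set \<Rightarrow> nat \<Rightarrow> 'a set" where
  "ideal_power R I 0 = carrier R"
| "ideal_power R I (Suc n) = ideal_prod R (ideal_power R I n) I"


section \<open>The associated graded ring\<close>

text \<open>An element of \<open>G(A)\<close> is a finitely supported sequence whose \<open>n\<close>-th entry is a coset of
  \<open>\<mm>\<^sup>n\<^sup>+\<^sup>1\<close> meeting \<open>\<mm>\<^sup>n\<close>. The product of \<open>x + \<mm>\<^sup>i\<^sup>+\<^sup>1\<close> and \<open>y + \<mm>\<^sup>j\<^sup>+\<^sup>1\<close> is
  \<open>xy + \<mm>\<^sup>i\<^sup>+\<^sup>j\<^sup>+\<^sup>1\<close>, which is what \<^const>\<open>rcoset_mult\<close> modulo \<open>\<mm>\<^sup>i\<^sup>+\<^sup>j\<^sup>+\<^sup>1\<close> yields.\<close>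

definition gr :: "('a, 'c) ring_scheme \<Rightarrow> 'a set \<Rightarrow> (nat \<Rightarrow> 'a set) ring" where
  "gr A \<mm> =
    \<lparr> carrier = {f. (\<forall>n. \<exists>x \<in> ideal_power A \<mm> n. f n = ideal_power A \<mm> (Suc n) +>\<^bsub>A\<^esub> x) \<and>
                    finite {n. f n \<noteq> ideal_power A \<mm> (Suc n)}},
      monoid.mult = (\<lambda>f g n. finsum (A Quot ideal_power A \<mm> (Suc n))
                (\<lambda>i. rcoset_mult A (ideal_power A \<mm> (Suc n)) (f i) (g (n - i))) {..n}),
      one = (\<lambda>n. ideal_power A \<mm> (Suc n) +>\<^bsub>A\<^esub> (if n = 0 then \<one>\<^bsub>A\<^esub> else \<zero>\<^bsub>A\<^esub>)),
      zero = (\<lambda>n. ideal_power A \<mm> (Suc n)),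
      add = (\<lambda>f g n. f n <+>\<^bsub>A\<^esub> g n) \<rparr>"

definition gr_part :: "('a, 'c) ring_scheme \<Rightarrow> 'a set \<Rightarrow> nat \<Rightarrow> (nat \<Rightarrow> 'a set) set" where
  "gr_part A \<mm> n = {f \<in> carrier (gr A \<mm>). \<forall>i. i \<noteq> n \<longrightarrow> f i = ideal_power A \<mm> (Suc i)}"

text \<open>The identification of \<open>A/\<mm>\<close> with the degree zero part.\<close>

definition gr_const :: "('a, 'c) ring_scheme \<Rightarrow> 'a set \<Rightarrow> 'a set \<Rightarrow> (nat \<Rightarrow> 'a set)" where
  "gr_const A \<mm> c = (\<lambda>n. if n = 0 then c else ideal_power A \<mm> (Suc n))"

text \<open>\<open>emdim A \<mm> d\<close> says that \<open>\<mm>/\<mm>\<^sup>2\<close> has dimension \<open>d\<close> over \<open>A/\<mm>\<close>. Inside \<open>G(A)\<close>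
  these are the parts of degree one and zero, which allows the use of the library's
  \<^const>\<open>ring.dimension\<close>.\<close>

definition emdim :: "('a, 'c) ring_scheme \<Rightarrow> 'a set \<Rightarrow> nat \<Rightarrow> bool" where
  "emdim A \<mm> d \<longleftrightarrow> ring.dimension (gr A \<mm>) d (gr_const A \<mm> ` carrier (A Quot \<mm>)) (gr_part A \<mm> 1)"


section \<open>Monoid rings, polynomial rings and tensor products\<close>

definition monoid_ring ::
    "('a, 'c) ring_scheme \<Rightarrow> ('g, 'd) monoid_scheme \<Rightarrow> ('g \<Rightarrow> 'a) ring" where
  "monoid_ring R M =
    \<lparr> carrier = {f. (\<forall>x. f x \<in> carrier R) \<and> (\<forall>x. x \<notin> carrier M \<longrightarrow> f x = \<zero>\<^bsub>R\<^esub>) \<and>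
                    finite {x. f x \<noteq> \<zero>\<^bsub>R\<^esub>}},
      monoid.mult = (\<lambda>f g z. finsum R (\<lambda>(x, y). f x \<otimes>\<^bsub>R\<^esub> g y)
                {(x, y). f x \<noteq> \<zero>\<^bsub>R\<^esub> \<and> g y \<noteq> \<zero>\<^bsub>R\<^esub> \<and> x \<otimes>\<^bsub>M\<^esub> y = z}),
      one = (\<lambda>x. if x = \<one>\<^bsub>M\<^esub> then \<one>\<^bsub>R\<^esub> else \<zero>\<^bsub>R\<^esub>),
      zero = (\<lambda>x. \<zero>\<^bsub>R\<^esub>),
      add = (\<lambda>f g x. f x \<oplus>\<^bsub>R\<^esub> g x) \<rparr>"

text \<open>Exponents of monomials in \<open>X\<^sub>0, \<dots>, X\<^sub>r\<close>.\<close>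

definition exponents :: "nat \<Rightarrow> (nat \<Rightarrow> nat) monoid" where
  "exponents r = \<lparr> carrier = {\<mu>. \<forall>i>r. \<mu> i = 0}, monoid.mult = (\<lambda>\<mu> \<nu> i. \<mu> i + \<nu> i), one = (\<lambda>i. 0) \<rparr>"

abbreviation mpoly_ring :: "('b, 'd) ring_scheme \<Rightarrow> nat \<Rightarrow> ((nat \<Rightarrow> nat) \<Rightarrow> 'b) ring" where
  "mpoly_ring K r \<equiv> monoid_ring K (exponents r)"

definition mpoly_const :: "('b, 'd) ring_scheme \<Rightarrow> 'b \<Rightarrow> ((nat \<Rightarrow> nat) \<Rightarrow> 'b)" where
  "mpoly_const K c = (\<lambda>\<mu>. if \<mu> = (\<lambda>i. 0) then c else \<zero>\<^bsub>K\<^esub>)"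

definition forms :: "('b, 'd) ring_scheme \<Rightarrow> nat \<Rightarrow> nat \<Rightarrow> ((nat \<Rightarrow> nat) \<Rightarrow> 'b) set" where
  "forms K r n = {f \<in> carrier (mpoly_ring K r). \<forall>\<mu>. f \<mu> \<noteq> \<zero>\<^bsub>K\<^esub> \<longrightarrow> (\<Sum>i\<le>r. \<mu> i) = n}"

text \<open>The value of a polynomial over \<open>K\<close> at \<open>b\<^sub>0, \<dots>, b\<^sub>r\<close> in the \<open>K\<close>-algebra \<open>h : K \<rightarrow> B\<close>.\<close>

definition mpoly_eval :: "('b, 'd) ring_scheme \<Rightarrow> nat \<Rightarrow> ('e, 'f) ring_scheme \<Rightarrow> ('b \<Rightarrow> 'e) \<Rightarrow>
    (nat \<Rightarrow> 'e) \<Rightarrow> ((nat \<Rightarrow> nat) \<Rightarrow> 'b) \<Rightarrow> 'e" where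
  "mpoly_eval K r B h b f =
     finsum B (\<lambda>\<mu>. h (f \<mu>) \<otimes>\<^bsub>B\<^esub> finprod B (\<lambda>i. b i [^]\<^bsub>B\<^esub> \<mu> i) {..r}) {\<mu>. f \<mu> \<noteq> \<zero>\<^bsub>K\<^esub>}"

text \<open>The tensor product of the \<open>k\<close>-algebras \<open>\<phi> : k \<rightarrow> R\<close> and \<open>\<psi> : k \<rightarrow> S\<close>: the free abelian
  group on \<open>R \<times> S\<close> modulo the bilinearity relations. With \<open>(a, b)(a', b') = (aa', bb')\<close> the free
  abelian group is the monoid ring over \<open>\<int>\<close> of the multiplicative monoid \<open>R \<times> S\<close>; the subgroup
  generated by the relations is an ideal of it.\<close>

definition pair_gen :: "'a \<Rightarrow> 'b \<Rightarrow> ('a \<times> 'b \<Rightarrow> int)" where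
  "pair_gen a b = (\<lambda>p. if p = (a, b) then 1 else 0)"

definition tensor_ideal :: "('k, 'c) ring_scheme \<Rightarrow> ('a, 'd) ring_scheme \<Rightarrow> ('k \<Rightarrow> 'a) \<Rightarrow>
    ('b, 'e) ring_scheme \<Rightarrow> ('k \<Rightarrow> 'b) \<Rightarrow> ('a \<times> 'b \<Rightarrow> int) set" where
  "tensor_ideal k R \<phi> S \<psi> = Idl\<^bsub>monoid_ring \<Z> (R \<times>\<times> S)\<^esub>
    ({(\<lambda>p. pair_gen (a \<oplus>\<^bsub>R\<^esub> a') b p - (pair_gen a b p + pair_gen a' b p)) | a a' b.
        a \<in> carrier R \<and> a' \<in> carrier R \<and> b \<in> carrier S} \<union>
     {(\<lambda>p. pair_gen a (b \<oplus>\<^bsub>S\<^esub> b') p - (pair_gen a b p + pair_gen a b' p)) | a b b'.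
        a \<in> carrier R \<and> b \<in> carrier S \<and> b' \<in> carrier S} \<union>
     {(\<lambda>p. pair_gen (\<phi> c \<otimes>\<^bsub>R\<^esub> a) b p - pair_gen a (\<psi> c \<otimes>\<^bsub>S\<^esub> b) p) | a b c.
        a \<in> carrier R \<and> b \<in> carrier S \<and> c \<in> carrier k})"

definition tensor_ring :: "('k, 'c) ring_scheme \<Rightarrow> ('a, 'd) ring_scheme \<Rightarrow> ('k \<Rightarrow> 'a) \<Rightarrow>
    ('b, 'e) ring_scheme \<Rightarrow> ('k \<Rightarrow> 'b) \<Rightarrow> ('a \<times> 'b \<Rightarrow> int) set ring" where
  "tensor_ring k R \<phi> S \<psi> = monoid_ring \<Z> (R \<times>\<times> S) Quot tensor_ideal k R \<phi> S \<psi>"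

definition pure_tensor :: "('k, 'c) ring_scheme \<Rightarrow> ('a, 'd) ring_scheme \<Rightarrow> ('k \<Rightarrow> 'a) \<Rightarrow>
    ('b, 'e) ring_scheme \<Rightarrow> ('k \<Rightarrow> 'b) \<Rightarrow> 'a \<Rightarrow> 'b \<Rightarrow> ('a \<times> 'b \<Rightarrow> int) set" where
  "pure_tensor k R \<phi> S \<psi> a b =
     tensor_ideal k R \<phi> S \<psi> +>\<^bsub>monoid_ring \<Z> (R \<times>\<times> S)\<^esub> pair_gen a b"


section \<open>The scheme \<open>Proj S\<close>\<close>

text \<open>A graded ring is given by a ring \<open>S\<close> and the family \<open>Sn\<close> of its homogeneous parts.\<close>

definition homogeneous_ideal :: "('a, 'c) ring_scheme \<Rightarrow> (nat \<Rightarrow> 'a set) \<Rightarrow> 'a set \<Rightarrow> bool" where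
  "homogeneous_ideal S Sn I \<longleftrightarrow> ideal I S \<and> I = Idl\<^bsub>S\<^esub> (I \<inter> (\<Union>n. Sn n))"

definition irrelevant_ideal :: "('a, 'c) ring_scheme \<Rightarrow> (nat \<Rightarrow> 'a set) \<Rightarrow> 'a set" where
  "irrelevant_ideal S Sn = Idl\<^bsub>S\<^esub> (\<Union>n\<in>{1..}. Sn n)"

definition Proj :: "('a, 'c) ring_scheme \<Rightarrow> (nat \<Rightarrow> 'a set) \<Rightarrow> 'a set set" where
  "Proj S Sn = {p. primeideal p S \<and> homogeneous_ideal S Sn p \<and> \<not> irrelevant_ideal S Sn \<subseteq> p}"

definition Proj_open :: "('a, 'c) ring_scheme \<Rightarrow> (nat \<Rightarrow> 'a set) \<Rightarrow> 'a set set \<Rightarrow> bool" where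
  "Proj_open S Sn U \<longleftrightarrow> (\<exists>I. homogeneous_ideal S Sn I \<and> U = {p \<in> Proj S Sn. \<not> I \<subseteq> p})"

text \<open>The homogeneous localization \<open>S\<^sub>(\<^sub>p\<^sub>)\<close>: fractions of homogeneous elements of equal degree with
  denominator outside \<open>p\<close>, a fraction being the class of all pairs representing it.\<close>

definition hfrac :: "('a, 'c) ring_scheme \<Rightarrow> (nat \<Rightarrow> 'a set) \<Rightarrow> 'a set \<Rightarrow> 'a \<Rightarrow> 'a \<Rightarrow> ('a \<times> 'a) set" where
  "hfrac S Sn p f g = {(f', g'). (\<exists>n. f' \<in> Sn n \<and> g' \<in> Sn n) \<and> g' \<notin> p \<and>
     (\<exists>d. \<exists>t \<in> Sn d. t \<notin> p \<and> t \<otimes>\<^bsub>S\<^esub> (f \<otimes>\<^bsub>S\<^esub> g') = t \<otimes>\<^bsub>S\<^esub> (f' \<otimes>\<^bsub>S\<^esub> g))}"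

definition hlocalization ::
    "('a, 'c) ring_scheme \<Rightarrow> (nat \<Rightarrow> 'a set) \<Rightarrow> 'a set \<Rightarrow> ('a \<times> 'a) set ring" where
  "hlocalization S Sn p =
    \<lparr> carrier = {hfrac S Sn p f g | f g n. f \<in> Sn n \<and> g \<in> Sn n \<and> g \<notin> p},
      monoid.mult = (\<lambda>F G. \<Union>{hfrac S Sn p (f \<otimes>\<^bsub>S\<^esub> f') (g \<otimes>\<^bsub>S\<^esub> g') | f g f' g'.
               (f, g) \<in> F \<and> (f', g') \<in> G}),
      one = hfrac S Sn p \<one>\<^bsub>S\<^esub> \<one>\<^bsub>S\<^esub>,
      zero = hfrac S Sn p \<zero>\<^bsub>S\<^esub> \<one>\<^bsub>S\<^esub>,
      add = (\<lambda>F G. \<Union>{hfrac S Sn p ((f \<otimes>\<^bsub>S\<^esub> g') \<oplus>\<^bsub>S\<^esub> (f' \<otimes>\<^bsub>S\<^esub> g)) (g \<otimes>\<^bsub>S\<^esub> g') | f g f' g'.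
               (f, g) \<in> F \<and> (f', g') \<in> G}) \<rparr>"

text \<open>The ring of sections over \<open>U\<close> of the structure sheaf: functions into the homogeneous
  localizations that are locally given by a fraction.\<close>

definition Proj_sections ::
    "('a, 'c) ring_scheme \<Rightarrow> (nat \<Rightarrow> 'a set) \<Rightarrow> 'a set set \<Rightarrow> ('a set \<Rightarrow> ('a \<times> 'a) set) ring" where
  "Proj_sections S Sn U =
    \<lparr> carrier = {s \<in> (\<Pi>\<^sub>E p\<in>U. carrier (hlocalization S Sn p)).
        \<forall>p\<in>U. \<exists>V. Proj_open S Sn V \<and> p \<in> V \<and> V \<subseteq> U \<and>
          (\<exists>n. \<exists>a\<in>Sn n. \<exists>b\<in>Sn n. \<forall>q\<in>V. b \<notin> q \<and> s q = hfrac S Sn q a b)},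
      monoid.mult = (\<lambda>s t. \<lambda>p\<in>U. s p \<otimes>\<^bsub>hlocalization S Sn p\<^esub> t p),
      one = (\<lambda>p\<in>U. \<one>\<^bsub>hlocalization S Sn p\<^esub>),
      zero = (\<lambda>p\<in>U. \<zero>\<^bsub>hlocalization S Sn p\<^esub>),
      add = (\<lambda>s t. \<lambda>p\<in>U. s p \<oplus>\<^bsub>hlocalization S Sn p\<^esub> t p) \<rparr>"

definition Proj_reduced :: "('a, 'c) ring_scheme \<Rightarrow> (nat \<Rightarrow> 'a set) \<Rightarrow> bool" where
  "Proj_reduced S Sn \<longleftrightarrow> (\<forall>U. Proj_open S Sn U \<longrightarrow> reduced_ring (Proj_sections S Sn U))"


section \<open>Points of projective space and generic position\<close>

text \<open>A point of \<open>\<P>\<^sup>r\<^sub>K\<close> is a line through the origin of \<open>\<A>\<^sup>r\<^sup>+\<^sup>1\<^sub>K\<close>, so that sets of points of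
  \<open>\<P>\<^sup>r\<^sub>K\<close> and sets of such lines are the same thing.\<close>

definition affine_space :: "('b, 'd) ring_scheme \<Rightarrow> nat \<Rightarrow> (nat \<Rightarrow> 'b) set" where
  "affine_space K r = (\<Pi>\<^sub>E i\<in>{..r}. carrier K)"

definition proj_points :: "('b, 'd) ring_scheme \<Rightarrow> nat \<Rightarrow> (nat \<Rightarrow> 'b) set set" where
  "proj_points K r = {{(\<lambda>i\<in>{..r}. c \<otimes>\<^bsub>K\<^esub> v i) | c. c \<in> carrier K} | v.
     v \<in> affine_space K r \<and> (\<exists>i\<le>r. v i \<noteq> \<zero>\<^bsub>K\<^esub>)}"

definition vanishing_ideal ::
    "('b, 'd) ring_scheme \<Rightarrow> nat \<Rightarrow> (nat \<Rightarrow> 'b) set set \<Rightarrow> ((nat \<Rightarrow> nat) \<Rightarrow> 'b) set" where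
  "vanishing_ideal K r Z = Idl\<^bsub>mpoly_ring K r\<^esub>
     {f. \<exists>n. f \<in> forms K r n \<and> (\<forall>L\<in>Z. \<forall>v\<in>L. mpoly_eval K r K (\<lambda>c. c) v f = \<zero>\<^bsub>K\<^esub>)}"

definition coord_ring ::
    "('b, 'd) ring_scheme \<Rightarrow> nat \<Rightarrow> (nat \<Rightarrow> 'b) set set \<Rightarrow> ((nat \<Rightarrow> nat) \<Rightarrow> 'b) set ring" where
  "coord_ring K r Z = mpoly_ring K r Quot vanishing_ideal K r Z"

definition coord_proj :: "('b, 'd) ring_scheme \<Rightarrow> nat \<Rightarrow> (nat \<Rightarrow> 'b) set set \<Rightarrow>
    ((nat \<Rightarrow> nat) \<Rightarrow> 'b) \<Rightarrow> ((nat \<Rightarrow> nat) \<Rightarrow> 'b) set" where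
  "coord_proj K r Z f = vanishing_ideal K r Z +>\<^bsub>mpoly_ring K r\<^esub> f"

definition generic_position :: "('b, 'd) ring_scheme \<Rightarrow> nat \<Rightarrow> (nat \<Rightarrow> 'b) set set \<Rightarrow> bool" where
  "generic_position K r Z \<longleftrightarrow> Z \<subseteq> proj_points K r \<and> finite Z \<and>
     (\<forall>n. ring.dimension (coord_ring K r Z) (min (card Z) ((n + r) choose r))
            (coord_proj K r Z ` mpoly_const K ` carrier K) (coord_proj K r Z ` forms K r n))"


section \<open>The geometric tangent cone\<close>

text \<open>Here \<open>\<iota> : A/\<mm> \<rightarrow> K\<close> is the inclusion of the residue field.\<close>

definition gr_ext :: "('a, 'c) ring_scheme \<Rightarrow> 'a set \<Rightarrow> ('b, 'd) ring_scheme \<Rightarrow> ('a set \<Rightarrow> 'b) \<Rightarrow>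
    ((nat \<Rightarrow> 'a set) \<times> 'b \<Rightarrow> int) set ring" where
  "gr_ext A \<mm> K \<iota> = tensor_ring (A Quot \<mm>) (gr A \<mm>) (gr_const A \<mm>) K \<iota>"

definition gr_ext_tensor :: "('a, 'c) ring_scheme \<Rightarrow> 'a set \<Rightarrow> ('b, 'd) ring_scheme \<Rightarrow>
    ('a set \<Rightarrow> 'b) \<Rightarrow> (nat \<Rightarrow> 'a set) \<Rightarrow> 'b \<Rightarrow> ((nat \<Rightarrow> 'a set) \<times> 'b \<Rightarrow> int) set" where
  "gr_ext_tensor A \<mm> K \<iota> g c = pure_tensor (A Quot \<mm>) (gr A \<mm>) (gr_const A \<mm>) K \<iota> g c"

definition gr_ext_const :: "('a, 'c) ring_scheme \<Rightarrow> 'a set \<Rightarrow> ('b, 'd) ring_scheme \<Rightarrow>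
    ('a set \<Rightarrow> 'b) \<Rightarrow> 'b \<Rightarrow> ((nat \<Rightarrow> 'a set) \<times> 'b \<Rightarrow> int) set" where
  "gr_ext_const A \<mm> K \<iota> c = gr_ext_tensor A \<mm> K \<iota> \<one>\<^bsub>gr A \<mm>\<^esub> c"

definition gr_ext_part :: "('a, 'c) ring_scheme \<Rightarrow> 'a set \<Rightarrow> ('b, 'd) ring_scheme \<Rightarrow>
    ('a set \<Rightarrow> 'b) \<Rightarrow> nat \<Rightarrow> ((nat \<Rightarrow> 'a set) \<times> 'b \<Rightarrow> int) set set" where
  "gr_ext_part A \<mm> K \<iota> n = generate (add_monoid (gr_ext A \<mm> K \<iota>))
     {gr_ext_tensor A \<mm> K \<iota> g c | g c. g \<in> gr_part A \<mm> n \<and> c \<in> carrier K}"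

definition closed_point_ordinary ::
    "('a, 'c) ring_scheme \<Rightarrow> 'a set \<Rightarrow> ('b, 'd) ring_scheme \<Rightarrow> ('a set \<Rightarrow> 'b) \<Rightarrow> bool" where
  "closed_point_ordinary A \<mm> K \<iota> \<longleftrightarrow> Proj_reduced (gr_ext A \<mm> K \<iota>) (gr_ext_part A \<mm> K \<iota>)"

text \<open>The embedding of \<open>Spec (G(A) \<otimes> K)\<close> into \<open>\<A>\<^sup>r\<^sup>+\<^sup>1\<^sub>K\<close> depends on the choice of a basis
  \<open>x\<^sub>0, \<dots>, x\<^sub>r\<close> of the part of degree one.\<close>

definition tangent_coordinates :: "('a, 'c) ring_scheme \<Rightarrow> 'a set \<Rightarrow> ('b, 'd) ring_scheme \<Rightarrow>
    ('a set \<Rightarrow> 'b) \<Rightarrow> nat \<Rightarrow> (nat \<Rightarrow> ((nat \<Rightarrow> 'a set) \<times> 'b \<Rightarrow> int) set) \<Rightarrow> bool" where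
  "tangent_coordinates A \<mm> K \<iota> r x \<longleftrightarrow>
     ring.independent (gr_ext A \<mm> K \<iota>) (gr_ext_const A \<mm> K \<iota> ` carrier K) (map x [0..<Suc r]) \<and>
     ring.Span (gr_ext A \<mm> K \<iota>) (gr_ext_const A \<mm> K \<iota> ` carrier K) (map x [0..<Suc r])
       = gr_ext_part A \<mm> K \<iota> 1"

text \<open>The ideal of the closed subscheme \<open>Spec ((G(A) \<otimes> K)\<^sub>r\<^sub>e\<^sub>d)\<close> of \<open>\<A>\<^sup>r\<^sup>+\<^sup>1\<^sub>K\<close>, and the lines
  through the origin contained in that subscheme.\<close>

definition tangent_ideal :: "('a, 'c) ring_scheme \<Rightarrow> 'a set \<Rightarrow> ('b, 'd) ring_scheme \<Rightarrow>
    ('a set \<Rightarrow> 'b) \<Rightarrow> nat \<Rightarrow> (nat \<Rightarrow> ((nat \<Rightarrow> 'a set) \<times> 'b \<Rightarrow> int) set) \<Rightarrow>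
    ((nat \<Rightarrow> nat) \<Rightarrow> 'b) set" where
  "tangent_ideal A \<mm> K \<iota> r x =
    (let T = gr_ext A \<mm> K \<iota>; \<pi> = (\<lambda>y. nilradical T +>\<^bsub>T\<^esub> y)
     in {f \<in> carrier (mpoly_ring K r).
           mpoly_eval K r (red T) (\<lambda>c. \<pi> (gr_ext_const A \<mm> K \<iota> c)) (\<lambda>i. \<pi> (x i)) f
             = \<zero>\<^bsub>red T\<^esub>})"

definition geometric_tangents :: "('a, 'c) ring_scheme \<Rightarrow> 'a set \<Rightarrow> ('b, 'd) ring_scheme \<Rightarrow>
    ('a set \<Rightarrow> 'b) \<Rightarrow> nat \<Rightarrow> (nat \<Rightarrow> ((nat \<Rightarrow> 'a set) \<times> 'b \<Rightarrow> int) set) \<Rightarrow>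
    (nat \<Rightarrow> 'b) set set" where
  "geometric_tangents A \<mm> K \<iota> r x = {L \<in> proj_points K r.
     \<forall>v\<in>L. \<forall>f\<in>tangent_ideal A \<mm> K \<iota> r x. mpoly_eval K r K (\<lambda>c. c) v f = \<zero>\<^bsub>K\<^esub>}"

end

theory Submission
  imports Defs
begin

text \<open>Let \<open>T = G(A) \<otimes> K\<close>, let \<open>s\<close> be the number of tangents, and let \<open>t \<in> T\<^sub>n\<close> be nilpotent. By the
  graded Nullstellensatz, nilpotency means vanishing on all tangents. If \<open>s \<ge> (n+r choose r)\<close>, generic
  position says that no nonzero form of degree \<open>n\<close> vanishes at all \<open>s\<close> points, so \<open>t = 0\<close>. In large
  degrees, \<open>Proj T\<close> being reduced gives \<open>t = 0\<close>. For the remaining \<open>n\<close>, the coordinate ring of the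
  points has dimension \<open>s\<close> in all degrees \<open>\<ge> n\<close>. Prime avoidance provides a homogeneous \<open>y \<in> G(A)\<close>
  of large degree \<open>d\<close> that vanishes at no point, and equality of dimensions gives
  \<open>T\<^sub>i\<^sub>+\<^sub>d = y T\<^sub>i\<close> for \<open>i \<ge> n\<close>. By faithfully flat descent and Nakayama's lemma, a lift \<open>a\<close> of \<open>y\<close>
  satisfies \<open>\<mm>\<^sup>i\<^sup>+\<^sup>d = a \<mm>\<^sup>i\<close> for \<open>i \<ge> n\<close>. As \<open>A\<close> is reduced, \<open>a\<close> is not a zero divisor, hence
  multiplication by \<open>y\<close> is injective on \<open>T\<^sub>n\<close>. But \<open>y t\<close> is nilpotent of large degree, so \<open>y t = 0\<close>
  and \<open>t = 0\<close>.\<close>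

section \<open>Monoid rings\<close>

text \<open>A dimension count on T cannot exclude nilpotents, since only the coordinate ring of the
  points has known dimensions. Injectivity on T has to come from A, the reduced object at hand, and
  this is why y is taken from G(A): only such elements have a lift. The residue field may be finite,
  so no linear form over it need avoid all tangents; allowing forms of any degree cures this. The
  implication from "y maps \<open>T_i\<close> onto \<open>T_(i+d)\<close> for all i from some degree
  on" to "y is injective from that degree on" is used three times, with different sources of
  surjectivity. For y avoiding the tangents the Nullstellensatz gives it in large degrees, which
  removes the torsion left by reducedness of Proj. For a high power of y, equal dimensions give it
  from degree n on. For y = 0 it would hold if there were no tangents at all, which is absurd. The
  degree of y has to be large because equal dimensions only give \<open>T_(i+d) = y T_i\<close> up
  to elements vanishing at the points, and these are known to be zero only in large degrees.\<close>

definition single :: "('a, 'c) ring_scheme \<Rightarrow> 'g \<Rightarrow> 'a \<Rightarrow> ('g \<Rightarrow> 'a)" where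
  "single R x a = (\<lambda>z. if z = x then a else \<zero>\<^bsub>R\<^esub>)"

text \<open>One formula covers two later maps: with \<open>\<alpha> a x\<close> equal to h a times a
  monomial it is evaluation of polynomials; with \<open>\<alpha> n p\<close> equal to n times the
  value of a pairing at p it is the map induced on the free abelian group over pairs.\<close>

definition additive_extension ::
    "('a, 'c) ring_scheme \<Rightarrow> ('b, 'd) ring_scheme \<Rightarrow> ('a \<Rightarrow> 'g \<Rightarrow> 'b) \<Rightarrow> ('g \<Rightarrow> 'a) \<Rightarrow> 'b" where
  "additive_extension R B \<alpha> f = finsum B (\<lambda>x. \<alpha> (f x) x) {x. f x \<noteq> \<zero>\<^bsub>R\<^esub>}"

text \<open>Two instances matter: integers over the multiplicative monoid of R x S, whose quotient
  is the tensor product, and a coefficient ring over exponent vectors, which gives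
  polynomials.\<close>

locale monoid_algebra = R?: cring R + M?: comm_monoid M
  for R (structure) and M (structure)
begin

abbreviation "RM \<equiv> monoid_ring R M"

lemma RM_simps:
  "\<zero>\<^bsub>RM\<^esub> = (\<lambda>x. \<zero>)" "f \<oplus>\<^bsub>RM\<^esub> g = (\<lambda>x. f x \<oplus> g x)"
  "\<one>\<^bsub>RM\<^esub> = single R \<one>\<^bsub>M\<^esub> \<one>"
  by (auto simp: monoid_ring_def single_def)

lemma RM_carrierD:
  assumes "f \<in> carrier RM"
  shows "f x \<in> carrier R" "f x \<noteq> \<zero> \<Longrightarrow> x \<in> carrier M" "finite {x. f x \<noteq> \<zero>}"
  using assms by (auto simp: monoid_ring_def)

lemma RM_carrierI:
  "\<lbrakk>\<And>x. f x \<in> carrier R; \<And>x. f x \<noteq> \<zero> \<Longrightarrow> x \<in> carrier M; finite {x. f x \<noteq> \<zero>}\<rbrakk> \<Longrightarrow> f \<in> carrier RM"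
  by (auto simp: monoid_ring_def)

lemma single_closed [simp]: "\<lbrakk>x \<in> carrier M; a \<in> carrier R\<rbrakk> \<Longrightarrow> single R x a \<in> carrier RM"
  by (auto simp: single_def intro!: RM_carrierI split: if_splits)

lemma single_supp: "single R x a z \<noteq> \<zero> \<Longrightarrow> z = x"
  by (auto simp: single_def split: if_splits)

lemma RM_add_closed: "\<lbrakk>f \<in> carrier RM; g \<in> carrier RM\<rbrakk> \<Longrightarrow> f \<oplus>\<^bsub>RM\<^esub> g \<in> carrier RM"
proof (rule RM_carrierI)
  assume f: "f \<in> carrier RM" and g: "g \<in> carrier RM"
  show "(f \<oplus>\<^bsub>RM\<^esub> g) x \<in> carrier R" for x
    using RM_carrierD(1)[OF f] RM_carrierD(1)[OF g] by (simp add: RM_simps)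
  have sub: "{x. (f \<oplus>\<^bsub>RM\<^esub> g) x \<noteq> \<zero>} \<subseteq> {x. f x \<noteq> \<zero>} \<union> {x. g x \<noteq> \<zero>}"
    by (auto simp: RM_simps)
  then show "finite {x. (f \<oplus>\<^bsub>RM\<^esub> g) x \<noteq> \<zero>}"
    using RM_carrierD(3)[OF f] RM_carrierD(3)[OF g] by (metis finite_UnI finite_subset)
  show "x \<in> carrier M" if "(f \<oplus>\<^bsub>RM\<^esub> g) x \<noteq> \<zero>" for x
    using that sub RM_carrierD(2)[OF f] RM_carrierD(2)[OF g] by blast
qed

lemma RM_abelian_group: "abelian_group RM"
proof (rule abelian_groupI)
  show "\<zero>\<^bsub>RM\<^esub> \<in> carrier RM" by (auto simp: RM_simps intro!: RM_carrierI)
  fix f assume f: "f \<in> carrier RM"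
  note D = RM_carrierD(1)[OF f]
  show "\<exists>g\<in>carrier RM. g \<oplus>\<^bsub>RM\<^esub> f = \<zero>\<^bsub>RM\<^esub>"
  proof
    show "(\<lambda>x. \<ominus> f x) \<in> carrier RM"
    proof (rule RM_carrierI)
      have "{x. \<ominus> f x \<noteq> \<zero>} \<subseteq> {x. f x \<noteq> \<zero>}" by auto
      then show "finite {x. \<ominus> f x \<noteq> \<zero>}" using RM_carrierD(3)[OF f] finite_subset by blast
      show "x \<in> carrier M" if "\<ominus> f x \<noteq> \<zero>" for x
        using that RM_carrierD(2)[OF f, of x] by force
    qed (use D in auto)
  qed (use D in \<open>auto simp: RM_simps R.l_neg\<close>)
  show "\<zero>\<^bsub>RM\<^esub> \<oplus>\<^bsub>RM\<^esub> f = f" using D by (auto simp: RM_simps)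
  fix g assume g: "g \<in> carrier RM"
  show "f \<oplus>\<^bsub>RM\<^esub> g = g \<oplus>\<^bsub>RM\<^esub> f" "f \<oplus>\<^bsub>RM\<^esub> g \<in> carrier RM"
    using D RM_carrierD(1)[OF g] RM_add_closed[OF f g] by (auto simp: RM_simps R.a_comm)
  fix h assume h: "h \<in> carrier RM"
  show "f \<oplus>\<^bsub>RM\<^esub> g \<oplus>\<^bsub>RM\<^esub> h = f \<oplus>\<^bsub>RM\<^esub> (g \<oplus>\<^bsub>RM\<^esub> h)"
    using D RM_carrierD(1)[OF g] RM_carrierD(1)[OF h] by (auto simp: RM_simps R.a_assoc)
qed

text \<open>Needed because \<open>tensor_ideal\<close> writes its generators with pointwise
  subtraction, whereas facts about ideals speak of subtraction in the ring.\<close>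

lemma RM_minus:
  assumes f: "f \<in> carrier RM" and g: "g \<in> carrier RM"
  shows "f \<ominus>\<^bsub>RM\<^esub> g = (\<lambda>x. f x \<ominus> g x)"
proof -
  interpret RM: abelian_group RM by (rule RM_abelian_group)
  have "f x = (f \<ominus>\<^bsub>RM\<^esub> g) x \<oplus> g x" for x
  proof -
    have "f = (f \<ominus>\<^bsub>RM\<^esub> g) \<oplus>\<^bsub>RM\<^esub> g"
      using f g by (simp add: a_minus_def RM.a_assoc RM.l_neg)
    then show ?thesis by (metis RM_simps(2))
  qed
  then show ?thesis
    using RM_carrierD(1)[OF RM.minus_closed[OF f g]] RM_carrierD(1)[OF g]
    by (auto simp: fun_eq_iff a_minus_def R.a_assoc R.r_neg)
qed

text \<open>One point of the finite support is split off at a time. Identities that are additive in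
  each argument are reduced to monomials by this rule.\<close>

lemma RM_induct [consumes 1, case_names single add]:
  assumes f: "f \<in> carrier RM"
    and sg: "\<And>x a. \<lbrakk>x \<in> carrier M; a \<in> carrier R\<rbrakk> \<Longrightarrow> P (single R x a)"
    and ad: "\<And>f g. \<lbrakk>f \<in> carrier RM; g \<in> carrier RM; P f; P g\<rbrakk> \<Longrightarrow> P (f \<oplus>\<^bsub>RM\<^esub> g)"
  shows "P f"
proof -
  have "finite S \<Longrightarrow> f \<in> carrier RM \<Longrightarrow> {x. f x \<noteq> \<zero>} \<subseteq> S \<Longrightarrow> P f" for S f
  proof (induction S arbitrary: f rule: finite_induct)
    case empty
    \<comment> \<open>Zero counts as a monomial with coefficient zero, which is why the rule has no
      separate case for it.\<close>
    then have "f = single R \<one>\<^bsub>M\<^esub> \<zero>" by (auto simp: single_def)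
    then show ?case using sg[of "\<one>\<^bsub>M\<^esub>" "\<zero>"] by simp
  next
    case (insert x S)
    note D = RM_carrierD[OF insert.prems(1)]
    show ?case
    proof (cases "f x = \<zero>")
      case True
      then show ?thesis using insert.prems by (intro insert.IH) auto
    next
      case False
      let ?g = "f(x := \<zero>)"
      have "{y. ?g y \<noteq> \<zero>} \<subseteq> {y. f y \<noteq> \<zero>}" by auto
      then have fin: "finite {y. ?g y \<noteq> \<zero>}" using D(3) finite_subset by blast
      have g: "?g \<in> carrier RM"
        by (rule RM_carrierI[OF _ _ fin]) (use D in \<open>auto split: if_splits\<close>)
      have "P ?g" by (rule insert.IH[OF g]) (use insert.prems in auto)
      moreover have "f = single R x (f x) \<oplus>\<^bsub>RM\<^esub> ?g"
        using D by (auto simp: RM_simps single_def)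
      ultimately show ?thesis
        using ad[OF single_closed[OF D(2)[OF False] D(1)] g] sg[OF D(2)[OF False] D(1)] by metis
    qed
  qed
  then show ?thesis using f RM_carrierD(3)[OF f] by blast
qed

text \<open>The defining sum runs over the exact supports, which shrink when terms cancel. Enlarging
  them to arbitrary finite sets lets products with different supports be compared over one index
  set.\<close>

lemma RM_mult_eq:
  assumes f: "f \<in> carrier RM" and g: "g \<in> carrier RM"
    and A: "finite A" "{x. f x \<noteq> \<zero>} \<subseteq> A" and B: "finite B" "{x. g x \<noteq> \<zero>} \<subseteq> B"
  shows "(f \<otimes>\<^bsub>RM\<^esub> g) z = finsum R (\<lambda>(x, y). f x \<otimes> g y) {(x, y) \<in> A \<times> B. x \<otimes>\<^bsub>M\<^esub> y = z}"
proof -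
  note D = RM_carrierD(1)[OF f] RM_carrierD(1)[OF g]
  have "(f \<otimes>\<^bsub>RM\<^esub> g) z = finsum R (\<lambda>(x, y). f x \<otimes> g y) {(x, y). f x \<noteq> \<zero> \<and> g y \<noteq> \<zero> \<and> x \<otimes>\<^bsub>M\<^esub> y = z}"
    by (simp add: monoid_ring_def)
  also have "\<dots> = finsum R (\<lambda>(x, y). f x \<otimes> g y) {(x, y) \<in> A \<times> B. x \<otimes>\<^bsub>M\<^esub> y = z}"
  proof (rule R.add.finprod_mono_neutral_cong_left)
    show "finite {(x, y) \<in> A \<times> B. x \<otimes>\<^bsub>M\<^esub> y = z}"
      by (rule finite_subset[of _ "A \<times> B"]) (use A B in auto)
    show "{(x, y). f x \<noteq> \<zero> \<and> g y \<noteq> \<zero> \<and> x \<otimes>\<^bsub>M\<^esub> y = z} \<subseteq> {(x, y) \<in> A \<times> B. x \<otimes>\<^bsub>M\<^esub> y = z}"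
      using A B by auto
    show "(case p of (x, y) \<Rightarrow> f x \<otimes> g y) = \<zero>"
      if "p \<in> {(x, y) \<in> A \<times> B. x \<otimes>\<^bsub>M\<^esub> y = z} - {(x, y). f x \<noteq> \<zero> \<and> g y \<noteq> \<zero> \<and> x \<otimes>\<^bsub>M\<^esub> y = z}" for p
    proof -
      obtain x y where p: "p = (x, y)" by (cases p)
      then have "f x = \<zero> \<or> g y = \<zero>" using that by auto
      then show ?thesis using D[of x] D(2)[of y] unfolding p by (metis case_prod_conv R.l_null R.r_null)
    qed
  qed (use D in auto)
  finally show ?thesis .
qed

lemma RM_mult_closed:
  assumes f: "f \<in> carrier RM" and g: "g \<in> carrier RM"
  shows "f \<otimes>\<^bsub>RM\<^esub> g \<in> carrier RM"
proof (rule RM_carrierI)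
  let ?A = "{x. f x \<noteq> \<zero>}" and ?B = "{x. g x \<noteq> \<zero>}"
  have fin: "finite ?A" "finite ?B" using RM_carrierD(3) f g by auto
  note eq = RM_mult_eq[OF f g fin(1) order_refl fin(2) order_refl]
  show "(f \<otimes>\<^bsub>RM\<^esub> g) z \<in> carrier R" for z
    unfolding eq using RM_carrierD(1)[OF f] RM_carrierD(1)[OF g]
    by (intro R.finsum_closed) auto
  have ne: "\<exists>x\<in>?A. \<exists>y\<in>?B. x \<otimes>\<^bsub>M\<^esub> y = z" if "(f \<otimes>\<^bsub>RM\<^esub> g) z \<noteq> \<zero>" for z
  proof (rule ccontr)
    assume "\<not> ?thesis"
    then have "{(x, y) \<in> ?A \<times> ?B. x \<otimes>\<^bsub>M\<^esub> y = z} = {}" by auto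
    then have "(f \<otimes>\<^bsub>RM\<^esub> g) z = \<zero>" unfolding eq by (simp only: R.finsum_empty)
    then show False using that by simp
  qed
  have "{z. (f \<otimes>\<^bsub>RM\<^esub> g) z \<noteq> \<zero>} \<subseteq> (\<lambda>(x, y). x \<otimes>\<^bsub>M\<^esub> y) ` (?A \<times> ?B)"
    using ne by fastforce
  then show "finite {z. (f \<otimes>\<^bsub>RM\<^esub> g) z \<noteq> \<zero>}"
    using fin by (meson finite_SigmaI finite_imageI finite_subset)
  show "z \<in> carrier M" if "(f \<otimes>\<^bsub>RM\<^esub> g) z \<noteq> \<zero>" for z
    using ne[OF that] RM_carrierD(2)[OF f] RM_carrierD(2)[OF g] by auto
qed

lemma RM_l_distr:
  assumes f: "f \<in> carrier RM" and f': "f' \<in> carrier RM" and g: "g \<in> carrier RM"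
  shows "(f \<oplus>\<^bsub>RM\<^esub> f') \<otimes>\<^bsub>RM\<^esub> g = (f \<otimes>\<^bsub>RM\<^esub> g) \<oplus>\<^bsub>RM\<^esub> (f' \<otimes>\<^bsub>RM\<^esub> g)"
proof
  fix z
  let ?A = "{x. f x \<noteq> \<zero>} \<union> {x. f' x \<noteq> \<zero>}" and ?B = "{x. g x \<noteq> \<zero>}"
  have fin: "finite ?A" "finite ?B" using RM_carrierD(3) f f' g by auto
  have sub: "{x. (f \<oplus>\<^bsub>RM\<^esub> f') x \<noteq> \<zero>} \<subseteq> ?A" by (auto simp: RM_simps)
  have A: "{x. f x \<noteq> \<zero>} \<subseteq> ?A" "{x. f' x \<noteq> \<zero>} \<subseteq> ?A" by auto
  note D = RM_carrierD(1)[OF f] RM_carrierD(1)[OF f'] RM_carrierD(1)[OF g]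
  let ?S = "{(x, y) \<in> ?A \<times> ?B. x \<otimes>\<^bsub>M\<^esub> y = z}"
  have "((f \<oplus>\<^bsub>RM\<^esub> f') \<otimes>\<^bsub>RM\<^esub> g) z = finsum R (\<lambda>(x, y). (f \<oplus>\<^bsub>RM\<^esub> f') x \<otimes> g y) ?S"
    by (rule RM_mult_eq[OF RM_add_closed[OF f f'] g fin(1) sub fin(2) order_refl])
  also have "\<dots> = finsum R (\<lambda>p. (case p of (x, y) \<Rightarrow> f x \<otimes> g y) \<oplus> (case p of (x, y) \<Rightarrow> f' x \<otimes> g y)) ?S"
    by (rule R.finsum_cong') (use D in \<open>auto simp: RM_simps R.l_distr\<close>)
  also have "\<dots> = finsum R (\<lambda>(x, y). f x \<otimes> g y) ?S \<oplus> finsum R (\<lambda>(x, y). f' x \<otimes> g y) ?S"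
    by (rule R.finsum_addf) (use D in auto)
  finally show "((f \<oplus>\<^bsub>RM\<^esub> f') \<otimes>\<^bsub>RM\<^esub> g) z = ((f \<otimes>\<^bsub>RM\<^esub> g) \<oplus>\<^bsub>RM\<^esub> (f' \<otimes>\<^bsub>RM\<^esub> g)) z"
    unfolding RM_mult_eq[OF f g fin(1) A(1) fin(2) order_refl]
      RM_mult_eq[OF f' g fin(1) A(2) fin(2) order_refl] RM_simps .
qed

lemma RM_m_comm:
  assumes f: "f \<in> carrier RM" and g: "g \<in> carrier RM"
  shows "f \<otimes>\<^bsub>RM\<^esub> g = g \<otimes>\<^bsub>RM\<^esub> f"
proof
  fix z
  let ?A = "{x. f x \<noteq> \<zero>}" and ?B = "{x. g x \<noteq> \<zero>}"
  have fin: "finite ?A" "finite ?B" using RM_carrierD(3) f g by auto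
  note D = RM_carrierD(1)[OF f] RM_carrierD(1)[OF g]
  have AB: "?A \<subseteq> carrier M" "?B \<subseteq> carrier M" using RM_carrierD(2) f g by auto
  let ?S = "{(x, y) \<in> ?A \<times> ?B. x \<otimes>\<^bsub>M\<^esub> y = z}" and ?S' = "{(x, y) \<in> ?B \<times> ?A. x \<otimes>\<^bsub>M\<^esub> y = z}"
  have "?S' = prod.swap ` ?S"
    using AB M.m_comm by (auto simp: image_iff subset_iff)
  then have "finsum R (\<lambda>(x, y). g x \<otimes> f y) ?S' = finsum R (\<lambda>p. case prod.swap p of (x, y) \<Rightarrow> g x \<otimes> f y) ?S"
    using D by (subst R.finsum_reindex[symmetric]) auto
  also have "\<dots> = finsum R (\<lambda>(x, y). f x \<otimes> g y) ?S"
    by (rule R.finsum_cong') (use D in \<open>auto simp: R.m_comm\<close>)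
  finally show "(f \<otimes>\<^bsub>RM\<^esub> g) z = (g \<otimes>\<^bsub>RM\<^esub> f) z"
    unfolding RM_mult_eq[OF f g fin(1) order_refl fin(2) order_refl]
      RM_mult_eq[OF g f fin(2) order_refl fin(1) order_refl] by simp
qed

lemma single_mult:
  assumes x: "x \<in> carrier M" "y \<in> carrier M" and a: "a \<in> carrier R" "b \<in> carrier R"
  shows "single R x a \<otimes>\<^bsub>RM\<^esub> single R y b = single R (x \<otimes>\<^bsub>M\<^esub> y) (a \<otimes> b)"
proof
  fix z
  have eq: "(single R x a \<otimes>\<^bsub>RM\<^esub> single R y b) z =
     finsum R (\<lambda>(x', y'). single R x a x' \<otimes> single R y b y') {(x', y') \<in> {x} \<times> {y}. x' \<otimes>\<^bsub>M\<^esub> y' = z}"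
    by (rule RM_mult_eq) (use assms in \<open>auto dest: single_supp\<close>)
  show "(single R x a \<otimes>\<^bsub>RM\<^esub> single R y b) z = single R (x \<otimes>\<^bsub>M\<^esub> y) (a \<otimes> b) z"
  proof (cases "x \<otimes>\<^bsub>M\<^esub> y = z")
    case True
    then have e: "{(x', y') \<in> {x} \<times> {y}. x' \<otimes>\<^bsub>M\<^esub> y' = z} = {(x, y)}" by auto
    show ?thesis unfolding eq e using assms True by (simp add: single_def)
  next
    case False
    then have e: "{(x', y') \<in> {x} \<times> {y}. x' \<otimes>\<^bsub>M\<^esub> y' = z} = {}" by auto
    show ?thesis unfolding eq e using False by (simp add: single_def)
  qed
qed

lemma RM_cring: "cring RM"
proof (rule cringI[OF RM_abelian_group])
  have r_distr: "f \<otimes>\<^bsub>RM\<^esub> (g \<oplus>\<^bsub>RM\<^esub> h) = (f \<otimes>\<^bsub>RM\<^esub> g) \<oplus>\<^bsub>RM\<^esub> (f \<otimes>\<^bsub>RM\<^esub> h)"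
    if "f \<in> carrier RM" "g \<in> carrier RM" "h \<in> carrier RM" for f g h
    using that RM_l_distr RM_m_comm RM_add_closed by metis
  show "comm_monoid RM"
  proof (rule comm_monoidI)
    show "\<one>\<^bsub>RM\<^esub> \<in> carrier RM" by (simp add: RM_simps)
    fix f assume f: "f \<in> carrier RM"
    show "\<one>\<^bsub>RM\<^esub> \<otimes>\<^bsub>RM\<^esub> f = f" using f
    proof (induction rule: RM_induct)
      case (single x a)
      then show ?case by (simp add: RM_simps(3) single_mult)
    next
      case (add f g)
      then show ?case by (simp add: RM_simps(3) r_distr)
    qed
    fix g assume g: "g \<in> carrier RM"
    show "f \<otimes>\<^bsub>RM\<^esub> g \<in> carrier RM" "f \<otimes>\<^bsub>RM\<^esub> g = g \<otimes>\<^bsub>RM\<^esub> f"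
      using RM_mult_closed RM_m_comm f g by auto
    fix h assume h: "h \<in> carrier RM"
    \<comment> \<open>Both sides are additive in f, g and h, so three nested inductions leave only
      associativity in M and in R.\<close>
    show "f \<otimes>\<^bsub>RM\<^esub> g \<otimes>\<^bsub>RM\<^esub> h = f \<otimes>\<^bsub>RM\<^esub> (g \<otimes>\<^bsub>RM\<^esub> h)" using f
    proof (induction rule: RM_induct)
      case x: (single x a)
      show ?case using g
      proof (induction rule: RM_induct)
        case y: (single y b)
        show ?case using h
        proof (induction rule: RM_induct)
          case (single z c)
          then show ?case using x y by (simp add: single_mult M.m_assoc R.m_assoc)
        next
          case (add h h')
          then show ?case using x y by (simp add: r_distr RM_mult_closed)
        qed
      next
        case (add g g')
        then show ?case using x h by (simp add: r_distr RM_l_distr RM_mult_closed)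
      qed
    next
      case (add f f')
      then show ?case using g h by (simp add: RM_l_distr RM_mult_closed)
    qed
  qed
qed (rule RM_l_distr)

end

text \<open>Only additivity in the coefficient is demanded, so that the target may be a mere abelian
  group; the universal property of the tensor product is stated for such targets.\<close>

locale additive_action = monoid_algebra R M + B?: abelian_group B
  for R (structure) and M (structure) and B (structure) +
  fixes \<alpha>
  assumes act_closed: "\<lbrakk>a \<in> carrier R; x \<in> carrier M\<rbrakk> \<Longrightarrow> \<alpha> a x \<in> carrier B"
    and act_add: "\<lbrakk>a \<in> carrier R; b \<in> carrier R; x \<in> carrier M\<rbrakk> \<Longrightarrow> \<alpha> (a \<oplus> b) x = \<alpha> a x \<oplus>\<^bsub>B\<^esub> \<alpha> b x"
begin

abbreviation "ext \<equiv> additive_extension R B \<alpha>"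

lemma act_zero: "x \<in> carrier M \<Longrightarrow> \<alpha> \<zero> x = \<zero>\<^bsub>B\<^esub>"
  using act_add[of "\<zero>" "\<zero>" x] act_closed[of "\<zero>" x] by (simp add: B.add.r_cancel_one')

lemma ext_superset:
  assumes f: "f \<in> carrier RM" and A: "finite A" "{x. f x \<noteq> \<zero>} \<subseteq> A" "A \<subseteq> carrier M"
  shows "ext f = finsum B (\<lambda>x. \<alpha> (f x) x) A"
  unfolding additive_extension_def
  by (rule B.add.finprod_mono_neutral_cong_left)
    (use RM_carrierD[OF f] A act_zero act_closed in auto)

lemma ext_closed: "f \<in> carrier RM \<Longrightarrow> ext f \<in> carrier B"
  unfolding additive_extension_def using RM_carrierD act_closed by (intro B.finsum_closed) blast

lemma ext_add:
  assumes f: "f \<in> carrier RM" and g: "g \<in> carrier RM"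
  shows "ext (f \<oplus>\<^bsub>RM\<^esub> g) = ext f \<oplus>\<^bsub>B\<^esub> ext g"
proof -
  let ?A = "{x. f x \<noteq> \<zero>} \<union> {x. g x \<noteq> \<zero>}"
  have A: "finite ?A" "?A \<subseteq> carrier M" using RM_carrierD f g by auto
  have sub: "{x. (f \<oplus>\<^bsub>RM\<^esub> g) x \<noteq> \<zero>} \<subseteq> ?A" by (auto simp: RM_simps)
  have "ext (f \<oplus>\<^bsub>RM\<^esub> g) = finsum B (\<lambda>x. \<alpha> ((f \<oplus>\<^bsub>RM\<^esub> g) x) x) ?A"
    by (rule ext_superset[OF RM_add_closed[OF f g] A(1) sub A(2)])
  also have "\<dots> = finsum B (\<lambda>x. \<alpha> (f x) x \<oplus>\<^bsub>B\<^esub> \<alpha> (g x) x) ?A"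
    using RM_carrierD(1)[OF f] RM_carrierD(1)[OF g] A(2) act_closed act_add
    by (intro B.finsum_cong') (auto simp: RM_simps)
  also have "\<dots> = finsum B (\<lambda>x. \<alpha> (f x) x) ?A \<oplus>\<^bsub>B\<^esub> finsum B (\<lambda>x. \<alpha> (g x) x) ?A"
    using RM_carrierD(1)[OF f] RM_carrierD(1)[OF g] A(2) act_closed
    by (intro B.finsum_addf) auto
  finally show ?thesis
    using ext_superset[OF f A(1) _ A(2)] ext_superset[OF g A(1) _ A(2)] by auto
qed

lemma ext_single:
  assumes "x \<in> carrier M" "a \<in> carrier R"
  shows "ext (single R x a) = \<alpha> a x"
proof -
  have "ext (single R x a) = finsum B (\<lambda>z. \<alpha> (single R x a z) z) {x}"
    by (rule ext_superset) (use assms in \<open>auto dest: single_supp\<close>)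
  then show ?thesis using assms act_closed[of a x] by (simp add: single_def)
qed

end

locale monoid_algebra_hom = monoid_algebra R M + B?: cring B
  for R (structure) and M (structure) and B (structure) +
  fixes h \<mu>
  assumes h: "h \<in> ring_hom R B"
    and mu_closed: "x \<in> carrier M \<Longrightarrow> \<mu> x \<in> carrier B"
    and mu_one: "\<mu> \<one>\<^bsub>M\<^esub> = \<one>\<^bsub>B\<^esub>"
    and mu_mult: "\<lbrakk>x \<in> carrier M; y \<in> carrier M\<rbrakk> \<Longrightarrow> \<mu> (x \<otimes>\<^bsub>M\<^esub> y) = \<mu> x \<otimes>\<^bsub>B\<^esub> \<mu> y"

sublocale monoid_algebra_hom \<subseteq> additive_action R M B "\<lambda>a x. h a \<otimes>\<^bsub>B\<^esub> \<mu> x"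
  by unfold_locales
    (use ring_hom_memE[OF h] mu_closed in \<open>auto simp: B.l_distr\<close>)

lemma (in monoid_algebra_hom) ext_hom: "ext \<in> ring_hom RM B"
proof (rule ring_hom_memI)
  interpret RM: cring RM by (rule RM_cring)
  note H = ring_hom_memE[OF h]
  show "ext \<one>\<^bsub>RM\<^esub> = \<one>\<^bsub>B\<^esub>" using H(4) by (simp add: RM_simps ext_single mu_one)
  fix f g assume f: "f \<in> carrier RM" and g: "g \<in> carrier RM"
  show "ext f \<in> carrier B" "ext (f \<oplus>\<^bsub>RM\<^esub> g) = ext f \<oplus>\<^bsub>B\<^esub> ext g"
    using f g ext_closed ext_add by auto
  show "ext (f \<otimes>\<^bsub>RM\<^esub> g) = ext f \<otimes>\<^bsub>B\<^esub> ext g" using f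
  proof (induction rule: RM_induct)
    case x: (single x a)
    show ?case using g
    proof (induction rule: RM_induct)
      case (single y b)
      then show ?case using x H(1,2) mu_closed
        by (simp add: single_mult ext_single mu_mult B.m_ac)
    next
      case (add g g')
      then show ?case using x by (simp add: RM.r_distr ext_add ext_closed B.r_distr)
    qed
  next
    case (add f f')
    then show ?case using g by (simp add: RM.l_distr ext_add ext_closed B.l_distr)
  qed
qed

section \<open>Tensor products of algebras\<close>

lemma pair_gen_eq_single: "pair_gen a b = single \<Z> (a, b) 1"
  by (auto simp: pair_gen_def single_def)

locale tensor = R?: cring R + S?: cring S
  for k :: "('k, 'e) ring_scheme" and R :: "('a, 'c) ring_scheme" (structure) and \<phi>
    and S :: "('b, 'd) ring_scheme" (structure) and \<psi> +
  assumes phi_closed: "c \<in> carrier k \<Longrightarrow> \<phi> c \<in> carrier R"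
    and psi_closed: "c \<in> carrier k \<Longrightarrow> \<psi> c \<in> carrier S"

sublocale tensor \<subseteq> ZM: monoid_algebra \<Z> "R \<times>\<times> S"
proof unfold_locales
  fix x y z assume "x \<in> carrier (R \<times>\<times> S)" "y \<in> carrier (R \<times>\<times> S)" "z \<in> carrier (R \<times>\<times> S)"
  then show "x \<otimes>\<^bsub>R \<times>\<times> S\<^esub> y \<otimes>\<^bsub>R \<times>\<times> S\<^esub> z = x \<otimes>\<^bsub>R \<times>\<times> S\<^esub> (y \<otimes>\<^bsub>R \<times>\<times> S\<^esub> z)"
    by (auto simp: R.m_assoc S.m_assoc)
qed (auto simp: R.m_comm S.m_comm int.m_comm)

context tensor
begin

abbreviation "ZM \<equiv> monoid_ring \<Z> (R \<times>\<times> S)"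
abbreviation "I \<equiv> tensor_ideal k R \<phi> S \<psi>"
abbreviation "T \<equiv> tensor_ring k R \<phi> S \<psi>"
abbreviation "pt \<equiv> pure_tensor k R \<phi> S \<psi>"

sublocale ZMc: cring ZM by (rule ZM.RM_cring)

text \<open>The generators of \<open>tensor_ideal\<close>, rewritten with the operations of the
  monoid ring so that closure and homomorphism rules apply to them.\<close>

definition relations :: "('a \<times> 'b \<Rightarrow> int) set" where
  "relations =
    {pair_gen (a \<oplus> a') b \<ominus>\<^bsub>ZM\<^esub> (pair_gen a b \<oplus>\<^bsub>ZM\<^esub> pair_gen a' b) | a a' b.
        a \<in> carrier R \<and> a' \<in> carrier R \<and> b \<in> carrier S} \<union>
    {pair_gen a (b \<oplus>\<^bsub>S\<^esub> b') \<ominus>\<^bsub>ZM\<^esub> (pair_gen a b \<oplus>\<^bsub>ZM\<^esub> pair_gen a b') | a b b'.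
        a \<in> carrier R \<and> b \<in> carrier S \<and> b' \<in> carrier S} \<union>
    {pair_gen (\<phi> c \<otimes> a) b \<ominus>\<^bsub>ZM\<^esub> pair_gen a (\<psi> c \<otimes>\<^bsub>S\<^esub> b) | a b c.
        a \<in> carrier R \<and> b \<in> carrier S \<and> c \<in> carrier k}"

lemma pg_closed [simp]: "\<lbrakk>a \<in> carrier R; b \<in> carrier S\<rbrakk> \<Longrightarrow> pair_gen a b \<in> carrier ZM"
  unfolding pair_gen_eq_single by (rule ZM.single_closed) auto

lemma pg_mult: "\<lbrakk>a \<in> carrier R; b \<in> carrier S; a' \<in> carrier R; b' \<in> carrier S\<rbrakk>
    \<Longrightarrow> pair_gen a b \<otimes>\<^bsub>ZM\<^esub> pair_gen a' b' = pair_gen (a \<otimes> a') (b \<otimes>\<^bsub>S\<^esub> b')"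
  unfolding pair_gen_eq_single by (subst ZM.single_mult) auto

lemma relations_closed: "relations \<subseteq> carrier ZM"
  unfolding relations_def using phi_closed psi_closed by auto

lemma tensor_ideal_eq: "I = Idl\<^bsub>ZM\<^esub> relations"
proof -
  have m: "(\<lambda>p. f p - g p) = f \<ominus>\<^bsub>ZM\<^esub> g" if "f \<in> carrier ZM" "g \<in> carrier ZM" for f g
    using ZM.RM_minus[OF that] by (simp add: a_minus_def int_a_inv_eq)
  have a: "(\<lambda>p. f p + g p) = f \<oplus>\<^bsub>ZM\<^esub> g" for f g
    by (simp add: ZM.RM_simps)
  \<comment> \<open>The two descriptions of a generator agree only for parameters in the carriers,
    so the equality has to be proved under the membership condition of the set
    comprehension.\<close>
  have c: "(u = x \<and> P) = (u = y \<and> P)" if "P \<Longrightarrow> x = y" for u x y :: "'a \<times> 'b \<Rightarrow> int" and P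
    using that by auto
  show ?thesis
    unfolding tensor_ideal_def relations_def
    by (intro arg_cong[where f = "genideal ZM"] arg_cong2[where f = "(\<union>)"] Collect_cong iff_exI c)
      (auto simp: a m phi_closed psi_closed)
qed

lemma tensor_ideal: "ideal I ZM"
  unfolding tensor_ideal_eq by (rule ZMc.genideal_ideal[OF relations_closed])

lemma rel_in_ideal: "f \<in> relations \<Longrightarrow> f \<in> I"
  unfolding tensor_ideal_eq using ZMc.genideal_self[OF relations_closed] by blast

sublocale I: ideal I ZM by (rule tensor_ideal)

lemma T_cring: "cring T"
  unfolding tensor_ring_def by (rule I.quotient_is_cring[OF ZMc.is_cring])

sublocale Tc: cring T by (rule T_cring)

abbreviation "proj \<equiv> (+>\<^bsub>ZM\<^esub>) I"

lemma proj_hom: "proj \<in> ring_hom ZM T"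
  unfolding tensor_ring_def by (rule I.rcos_ring_hom)

lemmas projD = ring_hom_memE[OF proj_hom]

lemma pt_eq: "pt a b = proj (pair_gen a b)"
  by (simp add: pure_tensor_def)

lemma pt_closed [simp]: "\<lbrakk>a \<in> carrier R; b \<in> carrier S\<rbrakk> \<Longrightarrow> pt a b \<in> carrier T"
  by (simp add: pt_eq projD)

lemma pt_mult: "\<lbrakk>a \<in> carrier R; b \<in> carrier S; a' \<in> carrier R; b' \<in> carrier S\<rbrakk>
    \<Longrightarrow> pt a b \<otimes>\<^bsub>T\<^esub> pt a' b' = pt (a \<otimes> a') (b \<otimes>\<^bsub>S\<^esub> b')"
  by (simp add: pt_eq projD(2)[symmetric] pg_mult)

lemma pt_one: "pt \<one> \<one>\<^bsub>S\<^esub> = \<one>\<^bsub>T\<^esub>"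
  using projD(4) by (simp add: pt_eq pair_gen_eq_single ZM.RM_simps)

lemma proj_eqI: "\<lbrakk>f \<in> carrier ZM; g \<in> carrier ZM; f \<ominus>\<^bsub>ZM\<^esub> g \<in> relations\<rbrakk> \<Longrightarrow> proj f = proj g"
  using ZMc.quotient_eq_iff_same_a_r_cos[OF tensor_ideal, of f g] rel_in_ideal by blast

lemma pt_add_left:
  assumes "a \<in> carrier R" "a' \<in> carrier R" "b \<in> carrier S"
  shows "pt (a \<oplus> a') b = pt a b \<oplus>\<^bsub>T\<^esub> pt a' b"
  using assms unfolding pt_eq
  by (subst projD(3)[symmetric], simp, simp, intro proj_eqI) (auto simp: relations_def)

lemma pt_add_right:
  assumes "a \<in> carrier R" "b \<in> carrier S" "b' \<in> carrier S"
  shows "pt a (b \<oplus>\<^bsub>S\<^esub> b') = pt a b \<oplus>\<^bsub>T\<^esub> pt a b'"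
  using assms unfolding pt_eq
  by (subst projD(3)[symmetric], simp, simp, intro proj_eqI) (auto simp: relations_def)

lemma pt_balanced:
  assumes "a \<in> carrier R" "b \<in> carrier S" "c \<in> carrier k"
  shows "pt (\<phi> c \<otimes> a) b = pt a (\<psi> c \<otimes>\<^bsub>S\<^esub> b)"
  using assms phi_closed psi_closed unfolding pt_eq
  by (intro proj_eqI) (auto simp: relations_def)

lemma pt_zero_left: "b \<in> carrier S \<Longrightarrow> pt \<zero> b = \<zero>\<^bsub>T\<^esub>"
  using pt_add_left[of \<zero> \<zero> b] by (simp add: Tc.add.r_cancel_one')

lemma pt_zero_right: "a \<in> carrier R \<Longrightarrow> pt a \<zero>\<^bsub>S\<^esub> = \<zero>\<^bsub>T\<^esub>"
  using pt_add_right[of a "\<zero>\<^bsub>S\<^esub>" "\<zero>\<^bsub>S\<^esub>"] by (simp add: Tc.add.r_cancel_one')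

text \<open>Integer coefficients disappear: a positive multiple is a repeated sum, and a negative
  sign is absorbed in the first factor, as -(a \<otimes> b) = (-a) \<otimes> b.\<close>

lemma T_induct [consumes 1, case_names pure add]:
  assumes t: "t \<in> carrier T"
    and pure: "\<And>a b. \<lbrakk>a \<in> carrier R; b \<in> carrier S\<rbrakk> \<Longrightarrow> P (pt a b)"
    and ad: "\<And>t u. \<lbrakk>t \<in> carrier T; u \<in> carrier T; P t; P u\<rbrakk> \<Longrightarrow> P (t \<oplus>\<^bsub>T\<^esub> u)"
  shows "P t"
proof -
  have add: "single \<Z> x (i + j) = single \<Z> x i \<oplus>\<^bsub>ZM\<^esub> single \<Z> x j" for x :: "'a \<times> 'b" and i j
    by (auto simp: ZM.RM_simps single_def)
  have cl: "single \<Z> (a, b) n \<in> carrier ZM" if "a \<in> carrier R" "b \<in> carrier S" for a b n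
    using that by (intro ZM.single_closed) auto
  have pos: "P (proj (single \<Z> (a, b) (int n)))" if "a \<in> carrier R" "b \<in> carrier S" for a b n
  proof (induction n)
    case 0
    have "single \<Z> (a, b) 0 = \<zero>\<^bsub>ZM\<^esub>" by (auto simp: ZM.RM_simps single_def)
    then have "proj (single \<Z> (a, b) 0) = \<zero>\<^bsub>T\<^esub>"
      using ring_hom_zero[OF proj_hom ZMc.ring_axioms Tc.ring_axioms] by simp
    then show ?case using pure[of \<zero> b] that pt_zero_left by simp
  next
    case (Suc n)
    have "proj (single \<Z> (a, b) (int (Suc n))) = proj (single \<Z> (a, b) (int n)) \<oplus>\<^bsub>T\<^esub> pt a b"
      using that by (simp add: pt_eq pair_gen_eq_single add cl projD(3)[symmetric] add.commute[of 1])
    then show ?case using ad[OF _ _ Suc pure[OF that]] cl[OF that] that projD(1) by simp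
  qed
  have neg: "proj (single \<Z> (a, b) (- int n)) = proj (single \<Z> (\<ominus> a, b) (int n))"
    if a: "a \<in> carrier R" and b: "b \<in> carrier S" for a b n
  proof (induction n)
    case 0
    have "single \<Z> (a, b) 0 = single \<Z> (\<ominus> a, b) 0" by (auto simp: single_def)
    then show ?case by simp
  next
    case (Suc n)
    have "proj (single \<Z> (a, b) (- 1)) \<oplus>\<^bsub>T\<^esub> pt a b = \<zero>\<^bsub>T\<^esub>"
    proof -
      have "single \<Z> (a, b) (- 1) \<oplus>\<^bsub>ZM\<^esub> pair_gen a b = \<zero>\<^bsub>ZM\<^esub>"
        by (auto simp: pair_gen_eq_single ZM.RM_simps single_def)
      then show ?thesis
        using a b projD(3)[of "single \<Z> (a, b) (- 1)" "pair_gen a b"] cl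
          ring_hom_zero[OF proj_hom ZMc.ring_axioms Tc.ring_axioms] by (simp add: pt_eq)
    qed
    moreover have "pt (\<ominus> a) b \<oplus>\<^bsub>T\<^esub> pt a b = \<zero>\<^bsub>T\<^esub>"
      using pt_add_left[of "\<ominus> a" a b] a b by (simp add: R.l_neg pt_zero_left)
    ultimately have one: "proj (single \<Z> (a, b) (- 1)) = pt (\<ominus> a) b"
      using a b cl projD(1) by (metis R.a_inv_closed pt_closed Tc.add.r_cancel)
    have "proj (single \<Z> (a, b) (- int (Suc n))) = proj (single \<Z> (a, b) (- int n)) \<oplus>\<^bsub>T\<^esub> pt (\<ominus> a) b"
    proof -
      have e: "- int (Suc n) = - int n + - 1" by simp
      show ?thesis
        unfolding e add by (simp only: one[symmetric] projD(3)[OF cl[OF a b] cl[OF a b]])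
    qed
    also have "\<dots> = proj (single \<Z> (\<ominus> a, b) (int (Suc n)))"
      using a b add[of "(\<ominus> a, b)" "int n" 1]
      by (simp add: Suc pt_eq pair_gen_eq_single cl projD(3)[symmetric] add.commute[of 1])
    finally show ?case .
  qed
  have "P (proj f)" if "f \<in> carrier ZM" for f
    using that
  proof (induction rule: ZM.RM_induct)
    case (single x n)
    obtain a b where x: "x = (a, b)" "a \<in> carrier R" "b \<in> carrier S"
      using single by (cases x) auto
    show ?case
      using pos[OF x(2,3)] neg[OF x(2,3)] pos[of "\<ominus> a" b] x by (cases n rule: int_cases2) auto
  next
    case (add f g)
    then show ?case by (simp add: projD ad)
  qed
  moreover obtain f where "f \<in> carrier ZM" "t = proj f"
    using t by (auto simp: tensor_ring_def FactRing_def A_RCOSETS_def')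
  ultimately show ?thesis by blast
qed

text \<open>The universal property for additive maps into an abelian group. The obstacle is that
  \<open>tensor_ideal\<close> is generated as an ideal while the map induced by \<beta> is not
  multiplicative, so killing the generators alone does not suffice.\<close>

lemma lift_exists:
  fixes B (structure)
  assumes "abelian_group B"
    and closed: "\<And>a b. \<lbrakk>a \<in> carrier R; b \<in> carrier S\<rbrakk> \<Longrightarrow> \<beta> a b \<in> carrier B"
    and addl: "\<And>a a' b. \<lbrakk>a \<in> carrier R; a' \<in> carrier R; b \<in> carrier S\<rbrakk>
        \<Longrightarrow> \<beta> (a \<oplus>\<^bsub>R\<^esub> a') b = \<beta> a b \<oplus>\<^bsub>B\<^esub> \<beta> a' b"
    and addr: "\<And>a b b'. \<lbrakk>a \<in> carrier R; b \<in> carrier S; b' \<in> carrier S\<rbrakk>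
        \<Longrightarrow> \<beta> a (b \<oplus>\<^bsub>S\<^esub> b') = \<beta> a b \<oplus>\<^bsub>B\<^esub> \<beta> a b'"
    and bal: "\<And>a b c. \<lbrakk>a \<in> carrier R; b \<in> carrier S; c \<in> carrier k\<rbrakk>
        \<Longrightarrow> \<beta> (\<phi> c \<otimes>\<^bsub>R\<^esub> a) b = \<beta> a (\<psi> c \<otimes>\<^bsub>S\<^esub> b)"
  obtains \<Phi> where "\<And>t. t \<in> carrier T \<Longrightarrow> \<Phi> t \<in> carrier B"
    and "\<And>t u. \<lbrakk>t \<in> carrier T; u \<in> carrier T\<rbrakk> \<Longrightarrow> \<Phi> (t \<oplus>\<^bsub>T\<^esub> u) = \<Phi> t \<oplus>\<^bsub>B\<^esub> \<Phi> u"
    and "\<And>a b. \<lbrakk>a \<in> carrier R; b \<in> carrier S\<rbrakk> \<Longrightarrow> \<Phi> (pt a b) = \<beta> a b"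
proof -
  interpret B: abelian_group B by fact
  interpret act: additive_action \<Z> "R \<times>\<times> S" B "\<lambda>n p. [n] \<cdot>\<^bsub>B\<^esub> \<beta> (fst p) (snd p)"
    by unfold_locales (auto simp: closed B.add.int_pow_mult)
  let ?F = act.ext
  have F0: "?F \<zero>\<^bsub>ZM\<^esub> = \<zero>\<^bsub>B\<^esub>"
    using act.ext_add[of "\<zero>\<^bsub>ZM\<^esub>" "\<zero>\<^bsub>ZM\<^esub>"] act.ext_closed[of "\<zero>\<^bsub>ZM\<^esub>"] by (simp add: B.add.r_cancel_one')
  have Finv: "?F (\<ominus>\<^bsub>ZM\<^esub> f) = \<ominus>\<^bsub>B\<^esub> ?F f" if "f \<in> carrier ZM" for f
    using act.ext_add[of "\<ominus>\<^bsub>ZM\<^esub> f" f] act.ext_closed that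
    by (simp add: ZMc.l_neg F0 B.minus_equality)
  \<comment> \<open>The elements all of whose multiples die under \<open>?F\<close>: an ideal inside
    the kernel. It contains the relations because a relation times a monomial is an integer multiple
    of a relation.\<close>
  define N where "N = {f \<in> carrier ZM. \<forall>g\<in>carrier ZM. ?F (g \<otimes>\<^bsub>ZM\<^esub> f) = \<zero>\<^bsub>B\<^esub>}"
  have Fm: "?F (f \<ominus>\<^bsub>ZM\<^esub> g) = ?F f \<ominus>\<^bsub>B\<^esub> ?F g" if "f \<in> carrier ZM" "g \<in> carrier ZM" for f g
    using that by (simp add: a_minus_def act.ext_add Finv)
  have N: "ideal N ZM"
  proof (rule idealI[OF ZMc.ring_axioms])
    show "subgroup N (add_monoid ZM)"
      by (rule ZMc.add.subgroupI)
        (auto simp: N_def ZMc.r_distr ZMc.r_minus act.ext_add Finv F0 intro!: exI[of _ "\<zero>\<^bsub>ZM\<^esub>"])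
    fix f g assume fg: "f \<in> N" "g \<in> carrier ZM"
    then have f: "f \<in> carrier ZM" by (simp add: N_def)
    show gf: "g \<otimes>\<^bsub>ZM\<^esub> f \<in> N"
      using fg by (auto simp: N_def ZMc.m_assoc[symmetric])
    show "f \<otimes>\<^bsub>ZM\<^esub> g \<in> N" using gf ZMc.m_comm[OF f fg(2)] by simp
  qed
  have pg: "?F (single \<Z> (a, b) n \<otimes>\<^bsub>ZM\<^esub> pair_gen a' b') = [n] \<cdot>\<^bsub>B\<^esub> \<beta> (a \<otimes>\<^bsub>R\<^esub> a') (b \<otimes>\<^bsub>S\<^esub> b')"
    if "a \<in> carrier R" "b \<in> carrier S" "a' \<in> carrier R" "b' \<in> carrier S" for a b n a' b'
    using that unfolding pair_gen_eq_single
    by (subst ZM.single_mult) (auto simp: act.ext_single)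
  have van: "?F (g \<otimes>\<^bsub>ZM\<^esub> f) = \<zero>\<^bsub>B\<^esub>" if f: "f \<in> relations" and g: "g \<in> carrier ZM" for f g
    using g
  proof (induction rule: ZM.RM_induct)
    case (single x n)
    obtain a b where x: "x = (a, b)" "a \<in> carrier R" "b \<in> carrier S"
      using single by (cases x) auto
    have s: "single \<Z> (a, b) n \<in> carrier ZM" using x by (intro ZM.single_closed) auto
    have assoc: "a \<otimes>\<^bsub>R\<^esub> (\<phi> c \<otimes>\<^bsub>R\<^esub> a') = \<phi> c \<otimes>\<^bsub>R\<^esub> (a \<otimes>\<^bsub>R\<^esub> a')" "b \<otimes>\<^bsub>S\<^esub> (\<psi> c \<otimes>\<^bsub>S\<^esub> b') = \<psi> c \<otimes>\<^bsub>S\<^esub> (b \<otimes>\<^bsub>S\<^esub> b')"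
      if "c \<in> carrier k" "a' \<in> carrier R" "b' \<in> carrier S" for c a' b'
      using that x phi_closed psi_closed by (simp_all add: R.m_lcomm S.m_lcomm)
    show ?case
      using f x s unfolding relations_def
      by (auto simp: ZMc.r_minus Finv ZMc.r_distr act.ext_add pg phi_closed psi_closed R.r_distr S.r_distr addl addr closed
          assoc bal B.add.int_pow_distrib B.r_neg a_minus_def)
  next
    case (add g h)
    then show ?case using f relations_closed by (auto simp: ZMc.l_distr subset_iff act.ext_add)
  qed
  have sub: "I \<subseteq> N"
    unfolding tensor_ideal_eq
    by (rule ZMc.genideal_minimal[OF N]) (use van relations_closed in \<open>auto simp: N_def\<close>)
  have van_I: "?F f = \<zero>\<^bsub>B\<^esub>" if "f \<in> I" for f
  proof -
    have "f \<in> N" using that sub by blast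
    then have "?F (\<one>\<^bsub>ZM\<^esub> \<otimes>\<^bsub>ZM\<^esub> f) = \<zero>\<^bsub>B\<^esub>" "f \<in> carrier ZM" unfolding N_def by blast+
    then show ?thesis by simp
  qed
  \<comment> \<open>Any representative will do: two of them differ by an element of the ideal, on
    which \<open>?F\<close> vanishes.\<close>
  define \<Phi> where "\<Phi> t = ?F (SOME f. f \<in> carrier ZM \<and> t = proj f)" for t
  have Phi: "\<Phi> (proj f) = ?F f" if f: "f \<in> carrier ZM" for f
  proof -
    define g where "g = (SOME g. g \<in> carrier ZM \<and> proj f = proj g)"
    have g: "g \<in> carrier ZM" "proj f = proj g"
      using someI[of "\<lambda>g. g \<in> carrier ZM \<and> proj f = proj g" f] f unfolding g_def by auto
    then have "g \<ominus>\<^bsub>ZM\<^esub> f \<in> I"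
      using ZMc.quotient_eq_iff_same_a_r_cos[OF tensor_ideal g(1) f] by simp
    from van_I[OF this] have "?F g \<ominus>\<^bsub>B\<^esub> ?F f = \<zero>\<^bsub>B\<^esub>" using Fm g f by simp
    then have "?F g = ?F f"
      using g(1) f B.minus_equality[of "?F g" "\<ominus>\<^bsub>B\<^esub> ?F f"] act.ext_closed
      by (simp add: a_minus_def B.minus_minus)
    then show ?thesis by (simp add: \<Phi>_def g_def)
  qed
  have rep: "\<exists>f\<in>carrier ZM. t = proj f" if "t \<in> carrier T" for t
    using that by (auto simp: tensor_ring_def FactRing_def A_RCOSETS_def')
  show thesis
  proof (rule that)
    show "\<Phi> t \<in> carrier B" if "t \<in> carrier T" for t
      using rep[OF that] Phi act.ext_closed by auto
    show "\<Phi> (t \<oplus>\<^bsub>T\<^esub> u) = \<Phi> t \<oplus>\<^bsub>B\<^esub> \<Phi> u" if tu: "t \<in> carrier T" "u \<in> carrier T" for t u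
    proof -
      obtain f g where "f \<in> carrier ZM" "t = proj f" "g \<in> carrier ZM" "u = proj g"
        using rep tu by meson
      then show ?thesis using Phi by (simp add: projD(3)[symmetric] act.ext_add)
    qed
    show "\<Phi> (pt a b) = \<beta> a b" if "a \<in> carrier R" "b \<in> carrier S" for a b
      using Phi[OF pg_closed[OF that]] that closed
      by (simp add: pt_eq pair_gen_eq_single act.ext_single)
  qed
qed

end

section \<open>The associated graded ring\<close>

text \<open>For a in \<open>\<mm>^n\<close> this is the class of a in degree n, its initial form if
  a is not in the next power.\<close>

definition gr_class :: "('a, 'c) ring_scheme \<Rightarrow> 'a set \<Rightarrow> nat \<Rightarrow> 'a \<Rightarrow> (nat \<Rightarrow> 'a set)" where
  "gr_class A \<mm> n a = (\<lambda>i. if i = n then ideal_power A \<mm> (Suc n) +>\<^bsub>A\<^esub> a else ideal_power A \<mm> (Suc i))"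

definition gr_comp :: "('a, 'c) ring_scheme \<Rightarrow> 'a set \<Rightarrow> nat \<Rightarrow> (nat \<Rightarrow> 'a set) \<Rightarrow> (nat \<Rightarrow> 'a set)" where
  "gr_comp A \<mm> n f = (\<lambda>i. if i = n then f n else ideal_power A \<mm> (Suc i))"

declare ideal_power.simps(2) [simp del]

locale adic_filtration = A?: cring A + ideal \<mm> A for A (structure) and \<mm>
begin

abbreviation "mp \<equiv> ideal_power A \<mm>"
abbreviation "G \<equiv> gr A \<mm>"
abbreviation "el \<equiv> gr_class A \<mm>"

lemma mp_ideal: "ideal (mp n) A"
  by (induction n) (auto simp: ideal_power.simps(2) intro: A.oneideal A.ideal_prod_is_ideal ideal_axioms)

lemma mp_carr: "a \<in> mp n \<Longrightarrow> a \<in> carrier A"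
  using ideal.Icarr[OF mp_ideal] .

lemma mp_zero [simp]: "\<zero> \<in> mp n"
  using additive_subgroup.zero_closed[OF ideal.axioms(1)[OF mp_ideal]] .

lemma mp_add: "\<lbrakk>a \<in> mp n; b \<in> mp n\<rbrakk> \<Longrightarrow> a \<oplus> b \<in> mp n"
  using additive_subgroup.a_closed[OF ideal.axioms(1)[OF mp_ideal]] .

lemma mp_minus: "a \<in> mp n \<Longrightarrow> \<ominus> a \<in> mp n"
  using additive_subgroup.a_inv_closed[OF ideal.axioms(1)[OF mp_ideal]] .

lemma mp_lmult: "\<lbrakk>x \<in> carrier A; a \<in> mp n\<rbrakk> \<Longrightarrow> x \<otimes> a \<in> mp n"
  using ideal.I_l_closed[OF mp_ideal] by blast

lemma mp_Suc_subset: "mp (Suc n) \<subseteq> mp n"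
  using A.ideal_prod_inter[OF mp_ideal ideal_axioms] by (auto simp: ideal_power.simps(2))

lemma mp_finsum:
  assumes "finite S" "\<And>i. i \<in> S \<Longrightarrow> f i \<in> mp n"
  shows "finsum A f S \<in> mp n"
  using assms
proof (induction S rule: finite_induct)
  case (insert i S)
  have "finsum A f (insert i S) = f i \<oplus> finsum A f S"
    using insert mp_carr by (intro A.finsum_insert) auto
  then show ?case using insert mp_add by simp
qed simp

lemma mp_1: "mp (Suc 0) = \<mm>"
  using A.ideal_prod_one[OF ideal_axioms] A.ideal_prod_commute[OF ideal_axioms A.oneideal]
  by (simp add: ideal_power.simps(2))

lemma mp_mult:
  assumes a: "a \<in> mp i" and b: "b \<in> mp j"
  shows "a \<otimes> b \<in> mp (i + j)"
  using b
proof (induction j arbitrary: b)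
  case 0
  then show ?case using a ideal.I_r_closed[OF mp_ideal] by auto
next
  case (Suc j)
  have "b \<in> ideal_prod A (mp j) \<mm>" using Suc.prems by (simp add: ideal_power.simps(2))
  then show ?case
  proof (induction b rule: ideal_prod.induct)
    case (prod x y)
    then have "(a \<otimes> x) \<otimes> y \<in> mp (i + Suc j)"
      using Suc.IH by (auto simp: ideal_power.simps(2) intro: ideal_prod.prod)
    then show ?case using prod a mp_carr Icarr by (simp add: A.m_assoc)
  next
    case (sum x y)
    have "x \<in> carrier A" "y \<in> carrier A"
      using sum.hyps A.ideal_prod_in_carrier[OF mp_ideal ideal_axioms] by auto
    then show ?case using sum mp_add a mp_carr by (simp add: A.r_distr)
  qed
qed

lemma mp_pow: "a \<in> mp i \<Longrightarrow> a [^] (n::nat) \<in> mp (i * n)"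
proof (induction n)
  case (Suc n)
  then show ?case using mp_mult[of "a [^] n" "i * n" a i] by (simp add: add.commute)
qed simp

lemma coset_eq_iff: "\<lbrakk>a \<in> carrier A; b \<in> carrier A\<rbrakk> \<Longrightarrow> mp n +> a = mp n +> b \<longleftrightarrow> a \<ominus> b \<in> mp n"
  using A.quotient_eq_iff_same_a_r_cos[OF mp_ideal] by blast

lemma coset_zero [simp]: "mp n +> \<zero> = mp n"
  using A.a_coset_add_zero ideal.Icarr[OF mp_ideal] by blast

lemma coset_eq_mp_iff: "a \<in> carrier A \<Longrightarrow> mp n +> a = mp n \<longleftrightarrow> a \<in> mp n"
  using coset_eq_iff[of a \<zero> n] by (simp add: a_minus_def)

lemma coset_add: "\<lbrakk>a \<in> carrier A; b \<in> carrier A\<rbrakk> \<Longrightarrow> (mp n +> a) <+> (mp n +> b) = mp n +> (a \<oplus> b)"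
  using ideal.a_rcos_sum[OF mp_ideal] .

text \<open>\<open>rcoset_mult\<close> is a union over representatives taken from cosets of
  different ideals. Changing a by an element of \<open>\<mm>^(i+1)\<close> or b by one of
  \<open>\<mm>^(j+1)\<close> changes the product by an element of \<open>\<mm>^(i+j+1)\<close>, so
  the union is one coset.\<close>

lemma coset_mult:
  assumes a: "a \<in> mp i" and b: "b \<in> mp j"
  shows "rcoset_mult A (mp (Suc (i + j))) (mp (Suc i) +> a) (mp (Suc j) +> b) = mp (Suc (i + j)) +> (a \<otimes> b)"
proof -
  have "mp (Suc (i + j)) +> (a' \<otimes> b') = mp (Suc (i + j)) +> (a \<otimes> b)"
    if a': "a' \<in> mp (Suc i) +> a" and b': "b' \<in> mp (Suc j) +> b" for a' b'
  proof -
    obtain u v where u: "u \<in> mp (Suc i)" "a' = u \<oplus> a" and v: "v \<in> mp (Suc j)" "b' = v \<oplus> b"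
      using a' b' by (auto simp: a_r_coset_def')
    note c = mp_carr[OF a] mp_carr[OF b] mp_carr[OF u(1)] mp_carr[OF v(1)]
    have "a' \<otimes> b' \<ominus> a \<otimes> b = u \<otimes> (v \<oplus> b) \<oplus> a \<otimes> v"
      using c unfolding u v a_minus_def by algebra
    moreover have "u \<otimes> (v \<oplus> b) \<in> mp (Suc (i + j))"
      using mp_mult[OF u(1), of "v \<oplus> b" j] v(1) mp_Suc_subset b mp_add by fastforce
    moreover have "a \<otimes> v \<in> mp (Suc (i + j))"
      using mp_mult[OF a v(1)] by simp
    ultimately have "a' \<otimes> b' \<ominus> a \<otimes> b \<in> mp (Suc (i + j))" using mp_add by simp
    moreover have "a' \<in> carrier A" "b' \<in> carrier A" using u v c by auto
    ultimately show ?thesis using c coset_eq_iff by simp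
  qed
  moreover have "a \<in> mp (Suc i) +> a" "b \<in> mp (Suc j) +> b"
    using abelian_subgroup.a_rcos_self[OF abelian_subgroupI3[OF ideal.axioms(1)[OF mp_ideal] A.abelian_group_axioms]]
      mp_carr[OF a] mp_carr[OF b] by auto
  ultimately show ?thesis unfolding rcoset_mult_def by blast
qed

section \<open>The Rees algebra and the ring axioms for G(A)\<close>

definition cls :: "(nat \<Rightarrow> 'a) \<Rightarrow> (nat \<Rightarrow> 'a set)" where
  "cls p = (\<lambda>n. mp (Suc n) +> p n)"

text \<open>The Rees algebra, the sum of the \<open>\<mm>^n X^n\<close> inside A[X]. The ring axioms
  for G(A) are transported from it along the surjection \<open>cls\<close>, instead of being checked
  on products of cosets.\<close>

definition rees :: "(nat \<Rightarrow> 'a) set" where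
  "rees = {p \<in> carrier (UP A). \<forall>n. p n \<in> mp n}"

abbreviation "Rees \<equiv> UP A \<lparr>carrier := rees\<rparr>"

lemma UP_simps:
  assumes "p \<in> carrier (UP A)" "q \<in> carrier (UP A)"
  shows "(p \<oplus>\<^bsub>UP A\<^esub> q) n = p n \<oplus> q n"
    and "(p \<otimes>\<^bsub>UP A\<^esub> q) n = (\<Oplus>i\<in>{..n}. p i \<otimes> q (n - i))"
  using assms by (auto simp: UP_def)

lemma UP_coeff: "p \<in> carrier (UP A) \<Longrightarrow> up_ring.coeff (UP A) p n = p n"
  by (simp add: UP_def)

lemma UP_one: "\<one>\<^bsub>UP A\<^esub> = (\<lambda>i. if i = 0 then \<one> else \<zero>)" and UP_zero: "\<zero>\<^bsub>UP A\<^esub> = (\<lambda>i. \<zero>)"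
  by (simp_all add: UP_def)

lemma UP_monom: "a \<in> carrier A \<Longrightarrow> up_ring.monom (UP A) a n = (\<lambda>i. if i = n then a else \<zero>)"
  by (simp add: UP_def)

lemma UP_carrierI: "\<lbrakk>\<And>n. p n \<in> carrier A; finite {n. p n \<noteq> \<zero>}\<rbrakk> \<Longrightarrow> p \<in> carrier (UP A)"
proof -
  assume p: "\<And>n. p n \<in> carrier A" and fin: "finite {n. p n \<noteq> \<zero>}"
  obtain N where "\<forall>n\<in>{n. p n \<noteq> \<zero>}. n \<le> N" using fin finite_nat_set_iff_bounded_le by auto
  then have "bound \<zero> N p" by (force simp: bound_def)
  then show ?thesis using p by (auto simp: UP_def up_def)
qed

lemma UP_A_cring: "cring (UP A)"
proof -
  interpret UP_cring A "UP A" by unfold_locales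
  show ?thesis by (rule UP_cring)
qed

lemma rees_subring: "subring rees (UP A)"
proof -
  interpret U: cring "UP A" by (rule UP_A_cring)
  have inv: "(\<ominus>\<^bsub>UP A\<^esub> p) n = \<ominus> p n" if "p \<in> carrier (UP A)" for p n
  proof -
    interpret UP_cring A "UP A" by unfold_locales
    show ?thesis using coeff_a_inv[OF that, of n] that U.a_inv_closed[OF that] by (simp only: UP_coeff)
  qed
  show ?thesis
  proof (rule U.subringI)
    show "rees \<subseteq> carrier (UP A)" by (auto simp: rees_def)
    show "\<one>\<^bsub>UP A\<^esub> \<in> rees" using U.one_closed by (simp add: rees_def UP_one)
    show "\<ominus>\<^bsub>UP A\<^esub> p \<in> rees" if "p \<in> rees" for p
      using that mp_minus U.a_inv_closed by (simp add: rees_def inv)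
    show "p \<oplus>\<^bsub>UP A\<^esub> q \<in> rees" if "p \<in> rees" "q \<in> rees" for p q
      using that mp_add U.add.m_closed by (simp add: rees_def UP_simps)
    show "p \<otimes>\<^bsub>UP A\<^esub> q \<in> rees" if "p \<in> rees" "q \<in> rees" for p q
    proof -
      have "(\<Oplus>i\<in>{..n}. p i \<otimes> q (n - i)) \<in> mp n" for n
      proof (rule mp_finsum)
        show "p i \<otimes> q (n - i) \<in> mp n" if "i \<in> {..n}" for i
          using mp_mult[of "p i" i "q (n - i)" "n - i"] \<open>p \<in> rees\<close> \<open>q \<in> rees\<close> that
          by (auto simp: rees_def)
      qed simp
      then show ?thesis using that U.m_closed by (simp add: rees_def UP_simps)
    qed
  qed
qed

lemma cls_hom: "cls \<in> ring_hom Rees G"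
proof (rule ring_hom_memI)
  interpret U: cring "UP A" by (rule UP_A_cring)
  show "cls \<one>\<^bsub>Rees\<^esub> = \<one>\<^bsub>G\<^esub>"
    by (auto simp: cls_def gr_def UP_one)
  fix p assume p: "p \<in> carrier Rees"
  then have pU: "p \<in> carrier (UP A)" and pm: "\<And>n. p n \<in> mp n" by (auto simp: rees_def)
  show "cls p \<in> carrier G"
  proof -
    obtain N where "bound \<zero> N p" using pU by (auto simp: UP_def up_def)
    then have "n \<le> N" if "mp (Suc n) +> p n \<noteq> mp (Suc n)" for n
      using that bound_below[of \<zero> N p n] coset_zero by metis
    then have "{n. mp (Suc n) +> p n \<noteq> mp (Suc n)} \<subseteq> {..N}" by blast
    then have "finite {n. mp (Suc n) +> p n \<noteq> mp (Suc n)}" by (rule finite_subset) simp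
    then show ?thesis using pm unfolding cls_def gr_def by fastforce
  qed
  fix q assume q: "q \<in> carrier Rees"
  then have qU: "q \<in> carrier (UP A)" and qm: "\<And>n. q n \<in> mp n" by (auto simp: rees_def)
  show "cls (p \<oplus>\<^bsub>Rees\<^esub> q) = cls p \<oplus>\<^bsub>G\<^esub> cls q"
    using pU qU mp_carr[OF pm] mp_carr[OF qm] by (auto simp: cls_def gr_def UP_simps coset_add)
  show "cls (p \<otimes>\<^bsub>Rees\<^esub> q) = cls p \<otimes>\<^bsub>G\<^esub> cls q"
  proof
    fix n
    interpret Q: ring_hom_cring A "A Quot mp (Suc n)" "(+>) (mp (Suc n))"
      by (rule ideal.rcos_ring_hom_cring[OF mp_ideal A.is_cring])
    have c: "rcoset_mult A (mp (Suc n)) (mp (Suc i) +> p i) (mp (Suc (n - i)) +> q (n - i))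
        = mp (Suc n) +> (p i \<otimes> q (n - i))" if "i \<le> n" for i
      using coset_mult[OF pm[of i] qm[of "n - i"]] that by simp
    have "cls (p \<otimes>\<^bsub>Rees\<^esub> q) n = mp (Suc n) +> (\<Oplus>i\<in>{..n}. p i \<otimes> q (n - i))"
      using pU qU by (simp add: cls_def UP_simps)
    also have "\<dots> = finsum (A Quot mp (Suc n)) (\<lambda>i. mp (Suc n) +> (p i \<otimes> q (n - i))) {..n}"
      using mp_carr[OF pm] mp_carr[OF qm] by (subst Q.hom_finsum) (auto simp: comp_def)
    also have "\<dots> = finsum (A Quot mp (Suc n)) (\<lambda>i. rcoset_mult A (mp (Suc n))
        (mp (Suc i) +> p i) (mp (Suc (n - i)) +> q (n - i))) {..n}"
      using mp_carr[OF pm] mp_carr[OF qm] by (intro Q.S.finsum_cong') (auto simp: c)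
    finally show "cls (p \<otimes>\<^bsub>Rees\<^esub> q) n = (cls p \<otimes>\<^bsub>G\<^esub> cls q) n"
      by (simp add: cls_def gr_def)
  qed
qed

lemma cls_surj: "cls ` rees = carrier G"
proof
  show "cls ` rees \<subseteq> carrier G" using ring_hom_closed[OF cls_hom] by auto
  show "carrier G \<subseteq> cls ` rees"
  proof
    fix f assume f: "f \<in> carrier G"
    then have "\<forall>n. \<exists>x. x \<in> mp n \<and> f n = mp (Suc n) +> x" by (auto simp: gr_def)
    then obtain x where x: "\<And>n. x n \<in> mp n" "\<And>n. f n = mp (Suc n) +> x n" by metis
    let ?p = "\<lambda>n. if f n = mp (Suc n) then \<zero> else x n"
    have "finite {n. f n \<noteq> mp (Suc n)}" using f by (auto simp: gr_def)
    moreover have "{n. ?p n \<noteq> \<zero>} \<subseteq> {n. f n \<noteq> mp (Suc n)}" by auto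
    ultimately have "finite {n. ?p n \<noteq> \<zero>}" by (rule rev_finite_subset)
    moreover have "x n \<in> carrier A" for n using x(1) mp_carr by blast
    ultimately have "?p \<in> rees"
      unfolding rees_def using x(1) by (auto intro!: UP_carrierI)
    moreover have "f = cls ?p" using x(2) by (auto simp: cls_def fun_eq_iff)
    ultimately show "f \<in> cls ` rees" by blast
  qed
qed

lemma G_cring: "cring G"
proof -
  interpret U: cring "UP A" by (rule UP_A_cring)
  interpret Re: ring Rees by (rule U.subring_is_ring[OF rees_subring])
  \<comment> \<open>The image of a ring is equipped with the image of zero, so this has to be
    identified with the zero of G.\<close>
  have z: "cls \<zero>\<^bsub>Rees\<^esub> = \<zero>\<^bsub>G\<^esub>" by (auto simp: cls_def gr_def UP_zero)
  have "G \<lparr>carrier := cls ` carrier Rees, zero := cls \<zero>\<^bsub>Rees\<^esub>\<rparr> = G"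
    unfolding z using cls_surj by simp
  then interpret G: ring G using Re.ring_hom_imp_img_ring[OF cls_hom] by simp
  show ?thesis
  proof (intro cring.intro comm_monoid.intro comm_monoid_axioms.intro G.ring_axioms G.monoid_axioms)
    fix f g assume "f \<in> carrier G" "g \<in> carrier G"
    then obtain p q where p: "p \<in> rees" "f = cls p" and q: "q \<in> rees" "g = cls q"
      using cls_surj by blast
    have "p \<otimes>\<^bsub>Rees\<^esub> q = q \<otimes>\<^bsub>Rees\<^esub> p" using p q U.m_comm by (auto simp: rees_def)
    then show "f \<otimes>\<^bsub>G\<^esub> g = g \<otimes>\<^bsub>G\<^esub> f"
      using ring_hom_mult[OF cls_hom, of p q] ring_hom_mult[OF cls_hom, of q p] p q by simp
  qed
qed

sublocale G: cring G by (rule G_cring)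

section \<open>Homogeneous elements and components of G(A)\<close>

lemma el_eq_cls: "a \<in> carrier A \<Longrightarrow> el n a = cls (up_ring.monom (UP A) a n)"
  by (simp add: gr_class_def cls_def UP_monom fun_eq_iff)

lemma monom_rees: "a \<in> mp n \<Longrightarrow> up_ring.monom (UP A) a n \<in> rees"
proof -
  interpret UP_cring A "UP A" by unfold_locales
  assume a: "a \<in> mp n"
  show ?thesis
    using monom_closed[OF mp_carr[OF a], of n] a by (simp add: rees_def UP_monom[OF mp_carr[OF a]])
qed

lemma el_closed [simp]: "a \<in> mp n \<Longrightarrow> el n a \<in> carrier G"
  using el_eq_cls[OF mp_carr, of a n n] monom_rees[of a n] cls_surj by auto

lemma el_add:
  assumes "a \<in> mp n" "b \<in> mp n"
  shows "el n (a \<oplus> b) = el n a \<oplus>\<^bsub>G\<^esub> el n b"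
proof -
  interpret UP_cring A "UP A" by unfold_locales
  note c = mp_carr[OF assms(1)] mp_carr[OF assms(2)]
  show ?thesis
    using ring_hom_add[OF cls_hom, of "up_ring.monom (UP A) a n" "up_ring.monom (UP A) b n"]
      monom_rees[OF assms(1)] monom_rees[OF assms(2)] monom_add[OF c, of n]
    by (simp add: el_eq_cls[OF c(1)] el_eq_cls[OF c(2)] el_eq_cls[OF A.add.m_closed[OF c]] del: monom_add)
qed

lemma el_mult:
  assumes "a \<in> mp n" "b \<in> mp n'"
  shows "el n a \<otimes>\<^bsub>G\<^esub> el n' b = el (n + n') (a \<otimes> b)"
proof -
  interpret UP_cring A "UP A" by unfold_locales
  note c = mp_carr[OF assms(1)] mp_carr[OF assms(2)]
  show ?thesis
    using ring_hom_mult[OF cls_hom, of "up_ring.monom (UP A) a n" "up_ring.monom (UP A) b n'"]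
      monom_rees[OF assms(1)] monom_rees[OF assms(2)] monom_mult[OF c, of n n']
    by (simp add: el_eq_cls[OF c(1)] el_eq_cls[OF c(2)] el_eq_cls[OF A.m_closed[OF c]] del: monom_mult)
qed

lemma G_zero: "\<zero>\<^bsub>G\<^esub> = (\<lambda>n. mp (Suc n))" and G_add: "f \<oplus>\<^bsub>G\<^esub> g = (\<lambda>n. f n <+> g n)"
  by (simp_all add: gr_def)

lemma el_eq_iff: "\<lbrakk>a \<in> carrier A; b \<in> carrier A\<rbrakk> \<Longrightarrow> el n a = el n b \<longleftrightarrow> a \<ominus> b \<in> mp (Suc n)"
  using coset_eq_iff by (auto simp: gr_class_def fun_eq_iff)

lemma el_zero_iff: "a \<in> carrier A \<Longrightarrow> el n a = \<zero>\<^bsub>G\<^esub> \<longleftrightarrow> a \<in> mp (Suc n)"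
  using coset_eq_mp_iff by (auto simp: gr_class_def G_zero fun_eq_iff)

lemma G_one: "\<one>\<^bsub>G\<^esub> = el 0 \<one>"
  by (simp add: gr_class_def gr_def fun_eq_iff)

lemma G_memE:
  assumes "f \<in> carrier G"
  obtains x where "x \<in> mp n" "f n = mp (Suc n) +> x"
  using assms unfolding gr_def by auto

lemma gr_part_eq: "gr_part A \<mm> n = el n ` mp n"
proof
  show "el n ` mp n \<subseteq> gr_part A \<mm> n"
    using el_closed by (auto simp: gr_part_def gr_class_def)
  show "gr_part A \<mm> n \<subseteq> el n ` mp n"
  proof
    fix f assume f: "f \<in> gr_part A \<mm> n"
    then obtain x where x: "x \<in> mp n" "f n = mp (Suc n) +> x"
      using G_memE[of f n] by (auto simp: gr_part_def)
    have "\<forall>i. i \<noteq> n \<longrightarrow> f i = mp (Suc i)" using f by (simp add: gr_part_def)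
    then have "f = el n x" using x(2) by (simp add: gr_class_def fun_eq_iff)
    then show "f \<in> el n ` mp n" using x by blast
  qed
qed

lemma gr_const_coset: "gr_const A \<mm> (\<mm> +> a) = el 0 a"
  unfolding gr_const_def gr_class_def mp_1 by (auto simp: fun_eq_iff)

lemma A_Quot_carrier: "carrier (A Quot \<mm>) = {\<mm> +> a | a. a \<in> carrier A}"
  by (auto simp: FactRing_def A_RCOSETS_def')

lemma gr_const_hom: "gr_const A \<mm> \<in> ring_hom (A Quot \<mm>) G"
proof (rule ring_hom_memI)
  note H = ring_hom_memE[OF rcos_ring_hom]
  have cl: "a \<in> mp 0" if "a \<in> carrier A" for a using that by simp
  show "gr_const A \<mm> \<one>\<^bsub>A Quot \<mm>\<^esub> = \<one>\<^bsub>G\<^esub>"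
    using H(4) gr_const_coset[of \<one>] G_one by simp
  fix x assume "x \<in> carrier (A Quot \<mm>)"
  then obtain a where a: "x = \<mm> +> a" "a \<in> carrier A" by (auto simp: A_Quot_carrier)
  show "gr_const A \<mm> x \<in> carrier G" using a el_closed[OF cl] by (simp add: gr_const_coset)
  fix y assume "y \<in> carrier (A Quot \<mm>)"
  then obtain b where b: "y = \<mm> +> b" "b \<in> carrier A" by (auto simp: A_Quot_carrier)
  show "gr_const A \<mm> (x \<otimes>\<^bsub>A Quot \<mm>\<^esub> y) = gr_const A \<mm> x \<otimes>\<^bsub>G\<^esub> gr_const A \<mm> y"
    using a b H(2)[of a b] el_mult[of a 0 b 0] gr_const_coset[of "a \<otimes> b"] by (simp add: gr_const_coset)
  show "gr_const A \<mm> (x \<oplus>\<^bsub>A Quot \<mm>\<^esub> y) = gr_const A \<mm> x \<oplus>\<^bsub>G\<^esub> gr_const A \<mm> y"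
    using a b H(3)[of a b] el_add[of a 0 b] gr_const_coset[of "a \<oplus> b"] by (simp add: gr_const_coset)
qed

lemma gr_comp_closed: "f \<in> carrier G \<Longrightarrow> gr_comp A \<mm> n f \<in> gr_part A \<mm> n"
proof -
  assume "f \<in> carrier G"
  then obtain x where "x \<in> mp n" "f n = mp (Suc n) +> x" by (rule G_memE)
  then show ?thesis by (auto simp: gr_part_eq gr_comp_def gr_class_def fun_eq_iff image_iff)
qed

lemma gr_comp_add: "gr_comp A \<mm> n (f \<oplus>\<^bsub>G\<^esub> g) = gr_comp A \<mm> n f \<oplus>\<^bsub>G\<^esub> gr_comp A \<mm> n g"
  using coset_add[of \<zero> \<zero>] by (auto simp: gr_comp_def G_add fun_eq_iff)

lemma gr_comp_el: "gr_comp A \<mm> n (el n' a) = (if n = n' then el n a else \<zero>\<^bsub>G\<^esub>)"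
  by (simp add: gr_comp_def gr_class_def G_zero fun_eq_iff)

text \<open>An element is the finite sum of its homogeneous components; zero is
  \<open>el 0 \<zero>\<close>, hence no case of its own.\<close>

lemma G_induct [consumes 1, case_names el add]:
  assumes f: "f \<in> carrier G"
    and e: "\<And>n a. a \<in> mp n \<Longrightarrow> P (el n a)"
    and ad: "\<And>f g. \<lbrakk>f \<in> carrier G; g \<in> carrier G; P f; P g\<rbrakk> \<Longrightarrow> P (f \<oplus>\<^bsub>G\<^esub> g)"
  shows "P f"
proof -
  have "finite S \<Longrightarrow> f \<in> carrier G \<Longrightarrow> {n. f n \<noteq> mp (Suc n)} \<subseteq> S \<Longrightarrow> P f" for S f
  proof (induction S arbitrary: f rule: finite_induct)
    case empty
    then have "f = el 0 \<zero>" by (auto simp: gr_class_def fun_eq_iff)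
    then show ?case using e by simp
  next
    case (insert n S)
    obtain x where x: "x \<in> mp n" "f n = mp (Suc n) +> x" using insert.prems G_memE by blast
    let ?g = "f(n := mp (Suc n))"
    have "finite {n. f n \<noteq> mp (Suc n)}" using insert.prems by (auto simp: gr_def)
    then have "finite {i. ?g i \<noteq> mp (Suc i)}" by (rule rev_finite_subset) auto
    moreover have "\<exists>y\<in>mp i. ?g i = mp (Suc i) +> y" for i
      using insert.prems by (cases "i = n") (auto simp: gr_def intro!: bexI[of _ \<zero>])
    ultimately have g: "?g \<in> carrier G" by (auto simp: gr_def)
    have "P ?g" by (rule insert.IH[OF g]) (use insert.prems in auto)
    moreover have "f = el n x \<oplus>\<^bsub>G\<^esub> ?g"
    proof
      fix i
      obtain y where y: "y \<in> mp i" "f i = mp (Suc i) +> y" using insert.prems G_memE by blast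
      show "f i = (el n x \<oplus>\<^bsub>G\<^esub> ?g) i"
        using x y mp_carr coset_add[of x \<zero> "Suc n"] coset_add[of \<zero> y "Suc i"]
        by (auto simp: gr_class_def G_add)
    qed
    ultimately show ?case using ad[OF el_closed[OF x(1)] g] e[OF x(1)] by metis
  qed
  moreover have "finite {n. f n \<noteq> mp (Suc n)}" using f by (auto simp: gr_def)
  ultimately show ?thesis using f by blast
qed

end

section \<open>The weak Nullstellensatz\<close>

lemma (in domain) nat_pow_nonzero: "\<lbrakk>a \<in> carrier R; a \<noteq> \<zero>\<rbrakk> \<Longrightarrow> a [^] (n::nat) \<noteq> \<zero>"
  by (induction n) (auto simp: integral_iff)

text \<open>Translates between polynomials as coefficient lists, for which algebraic closedness is
  formulated, and the sums produced by \<open>UnivPoly.eval\<close>. The lists run from the leading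
  coefficient down, hence \<open>rev\<close>.\<close>

lemma (in algebraically_closed) exists_root_of_sum:
  assumes a: "\<And>i. a i \<in> carrier L" and m: "a m \<noteq> \<zero>" "0 < m"
  obtains \<xi> where "\<xi> \<in> carrier L" "(\<Oplus>i\<in>{..m}. a i \<otimes> \<xi> [^] (i::nat)) = \<zero>"
proof -
  have ev: "eval (map a (rev [0..<Suc m])) \<xi> = (\<Oplus>i\<in>{..m}. a i \<otimes> \<xi> [^] i)" if "\<xi> \<in> carrier L" for \<xi> m
  proof (induction m)
    case 0
    then show ?case using a that by simp
  next
    case (Suc m)
    have "eval (map a (rev [0..<Suc (Suc m)])) \<xi>
        = a (Suc m) \<otimes> \<xi> [^] Suc m \<oplus> eval (map a (rev [0..<Suc m])) \<xi>" by simp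
    then show ?case using Suc a that by (subst finsum_Suc) (auto simp del: upt_Suc)
  qed
  let ?p = "map a (rev [0..<Suc m])"
  have p: "?p \<in> carrier (poly_ring L)"
    using a m by (auto simp: univ_poly_carrier[symmetric] polynomial_def)
  have "size (roots ?p) = m" using roots_over_carrier[OF p] by (simp add: splitted_def)
  then obtain \<xi> where "\<xi> \<in># roots ?p" using m(2) by (metis multiset_nonemptyE not_gr_zero size_empty)
  then have "is_root ?p \<xi>" using roots_mem_iff_is_root[OF p] by simp
  then have "\<xi> \<in> carrier L" "eval ?p \<xi> = \<zero>" by (auto simp: is_root_def)
  then show thesis using that ev by metis
qed

text \<open>A root of 1 + X p(X) cannot be a root of p; \<open>c\<close> lists the coefficients of
  that polynomial. This yields a non-root without counting the elements of the field.\<close>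

lemma (in algebraically_closed) exists_nonroot_of_sum:
  assumes a: "\<And>i. a i \<in> carrier L" and m: "a m \<noteq> \<zero>"
  obtains \<xi> where "\<xi> \<in> carrier L" "(\<Oplus>i\<in>{..m}. a i \<otimes> \<xi> [^] (i::nat)) \<noteq> \<zero>"
proof -
  define c where "c i = (case i of 0 \<Rightarrow> \<one> | Suc j \<Rightarrow> a j)" for i
  have c: "c i \<in> carrier L" for i using a by (simp add: c_def split: nat.split)
  obtain \<xi> where x: "\<xi> \<in> carrier L" "(\<Oplus>i\<in>{..Suc m}. c i \<otimes> \<xi> [^] i) = \<zero>"
    by (rule exists_root_of_sum[of c "Suc m"]) (use c m in \<open>auto simp: c_def\<close>)
  have "(\<Oplus>i\<in>{..Suc m}. c i \<otimes> \<xi> [^] i) = (\<Oplus>i\<in>{..m}. c (Suc i) \<otimes> \<xi> [^] Suc i) \<oplus> \<one>"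
    using x(1) c by (subst finsum_Suc2) (auto simp: c_def)
  also have "(\<Oplus>i\<in>{..m}. c (Suc i) \<otimes> \<xi> [^] Suc i) = (\<Oplus>i\<in>{..m}. (a i \<otimes> \<xi> [^] i) \<otimes> \<xi>)"
    using x(1) a by (intro finsum_cong') (auto simp: c_def m_assoc)
  also have "\<dots> = (\<Oplus>i\<in>{..m}. a i \<otimes> \<xi> [^] i) \<otimes> \<xi>"
    using x(1) a by (intro finsum_ldistr[symmetric]) auto
  finally have "(\<Oplus>i\<in>{..m}. a i \<otimes> \<xi> [^] i) \<otimes> \<xi> \<oplus> \<one> = \<zero>" using x(2) by simp
  then have "(\<Oplus>i\<in>{..m}. a i \<otimes> \<xi> [^] i) \<noteq> \<zero>" using x(1) by auto
  then show thesis using that x by blast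
qed

text \<open>A homomorphism \<open>\<phi>\<close> from \<open>R\<close> to an algebraically closed field extends to \<open>R[b]\<close>, without
  killing \<open>w\<close>, as soon as it does not kill a certain element \<open>u\<close>. For algebraic \<open>b\<close>, the element
  \<open>u\<close> contains the leading coefficient of a relation of least degree, so that pseudo-division
  works after applying \<open>\<phi>\<close>.\<close>

lemma hom_extension:
  assumes R: "domain R" and D: "domain D" and K: "algebraically_closed K"
    and j: "j \<in> ring_hom R D" "inj_on j (carrier R)" and b: "b \<in> carrier D"
    and f: "f \<in> carrier (UP R)" and w: "UnivPoly.eval R D j b f \<noteq> \<zero>\<^bsub>D\<^esub>"
  obtains u where "u \<in> carrier R" "u \<noteq> \<zero>\<^bsub>R\<^esub>"
    "\<And>\<phi>. \<lbrakk>\<phi> \<in> ring_hom R K; \<phi> u \<noteq> \<zero>\<^bsub>K\<^esub>\<rbrakk> \<Longrightarrow> \<exists>\<xi>\<in>carrier K.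
        (\<forall>q\<in>carrier (UP R). UnivPoly.eval R D j b q = \<zero>\<^bsub>D\<^esub> \<longrightarrow> UnivPoly.eval R K \<phi> \<xi> q = \<zero>\<^bsub>K\<^esub>) \<and>
        UnivPoly.eval R K \<phi> \<xi> f \<noteq> \<zero>\<^bsub>K\<^esub>"
proof -
  interpret R: domain R by fact
  interpret D: domain D by fact
  interpret K: algebraically_closed K by fact
  interpret UP_domain R "UP R" by unfold_locales
  interpret P: domain "UP R" by (rule UP_domain)
  interpret pb: UP_pre_univ_prop R D j "UP R"
    by unfold_locales (rule j(1))
  let ?P = "UP R"
  let ?b = "UnivPoly.eval R D j b"
  have bh: "?b \<in> ring_hom ?P D" by (rule pb.eval_ring_hom[OF b])
  interpret bh: ring_hom_cring ?P D ?b by unfold_locales (rule bh)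
  have b_smult: "?b (a \<odot>\<^bsub>?P\<^esub> q) = j a \<otimes>\<^bsub>D\<^esub> ?b q" if "a \<in> carrier R" "q \<in> carrier ?P" for a q
    using that b bh.hom_mult[of "up_ring.monom ?P a 0" q] by (simp add: monom_mult_is_smult pb.eval_const)
  have j0: "j a \<noteq> \<zero>\<^bsub>D\<^esub>" if "a \<in> carrier R" "a \<noteq> \<zero>\<^bsub>R\<^esub>" for a
    using that j(2) ring_hom_zero[OF j(1) R.ring_axioms D.ring_axioms] inj_onD[OF j(2), of a "\<zero>\<^bsub>R\<^esub>"] by auto
  have jcl: "j a \<in> carrier D" if "a \<in> carrier R" for a
    using ring_hom_closed[OF j(1) that] .
  have pow_nz: "a [^]\<^bsub>R\<^esub> k \<noteq> \<zero>\<^bsub>R\<^esub>" if "a \<in> carrier R" "a \<noteq> \<zero>\<^bsub>R\<^esub>" for a and k :: nat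
    using that R.nat_pow_nonzero by blast
  have ev: "UnivPoly.eval R K \<phi> \<xi> \<in> ring_hom ?P K"
    "\<And>a q. \<lbrakk>a \<in> carrier R; q \<in> carrier ?P\<rbrakk> \<Longrightarrow> UnivPoly.eval R K \<phi> \<xi> (a \<odot>\<^bsub>?P\<^esub> q) = \<phi> a \<otimes>\<^bsub>K\<^esub> UnivPoly.eval R K \<phi> \<xi> q"
    "\<And>a. a \<in> carrier R \<Longrightarrow> UnivPoly.eval R K \<phi> \<xi> (up_ring.monom ?P a 0) = \<phi> a"
    if phi: "\<phi> \<in> ring_hom R K" and xi: "\<xi> \<in> carrier K" for \<phi> \<xi>
  proof -
    interpret pk: UP_pre_univ_prop R K \<phi> "UP R"
      by unfold_locales (rule phi)
    show h: "UnivPoly.eval R K \<phi> \<xi> \<in> ring_hom ?P K" by (rule pk.eval_ring_hom[OF xi])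
    show "UnivPoly.eval R K \<phi> \<xi> (a \<odot>\<^bsub>?P\<^esub> q) = \<phi> a \<otimes>\<^bsub>K\<^esub> UnivPoly.eval R K \<phi> \<xi> q" if "a \<in> carrier R" "q \<in> carrier ?P" for a q
      using that xi ring_hom_mult[OF h, of "up_ring.monom ?P a 0" q] by (simp add: monom_mult_is_smult pk.eval_const)
    show "\<And>a. a \<in> carrier R \<Longrightarrow> UnivPoly.eval R K \<phi> \<xi> (up_ring.monom ?P a 0) = \<phi> a"
      by (rule pk.eval_const[OF xi])
  qed
  have ev_sum: "UnivPoly.eval R K \<phi> \<xi> q = (\<Oplus>\<^bsub>K\<^esub>i\<in>{..deg R q}. \<phi> (up_ring.coeff ?P q i) \<otimes>\<^bsub>K\<^esub> \<xi> [^]\<^bsub>K\<^esub> i)"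
    if "q \<in> carrier ?P" for \<phi> \<xi> q
    using that by (simp add: UnivPoly.eval_def)
  show thesis
  proof (cases "\<exists>p\<in>carrier ?P. p \<noteq> \<zero>\<^bsub>?P\<^esub> \<and> ?b p = \<zero>\<^bsub>D\<^esub>")
    \<comment> \<open>b is transcendental: no relation has to be respected, and \<xi> only has to
      avoid the roots of the image of f, which is nonzero when its leading coefficient
      survives.\<close>
    case False
    have fnz: "f \<noteq> \<zero>\<^bsub>?P\<^esub>" using w bh.hom_zero by metis
    show thesis
    proof (rule that)
      show "lcoeff f \<in> carrier R" "lcoeff f \<noteq> \<zero>\<^bsub>R\<^esub>" using f fnz lcoeff_nonzero by auto
      fix \<phi> assume phi: "\<phi> \<in> ring_hom R K" "\<phi> (lcoeff f) \<noteq> \<zero>\<^bsub>K\<^esub>"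
      have cl: "\<phi> (up_ring.coeff ?P f i) \<in> carrier K" for i
        using ring_hom_closed[OF phi(1)] f by simp
      obtain \<xi> where xi: "\<xi> \<in> carrier K" "UnivPoly.eval R K \<phi> \<xi> f \<noteq> \<zero>\<^bsub>K\<^esub>"
        using K.exists_nonroot_of_sum[of "\<lambda>i. \<phi> (up_ring.coeff ?P f i)" "deg R f"] cl phi(2) ev_sum[OF f] by metis
      have "UnivPoly.eval R K \<phi> \<xi> q = \<zero>\<^bsub>K\<^esub>" if "q \<in> carrier ?P" "?b q = \<zero>\<^bsub>D\<^esub>" for q
        using that False ring_hom_zero[OF ev(1)[OF phi(1) xi(1)] P.ring_axioms K.ring_axioms] by auto
      then show "\<exists>\<xi>\<in>carrier K. (\<forall>q\<in>carrier ?P. ?b q = \<zero>\<^bsub>D\<^esub> \<longrightarrow> UnivPoly.eval R K \<phi> \<xi> q = \<zero>\<^bsub>K\<^esub>) \<and>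
        UnivPoly.eval R K \<phi> \<xi> f \<noteq> \<zero>\<^bsub>K\<^esub>" using xi by blast
    qed
  next
    case True
    let ?Q = "\<lambda>p. p \<in> carrier ?P \<and> p \<noteq> \<zero>\<^bsub>?P\<^esub> \<and> ?b p = \<zero>\<^bsub>D\<^esub>"
    obtain p0 where "?Q p0" using True by blast
    then obtain p where pp: "?Q p \<and> (\<forall>q. ?Q q \<longrightarrow> deg R p \<le> deg R q)"
      using ex_has_least_nat[of ?Q p0 "deg R"] by blast
    then have p: "p \<in> carrier ?P" "p \<noteq> \<zero>\<^bsub>?P\<^esub>" "?b p = \<zero>\<^bsub>D\<^esub>" by blast+
    have pmin: "\<And>q. ?Q q \<Longrightarrow> deg R p \<le> deg R q" using pp by blast
    let ?a = "lcoeff p"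
    have a: "?a \<in> carrier R" "?a \<noteq> \<zero>\<^bsub>R\<^esub>" using p lcoeff_nonzero by auto
    have dp: "deg R p \<noteq> 0"
    proof
      assume "deg R p = 0"
      then have "p = up_ring.monom ?P (up_ring.coeff ?P p 0) 0" using deg_zero_impl_monom[OF p(1)] by simp
      then have "?b p = j (up_ring.coeff ?P p 0)" using pb.eval_const[OF b, of "up_ring.coeff ?P p 0"] p(1) by simp
      then show False
        using j0[OF coeff_closed[OF p(1), of 0]] lcoeff_nonzero_nonzero[OF \<open>deg R p = 0\<close> p(2,1)] p(3) by simp
    qed
    have zero_min: "q = \<zero>\<^bsub>?P\<^esub>" if "q \<in> carrier ?P" "?b q = \<zero>\<^bsub>D\<^esub>" "q = \<zero>\<^bsub>?P\<^esub> \<or> deg R q < deg R p" for q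
      using pmin[of q] that by (metis not_le)
    \<comment> \<open>Polynomials whose value at b is a nonzero multiple of f(b) in R[b]. One of
      least degree turns out to be a constant c; so f(b) divides a nonzero element of R, and if
      \<phi> c is nonzero then f(\<xi>) cannot be zero.\<close>
    let ?W = "\<lambda>q. q \<in> carrier ?P \<and> ?b q \<noteq> \<zero>\<^bsub>D\<^esub> \<and> (\<exists>t\<in>carrier ?P. ?b q = ?b f \<otimes>\<^bsub>D\<^esub> ?b t)"
    have Wf: "?W f"
      using f w bh.hom_one D.r_one[OF bh.hom_closed[OF f]] P.one_closed by (metis (no_types))
    obtain q where qq: "?W q \<and> (\<forall>q'. ?W q' \<longrightarrow> deg R q \<le> deg R q')"
      using ex_has_least_nat[of ?W f "deg R", OF Wf] by (rule exE)
    have q: "?W q" and qmin: "\<And>q'. ?W q' \<Longrightarrow> deg R q \<le> deg R q'"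
      using qq by blast+
    obtain t where t: "t \<in> carrier ?P" "?b q = ?b f \<otimes>\<^bsub>D\<^esub> ?b t" using q by blast
    have qP: "q \<in> carrier ?P" and qnz: "?b q \<noteq> \<zero>\<^bsub>D\<^esub>" using q by auto
    have qnz': "q \<noteq> \<zero>\<^bsub>?P\<^esub>" using qnz bh.hom_zero by metis
    \<comment> \<open>The remainder of q modulo p has, up to a factor from R, the same value at b
      and so belongs to the family again.\<close>
    have dq: "deg R q < deg R p"
    proof -
      obtain s \<rho> k where s: "s \<in> carrier ?P" "\<rho> \<in> carrier ?P"
        "?a [^]\<^bsub>R\<^esub> (k::nat) \<odot>\<^bsub>?P\<^esub> q = p \<otimes>\<^bsub>?P\<^esub> s \<oplus>\<^bsub>?P\<^esub> \<rho>" "\<rho> = \<zero>\<^bsub>?P\<^esub> \<or> deg R \<rho> < deg R p"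
        using long_div_theorem[OF p(1) qP p(2)] by blast
      have ak: "?a [^]\<^bsub>R\<^esub> k \<in> carrier R" using a by simp
      have "?b (?a [^]\<^bsub>R\<^esub> k \<odot>\<^bsub>?P\<^esub> q) = ?b \<rho>" unfolding s(3) using s p by simp
      then have e: "?b \<rho> = j (?a [^]\<^bsub>R\<^esub> k) \<otimes>\<^bsub>D\<^esub> ?b q" using b_smult[OF ak qP] by simp
      then have nz: "?b \<rho> \<noteq> \<zero>\<^bsub>D\<^esub>"
        using qnz j0[OF ak pow_nz[OF a]] D.integral_iff[OF jcl[OF ak] bh.hom_closed[OF qP]] by auto
      have "?b \<rho> = ?b f \<otimes>\<^bsub>D\<^esub> ?b (?a [^]\<^bsub>R\<^esub> k \<odot>\<^bsub>?P\<^esub> t)"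
        unfolding e t(2) using b_smult[OF ak t(1)] jcl[OF ak] f t(1) by (simp add: D.m_lcomm)
      then have "?W \<rho>" using s nz ak t by blast
      then have "deg R q \<le> deg R \<rho>" by (rule qmin)
      moreover have "\<rho> \<noteq> \<zero>\<^bsub>?P\<^esub>" using nz bh.hom_zero by metis
      ultimately show ?thesis using s(4) by simp
    qed
    \<comment> \<open>Pseudo-division of p by a nonconstant q leaves remainder zero, by minimality
      of q and then of p. The quotient s also vanishes at b and has smaller degree than p, against
      the choice of p.\<close>
    have dq0: "deg R q = 0"
    proof (rule ccontr)
      assume dq0: "deg R q \<noteq> 0"
      let ?l = "lcoeff q"
      have l: "?l \<in> carrier R" "?l \<noteq> \<zero>\<^bsub>R\<^esub>" using qP qnz' lcoeff_nonzero by auto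
      obtain s \<rho> k where s: "s \<in> carrier ?P" "\<rho> \<in> carrier ?P"
        "?l [^]\<^bsub>R\<^esub> (k::nat) \<odot>\<^bsub>?P\<^esub> p = q \<otimes>\<^bsub>?P\<^esub> s \<oplus>\<^bsub>?P\<^esub> \<rho>" "\<rho> = \<zero>\<^bsub>?P\<^esub> \<or> deg R \<rho> < deg R q"
        using long_div_theorem[OF qP p(1) qnz'] by blast
      have lk: "?l [^]\<^bsub>R\<^esub> k \<in> carrier R" using l by simp
      have "?b (?l [^]\<^bsub>R\<^esub> k \<odot>\<^bsub>?P\<^esub> p) = \<zero>\<^bsub>D\<^esub>" using b_smult[OF lk p(1)] p(3) jcl[OF lk] by simp
      then have e: "?b q \<otimes>\<^bsub>D\<^esub> ?b s \<oplus>\<^bsub>D\<^esub> ?b \<rho> = \<zero>\<^bsub>D\<^esub>" unfolding s(3) using s qP by simp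
      have "?b \<rho> = \<zero>\<^bsub>D\<^esub>"
      proof (rule ccontr)
        assume nz: "?b \<rho> \<noteq> \<zero>\<^bsub>D\<^esub>"
        have cl: "?b \<rho> \<in> carrier D" "?b s \<in> carrier D" "?b t \<in> carrier D" "?b f \<in> carrier D" using s t f by auto
        have "?b \<rho> = \<ominus>\<^bsub>D\<^esub> (?b q \<otimes>\<^bsub>D\<^esub> ?b s)"
          using e cl qP by (metis D.a_comm D.m_closed D.minus_equality bh.hom_closed)
        also have "\<dots> = ?b f \<otimes>\<^bsub>D\<^esub> ?b (\<ominus>\<^bsub>?P\<^esub> (t \<otimes>\<^bsub>?P\<^esub> s))"
          unfolding t(2) using cl t s f by (simp add: D.r_minus D.m_assoc)
        finally have "?W \<rho>" using s nz t by blast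
        then have "deg R q \<le> deg R \<rho>" by (rule qmin)
        moreover have "\<rho> \<noteq> \<zero>\<^bsub>?P\<^esub>" using nz bh.hom_zero by metis
        ultimately show False using s(4) by simp
      qed
      then have "\<rho> = \<zero>\<^bsub>?P\<^esub>" using zero_min[OF s(2)] s(4) dq by auto
      moreover from \<open>?b \<rho> = \<zero>\<^bsub>D\<^esub>\<close> have "?b s = \<zero>\<^bsub>D\<^esub>"
        using e qnz D.integral[of "?b q" "?b s"] qP s by simp
      ultimately have e2: "?l [^]\<^bsub>R\<^esub> k \<odot>\<^bsub>?P\<^esub> p = q \<otimes>\<^bsub>?P\<^esub> s" using s qP by simp
      have d1: "deg R (?l [^]\<^bsub>R\<^esub> k \<odot>\<^bsub>?P\<^esub> p) = deg R p" using deg_smult[OF lk p(1)] pow_nz[OF l] by simp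
      show False
      proof (cases "s = \<zero>\<^bsub>?P\<^esub>")
        case True
        then show False using d1 e2 qP dp by simp
      next
        case False
        then have "deg R p = deg R q + deg R s" using d1 e2 deg_mult[OF qnz' False qP s(1)] by simp
        then show False using zero_min[OF s(1) \<open>?b s = \<zero>\<^bsub>D\<^esub>\<close>] False dq0 by simp
      qed
    qed
    let ?c = "up_ring.coeff ?P q 0"
    have c: "?c \<in> carrier R" "?c \<noteq> \<zero>\<^bsub>R\<^esub>" using lcoeff_nonzero_nonzero[OF dq0 qnz' qP] qP by auto
    have qc: "q = up_ring.monom ?P ?c 0" using deg_zero_impl_monom[OF qP dq0] .
    show thesis
    proof (rule that)
      show "?a \<otimes>\<^bsub>R\<^esub> ?c \<in> carrier R" "?a \<otimes>\<^bsub>R\<^esub> ?c \<noteq> \<zero>\<^bsub>R\<^esub>" using a c R.integral by auto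
      fix \<phi> assume phi: "\<phi> \<in> ring_hom R K" "\<phi> (?a \<otimes>\<^bsub>R\<^esub> ?c) \<noteq> \<zero>\<^bsub>K\<^esub>"
      have pc: "\<phi> ?a \<noteq> \<zero>\<^bsub>K\<^esub>" "\<phi> ?c \<noteq> \<zero>\<^bsub>K\<^esub>"
        using phi ring_hom_mult[OF phi(1) a(1) c(1)] ring_hom_closed[OF phi(1)] a c by auto
      have cl: "\<phi> (up_ring.coeff ?P p i) \<in> carrier K" for i
        using ring_hom_closed[OF phi(1)] p by simp
      obtain \<xi> where xi: "\<xi> \<in> carrier K" "UnivPoly.eval R K \<phi> \<xi> p = \<zero>\<^bsub>K\<^esub>"
        using K.exists_root_of_sum[of "\<lambda>i. \<phi> (up_ring.coeff ?P p i)" "deg R p"] cl pc(1) dp ev_sum[OF p(1)]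
        by (metis not_gr_zero)
      note E = ev[OF phi(1) xi(1)]
      interpret e: ring_hom_cring ?P K "UnivPoly.eval R K \<phi> \<xi>" by unfold_locales (rule E(1))
      \<comment> \<open>A relation g is, up to a power of the leading coefficient of p, a multiple
        of p: its remainder is a relation of smaller degree, hence zero. After applying \<phi> the
        power can be cancelled, because \<phi> keeps that coefficient nonzero.\<close>
      have ker: "UnivPoly.eval R K \<phi> \<xi> g = \<zero>\<^bsub>K\<^esub>" if g: "g \<in> carrier ?P" "?b g = \<zero>\<^bsub>D\<^esub>" for g
      proof -
        obtain s \<rho> k where s: "s \<in> carrier ?P" "\<rho> \<in> carrier ?P"
          "?a [^]\<^bsub>R\<^esub> (k::nat) \<odot>\<^bsub>?P\<^esub> g = p \<otimes>\<^bsub>?P\<^esub> s \<oplus>\<^bsub>?P\<^esub> \<rho>" "\<rho> = \<zero>\<^bsub>?P\<^esub> \<or> deg R \<rho> < deg R p"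
          using long_div_theorem[OF p(1) g(1) p(2)] by blast
        have ak: "?a [^]\<^bsub>R\<^esub> k \<in> carrier R" using a by simp
        have "?b (?a [^]\<^bsub>R\<^esub> k \<odot>\<^bsub>?P\<^esub> g) = ?b \<rho>" unfolding s(3) using s p by simp
        then have "?b \<rho> = \<zero>\<^bsub>D\<^esub>" using b_smult[OF ak g(1)] g(2) jcl[OF ak] by simp
        then have r: "\<rho> = \<zero>\<^bsub>?P\<^esub>" using zero_min s by blast
        have "UnivPoly.eval R K \<phi> \<xi> (?a [^]\<^bsub>R\<^esub> k \<odot>\<^bsub>?P\<^esub> g) = \<zero>\<^bsub>K\<^esub>"
          unfolding s(3) r using s p xi by simp
        then have "\<phi> (?a [^]\<^bsub>R\<^esub> k) \<otimes>\<^bsub>K\<^esub> UnivPoly.eval R K \<phi> \<xi> g = \<zero>\<^bsub>K\<^esub>" using E(2)[OF ak g(1)] by simp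
        moreover have "\<phi> (?a [^]\<^bsub>R\<^esub> k) \<noteq> \<zero>\<^bsub>K\<^esub>"
        proof -
          have "\<phi> (?a [^]\<^bsub>R\<^esub> k) = \<phi> ?a [^]\<^bsub>K\<^esub> k"
            using a(1) ring_hom_ring.hom_nat_pow[OF ring_hom_ringI2[OF R.ring_axioms K.ring_axioms phi(1)]] by blast
          then show ?thesis using K.nat_pow_nonzero[OF _ pc(1)] ring_hom_closed[OF phi(1) a(1)] by simp
        qed
        ultimately show ?thesis
          using K.integral[of "\<phi> (?a [^]\<^bsub>R\<^esub> k)" "UnivPoly.eval R K \<phi> \<xi> g"] ring_hom_closed[OF phi(1) ak] g by simp
      qed
      have "UnivPoly.eval R K \<phi> \<xi> f \<noteq> \<zero>\<^bsub>K\<^esub>"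
      proof
        assume z: "UnivPoly.eval R K \<phi> \<xi> f = \<zero>\<^bsub>K\<^esub>"
        \<comment> \<open>q - f t is a relation, so f(\<xi>) = 0 would force q(\<xi>) = \<phi> c =
          0.\<close>
        have "?b (q \<ominus>\<^bsub>?P\<^esub> f \<otimes>\<^bsub>?P\<^esub> t) = \<zero>\<^bsub>D\<^esub>"
          using qP f t by (simp add: a_minus_def t(2)[symmetric] D.r_neg)
        then have "UnivPoly.eval R K \<phi> \<xi> (q \<ominus>\<^bsub>?P\<^esub> f \<otimes>\<^bsub>?P\<^esub> t) = \<zero>\<^bsub>K\<^esub>"
          using ker qP f t by simp
        then have "UnivPoly.eval R K \<phi> \<xi> q = \<zero>\<^bsub>K\<^esub>"
          using qP f t z by (simp add: a_minus_def)
        then show False using E(3)[OF c(1)] qc pc by simp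
      qed
      then show "\<exists>\<xi>\<in>carrier K. (\<forall>q\<in>carrier ?P. ?b q = \<zero>\<^bsub>D\<^esub> \<longrightarrow> UnivPoly.eval R K \<phi> \<xi> q = \<zero>\<^bsub>K\<^esub>) \<and>
        UnivPoly.eval R K \<phi> \<xi> f \<noteq> \<zero>\<^bsub>K\<^esub>" using xi ker by blast
    qed
  qed
qed

lemma FactRing_zero: "\<zero>\<^bsub>R Quot I\<^esub> = I"
  by (simp add: FactRing_def)

text \<open>S has enough K-valued points to detect each of its nonzero elements. The mere existence
  of a point would not pass through an adjunction, since the extension step asks for a point
  avoiding a prescribed u.\<close>

definition separates_points ::
    "('b, 'd) ring_scheme \<Rightarrow> ('e, 'f) ring_scheme \<Rightarrow> ('b \<Rightarrow> 'e) \<Rightarrow> 'e set \<Rightarrow> bool" where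
  "separates_points K D h S \<longleftrightarrow> subring S D \<and> (\<forall>w\<in>S. w \<noteq> \<zero>\<^bsub>D\<^esub> \<longrightarrow>
     (\<exists>\<chi>\<in>ring_hom (D \<lparr>carrier := S\<rparr>) K. (\<forall>c\<in>carrier K. \<chi> (h c) = c) \<and> \<chi> w \<noteq> \<zero>\<^bsub>K\<^esub>))"

lemma separates_points_adjoin:
  assumes D: "domain D" and K: "algebraically_closed K" and S: "separates_points K D h S"
    and hS: "h ` carrier K \<subseteq> S" and b: "b \<in> carrier D"
  obtains S' where "separates_points K D h S'" "S \<subseteq> S'" "b \<in> S'"
proof -
  interpret D: domain D by fact
  interpret K: algebraically_closed K by fact
  have sS: "subring S D" using S by (simp add: separates_points_def)
  let ?R = "D \<lparr>carrier := S\<rparr>"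
  have SD: "S \<subseteq> carrier D" using subringE(1)[OF sS] .
  have R: "domain ?R" using D.subdomain_is_domain[OF D.subdomainI'[OF sS]] .
  interpret R: domain ?R by (rule R)
  have j: "id \<in> ring_hom ?R D" using SD by (auto intro!: ring_hom_memI)
  interpret UP_domain ?R "UP ?R" by unfold_locales
  interpret pb: UP_pre_univ_prop ?R D id "UP ?R" by unfold_locales (rule j)
  interpret P: domain "UP ?R" by (rule UP_domain)
  let ?P = "UP ?R"
  let ?b = "UnivPoly.eval ?R D id b"
  have bh: "?b \<in> ring_hom ?P D" by (rule pb.eval_ring_hom[OF b])
  interpret bh: ring_hom_ring ?P D ?b by (rule ring_hom_ringI2[OF P.ring_axioms D.ring_axioms bh])
  define S' where "S' = ?b ` carrier ?P"
  have sub: "subring S' D" unfolding S'_def by (rule bh.img_is_subring[OF P.carrier_is_subring])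
  have const: "?b (up_ring.monom ?P s 0) = s" if "s \<in> S" for s
    using pb.eval_const[OF b, of s] that by simp
  have inS': "s \<in> S'" if "s \<in> S" for s
    unfolding S'_def using const[OF that] monom_closed[of s 0] that
    by (intro image_eqI[of _ _ "up_ring.monom ?P s 0"]) auto
  have bS': "b \<in> S'"
    unfolding S'_def using pb.eval_monom1[OF b] monom_closed[OF R.one_closed, of 1]
    by (intro image_eqI[of _ _ "up_ring.monom ?P \<one>\<^bsub>?R\<^esub> 1"]) auto
  have "\<exists>\<chi>\<in>ring_hom (D \<lparr>carrier := S'\<rparr>) K. (\<forall>c\<in>carrier K. \<chi> (h c) = c) \<and> \<chi> w \<noteq> \<zero>\<^bsub>K\<^esub>"
    if w: "w \<in> S'" "w \<noteq> \<zero>\<^bsub>D\<^esub>" for w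
  proof -
    obtain f where f: "f \<in> carrier ?P" "w = ?b f" using w by (auto simp: S'_def)
    have inj: "inj_on id (carrier ?R)" by simp
    obtain u where u: "u \<in> S" "u \<noteq> \<zero>\<^bsub>D\<^esub>" and
      ext: "\<And>\<phi>. \<lbrakk>\<phi> \<in> ring_hom ?R K; \<phi> u \<noteq> \<zero>\<^bsub>K\<^esub>\<rbrakk> \<Longrightarrow> \<exists>\<xi>\<in>carrier K.
        (\<forall>q\<in>carrier ?P. ?b q = \<zero>\<^bsub>D\<^esub> \<longrightarrow> UnivPoly.eval ?R K \<phi> \<xi> q = \<zero>\<^bsub>K\<^esub>) \<and>
        UnivPoly.eval ?R K \<phi> \<xi> f \<noteq> \<zero>\<^bsub>K\<^esub>"
      using hom_extension[OF R D K j inj b f(1)] w f(2) by auto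
    obtain \<phi> where phi: "\<phi> \<in> ring_hom ?R K" "\<forall>c\<in>carrier K. \<phi> (h c) = c" "\<phi> u \<noteq> \<zero>\<^bsub>K\<^esub>"
      using S u unfolding separates_points_def by blast
    obtain \<xi> where xi: "\<xi> \<in> carrier K"
      and ker: "\<And>q. \<lbrakk>q \<in> carrier ?P; ?b q = \<zero>\<^bsub>D\<^esub>\<rbrakk> \<Longrightarrow> UnivPoly.eval ?R K \<phi> \<xi> q = \<zero>\<^bsub>K\<^esub>"
      and nz: "UnivPoly.eval ?R K \<phi> \<xi> f \<noteq> \<zero>\<^bsub>K\<^esub>"
      using ext[OF phi(1,3)] by blast
    interpret pk: UP_pre_univ_prop ?R K \<phi> "UP ?R" by unfold_locales (rule phi(1))
    let ?e = "UnivPoly.eval ?R K \<phi> \<xi>"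
    have eh: "?e \<in> ring_hom ?P K" by (rule pk.eval_ring_hom[OF xi])
    interpret e: ring_hom_ring ?P K ?e by (rule ring_hom_ringI2[OF P.ring_axioms K.ring_axioms eh])
    \<comment> \<open>The point of S[b] sends q(b) to q(\<xi>); relations of b are respected by
      \<xi>, so the choice of q is immaterial.\<close>
    define \<chi> where "\<chi> y = ?e (SOME q. q \<in> carrier ?P \<and> ?b q = y)" for y
    have chi: "\<chi> (?b q) = ?e q" if q: "q \<in> carrier ?P" for q
    proof -
      define q' where "q' = (SOME q'. q' \<in> carrier ?P \<and> ?b q' = ?b q)"
      have q': "q' \<in> carrier ?P" "?b q' = ?b q"
        using someI[of "\<lambda>q'. q' \<in> carrier ?P \<and> ?b q' = ?b q" q] q unfolding q'_def by auto
      have "?b (q' \<ominus>\<^bsub>?P\<^esub> q) = \<zero>\<^bsub>D\<^esub>" using q q' by (simp add: a_minus_def D.r_neg)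
      then have "?e (q' \<ominus>\<^bsub>?P\<^esub> q) = \<zero>\<^bsub>K\<^esub>" using ker q q' by simp
      then have "?e q' \<ominus>\<^bsub>K\<^esub> ?e q = \<zero>\<^bsub>K\<^esub>" using q q' by (simp add: a_minus_def)
      then have "?e q' = ?e q" using q q' by simp
      then show ?thesis by (simp add: \<chi>_def q'_def)
    qed
    show ?thesis
    proof (intro bexI conjI ballI)
      show "\<chi> w \<noteq> \<zero>\<^bsub>K\<^esub>" using nz chi f by simp
      show "\<chi> (h c) = c" if c: "c \<in> carrier K" for c
      proof -
        have hc: "h c \<in> S" using hS c by blast
        have "\<chi> (h c) = ?e (up_ring.monom ?P (h c) 0)"
          using chi[OF monom_closed, of "h c" 0] const[OF hc] hc by simp
        also have "\<dots> = \<phi> (h c)" using pk.eval_const[OF xi, of "h c"] hc by simp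
        finally show ?thesis using phi(2) c by simp
      qed
      show "\<chi> \<in> ring_hom (D \<lparr>carrier := S'\<rparr>) K"
      proof (rule ring_hom_memI; simp)
        show "\<chi> y \<in> carrier K" if "y \<in> S'" for y using that chi by (auto simp: S'_def)
        show "\<chi> (y \<otimes>\<^bsub>D\<^esub> z) = \<chi> y \<otimes>\<^bsub>K\<^esub> \<chi> z" "\<chi> (y \<oplus>\<^bsub>D\<^esub> z) = \<chi> y \<oplus>\<^bsub>K\<^esub> \<chi> z"
          if yz: "y \<in> S'" "z \<in> S'" for y z
        proof -
          obtain p q where pq: "p \<in> carrier ?P" "y = ?b p" "q \<in> carrier ?P" "z = ?b q"
            using yz by (auto simp: S'_def)
          have "y \<otimes>\<^bsub>D\<^esub> z = ?b (p \<otimes>\<^bsub>?P\<^esub> q)" "y \<oplus>\<^bsub>D\<^esub> z = ?b (p \<oplus>\<^bsub>?P\<^esub> q)" using pq by auto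
          then show "\<chi> (y \<otimes>\<^bsub>D\<^esub> z) = \<chi> y \<otimes>\<^bsub>K\<^esub> \<chi> z" "\<chi> (y \<oplus>\<^bsub>D\<^esub> z) = \<chi> y \<oplus>\<^bsub>K\<^esub> \<chi> z"
            using pq chi[of p] chi[of q] chi[of "p \<otimes>\<^bsub>?P\<^esub> q"] chi[of "p \<oplus>\<^bsub>?P\<^esub> q"] by auto
        qed
        show "\<chi> \<one>\<^bsub>D\<^esub> = \<one>\<^bsub>K\<^esub>" using chi[of "\<one>\<^bsub>?P\<^esub>"] by simp
      qed
    qed
  qed
  then have "separates_points K D h S'" using sub by (simp add: separates_points_def)
  then show thesis using that inS' bS' by blast
qed

text \<open>Generators are adjoined one at a time, starting from the image of K, where the inverse
  of h detects everything. Finite generation enters as \<open>gen\<close>: a subring containing K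
  and all x i is the whole ring.\<close>

lemma affine_point_of_domain:
  fixes n :: nat
  assumes D: "domain D" and K: "algebraically_closed K" and h: "h \<in> ring_hom K D"
    and x: "\<And>i. i < n \<Longrightarrow> x i \<in> carrier D"
    and gen: "\<And>S. \<lbrakk>subring S D; h ` carrier K \<subseteq> S; \<And>i. i < n \<Longrightarrow> x i \<in> S\<rbrakk> \<Longrightarrow> S = carrier D"
  obtains \<chi> where "\<chi> \<in> ring_hom D K" "\<And>c. c \<in> carrier K \<Longrightarrow> \<chi> (h c) = c"
proof -
  interpret D: domain D by fact
  interpret K: algebraically_closed K by fact
  interpret h: ring_hom_ring K D h by (rule ring_hom_ringI2[OF K.ring_axioms D.ring_axioms h])
  have "\<one>\<^bsub>D\<^esub> \<in> h ` carrier K" using h.hom_one K.one_closed by (metis imageI)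
  then have "h ` carrier K \<noteq> {\<zero>\<^bsub>D\<^esub>}" using D.one_not_zero by blast
  then have inj: "inj_on h (carrier K)" by (rule h.non_trivial_field_hom_imp_inj[OF K.field_axioms])
  have "\<exists>S. separates_points K D h S \<and> h ` carrier K \<subseteq> S \<and> (\<forall>i<m. x i \<in> S)" if "m \<le> n" for m
    using that
  proof (induction m)
    case 0
    have sub: "subring (h ` carrier K) D" by (rule h.img_is_subring[OF K.carrier_is_subring])
    have "\<exists>\<chi>\<in>ring_hom (D \<lparr>carrier := h ` carrier K\<rparr>) K. (\<forall>c\<in>carrier K. \<chi> (h c) = c) \<and> \<chi> w \<noteq> \<zero>\<^bsub>K\<^esub>"
      if w: "w \<in> h ` carrier K" "w \<noteq> \<zero>\<^bsub>D\<^esub>" for w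
    proof (intro bexI conjI ballI)
      let ?\<chi> = "inv_into (carrier K) h"
      have inv: "?\<chi> (h c) = c" if "c \<in> carrier K" for c using inv_into_f_f[OF inj that] .
      then show "\<And>c. c \<in> carrier K \<Longrightarrow> ?\<chi> (h c) = c" .
      show "?\<chi> w \<noteq> \<zero>\<^bsub>K\<^esub>" using w inv by auto
      show "?\<chi> \<in> ring_hom (D \<lparr>carrier := h ` carrier K\<rparr>) K"
      proof (rule ring_hom_memI; simp)
        show "?\<chi> y \<in> carrier K" if "y \<in> h ` carrier K" for y using that inv by auto
        show "?\<chi> (y \<otimes>\<^bsub>D\<^esub> z) = ?\<chi> y \<otimes>\<^bsub>K\<^esub> ?\<chi> z" "?\<chi> (y \<oplus>\<^bsub>D\<^esub> z) = ?\<chi> y \<oplus>\<^bsub>K\<^esub> ?\<chi> z"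
          if yz: "y \<in> h ` carrier K" "z \<in> h ` carrier K" for y z
        proof -
          obtain c d where cd: "c \<in> carrier K" "y = h c" "d \<in> carrier K" "z = h d" using yz by auto
          then have "y \<otimes>\<^bsub>D\<^esub> z = h (c \<otimes>\<^bsub>K\<^esub> d)" "y \<oplus>\<^bsub>D\<^esub> z = h (c \<oplus>\<^bsub>K\<^esub> d)" by auto
          then show "?\<chi> (y \<otimes>\<^bsub>D\<^esub> z) = ?\<chi> y \<otimes>\<^bsub>K\<^esub> ?\<chi> z" "?\<chi> (y \<oplus>\<^bsub>D\<^esub> z) = ?\<chi> y \<oplus>\<^bsub>K\<^esub> ?\<chi> z"
            using cd inv[of c] inv[of d] inv[of "c \<otimes>\<^bsub>K\<^esub> d"] inv[of "c \<oplus>\<^bsub>K\<^esub> d"] by auto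
        qed
        show "?\<chi> \<one>\<^bsub>D\<^esub> = \<one>\<^bsub>K\<^esub>" using inv[of "\<one>\<^bsub>K\<^esub>"] h.hom_one by simp
      qed
    qed
    then show ?case using sub by (auto simp: separates_points_def)
  next
    case (Suc m)
    then obtain S where S: "separates_points K D h S" "h ` carrier K \<subseteq> S" "\<forall>i<m. x i \<in> S" by auto
    obtain S' where "separates_points K D h S'" "S \<subseteq> S'" "x m \<in> S'"
      using separates_points_adjoin[OF D K S(1,2)] x[of m] Suc.prems by auto
    then show ?case using S by (metis less_Suc_eq subset_iff)
  qed
  then obtain S where S: "separates_points K D h S" "h ` carrier K \<subseteq> S" "\<forall>i<n. x i \<in> S" by blast
  then have "subring S D" by (simp add: separates_points_def)
  then have eq: "S = carrier D" using S(2,3) by (intro gen) auto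
  obtain \<chi> where "\<chi> \<in> ring_hom (D \<lparr>carrier := S\<rparr>) K" "\<forall>c\<in>carrier K. \<chi> (h c) = c"
    using S(1) D.one_not_zero D.one_closed unfolding separates_points_def eq by blast
  then show thesis using that by (simp add: eq ring_hom_def)
qed

text \<open>Zorn's lemma applies because ideals avoiding 1 are closed under unions of nonempty
  chains.\<close>

lemma (in cring) exists_maximalideal_superset:
  assumes "ideal Q R" "\<one> \<notin> Q"
  obtains M where "maximalideal M R" "Q \<subseteq> M"
proof -
  let ?A = "{I. ideal I R \<and> Q \<subseteq> I \<and> \<one> \<notin> I}"
  have "\<exists>M\<in>?A. \<forall>I\<in>?A. M \<subseteq> I \<longrightarrow> I = M"
  proof (rule subset_Zorn_nonempty)
    show "?A \<noteq> {}" using assms by blast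
    fix C assume C: "C \<noteq> {}" "subset.chain ?A C"
    then have "subset.chain {I. ideal I R} C" by (auto simp: pred_on.chain_def)
    from chain_Union_is_ideal[OF this] have "ideal (\<Union>C) R" using C by simp
    then show "\<Union>C \<in> ?A" using C by (auto simp: pred_on.chain_def)
  qed
  then obtain M where M: "ideal M R" "Q \<subseteq> M" "\<one> \<notin> M" "\<And>I. \<lbrakk>ideal I R; Q \<subseteq> I; \<one> \<notin> I; M \<subseteq> I\<rbrakk> \<Longrightarrow> I = M"
    by auto
  have "maximalideal M R"
  proof (rule maximalidealI[OF M(1)])
    show "carrier R \<noteq> M" using M(3) by auto
    fix J assume J: "ideal J R" "M \<subseteq> J" "J \<subseteq> carrier R"
    show "J = M \<or> J = carrier R"
      using M J ideal.one_imp_carrier[OF J(1)] by blast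
  qed
  then show thesis using that M(2) by blast
qed

text \<open>The quotient by a maximal ideal above Q is a finitely generated domain over K, so it has
  a K-valued point.\<close>

lemma weak_nullstellensatz:
  fixes n :: nat
  assumes T: "cring T" and K: "algebraically_closed K" and h: "h \<in> ring_hom K T"
    and x: "\<And>i. i < n \<Longrightarrow> x i \<in> carrier T"
    and gen: "\<And>S. \<lbrakk>subring S T; h ` carrier K \<subseteq> S; \<And>i. i < n \<Longrightarrow> x i \<in> S\<rbrakk> \<Longrightarrow> S = carrier T"
    and Q: "ideal Q T" "\<one>\<^bsub>T\<^esub> \<notin> Q"
  obtains \<chi> where "\<chi> \<in> ring_hom T K" "\<And>c. c \<in> carrier K \<Longrightarrow> \<chi> (h c) = c" "\<And>q. q \<in> Q \<Longrightarrow> \<chi> q = \<zero>\<^bsub>K\<^esub>"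
proof -
  interpret T: cring T by fact
  interpret K: algebraically_closed K by fact
  obtain M where M: "maximalideal M T" "Q \<subseteq> M" using T.exists_maximalideal_superset[OF Q] by blast
  interpret M: primeideal M T by (rule T.maximalideal_prime[OF M(1)])
  let ?D = "T Quot M" and ?\<pi> = "(+>\<^bsub>T\<^esub>) M"
  interpret D: domain ?D by (rule M.quotient_is_domain)
  have pi: "?\<pi> \<in> ring_hom T ?D" by (rule M.rcos_ring_hom)
  interpret pi: ring_hom_ring T ?D ?\<pi> by (rule M.rcos_ring_hom_ring)
  have surj: "\<exists>t\<in>carrier T. y = ?\<pi> t" if "y \<in> carrier ?D" for y
    using that unfolding FactRing_def A_RCOSETS_def' partial_object.simps by blast
  have hh: "?\<pi> \<circ> h \<in> ring_hom K ?D" by (rule ring_hom_trans[OF h pi])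
  have gen': "S = carrier ?D"
    if S: "subring S ?D" "(?\<pi> \<circ> h) ` carrier K \<subseteq> S" "\<And>i. i < n \<Longrightarrow> ?\<pi> (x i) \<in> S" for S
  proof -
    \<comment> \<open>Generation passes to the quotient: the preimage of S is a subring containing
      all generators of T.\<close>
    let ?S = "{t \<in> carrier T. ?\<pi> t \<in> S}"
    note SE = subringE[OF S(1)]
    have "subring ?S T"
    proof (rule T.subringI)
      show "?S \<subseteq> carrier T" by blast
      show "\<one>\<^bsub>T\<^esub> \<in> ?S" using SE(3) pi.hom_one by simp
      show "\<ominus>\<^bsub>T\<^esub> t \<in> ?S" if "t \<in> ?S" for t using that SE(5) by simp
      show "t \<otimes>\<^bsub>T\<^esub> u \<in> ?S" if "t \<in> ?S" "u \<in> ?S" for t u using that SE(6) by simp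
      show "t \<oplus>\<^bsub>T\<^esub> u \<in> ?S" if "t \<in> ?S" "u \<in> ?S" for t u using that SE(7) by simp
    qed
    moreover have "h ` carrier K \<subseteq> ?S" using S(2) ring_hom_closed[OF h] by auto
    ultimately have "?S = carrier T" using S(3) x by (intro gen) auto
    then have inS: "?\<pi> t \<in> S" if "t \<in> carrier T" for t using that by blast
    show ?thesis
    proof
      show "S \<subseteq> carrier ?D" by (rule SE(1))
      show "carrier ?D \<subseteq> S"
      proof
        fix y assume "y \<in> carrier ?D"
        then obtain t where "t \<in> carrier T" "y = ?\<pi> t" using surj by (elim bexE[OF surj])
        then show "y \<in> S" using inS by simp
      qed
    qed
  qed
  have xD: "?\<pi> (x i) \<in> carrier ?D" if "i < n" for i
    by (rule ring_hom_closed[OF pi x[OF that]])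
  have "\<exists>\<chi>\<in>ring_hom ?D K. \<forall>c\<in>carrier K. \<chi> ((?\<pi> \<circ> h) c) = c"
  proof (rule affine_point_of_domain[OF D.domain_axioms K hh, of n "\<lambda>i. ?\<pi> (x i)"])
    show "?\<pi> (x i) \<in> carrier ?D" if "i < n" for i by (rule xD[OF that])
    show "S = carrier ?D" if "subring S ?D" "(?\<pi> \<circ> h) ` carrier K \<subseteq> S" "\<And>i. i < n \<Longrightarrow> ?\<pi> (x i) \<in> S" for S
      by (rule gen'[OF that])
    fix \<chi> assume "\<chi> \<in> ring_hom ?D K" "\<And>c. c \<in> carrier K \<Longrightarrow> \<chi> ((?\<pi> \<circ> h) c) = c"
    then show "\<exists>\<chi>\<in>ring_hom ?D K. \<forall>c\<in>carrier K. \<chi> ((?\<pi> \<circ> h) c) = c" by blast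
  qed
  then obtain \<chi> where chi: "\<chi> \<in> ring_hom ?D K" "\<And>c. c \<in> carrier K \<Longrightarrow> \<chi> ((?\<pi> \<circ> h) c) = c" by blast
  show thesis
  proof (rule that)
    show "\<chi> \<circ> ?\<pi> \<in> ring_hom T K" by (rule ring_hom_trans[OF pi chi(1)])
    show "(\<chi> \<circ> ?\<pi>) (h c) = c" if "c \<in> carrier K" for c using chi(2)[OF that] by simp
    show "(\<chi> \<circ> ?\<pi>) q = \<zero>\<^bsub>K\<^esub>" if "q \<in> Q" for q
    proof -
      have "?\<pi> q = \<zero>\<^bsub>?D\<^esub>" using M.a_rcos_const[OF subsetD[OF M(2) that]] unfolding FactRing_zero .
      then show ?thesis unfolding comp_def using ring_hom_zero[OF chi(1) D.ring_axioms K.ring_axioms] by metis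
    qed
  qed
qed

section \<open>Standard graded algebras over an algebraically closed field\<close>

text \<open>The grading is given by projections \<open>pr\<close> in place of a direct sum. The two
  induction rules encode that T is the sum of its parts and that \<open>Tn (Suc n)\<close> is
  additively generated by products of \<open>Tn n\<close> with the coordinates, that is, T is
  standard graded.\<close>

locale graded_algebra = T?: cring T + K?: algebraically_closed K
  for T :: "('t, 'm) ring_scheme" (structure) and K :: "('b, 'd) ring_scheme" (structure) +
  fixes h :: "'b \<Rightarrow> 't" and Tn :: "nat \<Rightarrow> 't set" and pr :: "nat \<Rightarrow> 't \<Rightarrow> 't" and r :: nat and x :: "nat \<Rightarrow> 't"
  assumes h: "h \<in> ring_hom K T"
    and Tn_sub: "Tn n \<subseteq> carrier T"
    and pr_in: "t \<in> carrier T \<Longrightarrow> pr n t \<in> Tn n"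
    and pr_add: "\<lbrakk>t \<in> carrier T; u \<in> carrier T\<rbrakk> \<Longrightarrow> pr n (t \<oplus>\<^bsub>T\<^esub> u) = pr n t \<oplus>\<^bsub>T\<^esub> pr n u"
    and pr_Tn: "t \<in> Tn m \<Longrightarrow> pr n t = (if n = m then t else \<zero>\<^bsub>T\<^esub>)"
    and Tn_mult: "\<lbrakk>t \<in> Tn i; u \<in> Tn j\<rbrakk> \<Longrightarrow> t \<otimes>\<^bsub>T\<^esub> u \<in> Tn (i + j)"
    and T0: "Tn 0 = h ` carrier K"
    and x_T1: "i \<le> r \<Longrightarrow> x i \<in> Tn 1"
    and homog_induct: "\<And>P t. \<lbrakk>t \<in> carrier T; \<And>n t. t \<in> Tn n \<Longrightarrow> P t;
        \<And>t u. \<lbrakk>t \<in> carrier T; u \<in> carrier T; P t; P u\<rbrakk> \<Longrightarrow> P (t \<oplus>\<^bsub>T\<^esub> u)\<rbrakk> \<Longrightarrow> P t"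
    and Tn_Suc_induct: "\<And>P n t. \<lbrakk>t \<in> Tn (Suc n); \<And>u i. \<lbrakk>u \<in> Tn n; i \<le> r\<rbrakk> \<Longrightarrow> P (u \<otimes>\<^bsub>T\<^esub> x i);
        \<And>t u. \<lbrakk>t \<in> Tn (Suc n); u \<in> Tn (Suc n); P t; P u\<rbrakk> \<Longrightarrow> P (t \<oplus>\<^bsub>T\<^esub> u)\<rbrakk> \<Longrightarrow> P t"
begin

lemmas homog_ind = homog_induct [consumes 1, case_names homog add]
lemmas Tn_Suc_ind = Tn_Suc_induct [consumes 1, case_names gen add]

lemma Tn_carr: "t \<in> Tn n \<Longrightarrow> t \<in> carrier T"
  using Tn_sub by blast

lemma pr_carr [simp]: "t \<in> carrier T \<Longrightarrow> pr n t \<in> carrier T"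
  using pr_in Tn_carr by blast

lemma pr_zero: "pr n \<zero>\<^bsub>T\<^esub> = \<zero>\<^bsub>T\<^esub>"
  using pr_add[of "\<zero>\<^bsub>T\<^esub>" "\<zero>\<^bsub>T\<^esub>" n] pr_carr[of "\<zero>\<^bsub>T\<^esub>" n] by (simp add: T.add.r_cancel_one')

lemma pr_minus: "t \<in> carrier T \<Longrightarrow> pr n (\<ominus>\<^bsub>T\<^esub> t) = \<ominus>\<^bsub>T\<^esub> pr n t"
  using pr_add[of "\<ominus>\<^bsub>T\<^esub> t" t n] by (simp add: T.l_neg pr_zero T.minus_equality)

lemma Tn_iff: "t \<in> Tn n \<longleftrightarrow> t \<in> carrier T \<and> pr n t = t"
  using pr_Tn[of t n n] pr_in[of t n] Tn_carr by auto

lemma Tn_add: "\<lbrakk>t \<in> Tn n; u \<in> Tn n\<rbrakk> \<Longrightarrow> t \<oplus>\<^bsub>T\<^esub> u \<in> Tn n"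
  by (auto simp: Tn_iff pr_add)

lemma Tn_zero [simp]: "\<zero>\<^bsub>T\<^esub> \<in> Tn n"
  by (auto simp: Tn_iff pr_zero)

lemma Tn_minus: "t \<in> Tn n \<Longrightarrow> \<ominus>\<^bsub>T\<^esub> t \<in> Tn n"
  by (auto simp: Tn_iff pr_minus)

lemma Tn_diff: "\<lbrakk>t \<in> Tn n; u \<in> Tn n\<rbrakk> \<Longrightarrow> t \<ominus>\<^bsub>T\<^esub> u \<in> Tn n"
  unfolding a_minus_def by (intro Tn_add Tn_minus)

lemma h_T0: "c \<in> carrier K \<Longrightarrow> h c \<in> Tn 0"
  by (simp add: T0)

lemma T_one: "\<one>\<^bsub>T\<^esub> \<in> Tn 0"
  using ring_hom_one[OF h] h_T0[OF K.one_closed] by simp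

lemma h_carr: "c \<in> carrier K \<Longrightarrow> h c \<in> carrier T"
  using h_T0 Tn_carr by blast

lemma x_carr: "i \<le> r \<Longrightarrow> x i \<in> carrier T"
  using x_T1 Tn_carr by blast

lemma Tn_pow: "t \<in> Tn n \<Longrightarrow> t [^]\<^bsub>T\<^esub> (k::nat) \<in> Tn (n * k)"
proof (induction k)
  case 0
  then show ?case using T_one by simp
next
  case (Suc k)
  then show ?case using Tn_mult[of "t [^]\<^bsub>T\<^esub> k" "n * k" t n] by (simp add: add.commute)
qed

text \<open>The bound is stated for all large N, so that the decompositions of two summands can be
  compared at a common one.\<close>

lemma decomposition:
  "t \<in> carrier T \<Longrightarrow> \<exists>N0. \<forall>N\<ge>N0. t = (\<Oplus>\<^bsub>T\<^esub>n\<in>{..<N}. pr n t) \<and> pr N t = \<zero>\<^bsub>T\<^esub>"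
proof (induction t rule: homog_ind)
  case (homog n t)
  have tc: "t \<in> carrier T" using homog Tn_carr by blast
  show ?case
  proof (intro exI[of _ "Suc n"] allI impI conjI)
    fix N assume N: "Suc n \<le> N"
    have "(\<Oplus>\<^bsub>T\<^esub>m\<in>{..<N}. pr m t) = (\<Oplus>\<^bsub>T\<^esub>m\<in>{..<N}. if n = m then t else \<zero>\<^bsub>T\<^esub>)"
      using pr_Tn[OF homog] tc by (intro T.finsum_cong') auto
    also have "\<dots> = t" using T.finsum_singleton[of n "{..<N}" "\<lambda>_. t"] N tc by simp
    finally show "t = (\<Oplus>\<^bsub>T\<^esub>m\<in>{..<N}. pr m t)" by simp
    show "pr N t = \<zero>\<^bsub>T\<^esub>" using pr_Tn[OF homog] N by simp
  qed
next
  case (add t u)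
  then obtain N1 N2 where N: "\<forall>N\<ge>N1. t = (\<Oplus>\<^bsub>T\<^esub>n\<in>{..<N}. pr n t) \<and> pr N t = \<zero>\<^bsub>T\<^esub>"
    "\<forall>N\<ge>N2. u = (\<Oplus>\<^bsub>T\<^esub>n\<in>{..<N}. pr n u) \<and> pr N u = \<zero>\<^bsub>T\<^esub>" by blast
  show ?case
  proof (intro exI[of _ "max N1 N2"] allI impI conjI)
    fix n assume n: "max N1 N2 \<le> n"
    have "(\<Oplus>\<^bsub>T\<^esub>m\<in>{..<n}. pr m (t \<oplus>\<^bsub>T\<^esub> u)) = (\<Oplus>\<^bsub>T\<^esub>m\<in>{..<n}. pr m t \<oplus>\<^bsub>T\<^esub> pr m u)"
      using add by (intro T.finsum_cong') (auto simp: pr_add)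
    also have "\<dots> = (\<Oplus>\<^bsub>T\<^esub>m\<in>{..<n}. pr m t) \<oplus>\<^bsub>T\<^esub> (\<Oplus>\<^bsub>T\<^esub>m\<in>{..<n}. pr m u)"
      using add by (intro T.finsum_addf) auto
    also have "\<dots> = t \<oplus>\<^bsub>T\<^esub> u" using N n by simp
    finally show "t \<oplus>\<^bsub>T\<^esub> u = (\<Oplus>\<^bsub>T\<^esub>m\<in>{..<n}. pr m (t \<oplus>\<^bsub>T\<^esub> u))" by simp
    show "pr n (t \<oplus>\<^bsub>T\<^esub> u) = \<zero>\<^bsub>T\<^esub>" using add N n by (simp add: pr_add)
  qed
qed

lemma pr_eventually_zero:
  assumes "t \<in> carrier T"
  obtains N where "\<And>n. n \<ge> N \<Longrightarrow> pr n t = \<zero>\<^bsub>T\<^esub>"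
  using decomposition[OF assms] by blast

lemma zero_if_components_zero:
  assumes "t \<in> carrier T" "\<And>n. pr n t = \<zero>\<^bsub>T\<^esub>"
  shows "t = \<zero>\<^bsub>T\<^esub>"
  using decomposition[OF assms(1)] assms(2) by auto

lemma pr_mult_homog:
  assumes t: "t \<in> Tn m" and u: "u \<in> carrier T"
  shows "pr n (t \<otimes>\<^bsub>T\<^esub> u) = (if m \<le> n then t \<otimes>\<^bsub>T\<^esub> pr (n - m) u else \<zero>\<^bsub>T\<^esub>)"
  using u
proof (induction u rule: homog_ind)
  case (homog j u)
  show ?case using pr_Tn[OF Tn_mult[OF t homog], of n] pr_Tn[OF homog, of "n - m"] Tn_carr[OF t] by auto
next
  case (add u v)
  then show ?case using Tn_carr[OF t] by (simp add: T.r_distr pr_add)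
qed

lemma pr_mult:
  assumes t: "t \<in> carrier T" and u: "u \<in> carrier T"
  shows "pr n (t \<otimes>\<^bsub>T\<^esub> u) = (\<Oplus>\<^bsub>T\<^esub>i\<in>{..n}. pr i t \<otimes>\<^bsub>T\<^esub> pr (n - i) u)"
  using t
proof (induction t rule: homog_ind)
  case (homog m t)
  have tc: "t \<in> carrier T" using homog Tn_carr by blast
  have "(\<Oplus>\<^bsub>T\<^esub>i\<in>{..n}. pr i t \<otimes>\<^bsub>T\<^esub> pr (n - i) u)
      = (\<Oplus>\<^bsub>T\<^esub>i\<in>{..n}. if m = i then t \<otimes>\<^bsub>T\<^esub> pr (n - i) u else \<zero>\<^bsub>T\<^esub>)"
    using pr_Tn[OF homog] tc u by (intro T.finsum_cong') auto
  also have "\<dots> = (if m \<le> n then t \<otimes>\<^bsub>T\<^esub> pr (n - m) u else \<zero>\<^bsub>T\<^esub>)"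
  proof (cases "m \<le> n")
    case True
    then show ?thesis using T.finsum_singleton[of m "{..n}" "\<lambda>i. t \<otimes>\<^bsub>T\<^esub> pr (n - i) u"] tc u by simp
  next
    case False
    then have "(\<Oplus>\<^bsub>T\<^esub>i\<in>{..n}. if m = i then t \<otimes>\<^bsub>T\<^esub> pr (n - i) u else \<zero>\<^bsub>T\<^esub>) = (\<Oplus>\<^bsub>T\<^esub>i\<in>{..n}. \<zero>\<^bsub>T\<^esub>)"
      by (intro T.finsum_cong') auto
    then show ?thesis using False by simp
  qed
  finally show ?case using pr_mult_homog[OF homog u] by simp
next
  case (add t t')
  have "(\<Oplus>\<^bsub>T\<^esub>i\<in>{..n}. pr i (t \<oplus>\<^bsub>T\<^esub> t') \<otimes>\<^bsub>T\<^esub> pr (n - i) u)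
      = (\<Oplus>\<^bsub>T\<^esub>i\<in>{..n}. pr i t \<otimes>\<^bsub>T\<^esub> pr (n - i) u \<oplus>\<^bsub>T\<^esub> pr i t' \<otimes>\<^bsub>T\<^esub> pr (n - i) u)"
    using add u by (intro T.finsum_cong') (auto simp: pr_add T.l_distr)
  also have "\<dots> = (\<Oplus>\<^bsub>T\<^esub>i\<in>{..n}. pr i t \<otimes>\<^bsub>T\<^esub> pr (n - i) u) \<oplus>\<^bsub>T\<^esub> (\<Oplus>\<^bsub>T\<^esub>i\<in>{..n}. pr i t' \<otimes>\<^bsub>T\<^esub> pr (n - i) u)"
    using add u by (intro T.finsum_addf) auto
  finally show ?case using add u by (simp add: T.l_distr pr_add)
qed

lemma generated:
  assumes S: "subring S T" "h ` carrier K \<subseteq> S" "\<And>i. i \<le> r \<Longrightarrow> x i \<in> S"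
  shows "S = carrier T"
proof
  note SE = subringE[OF S(1)]
  show "S \<subseteq> carrier T" using SE(1) .
  have Tn: "Tn n \<subseteq> S" for n
  proof (induction n)
    case 0
    then show ?case using S(2) T0 by simp
  next
    case (Suc n)
    show ?case
    proof
      fix t assume "t \<in> Tn (Suc n)"
      then show "t \<in> S"
      proof (induction t rule: Tn_Suc_ind)
        case (gen u i)
        then show ?case using Suc S(3) SE(6) by blast
      qed (use SE(7) in blast)
    qed
  qed
  show "carrier T \<subseteq> S"
  proof
    fix t assume "t \<in> carrier T"
    then show "t \<in> S"
      by (induction t rule: homog_ind) (use Tn SE(7) in blast)+
  qed
qed

text \<open>The K-algebra homomorphisms from T to K, that is, the K-valued points of the affine cone
  Spec T.\<close>

definition chars :: "('t \<Rightarrow> 'b) set" where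
  "chars = {\<chi> \<in> ring_hom T K. \<forall>c\<in>carrier K. \<chi> (h c) = c}"

lemma charsD:
  assumes "\<chi> \<in> chars"
  shows "\<chi> \<in> ring_hom T K" "\<And>c. c \<in> carrier K \<Longrightarrow> \<chi> (h c) = c"
  using assms by (auto simp: chars_def)

lemma char_hom: "\<chi> \<in> chars \<Longrightarrow> ring_hom_cring T K \<chi>"
  by unfold_locales (simp add: chars_def)

text \<open>The ideal \<open>Q + (f - 1)\<close> is proper: comparing the components of \<open>1 = q + g(f - 1)\<close> shows that
  the component of \<open>g\<close> of degree \<open>j deg f\<close> is \<open>-f\<^sup>j\<close> modulo \<open>Q\<close>.\<close>

lemma graded_nullstellensatz:
  assumes Q: "ideal Q T" and gr: "\<And>q i. q \<in> Q \<Longrightarrow> pr i q \<in> Q"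
    and f: "f \<in> Tn N" "0 < N" and pow: "\<And>k::nat. f [^]\<^bsub>T\<^esub> k \<notin> Q"
  obtains \<chi> where "\<chi> \<in> chars" "\<chi> f = \<one>\<^bsub>K\<^esub>" "\<And>q. q \<in> Q \<Longrightarrow> \<chi> q = \<zero>\<^bsub>K\<^esub>"
proof -
  interpret Q: ideal Q T by fact
  have fc: "f \<in> carrier T" using f Tn_carr by blast
  \<comment> \<open>A point of the cone where f is nonzero can be moved along its line to one where
    f = 1, since f has positive degree. So adding f - 1 to Q takes the place of the auxiliary
    variable in the argument of Rabinowitsch.\<close>
  let ?e = "f \<ominus>\<^bsub>T\<^esub> \<one>\<^bsub>T\<^esub>"
  have ec: "?e \<in> carrier T" using fc by simp
  have ePI: "ideal (PIdl\<^bsub>T\<^esub> ?e) T" by (rule T.cgenideal_ideal[OF ec])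
  let ?Q = "Q <+>\<^bsub>T\<^esub> PIdl\<^bsub>T\<^esub> ?e"
  have QI: "ideal ?Q T" by (rule T.add_ideals[OF Q ePI])
  have "\<one>\<^bsub>T\<^esub> \<notin> ?Q"
  proof
    assume "\<one>\<^bsub>T\<^esub> \<in> ?Q"
    then obtain q g where q: "q \<in> Q" and g: "g \<in> carrier T" and eq: "\<one>\<^bsub>T\<^esub> = q \<oplus>\<^bsub>T\<^esub> g \<otimes>\<^bsub>T\<^esub> ?e"
      by (auto simp: set_add_def' cgenideal_def)
    have qc: "q \<in> carrier T" using q Q.Icarr by blast
    have eq': "\<one>\<^bsub>T\<^esub> \<oplus>\<^bsub>T\<^esub> g = q \<oplus>\<^bsub>T\<^esub> f \<otimes>\<^bsub>T\<^esub> g"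
    proof -
      have "\<one>\<^bsub>T\<^esub> \<oplus>\<^bsub>T\<^esub> g = (q \<oplus>\<^bsub>T\<^esub> g \<otimes>\<^bsub>T\<^esub> ?e) \<oplus>\<^bsub>T\<^esub> g" using eq by simp
      also have "\<dots> = q \<oplus>\<^bsub>T\<^esub> f \<otimes>\<^bsub>T\<^esub> g"
        using qc g fc by (simp add: a_minus_def T.r_distr T.r_minus T.a_assoc T.l_neg T.m_comm)
      finally show ?thesis .
    qed
    have comp: "pr n \<one>\<^bsub>T\<^esub> \<oplus>\<^bsub>T\<^esub> pr n g = pr n q \<oplus>\<^bsub>T\<^esub> pr n (f \<otimes>\<^bsub>T\<^esub> g)" for n
      using arg_cong[OF eq', of "pr n"] qc g fc by (simp add: pr_add)
    have claim: "pr (j * N) g \<oplus>\<^bsub>T\<^esub> f [^]\<^bsub>T\<^esub> j \<in> Q" for j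
    proof (induction j)
      case 0
      have "pr 0 (f \<otimes>\<^bsub>T\<^esub> g) = \<zero>\<^bsub>T\<^esub>" using pr_mult_homog[OF f(1) g, of 0] f(2) by simp
      then have "\<one>\<^bsub>T\<^esub> \<oplus>\<^bsub>T\<^esub> pr 0 g = pr 0 q" using comp[of 0] pr_Tn[OF T_one, of 0] qc by simp
      then show ?case using gr[OF q, of 0] g by (simp add: T.a_comm)
    next
      case (Suc j)
      have "pr (Suc j * N) \<one>\<^bsub>T\<^esub> = \<zero>\<^bsub>T\<^esub>" using pr_Tn[OF T_one] f(2) by simp
      then have c: "pr (Suc j * N) g = pr (Suc j * N) q \<oplus>\<^bsub>T\<^esub> f \<otimes>\<^bsub>T\<^esub> pr (j * N) g"
        using comp[of "Suc j * N"] pr_mult_homog[OF f(1) g, of "Suc j * N"] g by simp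
      have "pr (Suc j * N) g \<oplus>\<^bsub>T\<^esub> f [^]\<^bsub>T\<^esub> Suc j
          = pr (Suc j * N) q \<oplus>\<^bsub>T\<^esub> f \<otimes>\<^bsub>T\<^esub> (pr (j * N) g \<oplus>\<^bsub>T\<^esub> f [^]\<^bsub>T\<^esub> j)"
        unfolding c using g qc fc by (simp add: T.r_distr T.a_assoc T.m_comm)
      then show ?case using gr[OF q] Suc Q.I_l_closed[OF Suc fc] Q.a_closed by simp
    qed
    obtain M where M: "\<And>n. n \<ge> M \<Longrightarrow> pr n g = \<zero>\<^bsub>T\<^esub>" using pr_eventually_zero[OF g] by blast
    have "pr (M * N) g = \<zero>\<^bsub>T\<^esub>" using M[of "M * N"] f(2) by simp
    then have "f [^]\<^bsub>T\<^esub> M \<in> Q" using claim[of M] fc by simp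
    then show False using pow by blast
  qed
  moreover have "S = carrier T"
    if "subring S T" "h ` carrier K \<subseteq> S" "\<And>i. i < Suc r \<Longrightarrow> x i \<in> S" for S
    using that by (intro generated) auto
  moreover have "x i \<in> carrier T" if "i < Suc r" for i using that x_carr by auto
  ultimately obtain \<chi> where chi: "\<chi> \<in> ring_hom T K" "\<And>c. c \<in> carrier K \<Longrightarrow> \<chi> (h c) = c"
    "\<And>q. q \<in> ?Q \<Longrightarrow> \<chi> q = \<zero>\<^bsub>K\<^esub>"
    using weak_nullstellensatz[OF T.is_cring K.algebraically_closed_axioms h, of "Suc r" x ?Q] QI by metis
  interpret chi: ring_hom_cring T K \<chi> by unfold_locales (rule chi(1))
  have e0: "\<zero>\<^bsub>T\<^esub> \<in> PIdl\<^bsub>T\<^esub> ?e" "?e \<in> PIdl\<^bsub>T\<^esub> ?e"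
    using additive_subgroup.zero_closed[OF ideal.axioms(1)[OF ePI]] T.cgenideal_self[OF ec] by auto
  have add: "u \<oplus>\<^bsub>T\<^esub> v \<in> ?Q" if "u \<in> Q" "v \<in> PIdl\<^bsub>T\<^esub> ?e" for u v
    using that unfolding set_add_def' by blast
  have "q \<in> ?Q" if "q \<in> Q" for q using add[OF that e0(1)] Q.Icarr[OF that] by simp
  moreover have "?e \<in> ?Q" using add[OF Q.zero_closed e0(2)] ec by simp
  then have "\<chi> f \<ominus>\<^bsub>K\<^esub> \<one>\<^bsub>K\<^esub> = \<zero>\<^bsub>K\<^esub>" using chi(3)[of ?e] fc by (simp add: a_minus_def)
  then have "\<chi> f = \<one>\<^bsub>K\<^esub>" using fc by simp
  moreover have "\<chi> \<in> chars" using chi by (simp add: chars_def)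
  ultimately show thesis using that chi(3) by blast
qed

text \<open>The homomorphism T \<rightarrow> K[X] sending t to the sum of the
  \<open>\<chi>(t_n) X^n\<close>: restriction of functions on the cone to the line through
  \<chi>.\<close>

definition char_poly :: "('t \<Rightarrow> 'b) \<Rightarrow> 't \<Rightarrow> (nat \<Rightarrow> 'b)" where
  "char_poly \<chi> t = (\<lambda>n. \<chi> (pr n t))"

lemma char_poly_hom:
  assumes chi: "\<chi> \<in> chars"
  shows "char_poly \<chi> \<in> ring_hom T (UP K)"
proof -
  interpret chi: ring_hom_cring T K \<chi> by (rule char_hom[OF chi])
  have cl: "char_poly \<chi> t \<in> up K" if t: "t \<in> carrier T" for t
  proof -
    obtain N where "\<And>n. n \<ge> N \<Longrightarrow> pr n t = \<zero>\<^bsub>T\<^esub>" using pr_eventually_zero[OF t] by blast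
    then show ?thesis using t by (auto simp: char_poly_def bound_def intro!: mem_upI exI[of _ N])
  qed
  show ?thesis
  proof (rule ring_hom_memI)
    show "char_poly \<chi> \<one>\<^bsub>T\<^esub> = \<one>\<^bsub>UP K\<^esub>"
      by (auto simp: char_poly_def UP_def pr_Tn[OF T_one])
    fix t u assume t: "t \<in> carrier T"
    then show "char_poly \<chi> t \<in> carrier (UP K)" using cl by (simp add: UP_def)
    assume u: "u \<in> carrier T"
    show "char_poly \<chi> (t \<oplus>\<^bsub>T\<^esub> u) = char_poly \<chi> t \<oplus>\<^bsub>UP K\<^esub> char_poly \<chi> u"
      using t u cl by (simp add: char_poly_def[of \<chi> "t \<oplus>\<^bsub>T\<^esub> u"] UP_def pr_add) (simp add: char_poly_def)
    have "\<chi> (pr n (t \<otimes>\<^bsub>T\<^esub> u)) = (\<Oplus>\<^bsub>K\<^esub>i\<in>{..n}. \<chi> (pr i t) \<otimes>\<^bsub>K\<^esub> \<chi> (pr (n - i) u))" for n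
    proof -
      have "\<chi> (pr n (t \<otimes>\<^bsub>T\<^esub> u)) = (\<Oplus>\<^bsub>K\<^esub>i\<in>{..n}. (\<chi> \<circ> (\<lambda>i. pr i t \<otimes>\<^bsub>T\<^esub> pr (n - i) u)) i)"
        unfolding pr_mult[OF t u] using t u by (subst chi.hom_finsum) auto
      also have "\<dots> = (\<Oplus>\<^bsub>K\<^esub>i\<in>{..n}. \<chi> (pr i t) \<otimes>\<^bsub>K\<^esub> \<chi> (pr (n - i) u))"
        using t u by (intro K.finsum_cong') auto
      finally show ?thesis .
    qed
    then show "char_poly \<chi> (t \<otimes>\<^bsub>T\<^esub> u) = char_poly \<chi> t \<otimes>\<^bsub>UP K\<^esub> char_poly \<chi> u"
      using cl[OF t] cl[OF u] by (simp add: UP_def) (simp add: char_poly_def)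
  qed
qed

lemma char_poly_homog:
  assumes chi: "\<chi> \<in> chars" and t: "t \<in> Tn n"
  shows "char_poly \<chi> t = up_ring.monom (UP K) (\<chi> t) n"
proof -
  interpret chi: ring_hom_cring T K \<chi> by (rule char_hom[OF chi])
  show ?thesis using Tn_carr[OF t] by (auto simp: char_poly_def UP_def pr_Tn[OF t] fun_eq_iff)
qed

text \<open>The character \<open>t \<mapsto> c\<^sup>n \<chi>(t)\<close> for \<open>t\<close> of degree \<open>n\<close>: the point \<open>\<chi>\<close> of the affine cone is moved
  along its line.\<close>

definition scaled_char :: "'b \<Rightarrow> ('t \<Rightarrow> 'b) \<Rightarrow> 't \<Rightarrow> 'b" where
  "scaled_char c \<chi> t = UnivPoly.eval K K id c (char_poly \<chi> t)"

lemma scaled_char: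
  assumes chi: "\<chi> \<in> chars" and c: "c \<in> carrier K"
  shows "scaled_char c \<chi> \<in> chars"
    and "t \<in> Tn n \<Longrightarrow> scaled_char c \<chi> t = c [^]\<^bsub>K\<^esub> n \<otimes>\<^bsub>K\<^esub> \<chi> t"
proof -
  interpret chi: ring_hom_cring T K \<chi> by (rule char_hom[OF chi])
  interpret UP_pre_univ_prop K K id "UP K" by unfold_locales simp
  have e: "UnivPoly.eval K K id c \<in> ring_hom (UP K) K" by (rule eval_ring_hom[OF c])
  show hom: "scaled_char c \<chi> t = c [^]\<^bsub>K\<^esub> n \<otimes>\<^bsub>K\<^esub> \<chi> t" if t: "t \<in> Tn n" for t n
    using char_poly_homog[OF chi t] eval_monom[of "\<chi> t" c n] Tn_carr[OF t] c
    by (simp add: scaled_char_def K.m_comm)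
  have "scaled_char c \<chi> = UnivPoly.eval K K id c \<circ> char_poly \<chi>" by (auto simp: scaled_char_def)
  then have "scaled_char c \<chi> \<in> ring_hom T K" using ring_hom_trans[OF char_poly_hom[OF chi] e] by simp
  then show "scaled_char c \<chi> \<in> chars" using hom[OF h_T0] charsD[OF chi] by (simp add: chars_def)
qed

text \<open>The kernel of \<open>char_poly \<chi>\<close>, consisting of the elements all of whose
  components are killed by \<chi>. If \<chi> is not the vertex of the cone, this is the point of
  Proj T belonging to its line.\<close>

definition homog_kernel :: "('t \<Rightarrow> 'b) \<Rightarrow> 't set" where
  "homog_kernel \<chi> = {t \<in> carrier T. \<forall>n. \<chi> (pr n t) = \<zero>\<^bsub>K\<^esub>}"

text \<open>The kernel of a homomorphism into K[X], which is a domain.\<close>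

lemma homog_kernel_prime:
  assumes chi: "\<chi> \<in> chars"
  shows "primeideal (homog_kernel \<chi>) T"
proof -
  interpret chi: ring_hom_cring T K \<chi> by (rule char_hom[OF chi])
  have "domain (UP K)"
  proof -
    interpret UP_domain K "UP K" by unfold_locales
    show ?thesis by (rule UP_domain)
  qed
  then interpret U: domain "UP K" .
  interpret c: ring_hom_ring T "UP K" "char_poly \<chi>"
    by (rule ring_hom_ringI2[OF T.ring_axioms U.ring_axioms char_poly_hom[OF chi]])
  have z: "\<zero>\<^bsub>UP K\<^esub> = (\<lambda>n. \<zero>\<^bsub>K\<^esub>)" by (simp add: UP_def)
  have eq: "homog_kernel \<chi> = {t \<in> carrier T. char_poly \<chi> t = \<zero>\<^bsub>UP K\<^esub>}"
    by (simp add: homog_kernel_def char_poly_def z fun_eq_iff)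
  have "ideal (homog_kernel \<chi>) T"
    using c.ideal_vimage[OF U.zeroideal] by (simp add: eq)
  then show ?thesis
  proof (rule primeidealI[OF _ T.is_cring])
    show "carrier T \<noteq> homog_kernel \<chi>" 
      using c.hom_one U.one_not_zero T.one_closed unfolding eq by (metis (mono_tags, lifting) mem_Collect_eq)
    show "a \<in> homog_kernel \<chi> \<or> b \<in> homog_kernel \<chi>"
      if "a \<in> carrier T" "b \<in> carrier T" "a \<otimes>\<^bsub>T\<^esub> b \<in> homog_kernel \<chi>" for a b
      using that U.integral[of "char_poly \<chi> a" "char_poly \<chi> b"] by (simp add: eq)
  qed
qed

lemma homog_kernel_homog: "\<lbrakk>\<chi> \<in> chars; t \<in> Tn n\<rbrakk> \<Longrightarrow> t \<in> homog_kernel \<chi> \<longleftrightarrow> \<chi> t = \<zero>\<^bsub>K\<^esub>"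
  using ring_hom_zero[OF charsD(1) T.ring_axioms K.ring_axioms] Tn_carr pr_Tn[of t n]
  by (auto simp: homog_kernel_def)

lemma nilpotent_in_homog_kernel:
  assumes "\<chi> \<in> chars" "t \<in> carrier T" "t [^]\<^bsub>T\<^esub> (n::nat) = \<zero>\<^bsub>T\<^esub>"
  shows "t \<in> homog_kernel \<chi>"
proof -
  interpret p: primeideal "homog_kernel \<chi>" T by (rule homog_kernel_prime[OF assms(1)])
  have "t [^]\<^bsub>T\<^esub> m \<in> homog_kernel \<chi> \<Longrightarrow> t \<in> homog_kernel \<chi>" for m :: nat
  proof (induction m)
    case 0
    then show ?case using p.one_imp_carrier p.I_notcarr by simp
  next
    case (Suc m)
    then show ?case using p.I_prime[of "t [^]\<^bsub>T\<^esub> m" t] assms(2) by auto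
  qed
  then show ?thesis using assms(3) p.zero_closed by metis
qed

end

section \<open>Reducedness of \<open>Proj\<close>\<close>

context graded_algebra
begin

text \<open>Transitivity of the relation defining homogeneous fractions. A fraction is encoded as
  the set of all pairs representing it, so equality of fractions amounts to two such
  inclusions.\<close>

lemma hfrac_subset:
  assumes q: "primeideal q T" and f: "f \<in> Tn n" "g \<in> Tn n" "g \<notin> q" and f1: "f1 \<in> Tn n1" "g1 \<in> Tn n1"
    and w: "w \<in> Tn d" "w \<notin> q" "w \<otimes>\<^bsub>T\<^esub> (f \<otimes>\<^bsub>T\<^esub> g1) = w \<otimes>\<^bsub>T\<^esub> (f1 \<otimes>\<^bsub>T\<^esub> g)"
  shows "hfrac T Tn q f g \<subseteq> hfrac T Tn q f1 g1"
proof (rule subrelI)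
  interpret q: primeideal q T by fact
  fix f' g' assume "(f', g') \<in> hfrac T Tn q f g"
  then obtain n' d' w' where f': "f' \<in> Tn n'" "g' \<in> Tn n'" "g' \<notin> q" and
    w': "w' \<in> Tn d'" "w' \<notin> q" "w' \<otimes>\<^bsub>T\<^esub> (f \<otimes>\<^bsub>T\<^esub> g') = w' \<otimes>\<^bsub>T\<^esub> (f' \<otimes>\<^bsub>T\<^esub> g)"
    unfolding hfrac_def by blast
  note c = Tn_carr[OF f(1)] Tn_carr[OF f(2)] Tn_carr[OF f1(1)] Tn_carr[OF f1(2)] Tn_carr[OF f'(1)]
    Tn_carr[OF f'(2)] Tn_carr[OF w(1)] Tn_carr[OF w'(1)]
  \<comment> \<open>As for ordinary fractions over a ring with zero divisors, the denominator g of
    the middle fraction enters the multiplier.\<close>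
  let ?w = "(w \<otimes>\<^bsub>T\<^esub> w') \<otimes>\<^bsub>T\<^esub> g"
  have "?w \<otimes>\<^bsub>T\<^esub> (f1 \<otimes>\<^bsub>T\<^esub> g') = (w' \<otimes>\<^bsub>T\<^esub> g') \<otimes>\<^bsub>T\<^esub> (w \<otimes>\<^bsub>T\<^esub> (f1 \<otimes>\<^bsub>T\<^esub> g))"
    using c by (simp add: T.m_ac)
  also have "\<dots> = (w' \<otimes>\<^bsub>T\<^esub> g') \<otimes>\<^bsub>T\<^esub> (w \<otimes>\<^bsub>T\<^esub> (f \<otimes>\<^bsub>T\<^esub> g1))" by (simp only: w(3))
  also have "\<dots> = (w \<otimes>\<^bsub>T\<^esub> g1) \<otimes>\<^bsub>T\<^esub> (w' \<otimes>\<^bsub>T\<^esub> (f \<otimes>\<^bsub>T\<^esub> g'))" using c by (simp add: T.m_ac)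
  also have "\<dots> = (w \<otimes>\<^bsub>T\<^esub> g1) \<otimes>\<^bsub>T\<^esub> (w' \<otimes>\<^bsub>T\<^esub> (f' \<otimes>\<^bsub>T\<^esub> g))" by (simp only: w'(3))
  also have "\<dots> = ?w \<otimes>\<^bsub>T\<^esub> (f' \<otimes>\<^bsub>T\<^esub> g1)" using c by (simp add: T.m_ac)
  finally have eq: "?w \<otimes>\<^bsub>T\<^esub> (f1 \<otimes>\<^bsub>T\<^esub> g') = ?w \<otimes>\<^bsub>T\<^esub> (f' \<otimes>\<^bsub>T\<^esub> g1)" .
  have "?w \<in> Tn ((d + d') + n)" using w w' f by (intro Tn_mult)
  moreover have "?w \<notin> q" using q.I_prime[of "w \<otimes>\<^bsub>T\<^esub> w'" g] q.I_prime[of w w'] c w w' f by auto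
  ultimately show "(f', g') \<in> hfrac T Tn q f1 g1"
    unfolding hfrac_def using f' eq by blast
qed

lemma hfrac_cong:
  assumes q: "primeideal q T" and f: "f \<in> Tn n" "g \<in> Tn n" "g \<notin> q" and f1: "f1 \<in> Tn n1" "g1 \<in> Tn n1" "g1 \<notin> q"
    and w: "w \<in> Tn d" "w \<notin> q" "w \<otimes>\<^bsub>T\<^esub> (f \<otimes>\<^bsub>T\<^esub> g1) = w \<otimes>\<^bsub>T\<^esub> (f1 \<otimes>\<^bsub>T\<^esub> g)"
  shows "hfrac T Tn q f g = hfrac T Tn q f1 g1"
  by (rule equalityI hfrac_subset[OF q f f1(1,2) w] hfrac_subset[OF q f1 f(1,2) w(1,2) w(3)[symmetric]])+

lemma one_notin: "primeideal q T \<Longrightarrow> \<one>\<^bsub>T\<^esub> \<notin> q"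
  using primeideal.I_notcarr ideal.one_imp_carrier primeideal.axioms(1) by metis

lemma hfrac_self:
  assumes "primeideal q T" "f \<in> Tn n" "g \<in> Tn n" "g \<notin> q"
  shows "(f, g) \<in> hfrac T Tn q f g"
  unfolding hfrac_def using assms T_one one_notin by blast

text \<open>Multiplication is defined as a union over all representatives; they all give the same
  class, so the union has a single member.\<close>

lemma hfrac_mult:
  assumes q: "primeideal q T" and f: "f \<in> Tn n" "g \<in> Tn n" "g \<notin> q" and f1: "f1 \<in> Tn n1" "g1 \<in> Tn n1" "g1 \<notin> q"
  shows "hfrac T Tn q f g \<otimes>\<^bsub>hlocalization T Tn q\<^esub> hfrac T Tn q f1 g1 = hfrac T Tn q (f \<otimes>\<^bsub>T\<^esub> f1) (g \<otimes>\<^bsub>T\<^esub> g1)"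
proof -
  interpret q: primeideal q T by fact
  have eq: "hfrac T Tn q (f' \<otimes>\<^bsub>T\<^esub> f1') (g' \<otimes>\<^bsub>T\<^esub> g1') = hfrac T Tn q (f \<otimes>\<^bsub>T\<^esub> f1) (g \<otimes>\<^bsub>T\<^esub> g1)"
    if a: "(f', g') \<in> hfrac T Tn q f g" and b: "(f1', g1') \<in> hfrac T Tn q f1 g1" for f' g' f1' g1'
  proof -
    obtain n' d w where f': "f' \<in> Tn n'" "g' \<in> Tn n'" "g' \<notin> q" and
      w: "w \<in> Tn d" "w \<notin> q" "w \<otimes>\<^bsub>T\<^esub> (f \<otimes>\<^bsub>T\<^esub> g') = w \<otimes>\<^bsub>T\<^esub> (f' \<otimes>\<^bsub>T\<^esub> g)"
      using a unfolding hfrac_def by blast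
    obtain n1' d1 w1 where f1': "f1' \<in> Tn n1'" "g1' \<in> Tn n1'" "g1' \<notin> q" and
      w1: "w1 \<in> Tn d1" "w1 \<notin> q" "w1 \<otimes>\<^bsub>T\<^esub> (f1 \<otimes>\<^bsub>T\<^esub> g1') = w1 \<otimes>\<^bsub>T\<^esub> (f1' \<otimes>\<^bsub>T\<^esub> g1)"
      using b unfolding hfrac_def by blast
    note c = Tn_carr[OF f(1)] Tn_carr[OF f(2)] Tn_carr[OF f1(1)] Tn_carr[OF f1(2)] Tn_carr[OF f'(1)]
      Tn_carr[OF f'(2)] Tn_carr[OF w(1)] Tn_carr[OF w1(1)] Tn_carr[OF f1'(1)] Tn_carr[OF f1'(2)]
    have "(w \<otimes>\<^bsub>T\<^esub> w1) \<otimes>\<^bsub>T\<^esub> ((f' \<otimes>\<^bsub>T\<^esub> f1') \<otimes>\<^bsub>T\<^esub> (g \<otimes>\<^bsub>T\<^esub> g1))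
        = (w \<otimes>\<^bsub>T\<^esub> (f' \<otimes>\<^bsub>T\<^esub> g)) \<otimes>\<^bsub>T\<^esub> (w1 \<otimes>\<^bsub>T\<^esub> (f1' \<otimes>\<^bsub>T\<^esub> g1))"
      using c by (simp add: T.m_ac)
    also have "\<dots> = (w \<otimes>\<^bsub>T\<^esub> (f \<otimes>\<^bsub>T\<^esub> g')) \<otimes>\<^bsub>T\<^esub> (w1 \<otimes>\<^bsub>T\<^esub> (f1 \<otimes>\<^bsub>T\<^esub> g1'))" by (simp only: w(3) w1(3))
    also have "\<dots> = (w \<otimes>\<^bsub>T\<^esub> w1) \<otimes>\<^bsub>T\<^esub> ((f \<otimes>\<^bsub>T\<^esub> f1) \<otimes>\<^bsub>T\<^esub> (g' \<otimes>\<^bsub>T\<^esub> g1'))" using c by (simp add: T.m_ac)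
    finally have e: "(w \<otimes>\<^bsub>T\<^esub> w1) \<otimes>\<^bsub>T\<^esub> ((f' \<otimes>\<^bsub>T\<^esub> f1') \<otimes>\<^bsub>T\<^esub> (g \<otimes>\<^bsub>T\<^esub> g1))
        = (w \<otimes>\<^bsub>T\<^esub> w1) \<otimes>\<^bsub>T\<^esub> ((f \<otimes>\<^bsub>T\<^esub> f1) \<otimes>\<^bsub>T\<^esub> (g' \<otimes>\<^bsub>T\<^esub> g1'))" .
    show ?thesis
    proof (rule hfrac_cong[OF q _ _ _ _ _ _ _ _ e])
      show "f' \<otimes>\<^bsub>T\<^esub> f1' \<in> Tn (n' + n1')" "g' \<otimes>\<^bsub>T\<^esub> g1' \<in> Tn (n' + n1')" "f \<otimes>\<^bsub>T\<^esub> f1 \<in> Tn (n + n1)"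
        "g \<otimes>\<^bsub>T\<^esub> g1 \<in> Tn (n + n1)" "w \<otimes>\<^bsub>T\<^esub> w1 \<in> Tn (d + d1)"
        using f f1 f' f1' w w1 by (auto intro: Tn_mult)
      show "g' \<otimes>\<^bsub>T\<^esub> g1' \<notin> q" "g \<otimes>\<^bsub>T\<^esub> g1 \<notin> q" "w \<otimes>\<^bsub>T\<^esub> w1 \<notin> q"
        using q.I_prime[of g' g1'] q.I_prime[of g g1] q.I_prime[of w w1] c f f1 f' f1' w w1 by auto
    qed
  qed
  have "hfrac T Tn q f g \<otimes>\<^bsub>hlocalization T Tn q\<^esub> hfrac T Tn q f1 g1 =
    \<Union>{hfrac T Tn q (f' \<otimes>\<^bsub>T\<^esub> f1') (g' \<otimes>\<^bsub>T\<^esub> g1') | f' g' f1' g1'.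
        (f', g') \<in> hfrac T Tn q f g \<and> (f1', g1') \<in> hfrac T Tn q f1 g1}"
    by (simp add: hlocalization_def)
  also have "{hfrac T Tn q (f' \<otimes>\<^bsub>T\<^esub> f1') (g' \<otimes>\<^bsub>T\<^esub> g1') | f' g' f1' g1'.
        (f', g') \<in> hfrac T Tn q f g \<and> (f1', g1') \<in> hfrac T Tn q f1 g1} = {hfrac T Tn q (f \<otimes>\<^bsub>T\<^esub> f1) (g \<otimes>\<^bsub>T\<^esub> g1)}"
    using eq hfrac_self[OF q f] hfrac_self[OF q f1] by blast
  finally show ?thesis by simp
qed

lemma ideal_finsum:
  assumes "ideal Q T" "finite S" "\<And>i. i \<in> S \<Longrightarrow> f i \<in> Q"
  shows "finsum T f S \<in> Q"
proof -
  interpret Q: ideal Q T by fact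
  show ?thesis using assms(2,3)
  proof (induction S rule: finite_induct)
    case (insert i S)
    have "finsum T f (insert i S) = f i \<oplus>\<^bsub>T\<^esub> finsum T f S"
      using insert Q.Icarr by (intro T.finsum_insert) auto
    then show ?case using insert by simp
  qed simp
qed

text \<open>The components of an element of the kernel lie in the kernel again, which makes the
  ideal homogeneous; y is the element of positive degree that it omits.\<close>

lemma homog_kernel_Proj:
  assumes chi: "\<chi> \<in> chars" and y: "y \<in> Tn d" "0 < d" "\<chi> y \<noteq> \<zero>\<^bsub>K\<^esub>"
  shows "homog_kernel \<chi> \<in> Proj T Tn"
proof -
  interpret p: primeideal "homog_kernel \<chi>" T by (rule homog_kernel_prime[OF chi])
  interpret chi: ring_hom_cring T K \<chi> by (rule char_hom[OF chi])
  let ?p = "homog_kernel \<chi>"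
  let ?H = "?p \<inter> (\<Union>n. Tn n)"
  have H: "?H \<subseteq> carrier T" using Tn_carr by blast
  have "?p = Idl\<^bsub>T\<^esub> ?H"
  proof
    show "Idl\<^bsub>T\<^esub> ?H \<subseteq> ?p" by (rule T.genideal_minimal[OF p.is_ideal]) blast
    show "?p \<subseteq> Idl\<^bsub>T\<^esub> ?H"
    proof
      fix t assume t: "t \<in> ?p"
      then have tc: "t \<in> carrier T" using p.Icarr by blast
      obtain N where N: "t = (\<Oplus>\<^bsub>T\<^esub>n\<in>{..<N}. pr n t)" using decomposition[OF tc] by blast
      have "pr n t \<in> ?H" for n
      proof -
        have "\<chi> (pr n t) = \<zero>\<^bsub>K\<^esub>" using t unfolding homog_kernel_def by simp
        then have "pr n t \<in> ?p" using homog_kernel_homog[OF chi pr_in[OF tc, of n]] by blast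
        then show ?thesis using pr_in[OF tc, of n] by blast
      qed
      then have "(\<Oplus>\<^bsub>T\<^esub>n\<in>{..<N}. pr n t) \<in> Idl\<^bsub>T\<^esub> ?H"
        using T.genideal_self[OF H] by (intro ideal_finsum T.genideal_ideal[OF H]) auto
      then show "t \<in> Idl\<^bsub>T\<^esub> ?H" using N by simp
    qed
  qed
  then have hom: "homogeneous_ideal T Tn ?p" unfolding homogeneous_ideal_def using p.is_ideal by blast
  have "(\<Union>n\<in>{1..}. Tn n) \<subseteq> carrier T" using Tn_carr by blast
  then have "(\<Union>n\<in>{1..}. Tn n) \<subseteq> irrelevant_ideal T Tn"
    unfolding irrelevant_ideal_def by (rule T.genideal_self)
  moreover have "y \<in> (\<Union>n\<in>{1..}. Tn n)" using y by (intro UN_I[of d]) simp_all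
  moreover have "y \<notin> ?p" using homog_kernel_homog[OF chi y(1)] y(3) by simp
  ultimately have "\<not> irrelevant_ideal T Tn \<subseteq> ?p" by blast
  then show ?thesis using hom p.primeideal by (simp add: Proj_def)
qed

text \<open>An element of positive degree is a sum of multiples of the coordinates.\<close>

lemma char_nonzero_on_variable:
  assumes chi: "\<chi> \<in> chars" and y: "y \<in> Tn d" "0 < d" "\<chi> y \<noteq> \<zero>\<^bsub>K\<^esub>"
  obtains i where "i \<le> r" "\<chi> (x i) \<noteq> \<zero>\<^bsub>K\<^esub>"
proof -
  interpret chi: ring_hom_cring T K \<chi> by (rule char_hom[OF chi])
  obtain n where "d = Suc n" using y(2) gr0_implies_Suc by blast
  with y have "y \<in> Tn (Suc n)" by simp
  then have "(\<forall>i\<le>r. \<chi> (x i) = \<zero>\<^bsub>K\<^esub>) \<longrightarrow> \<chi> y = \<zero>\<^bsub>K\<^esub>"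
  proof (induction y rule: Tn_Suc_ind)
    case (gen u i)
    then show ?case using Tn_carr[OF gen(1)] x_carr[OF gen(2)] by simp
  next
    case (add t u)
    then show ?case using Tn_carr[OF add(1)] Tn_carr[OF add(2)] by simp
  qed
  then show thesis using that y(3) by blast
qed

text \<open>If no power of y kills t, the annihilator of t has a zero \<chi> with \<chi> y = 1. Near
  this point, t divided by a power of a coordinate is a nilpotent section of the structure sheaf and
  so zero. Its vanishing in the stalk gives w with w t = 0 that does not vanish at \<chi>, although
  w lies in the annihilator.\<close>

lemma Proj_reduced_torsion:
  assumes red: "Proj_reduced T Tn" and t: "t \<in> Tn N" "t [^]\<^bsub>T\<^esub> (k::nat) = \<zero>\<^bsub>T\<^esub>"
    and y: "y \<in> Tn d" "0 < d"
  shows "\<exists>M::nat. y [^]\<^bsub>T\<^esub> M \<otimes>\<^bsub>T\<^esub> t = \<zero>\<^bsub>T\<^esub>"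
proof (rule ccontr)
  assume nz: "\<nexists>M::nat. y [^]\<^bsub>T\<^esub> M \<otimes>\<^bsub>T\<^esub> t = \<zero>\<^bsub>T\<^esub>"
  note tc = Tn_carr[OF t(1)]
  \<comment> \<open>The annihilator of t; it is homogeneous because t is.\<close>
  let ?Q = "{a \<in> carrier T. t \<otimes>\<^bsub>T\<^esub> a \<in> {\<zero>\<^bsub>T\<^esub>}}"
  have Q: "ideal ?Q T" by (rule ideal.helper_max_prime[OF T.zeroideal T.is_cring tc])
  have gr: "pr i a \<in> ?Q" if "a \<in> ?Q" for a i
    using that pr_mult_homog[OF t(1), of a "N + i"] pr_zero by auto
  have "y [^]\<^bsub>T\<^esub> M \<notin> ?Q" for M :: nat
    using nz tc Tn_carr[OF y(1)] by (auto simp: T.m_comm)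
  then obtain \<chi> where chi: "\<chi> \<in> chars" "\<chi> y = \<one>\<^bsub>K\<^esub>" "\<And>a. a \<in> ?Q \<Longrightarrow> \<chi> a = \<zero>\<^bsub>K\<^esub>"
    using graded_nullstellensatz[OF Q gr y] by blast
  have y1: "\<chi> y \<noteq> \<zero>\<^bsub>K\<^esub>" using chi(2) K.one_not_zero by simp
  let ?p = "homog_kernel \<chi>"
  have p: "?p \<in> Proj T Tn" by (rule homog_kernel_Proj[OF chi(1) y y1])
  \<comment> \<open>A coordinate rather than y serves as denominator: having degree one, its N-th
    power has exactly the degree of t.\<close>
  obtain i where i: "i \<le> r" "\<chi> (x i) \<noteq> \<zero>\<^bsub>K\<^esub>" by (rule char_nonzero_on_variable[OF chi(1) y y1])
  have xp: "x i \<notin> ?p" using homog_kernel_homog[OF chi(1) x_T1[OF i(1)]] i(2) by simp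
  define U where "U = {q \<in> Proj T Tn. \<not> Idl\<^bsub>T\<^esub> {x i} \<subseteq> q}"
  have sub: "Idl\<^bsub>T\<^esub> {x i} \<subseteq> q \<longleftrightarrow> x i \<in> q" if "ideal q T" for q
    using T.Idl_subset_ideal[OF that, of "{x i}"] x_carr[OF i(1)] by simp
  have UD: "primeideal q T" "x i \<notin> q" if "q \<in> U" for q
    using that sub by (auto simp: U_def Proj_def homogeneous_ideal_def)
  have pU: "?p \<in> U" using p sub xp by (auto simp: U_def Proj_def homogeneous_ideal_def)
  have "homogeneous_ideal T Tn (Idl\<^bsub>T\<^esub> {x i})"
  proof -
    let ?I = "Idl\<^bsub>T\<^esub> {x i}"
    have I: "ideal ?I T" using T.genideal_ideal x_carr[OF i(1)] by simp
    have xI: "x i \<in> ?I" using T.genideal_self'[OF x_carr[OF i(1)]] .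
    have H: "?I \<inter> (\<Union>n. Tn n) \<subseteq> carrier T" using Tn_carr by blast
    have "?I = Idl\<^bsub>T\<^esub> (?I \<inter> (\<Union>n. Tn n))"
    proof
      show "Idl\<^bsub>T\<^esub> (?I \<inter> (\<Union>n. Tn n)) \<subseteq> ?I" by (rule T.genideal_minimal[OF I]) blast
      show "?I \<subseteq> Idl\<^bsub>T\<^esub> (?I \<inter> (\<Union>n. Tn n))"
        using T.genideal_minimal[OF T.genideal_ideal[OF H], of "{x i}"] T.genideal_self[OF H] xI x_T1[OF i(1)] by blast
    qed
    then show ?thesis using I unfolding homogeneous_ideal_def by blast
  qed
  then have Uopen: "Proj_open T Tn U" unfolding Proj_open_def U_def by blast
  define u where "u = x i [^]\<^bsub>T\<^esub> N"
  have u: "u \<in> Tn N" using Tn_pow[OF x_T1[OF i(1)], of N] by (simp add: u_def)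
  note uc = Tn_carr[OF u]
  have pow_notin: "a [^]\<^bsub>T\<^esub> (m::nat) \<notin> q" if "primeideal q T" "a \<in> carrier T" "a \<notin> q" for a q m
  proof (induction m)
    case 0
    then show ?case using one_notin[OF that(1)] by simp
  next
    case (Suc m)
    then show ?case using primeideal.I_prime[OF that(1), of "a [^]\<^bsub>T\<^esub> m" a] that by auto
  qed
  have uq: "u \<notin> q" if "q \<in> U" for q
    unfolding u_def using pow_notin[OF UD(1)[OF that] x_carr[OF i(1)] UD(2)[OF that]] .
  let ?S = "Proj_sections T Tn U"
  define s where "s = (\<lambda>q\<in>U. hfrac T Tn q t u)"
  have sS: "s \<in> carrier ?S"
  proof -
    have "hfrac T Tn q t u \<in> carrier (hlocalization T Tn q)" if "q \<in> U" for q
      using t(1) u uq[OF that] unfolding hlocalization_def by auto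
    moreover have "\<forall>q\<in>U. \<exists>V. Proj_open T Tn V \<and> q \<in> V \<and> V \<subseteq> U \<and>
          (\<exists>n. \<exists>a\<in>Tn n. \<exists>b\<in>Tn n. \<forall>q\<in>V. b \<notin> q \<and> s q = hfrac T Tn q a b)"
    proof -
      have "\<forall>q\<in>U. u \<notin> q \<and> s q = hfrac T Tn q t u" using uq by (simp add: s_def)
      then show ?thesis using Uopen t(1) u by blast
    qed
    ultimately show ?thesis by (simp add: Proj_sections_def s_def)
  qed
  have pow: "s [^]\<^bsub>?S\<^esub> (m::nat) = (\<lambda>q\<in>U. hfrac T Tn q (t [^]\<^bsub>T\<^esub> m) (u [^]\<^bsub>T\<^esub> m))" for m
  proof (induction m)
    case 0
    show ?case by (simp add: nat_pow_def Proj_sections_def hlocalization_def)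
  next
    case (Suc m)
    have "s [^]\<^bsub>?S\<^esub> Suc m = (\<lambda>q\<in>U. (s [^]\<^bsub>?S\<^esub> m) q \<otimes>\<^bsub>hlocalization T Tn q\<^esub> s q)"
      by (simp add: nat_pow_def Proj_sections_def)
    also have "\<dots> = (\<lambda>q\<in>U. hfrac T Tn q (t [^]\<^bsub>T\<^esub> Suc m) (u [^]\<^bsub>T\<^esub> Suc m))"
    proof (rule restrict_ext)
      fix q assume q: "q \<in> U"
      show "(s [^]\<^bsub>?S\<^esub> m) q \<otimes>\<^bsub>hlocalization T Tn q\<^esub> s q = hfrac T Tn q (t [^]\<^bsub>T\<^esub> Suc m) (u [^]\<^bsub>T\<^esub> Suc m)"
      proof -
        have e1: "(s [^]\<^bsub>?S\<^esub> m) q = hfrac T Tn q (t [^]\<^bsub>T\<^esub> m) (u [^]\<^bsub>T\<^esub> m)"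
          using fun_cong[OF Suc, of q] q by simp
        have e2: "s q = hfrac T Tn q t u" using q by (simp add: s_def)
        show ?thesis
          unfolding e1 e2 using hfrac_mult[OF UD(1)[OF q] Tn_pow[OF t(1)] Tn_pow[OF u]
            pow_notin[OF UD(1)[OF q] uc uq[OF q]] t(1) u uq[OF q], of m] by simp
      qed
    qed
    finally show ?case .
  qed
  have "s [^]\<^bsub>?S\<^esub> k = \<zero>\<^bsub>?S\<^esub>"
  proof -
    have "hfrac T Tn q \<zero>\<^bsub>T\<^esub> (u [^]\<^bsub>T\<^esub> k) = hfrac T Tn q \<zero>\<^bsub>T\<^esub> \<one>\<^bsub>T\<^esub>" if q: "q \<in> U" for q
      by (rule hfrac_cong[OF UD(1)[OF q] _ Tn_pow[OF u] _ _ T_one _ T_one])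
        (use uc T_one one_notin[OF UD(1)[OF q]] pow_notin[OF UD(1)[OF q] uc uq[OF q]] in auto)
    then show ?thesis unfolding pow t(2) by (auto simp: Proj_sections_def hlocalization_def fun_eq_iff)
  qed
  then have "s = \<zero>\<^bsub>?S\<^esub>" using red Uopen sS unfolding Proj_reduced_def reduced_ring_def by blast
  then have "s ?p = \<zero>\<^bsub>?S\<^esub> ?p" by (rule fun_cong)
  then have "hfrac T Tn ?p t u = hfrac T Tn ?p \<zero>\<^bsub>T\<^esub> \<one>\<^bsub>T\<^esub>"
    using pU by (simp add: s_def Proj_sections_def hlocalization_def)
  then have "(t, u) \<in> hfrac T Tn ?p \<zero>\<^bsub>T\<^esub> \<one>\<^bsub>T\<^esub>"
    using hfrac_self[OF UD(1)[OF pU] t(1) u uq[OF pU]] by simp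
  then obtain e w where w: "w \<in> Tn e" "w \<notin> ?p"
    "w \<otimes>\<^bsub>T\<^esub> (\<zero>\<^bsub>T\<^esub> \<otimes>\<^bsub>T\<^esub> u) = w \<otimes>\<^bsub>T\<^esub> (t \<otimes>\<^bsub>T\<^esub> \<one>\<^bsub>T\<^esub>)" unfolding hfrac_def by blast
  then have "w \<in> ?Q" using tc uc Tn_carr[OF w(1)] by (simp add: T.m_comm)
  then show False using chi(3) homog_kernel_homog[OF chi(1) w(1)] w(2) by blast
qed

end

section \<open>Polynomials and forms\<close>

definition monomial_value :: "('e, 'f) ring_scheme \<Rightarrow> nat \<Rightarrow> (nat \<Rightarrow> 'e) \<Rightarrow> (nat \<Rightarrow> nat) \<Rightarrow> 'e" where
  "monomial_value B r b \<mu> = finprod B (\<lambda>i. b i [^]\<^bsub>B\<^esub> \<mu> i) {..r}"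

lemma exponents_comm_monoid: "comm_monoid (exponents r)"
  by (rule comm_monoidI) (auto simp: exponents_def)

lemma exponents_simps [simp]:
  "\<one>\<^bsub>exponents r\<^esub> = (\<lambda>i. 0)" "\<mu> \<otimes>\<^bsub>exponents r\<^esub> \<nu> = (\<lambda>i. \<mu> i + \<nu> i)"
  "\<mu> \<in> carrier (exponents r) \<longleftrightarrow> (\<forall>i>r. \<mu> i = 0)"
  by (auto simp: exponents_def)

locale mpoly = R?: cring R for R (structure) + fixes r :: nat
begin

sublocale monoid_algebra R "exponents r"
  by (intro monoid_algebra.intro R.is_cring exponents_comm_monoid)

abbreviation "P \<equiv> mpoly_ring R r"

sublocale P: cring P by (rule RM_cring)

lemma mpoly_const_eq: "mpoly_const R c = single R (\<lambda>i. 0) c"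
  by (auto simp: mpoly_const_def single_def)

end

locale mpoly_evaluation = mpoly R r + B?: cring B for R (structure) and r and B (structure) +
  fixes h b
  assumes h: "h \<in> ring_hom R B" and b: "i \<le> r \<Longrightarrow> b i \<in> carrier B"
begin

lemma mv_closed [simp]: "monomial_value B r b \<mu> \<in> carrier B"
  unfolding monomial_value_def using b by (intro B.finprod_closed) auto

sublocale monoid_algebra_hom R "exponents r" B h "monomial_value B r b"
proof
  show "monomial_value B r b \<one>\<^bsub>exponents r\<^esub> = \<one>\<^bsub>B\<^esub>"
    unfolding monomial_value_def by (intro B.finprod_one_eqI) simp
  show "monomial_value B r b (\<mu> \<otimes>\<^bsub>exponents r\<^esub> \<nu>) = monomial_value B r b \<mu> \<otimes>\<^bsub>B\<^esub> monomial_value B r b \<nu>"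
    for \<mu> \<nu>
  proof -
    have "finprod B (\<lambda>i. b i [^]\<^bsub>B\<^esub> (\<mu> i + \<nu> i)) {..r}
        = finprod B (\<lambda>i. b i [^]\<^bsub>B\<^esub> \<mu> i \<otimes>\<^bsub>B\<^esub> b i [^]\<^bsub>B\<^esub> \<nu> i) {..r}"
      using b by (intro B.finprod_cong') (auto simp: B.nat_pow_mult)
    also have "\<dots> = finprod B (\<lambda>i. b i [^]\<^bsub>B\<^esub> \<mu> i) {..r} \<otimes>\<^bsub>B\<^esub> finprod B (\<lambda>i. b i [^]\<^bsub>B\<^esub> \<nu> i) {..r}"
      using b by (intro B.finprod_multf) auto
    finally show ?thesis by (simp add: monomial_value_def)
  qed
qed (use h in auto)

abbreviation "ev \<equiv> mpoly_eval R r B h b"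

lemma ev_eq: "ev = additive_extension R B (\<lambda>a \<mu>. h a \<otimes>\<^bsub>B\<^esub> monomial_value B r b \<mu>)"
  by (auto simp: mpoly_eval_def additive_extension_def monomial_value_def fun_eq_iff)

lemma ev_hom: "ev \<in> ring_hom P B"
  unfolding ev_eq by (rule ext_hom)

lemma ev_single:
  "\<lbrakk>\<mu> \<in> carrier (exponents r); c \<in> carrier R\<rbrakk> \<Longrightarrow> ev (single R \<mu> c) = h c \<otimes>\<^bsub>B\<^esub> monomial_value B r b \<mu>"
  unfolding ev_eq by (rule ext_single)

end

text \<open>Points of affine space carry the default value \<open>undefined\<close> beyond r,
  whereas characters give unrestricted families; evaluation reads only the first r + 1
  entries.\<close>

lemma mpoly_eval_cong:
  assumes "mpoly_evaluation R r B h b" "\<And>i. i \<le> r \<Longrightarrow> b i = b' i" "f \<in> carrier (mpoly_ring R r)"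
  shows "mpoly_eval R r B h b f = mpoly_eval R r B h b' f"
proof -
  interpret mpoly_evaluation R r B h b by fact
  have b': "b' i \<in> carrier B" if "i \<le> r" for i using assms(2)[OF that] b[OF that] by simp
  have "finprod B (\<lambda>i. b i [^]\<^bsub>B\<^esub> \<mu> i) {..r} = finprod B (\<lambda>i. b' i [^]\<^bsub>B\<^esub> \<mu> i) {..r}" for \<mu> :: "nat \<Rightarrow> nat"
  proof (rule B.finprod_cong'[OF refl])
    show "(\<lambda>i. b' i [^]\<^bsub>B\<^esub> \<mu> i) \<in> {..r} \<rightarrow> carrier B" using b' by (simp add: Pi_iff)
    show "b i [^]\<^bsub>B\<^esub> \<mu> i = b' i [^]\<^bsub>B\<^esub> \<mu> i" if "i \<in> {..r}" for i
      using assms(2)[of i] that by simp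
  qed
  then show ?thesis by (simp add: mpoly_eval_def)
qed

lemma mpoly_eval_hom:
  assumes "mpoly_evaluation R r B h b" and C: "cring C" and \<theta>: "\<theta> \<in> ring_hom B C"
    and f: "f \<in> carrier (mpoly_ring R r)"
  shows "\<theta> (mpoly_eval R r B h b f) = mpoly_eval R r C (\<lambda>c. \<theta> (h c)) (\<lambda>i. \<theta> (b i)) f"
proof -
  interpret e: mpoly_evaluation R r B h b by fact
  interpret C: cring C by fact
  interpret t: ring_hom_cring B C \<theta>
    by (intro ring_hom_cring.intro ring_hom_cring_axioms.intro e.B.is_cring C \<theta>)
  have "(\<lambda>c. \<theta> (h c)) \<in> ring_hom R C"
    using ring_hom_trans[OF e.h \<theta>] by (simp add: comp_def)
  then interpret e': mpoly_evaluation R r C "\<lambda>c. \<theta> (h c)" "\<lambda>i. \<theta> (b i)"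
    by unfold_locales (use e.b in auto)
  have mv: "\<theta> (monomial_value B r b \<mu>) = monomial_value C r (\<lambda>i. \<theta> (b i)) \<mu>" for \<mu>
  proof -
    have "\<theta> (monomial_value B r b \<mu>) = finprod C (\<theta> \<circ> (\<lambda>i. b i [^]\<^bsub>B\<^esub> \<mu> i)) {..r}"
      unfolding monomial_value_def using e.b by (intro t.hom_finprod) auto
    also have "\<dots> = monomial_value C r (\<lambda>i. \<theta> (b i)) \<mu>"
      unfolding monomial_value_def using e.b by (intro C.finprod_cong') auto
    finally show ?thesis .
  qed
  note E = ring_hom_memE[OF e.ev_hom] and E' = ring_hom_memE[OF e'.ev_hom]
  show ?thesis using f
  proof (induction rule: e.RM_induct)
    case (single \<mu> c)
    then show ?case
      using ring_hom_closed[OF e.h] by (simp add: e.ev_single[OF single] e'.ev_single[OF single] mv del: exponents_simps)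
  next
    case (add f g)
    then show ?case using E E' by simp
  qed
qed

context mpoly
begin

lemma forms_carr: "f \<in> forms R r n \<Longrightarrow> f \<in> carrier P"
  by (simp add: forms_def)

lemma forms_single: "\<lbrakk>\<mu> \<in> carrier (exponents r); c \<in> carrier R; (\<Sum>i\<le>r. \<mu> i) = n\<rbrakk> \<Longrightarrow> single R \<mu> c \<in> forms R r n"
  using single_closed[of \<mu> c] single_supp[of \<mu> c] unfolding forms_def by blast

lemma forms_add: "\<lbrakk>f \<in> forms R r n; g \<in> forms R r n\<rbrakk> \<Longrightarrow> f \<oplus>\<^bsub>P\<^esub> g \<in> forms R r n"
proof -
  assume f: "f \<in> forms R r n" and g: "g \<in> forms R r n"
  have "f \<mu> \<noteq> \<zero> \<or> g \<mu> \<noteq> \<zero>" if "(f \<oplus>\<^bsub>P\<^esub> g) \<mu> \<noteq> \<zero>" for \<mu>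
    using that by (auto simp: RM_simps)
  moreover have "f \<oplus>\<^bsub>P\<^esub> g \<in> carrier P" using f g forms_carr by (intro P.add.m_closed) 
  ultimately show ?thesis using f g unfolding forms_def by blast
qed

lemma forms_induct [consumes 1, case_names single add]:
  assumes f: "f \<in> forms R r n"
    and s: "\<And>\<mu> c. \<lbrakk>\<mu> \<in> carrier (exponents r); c \<in> carrier R; (\<Sum>i\<le>r. \<mu> i) = n\<rbrakk> \<Longrightarrow> Q (single R \<mu> c)"
    and a: "\<And>f g. \<lbrakk>f \<in> forms R r n; g \<in> forms R r n; Q f; Q g\<rbrakk> \<Longrightarrow> Q (f \<oplus>\<^bsub>P\<^esub> g)"
  shows "Q f"
proof -
  \<comment> \<open>Induction over all polynomials meets monomials of other degrees. Cutting out the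
    component of degree n, an additive operation that fixes forms, discards them.\<close>
  define part where "part f = (\<lambda>\<mu>. if (\<Sum>i\<le>r. \<mu> i) = n then f \<mu> else \<zero>)" for f :: "(nat \<Rightarrow> nat) \<Rightarrow> 'a"
  have s0: "Q (\<lambda>\<mu>. \<zero>) \<and> (\<lambda>\<mu>. \<zero>) \<in> forms R r n"
  proof -
    \<comment> \<open>Zero as a form of degree n: the monomial \<open>X_0^n\<close> with coefficient
      zero.\<close>
    let ?\<mu> = "\<lambda>i. if i = 0 then n else 0 :: nat"
    have m: "?\<mu> \<in> carrier (exponents r)" by simp
    have d: "(\<Sum>i\<le>r. ?\<mu> i) = n" by (simp add: sum.delta)
    have e: "single R ?\<mu> \<zero> = (\<lambda>\<mu>. \<zero>)" by (simp add: single_def)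
    show ?thesis using s[OF m R.zero_closed d] forms_single[OF m R.zero_closed d] unfolding e by blast
  qed
  have "Q (part f) \<and> part f \<in> forms R r n" if "f \<in> carrier P" for f
    using that
  proof (induction rule: RM_induct)
    case (single \<mu> c)
    have "part (single R \<mu> c) = (if (\<Sum>i\<le>r. \<mu> i) = n then single R \<mu> c else (\<lambda>\<mu>. \<zero>))"
    proof (rule ext)
      fix \<nu>
      show "part (single R \<mu> c) \<nu> = (if (\<Sum>i\<le>r. \<mu> i) = n then single R \<mu> c else (\<lambda>\<mu>. \<zero>)) \<nu>"
        by (cases "\<nu> = \<mu>") (simp_all add: part_def single_def)
    qed
    then show ?case
      using s0 s[OF single] forms_single[OF single] by (cases "(\<Sum>i\<le>r. \<mu> i) = n") simp_all
  next
    case (add f g)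
    have "part (f \<oplus>\<^bsub>P\<^esub> g) = part f \<oplus>\<^bsub>P\<^esub> part g"
      unfolding RM_simps by (rule ext) (simp add: part_def)
    then show ?case using add(3,4) a[of "part f" "part g"] forms_add[of "part f" n "part g"] by simp
  qed
  then have "Q (part f)" using forms_carr[OF f] by blast
  moreover have "part f = f"
  proof (rule ext)
    fix \<nu>
    have "f \<nu> \<noteq> \<zero> \<Longrightarrow> (\<Sum>i\<le>r. \<nu> i) = n" using f unfolding forms_def by blast
    then show "part f \<nu> = f \<nu>" by (cases "f \<nu> = \<zero>") (simp_all add: part_def)
  qed
  ultimately show ?thesis by simp
qed

lemma forms_mult:
  assumes f: "f \<in> forms R r n" and g: "g \<in> forms R r m"
  shows "f \<otimes>\<^bsub>P\<^esub> g \<in> forms R r (n + m)"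
  using f
proof (induction rule: forms_induct)
  case x: (single \<mu> c)
  show ?case using g
  proof (induction rule: forms_induct)
    case (single \<nu> d)
    have "single R \<mu> c \<otimes>\<^bsub>P\<^esub> single R \<nu> d = single R (\<mu> \<otimes>\<^bsub>exponents r\<^esub> \<nu>) (c \<otimes> d)"
      by (rule single_mult[OF x(1) single(1) x(2) single(2)])
    then show ?case
      using x single by (auto intro!: forms_single simp: sum.distrib)
  next
    case (add g g')
    have "single R \<mu> c \<in> carrier P" by (rule single_closed[OF x(1,2)])
    then show ?case using add forms_carr forms_add by (simp add: P.r_distr)
  qed
next
  case (add f f')
  then show ?case using g forms_carr forms_add by (simp add: P.l_distr)
qed

end

text \<open>Stars and bars: an exponent vector is determined by the list of its first r + 1 entries,
  and lists of that length with sum n are counted by \<open>card_length_sum_list\<close>.\<close>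

lemma card_exponents_le: "finite {\<mu>. (\<forall>i>r. \<mu> i = 0) \<and> (\<Sum>i\<le>r. \<mu> i) = n} \<and>
  card {\<mu> :: nat \<Rightarrow> nat. (\<forall>i>r. \<mu> i = 0) \<and> (\<Sum>i\<le>r. \<mu> i) = n} \<le> (n + r) choose r"
proof -
  let ?E = "{\<mu> :: nat \<Rightarrow> nat. (\<forall>i>r. \<mu> i = 0) \<and> (\<Sum>i\<le>r. \<mu> i) = n}"
  let ?L = "{l :: nat list. length l = Suc r \<and> sum_list l = n}"
  let ?f = "\<lambda>\<mu> :: nat \<Rightarrow> nat. map \<mu> [0..<Suc r]"
  have inj: "inj_on ?f ?E"
  proof (rule inj_onI)
    fix \<mu> \<nu> assume m: "\<mu> \<in> ?E" "\<nu> \<in> ?E" and e: "?f \<mu> = ?f \<nu>"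
    show "\<mu> = \<nu>"
    proof
      fix i
      show "\<mu> i = \<nu> i"
        using m arg_cong[OF e, of "\<lambda>l. l ! i"] by (cases "i \<le> r") (auto simp del: upt_Suc)
    qed
  qed
  have "sum_list (?f \<mu>) = (\<Sum>i\<le>r. \<mu> i)" for \<mu>
    unfolding interv_sum_list_conv_sum_set_nat by (simp add: atLeast0LessThan lessThan_Suc_atMost del: upt_Suc)
  then have sub: "?f ` ?E \<subseteq> ?L" by (auto simp del: upt_Suc)
  have card_L: "card ?L = (n + r) choose r"
    using card_length_sum_list[of "Suc r" n] binomial_symmetric[of r "n + r"] by simp
  have fin: "finite ?L" using card_L by (metis card.infinite le_add2 not_less zero_less_binomial_iff zero_neq_one
        less_irrefl)
  show ?thesis
    using finite_imageD[OF finite_subset[OF sub fin] inj] card_image[OF inj] card_mono[OF fin sub] card_L by simp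
qed

section \<open>Points and characters\<close>

context graded_algebra
begin

lemma mpoly_evaluation_T: "mpoly_evaluation K r T h x"
  by unfold_locales (use h x_carr in auto)

interpretation eT: mpoly_evaluation K r T h x by (rule mpoly_evaluation_T)

abbreviation "evT \<equiv> mpoly_eval K r T h x"
abbreviation "evK v \<equiv> mpoly_eval K r K (\<lambda>c. c) v"

lemma mpoly_evaluation_K: "(\<And>i. i \<le> r \<Longrightarrow> v i \<in> carrier K) \<Longrightarrow> mpoly_evaluation K r K (\<lambda>c. c) v"
  by unfold_locales (auto intro: ring_hom_memI)

lemmas evT_hom = eT.ev_hom
lemmas evT_mem = ring_hom_memE[OF evT_hom]

lemma monomial_value_Tn: "monomial_value T r x \<mu> \<in> Tn (\<Sum>i\<le>r. \<mu> i)"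
proof -
  have "finprod T (\<lambda>i. x i [^]\<^bsub>T\<^esub> \<mu> i) {..m} \<in> Tn (\<Sum>i\<le>m. \<mu> i)" if "m \<le> r" for m
    using that
  proof (induction m)
    case 0
    then show ?case using Tn_pow[OF x_T1[of 0], of "\<mu> 0"] x_carr[of 0] by simp
  next
    case (Suc m)
    have "finprod T (\<lambda>i. x i [^]\<^bsub>T\<^esub> \<mu> i) {..Suc m}
        = x (Suc m) [^]\<^bsub>T\<^esub> \<mu> (Suc m) \<otimes>\<^bsub>T\<^esub> finprod T (\<lambda>i. x i [^]\<^bsub>T\<^esub> \<mu> i) {..m}"
      using Suc.prems x_carr by (intro T.finprod_Suc) auto
    then show ?case
      using Tn_mult[OF Tn_pow[OF x_T1[OF Suc.prems], of "\<mu> (Suc m)"] Suc.IH] Suc.prems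
      by (simp add: add.commute)
  qed
  then show ?thesis by (simp add: monomial_value_def)
qed

lemma evT_forms: "f \<in> forms K r n \<Longrightarrow> evT f \<in> Tn n"
proof (induction rule: eT.forms_induct)
  case (single \<mu> c)
  then show ?case
    using Tn_mult[OF h_T0[OF single(2)] monomial_value_Tn[of \<mu>]] eT.ev_single[OF single(1,2)] by simp
next
  case (add f g)
  then show ?case using evT_mem(3) eT.forms_carr Tn_add by simp
qed

lemma var_form:
  assumes "i \<le> r"
  shows "single K (\<lambda>j. if j = i then 1 else 0) \<one>\<^bsub>K\<^esub> \<in> forms K r 1"
    and "evT (single K (\<lambda>j. if j = i then 1 else 0) \<one>\<^bsub>K\<^esub>) = x i"
proof -
  let ?\<mu> = "\<lambda>j. if j = i then 1 else 0 :: nat"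
  have m: "?\<mu> \<in> carrier (exponents r)" using assms by simp
  show "single K ?\<mu> \<one>\<^bsub>K\<^esub> \<in> forms K r 1"
    by (rule eT.forms_single[OF m K.one_closed]) (use assms in \<open>simp add: sum.delta\<close>)
  have "monomial_value T r x ?\<mu> = finprod T (\<lambda>j. if i = j then x j else \<one>\<^bsub>T\<^esub>) {..r}"
    unfolding monomial_value_def
  proof (rule T.finprod_cong'[OF refl])
    show "(\<lambda>j. if i = j then x j else \<one>\<^bsub>T\<^esub>) \<in> {..r} \<rightarrow> carrier T" using x_carr by simp
    show "x j [^]\<^bsub>T\<^esub> ?\<mu> j = (if i = j then x j else \<one>\<^bsub>T\<^esub>)" if "j \<in> {..r}" for j
      using x_carr[of j] that by simp
  qed
  also have "\<dots> = x i" using assms x_carr by (intro T.finprod_singleton) auto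
  finally show "evT (single K ?\<mu> \<one>\<^bsub>K\<^esub>) = x i"
    using eT.ev_single[OF m K.one_closed] ring_hom_one[OF h] x_carr[OF assms] by simp
qed

text \<open>Forms lift along \<open>evT\<close> degree by degree, because T is generated in degree
  one by the x i, the images of the variables.\<close>

lemma Tn_forms: "t \<in> Tn n \<Longrightarrow> \<exists>f\<in>forms K r n. evT f = t"
proof (induction n arbitrary: t)
  case 0
  then obtain c where c: "c \<in> carrier K" "t = h c" using T0 by blast
  have m: "(\<lambda>i. 0) \<in> carrier (exponents r)" by simp
  have "monomial_value T r x (\<lambda>i. 0) = \<one>\<^bsub>T\<^esub>" by (simp add: monomial_value_def)
  then have "evT (single K (\<lambda>i. 0) c) = t" using eT.ev_single[OF m c(1)] h_carr[OF c(1)] c(2) by simp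
  moreover have "single K (\<lambda>i. 0) c \<in> forms K r 0" by (rule eT.forms_single[OF m c(1)]) simp
  ultimately show ?case by blast
next
  case (Suc n)
  show ?case using Suc.prems
  proof (induction t rule: Tn_Suc_ind)
    case (gen u i)
    obtain f where f: "f \<in> forms K r n" "evT f = u" using Suc.IH[OF gen(1)] by blast
    note v = var_form[OF gen(2)]
    show ?case
      using eT.forms_mult[OF f(1) v(1)] evT_mem(2)[OF eT.forms_carr[OF f(1)] eT.forms_carr[OF v(1)]] f(2) v(2)
      by (metis Suc_eq_plus1)
  next
    case (add t u)
    then obtain f g where f: "f \<in> forms K r (Suc n)" "evT f = t" "g \<in> forms K r (Suc n)" "evT g = u" by blast
    then show ?case
      using evT_mem(3)[OF eT.forms_carr[OF f(1)] eT.forms_carr[OF f(3)]]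
      by (intro bexI[OF _ eT.forms_add[OF f(1,3)]]) simp
  qed
qed

lemma evT_surj: "t \<in> carrier T \<Longrightarrow> \<exists>f\<in>carrier (mpoly_ring K r). evT f = t"
proof (induction t rule: homog_ind)
  case (homog n t)
  then show ?case using Tn_forms[OF homog] eT.forms_carr by blast
next
  case (add t u)
  then obtain f g where "f \<in> carrier (mpoly_ring K r)" "evT f = t" "g \<in> carrier (mpoly_ring K r)" "evT g = u" by blast
  then show ?case using evT_mem(3)[of f g] eT.P.add.m_closed by blast
qed

section \<open>Characters and tangent lines\<close>

lemma char_evT:
  assumes chi: "\<chi> \<in> chars" and f: "f \<in> carrier (mpoly_ring K r)"
  shows "\<chi> (evT f) = evK (\<lambda>i. \<chi> (x i)) f"
proof -
  have "\<chi> (evT f) = mpoly_eval K r K (\<lambda>c. \<chi> (h c)) (\<lambda>i. \<chi> (x i)) f"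
    by (rule mpoly_eval_hom[OF mpoly_evaluation_T K.is_cring charsD(1)[OF chi] f])
  also have "\<dots> = evK (\<lambda>i. \<chi> (x i)) f"
    unfolding mpoly_eval_def using charsD(2)[OF chi eT.RM_carrierD(1)[OF f]] by simp
  finally show ?thesis .
qed

lemma char_x: "\<lbrakk>\<chi> \<in> chars; i \<le> r\<rbrakk> \<Longrightarrow> \<chi> (x i) \<in> carrier K"
  using ring_hom_closed[OF charsD(1)] x_carr by blast

lemma chars_eqI:
  assumes "\<chi> \<in> chars" "\<chi>' \<in> chars" "\<And>i. i \<le> r \<Longrightarrow> \<chi> (x i) = \<chi>' (x i)" "t \<in> carrier T"
  shows "\<chi> t = \<chi>' t"
proof -
  obtain f where f: "f \<in> carrier (mpoly_ring K r)" "evT f = t" using evT_surj[OF assms(4)] by blast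
  have "evK (\<lambda>i. \<chi> (x i)) f = evK (\<lambda>i. \<chi>' (x i)) f"
    by (rule mpoly_eval_cong[OF mpoly_evaluation_K _ f(1)]) (use char_x[OF assms(1)] assms(3) in simp_all)
  then show ?thesis using char_evT[OF assms(1) f(1)] char_evT[OF assms(2) f(1)] f(2) by simp
qed

text \<open>The points of the cone other than its vertex; up to scaling, the K-valued points of Proj
  T.\<close>

definition nzchars :: "('t \<Rightarrow> 'b) set" where
  "nzchars = {\<chi> \<in> chars. \<exists>i\<le>r. \<chi> (x i) \<noteq> \<zero>\<^bsub>K\<^esub>}"

definition char_line :: "('t \<Rightarrow> 'b) \<Rightarrow> (nat \<Rightarrow> 'b) set" where
  "char_line \<chi> = {(\<lambda>i\<in>{..r}. c \<otimes>\<^bsub>K\<^esub> \<chi> (x i)) | c. c \<in> carrier K}"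

text \<open>The counterpart of \<open>geometric_tangents\<close>, with membership in the tangent
  ideal spelled out as nilpotency of the value in T; this form makes sense in any graded
  algebra.\<close>

definition tangent_lines :: "(nat \<Rightarrow> 'b) set set" where
  "tangent_lines = {L \<in> proj_points K r. \<forall>v\<in>L. \<forall>f\<in>carrier (mpoly_ring K r).
     (\<exists>k::nat. evT f [^]\<^bsub>T\<^esub> k = \<zero>\<^bsub>T\<^esub>) \<longrightarrow> evK v f = \<zero>\<^bsub>K\<^esub>}"

lemma nzcharsD: "\<chi> \<in> nzchars \<Longrightarrow> \<chi> \<in> chars"
  by (simp add: nzchars_def)

text \<open>The points on the line of \<chi> are the characters obtained from \<chi> by
  scaling.\<close>

lemma evK_scaled:
  assumes chi: "\<chi> \<in> chars" and c: "c \<in> carrier K" and f: "f \<in> carrier (mpoly_ring K r)"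
  shows "evK (\<lambda>i\<in>{..r}. c \<otimes>\<^bsub>K\<^esub> \<chi> (x i)) f = scaled_char c \<chi> (evT f)"
proof -
  note s = scaled_char(1)[OF chi c]
  have sx: "scaled_char c \<chi> (x i) = c \<otimes>\<^bsub>K\<^esub> \<chi> (x i)" if "i \<le> r" for i
    using scaled_char(2)[OF chi c x_T1[OF that]] c by simp
  have "evK (\<lambda>i. scaled_char c \<chi> (x i)) f = evK (\<lambda>i\<in>{..r}. c \<otimes>\<^bsub>K\<^esub> \<chi> (x i)) f"
    by (rule mpoly_eval_cong[OF mpoly_evaluation_K _ f]) (use char_x[OF s] sx in simp_all)
  then show ?thesis using char_evT[OF s f] by simp
qed

lemma nilpotent_char:
  assumes chi: "\<chi> \<in> chars" and t: "t \<in> carrier T" "t [^]\<^bsub>T\<^esub> (k::nat) = \<zero>\<^bsub>T\<^esub>"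
  shows "\<chi> t = \<zero>\<^bsub>K\<^esub>"
proof -
  interpret chi: ring_hom_cring T K \<chi> by (rule char_hom[OF chi])
  have "\<chi> t [^]\<^bsub>K\<^esub> k = \<zero>\<^bsub>K\<^esub>" using arg_cong[OF t(2), of \<chi>] t(1) by simp
  then show ?thesis using K.nat_pow_nonzero[of "\<chi> t" k] t(1) by auto
qed

lemma char_line_tangent: "\<chi> \<in> nzchars \<Longrightarrow> char_line \<chi> \<in> tangent_lines"
proof -
  assume chi: "\<chi> \<in> nzchars"
  then have c: "\<chi> \<in> chars" by (rule nzcharsD)
  let ?v = "\<lambda>i\<in>{..r}. \<chi> (x i)"
  have "char_line \<chi> = {(\<lambda>i\<in>{..r}. c \<otimes>\<^bsub>K\<^esub> ?v i) | c. c \<in> carrier K}"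
    unfolding char_line_def by (intro Collect_cong ex_cong1 conj_cong refl arg_cong2[where f = "(=)"] restrict_ext) simp
  moreover have "?v \<in> affine_space K r" using char_x[OF c] by (simp add: affine_space_def)
  moreover have "\<exists>i\<le>r. ?v i \<noteq> \<zero>\<^bsub>K\<^esub>" using chi by (auto simp: nzchars_def)
  ultimately have "char_line \<chi> \<in> proj_points K r" unfolding proj_points_def by blast
  moreover have "evK v f = \<zero>\<^bsub>K\<^esub>"
    if v: "v \<in> char_line \<chi>" and f: "f \<in> carrier (mpoly_ring K r)" and k: "evT f [^]\<^bsub>T\<^esub> (k::nat) = \<zero>\<^bsub>T\<^esub>" for v f k
  proof -
    obtain d where d: "d \<in> carrier K" "v = (\<lambda>i\<in>{..r}. d \<otimes>\<^bsub>K\<^esub> \<chi> (x i))" using v by (auto simp: char_line_def)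
    show ?thesis
      unfolding d(2) evK_scaled[OF c d(1) f] by (rule nilpotent_char[OF scaled_char(1)[OF c d(1)] evT_mem(1)[OF f] k])
  qed
  ultimately show ?thesis unfolding tangent_lines_def by blast
qed

text \<open>Evaluation at a direction vector v of a tangent kills the kernel of \<open>evT\<close>,
  since zero is nilpotent. Hence it factors through T and defines a character.\<close>

lemma tangent_line_char:
  assumes L: "L \<in> tangent_lines"
  obtains \<chi> where "\<chi> \<in> nzchars" "L = char_line \<chi>"
proof -
  obtain v where v: "L = {(\<lambda>i\<in>{..r}. c \<otimes>\<^bsub>K\<^esub> v i) | c. c \<in> carrier K}" "v \<in> affine_space K r" "\<exists>i\<le>r. v i \<noteq> \<zero>\<^bsub>K\<^esub>"
    using L unfolding tangent_lines_def proj_points_def by blast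
  have vc: "v i \<in> carrier K" if "i \<le> r" for i using v(2) that by (auto simp: affine_space_def PiE_iff)
  interpret eK: mpoly_evaluation K r K "\<lambda>c. c" v by (rule mpoly_evaluation_K[OF vc])
  note E = ring_hom_memE[OF eK.ev_hom]
  have "(\<lambda>i\<in>{..r}. \<one>\<^bsub>K\<^esub> \<otimes>\<^bsub>K\<^esub> v i) \<in> L" unfolding v(1) using K.one_closed by blast
  moreover have "evK (\<lambda>i\<in>{..r}. \<one>\<^bsub>K\<^esub> \<otimes>\<^bsub>K\<^esub> v i) f = evK v f" if "f \<in> carrier (mpoly_ring K r)" for f
    by (rule mpoly_eval_cong[OF mpoly_evaluation_K _ that]) (use vc in simp_all)
  ultimately have ker: "evK v f = \<zero>\<^bsub>K\<^esub>" if "f \<in> carrier (mpoly_ring K r)" "evT f = \<zero>\<^bsub>T\<^esub>" for f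
  proof -
    have "evT f [^]\<^bsub>T\<^esub> (1::nat) = \<zero>\<^bsub>T\<^esub>" using that by simp
    then have "evK (\<lambda>i\<in>{..r}. \<one>\<^bsub>K\<^esub> \<otimes>\<^bsub>K\<^esub> v i) f = \<zero>\<^bsub>K\<^esub>"
      using L \<open>(\<lambda>i\<in>{..r}. \<one>\<^bsub>K\<^esub> \<otimes>\<^bsub>K\<^esub> v i) \<in> L\<close> that(1) unfolding tangent_lines_def by blast
    then show ?thesis using \<open>\<And>f. f \<in> carrier (mpoly_ring K r) \<Longrightarrow> evK (\<lambda>i\<in>{..r}. \<one>\<^bsub>K\<^esub> \<otimes>\<^bsub>K\<^esub> v i) f = evK v f\<close>[OF that(1)]
      by simp
  qed
  define \<chi> where "\<chi> t = evK v (SOME f. f \<in> carrier (mpoly_ring K r) \<and> evT f = t)" for t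
  have chi: "\<chi> (evT f) = evK v f" if f: "f \<in> carrier (mpoly_ring K r)" for f
  proof -
    define g where "g = (SOME g. g \<in> carrier (mpoly_ring K r) \<and> evT g = evT f)"
    have g: "g \<in> carrier (mpoly_ring K r)" "evT g = evT f"
      using someI[of "\<lambda>g. g \<in> carrier (mpoly_ring K r) \<and> evT g = evT f" f] f unfolding g_def by auto
    interpret hT: ring_hom_ring "mpoly_ring K r" T evT
      by (rule ring_hom_ringI2[OF eT.P.ring_axioms T.ring_axioms evT_hom])
    interpret hK: ring_hom_ring "mpoly_ring K r" K "evK v"
      by (rule ring_hom_ringI2[OF eT.P.ring_axioms K.ring_axioms eK.ev_hom])
    have "evT (g \<ominus>\<^bsub>mpoly_ring K r\<^esub> f) = \<zero>\<^bsub>T\<^esub>"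
      using f g by (simp add: a_minus_def T.r_neg)
    then have "evK v (g \<ominus>\<^bsub>mpoly_ring K r\<^esub> f) = \<zero>\<^bsub>K\<^esub>" using ker f g(1) by simp
    then have "evK v g \<ominus>\<^bsub>K\<^esub> evK v f = \<zero>\<^bsub>K\<^esub>" using f g(1) by (simp add: a_minus_def)
    then have "evK v g = evK v f" using hK.hom_closed f g(1) by simp
    then show ?thesis by (simp add: \<chi>_def g_def)
  qed
  have "\<chi> \<in> ring_hom T K"
  proof (rule ring_hom_memI)
    show "\<chi> \<one>\<^bsub>T\<^esub> = \<one>\<^bsub>K\<^esub>" using chi[OF eT.P.one_closed] E(4) evT_mem(4) by simp
    fix t u assume t: "t \<in> carrier T"
    obtain f where f: "f \<in> carrier (mpoly_ring K r)" "evT f = t" using evT_surj[OF t] by blast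
    show "\<chi> t \<in> carrier K" using chi[OF f(1)] E(1)[OF f(1)] f(2) by simp
    assume u: "u \<in> carrier T"
    obtain g where g: "g \<in> carrier (mpoly_ring K r)" "evT g = u" using evT_surj[OF u] by blast
    show "\<chi> (t \<otimes>\<^bsub>T\<^esub> u) = \<chi> t \<otimes>\<^bsub>K\<^esub> \<chi> u"
      using chi[OF f(1)] chi[OF g(1)] chi[OF eT.P.m_closed[OF f(1) g(1)]] E(2)[OF f(1) g(1)] evT_mem(2)[OF f(1) g(1)] f(2) g(2) by simp
    show "\<chi> (t \<oplus>\<^bsub>T\<^esub> u) = \<chi> t \<oplus>\<^bsub>K\<^esub> \<chi> u"
      using chi[OF f(1)] chi[OF g(1)] chi[OF eT.P.add.m_closed[OF f(1) g(1)]] E(3)[OF f(1) g(1)] evT_mem(3)[OF f(1) g(1)] f(2) g(2) by simp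
  qed
  moreover have "\<chi> (h c) = c" if c: "c \<in> carrier K" for c
  proof -
    have m: "(\<lambda>i. 0) \<in> carrier (exponents r)" by simp
    have "monomial_value T r x (\<lambda>i. 0) = \<one>\<^bsub>T\<^esub>" "monomial_value K r v (\<lambda>i. 0) = \<one>\<^bsub>K\<^esub>"
      by (simp_all add: monomial_value_def)
    then show ?thesis
      using chi[OF eT.single_closed[OF m c]] eT.ev_single[OF m c] eK.ev_single[OF m c] h_carr[OF c] c by simp
  qed
  ultimately have chars: "\<chi> \<in> chars" by (simp add: chars_def)
  have chi_x: "\<chi> (x i) = v i" if i: "i \<le> r" for i
  proof -
    let ?\<mu> = "\<lambda>j. if j = i then 1 else 0 :: nat"
    have m: "?\<mu> \<in> carrier (exponents r)" using i by simp
    have "monomial_value K r v ?\<mu> = finprod K (\<lambda>j. if i = j then v j else \<one>\<^bsub>K\<^esub>) {..r}"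
      unfolding monomial_value_def
    proof (rule K.finprod_cong'[OF refl])
      show "(\<lambda>j. if i = j then v j else \<one>\<^bsub>K\<^esub>) \<in> {..r} \<rightarrow> carrier K" using vc by simp
      show "v j [^]\<^bsub>K\<^esub> ?\<mu> j = (if i = j then v j else \<one>\<^bsub>K\<^esub>)" if "j \<in> {..r}" for j
        using vc[of j] that by simp
    qed
    also have "\<dots> = v i" using i vc by (intro K.finprod_singleton) auto
    finally have "evK v (single K ?\<mu> \<one>\<^bsub>K\<^esub>) = v i" using eK.ev_single[OF m K.one_closed] vc[OF i] by simp
    then show ?thesis using chi[OF eT.single_closed[OF m K.one_closed]] var_form(2)[OF i] by simp
  qed
  have "\<chi> \<in> nzchars" using chars v(3) chi_x by (auto simp: nzchars_def)
  moreover have "L = char_line \<chi>"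
    unfolding v(1) char_line_def
    by (intro Collect_cong ex_cong1 conj_cong refl arg_cong2[where f = "(=)"] restrict_ext) (simp add: chi_x)
  ultimately show thesis by (rule that)
qed

definition vanishes :: "'t \<Rightarrow> bool" where
  "vanishes t \<longleftrightarrow> (\<forall>\<chi>\<in>nzchars. \<chi> t = \<zero>\<^bsub>K\<^esub>)"

text \<open>On the line of \<chi> a form of degree n takes the values
  \<open>c^n \<chi>(evT f)\<close>, so its vanishing there is decided at \<chi>, that is, at c =
  1.\<close>

lemma form_vanishes_iff:
  assumes f: "f \<in> forms K r n"
  shows "(\<forall>L\<in>tangent_lines. \<forall>v\<in>L. evK v f = \<zero>\<^bsub>K\<^esub>) \<longleftrightarrow> vanishes (evT f)"
proof -
  have fc: "f \<in> carrier (mpoly_ring K r)" by (rule eT.forms_carr[OF f])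
  have val: "evK (\<lambda>i\<in>{..r}. c \<otimes>\<^bsub>K\<^esub> \<chi> (x i)) f = c [^]\<^bsub>K\<^esub> n \<otimes>\<^bsub>K\<^esub> \<chi> (evT f)"
    if "\<chi> \<in> chars" "c \<in> carrier K" for \<chi> c
    using evK_scaled[OF that fc] scaled_char(2)[OF that evT_forms[OF f]] by simp
  show ?thesis
  proof
    assume a: "\<forall>L\<in>tangent_lines. \<forall>v\<in>L. evK v f = \<zero>\<^bsub>K\<^esub>"
    have "\<chi> (evT f) = \<zero>\<^bsub>K\<^esub>" if chi: "\<chi> \<in> nzchars" for \<chi>
    proof -
      have "(\<lambda>i\<in>{..r}. \<one>\<^bsub>K\<^esub> \<otimes>\<^bsub>K\<^esub> \<chi> (x i)) \<in> char_line \<chi>"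
        unfolding char_line_def using K.one_closed by blast
      then have "evK (\<lambda>i\<in>{..r}. \<one>\<^bsub>K\<^esub> \<otimes>\<^bsub>K\<^esub> \<chi> (x i)) f = \<zero>\<^bsub>K\<^esub>" using a char_line_tangent[OF chi] by blast
      then show ?thesis
        using val[OF nzcharsD[OF chi] K.one_closed] ring_hom_closed[OF charsD(1)[OF nzcharsD[OF chi]] evT_mem(1)[OF fc]] by simp
    qed
    then show "vanishes (evT f)" by (simp add: vanishes_def)
  next
    assume a: "vanishes (evT f)"
    show "\<forall>L\<in>tangent_lines. \<forall>v\<in>L. evK v f = \<zero>\<^bsub>K\<^esub>"
    proof (intro ballI)
      fix L v assume L: "L \<in> tangent_lines" and v: "v \<in> L"
      obtain \<chi> where chi: "\<chi> \<in> nzchars" "L = char_line \<chi>" by (rule tangent_line_char[OF L])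
      then obtain c where c: "c \<in> carrier K" "v = (\<lambda>i\<in>{..r}. c \<otimes>\<^bsub>K\<^esub> \<chi> (x i))"
        using v by (auto simp: char_line_def)
      have z: "\<chi> (evT f) = \<zero>\<^bsub>K\<^esub>" using a chi(1) by (simp add: vanishes_def)
      show "evK v f = \<zero>\<^bsub>K\<^esub>"
        unfolding c(2) val[OF nzcharsD[OF chi(1)] c(1)] z by (rule K.r_null[OF K.nat_pow_closed[OF c(1)]])
    qed
  qed
qed

abbreviation "VI \<equiv> vanishing_ideal K r tangent_lines"

lemma VI_gens: "{f. \<exists>n. f \<in> forms K r n \<and> (\<forall>L\<in>tangent_lines. \<forall>v\<in>L. evK v f = \<zero>\<^bsub>K\<^esub>)} \<subseteq> carrier (mpoly_ring K r)"
  using eT.forms_carr by blast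

lemma VI_ideal: "ideal VI (mpoly_ring K r)"
  unfolding vanishing_ideal_def by (rule eT.P.genideal_ideal[OF VI_gens])

text \<open>The ideal is generated by forms, but the condition \<open>vanishes (evT f)\<close> makes
  sense for all polynomials and cuts out an ideal, an intersection of kernels.\<close>

lemma VI_vanishes: "f \<in> VI \<Longrightarrow> vanishes (evT f)"
proof -
  let ?V = "{f \<in> carrier (mpoly_ring K r). \<forall>\<chi>\<in>nzchars. \<chi> (evT f) = \<zero>\<^bsub>K\<^esub>}"
  have hom: "ring_hom_ring (mpoly_ring K r) K (\<chi> \<circ> evT)" if "\<chi> \<in> chars" for \<chi>
    by (rule ring_hom_ringI2[OF eT.P.ring_axioms K.ring_axioms ring_hom_trans[OF evT_hom charsD(1)[OF that]]])
  have "ideal ?V (mpoly_ring K r)"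
  \<comment> \<open>Over the empty family the intersection would be the whole type and not the
    carrier.\<close>
  proof (cases "nzchars = {}")
    case True
    then show ?thesis using eT.P.oneideal by simp
  next
    case False
    have "?V = \<Inter> ((\<lambda>\<chi>. {f \<in> carrier (mpoly_ring K r). (\<chi> \<circ> evT) f \<in> {\<zero>\<^bsub>K\<^esub>}}) ` nzchars)"
      using False by auto
    then show ?thesis
      using False ring_hom_ring.ideal_vimage[OF hom[OF nzcharsD] K.zeroideal]
      by (auto intro!: eT.P.i_Intersect)
  qed
  moreover have "{f. \<exists>n. f \<in> forms K r n \<and> (\<forall>L\<in>tangent_lines. \<forall>v\<in>L. evK v f = \<zero>\<^bsub>K\<^esub>)} \<subseteq> ?V"
    using form_vanishes_iff eT.forms_carr unfolding vanishes_def by blast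
  ultimately have "VI \<subseteq> ?V" unfolding vanishing_ideal_def by (rule eT.P.genideal_minimal)
  then show "f \<in> VI \<Longrightarrow> vanishes (evT f)" by (auto simp: vanishes_def)
qed

lemma form_in_VI: "\<lbrakk>f \<in> forms K r n; vanishes (evT f)\<rbrakk> \<Longrightarrow> f \<in> VI"
  unfolding vanishing_ideal_def using eT.P.genideal_self[OF VI_gens] form_vanishes_iff by blast

text \<open>A line carries many characters, but prime avoidance works with a finite set. On
  homogeneous elements the values at \<chi> and at its representative differ by a nonzero
  factor.\<close>

lemma finite_representatives:
  assumes "finite tangent_lines"
  shows "\<exists>reps. finite reps \<and> reps \<subseteq> nzchars \<and> (\<forall>\<chi>\<in>nzchars.
    \<exists>\<chi>'\<in>reps. \<exists>c\<in>carrier K. c \<noteq> \<zero>\<^bsub>K\<^esub> \<and> (\<forall>n. \<forall>t\<in>Tn n. \<chi> t = c [^]\<^bsub>K\<^esub> n \<otimes>\<^bsub>K\<^esub> \<chi>' t))"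
proof -
  have "\<forall>L\<in>tangent_lines. \<exists>\<chi>. \<chi> \<in> nzchars \<and> L = char_line \<chi>" using tangent_line_char by metis
  then obtain F where F: "\<And>L. L \<in> tangent_lines \<Longrightarrow> F L \<in> nzchars \<and> L = char_line (F L)" by metis
  show ?thesis
  proof (intro exI[of _ "F ` tangent_lines"] conjI ballI)
    show "finite (F ` tangent_lines)" using assms by simp
    show "F ` tangent_lines \<subseteq> nzchars" using F by blast
    fix \<chi> assume chi: "\<chi> \<in> nzchars"
    let ?\<chi>' = "F (char_line \<chi>)"
    have L: "char_line \<chi> \<in> tangent_lines" by (rule char_line_tangent[OF chi])
    have chi': "?\<chi>' \<in> nzchars" "char_line \<chi> = char_line ?\<chi>'" using F[OF L] by auto
    have "(\<lambda>i\<in>{..r}. \<one>\<^bsub>K\<^esub> \<otimes>\<^bsub>K\<^esub> \<chi> (x i)) \<in> char_line \<chi>" unfolding char_line_def using K.one_closed by blast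
    then have "(\<lambda>i\<in>{..r}. \<one>\<^bsub>K\<^esub> \<otimes>\<^bsub>K\<^esub> \<chi> (x i)) \<in> char_line ?\<chi>'" using chi'(2) by simp
    then obtain c where c: "c \<in> carrier K" "(\<lambda>i\<in>{..r}. \<one>\<^bsub>K\<^esub> \<otimes>\<^bsub>K\<^esub> \<chi> (x i)) = (\<lambda>i\<in>{..r}. c \<otimes>\<^bsub>K\<^esub> ?\<chi>' (x i))"
      unfolding char_line_def by blast
    note ch = nzcharsD[OF chi] and ch' = nzcharsD[OF chi'(1)]
    have eq: "\<chi> (x i) = c \<otimes>\<^bsub>K\<^esub> ?\<chi>' (x i)" if "i \<le> r" for i
      using fun_cong[OF c(2), of i] that char_x[OF ch that] by simp
    have "c \<noteq> \<zero>\<^bsub>K\<^esub>"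
    proof
      assume "c = \<zero>\<^bsub>K\<^esub>"
      then have "\<chi> (x i) = \<zero>\<^bsub>K\<^esub>" if "i \<le> r" for i using eq[OF that] char_x[OF ch' that] by simp
      then show False using chi by (auto simp: nzchars_def)
    qed
    moreover have "\<chi> t = c [^]\<^bsub>K\<^esub> n \<otimes>\<^bsub>K\<^esub> ?\<chi>' t" if t: "t \<in> Tn n" for n t
    proof -
      have "\<chi> t = scaled_char c ?\<chi>' t"
      proof (rule chars_eqI[OF ch scaled_char(1)[OF ch' c(1)] _ Tn_carr[OF t]])
        show "\<chi> (x i) = scaled_char c ?\<chi>' (x i)" if "i \<le> r" for i
          using scaled_char(2)[OF ch' c(1) x_T1[OF that]] eq[OF that] c(1) by simp
      qed
      then show ?thesis using scaled_char(2)[OF ch' c(1) t] by simp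
    qed
    ultimately show "\<exists>\<chi>'\<in>F ` tangent_lines. \<exists>c\<in>carrier K. c \<noteq> \<zero>\<^bsub>K\<^esub> \<and> (\<forall>n. \<forall>t\<in>Tn n. \<chi> t = c [^]\<^bsub>K\<^esub> n \<otimes>\<^bsub>K\<^esub> \<chi>' t)"
      using L c(1) by blast
  qed
qed

end

section \<open>Points in generic position\<close>

text \<open>A spanning list is thinned out by dropping vectors that lie in the span of the later
  ones.\<close>

lemma (in ring) spanning_base:
  assumes K: "subfield K R" and "set Us \<subseteq> carrier R"
  shows "\<exists>Vs. independent K Vs \<and> Span K Vs = Span K Us \<and> length Vs \<le> length Us"
  using assms(2)
proof (induction Us)
  case Nil
  show ?case by (intro exI[of _ "[]"]) simp
next
  case (Cons u Us)
  then obtain Vs where Vs: "independent K Vs" "Span K Vs = Span K Us" "length Vs \<le> length Us" by auto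
  have eq: "Span K (u # Vs) = Span K (u # Us)" using Vs(2) by simp
  show ?case
  proof (cases "u \<in> Span K Vs")
    case True
    have c: "set Vs \<subseteq> carrier R" by (rule independent_in_carrier[OF Vs(1)])
    have "set (u # Vs) \<subseteq> Span K Vs" using True Span_base_incl[OF K c] by simp
    then have "Span K (u # Vs) \<subseteq> Span K Vs" by (rule mono_Span_subset[OF K _ c])
    moreover have "Span K Vs \<subseteq> Span K (u # Vs)" using Cons.prems by (intro mono_Span[OF K c]) simp
    ultimately have "Span K Vs = Span K (u # Us)" using eq by blast
    then show ?thesis using Vs by (intro exI[of _ Vs]) simp
  next
    case False
    then have "independent K (u # Vs)" using Cons.prems Vs(1) by (intro li_Cons) simp_all
    then show ?thesis using Vs(3) eq by (intro exI[of _ "u # Vs"]) simp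
  qed
qed

lemma (in ring) dimension_le_spanning:
  assumes K: "subfield K R" and "set Us \<subseteq> carrier R" and "dimension n K E" "E \<subseteq> Span K Us"
  shows "n \<le> length Us"
proof -
  obtain Vs where Vs: "independent K Vs" "Span K Vs = Span K Us" "length Vs \<le> length Us"
    using spanning_base[OF K assms(2)] by blast
  obtain Ws where Ws: "set Ws \<subseteq> carrier R" "independent K Ws" "length Ws = n" "Span K Ws = E"
    using exists_base[OF K assms(3)] by blast
  have "set Ws \<subseteq> Span K Vs" using Span_base_incl[OF K Ws(1)] Ws(4) assms(4) Vs(2) by blast
  then show ?thesis using independent_length_le[OF K Ws(2) Vs(1)] Ws(3) Vs(3) by simp
qed

text \<open>\<open>Gd n\<close> stands for the set of g \<otimes> 1 with g in \<open>G(A)_n\<close>,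
  the elements that lift to A. The assumption \<open>injective_mult\<close> carries the information
  about A: it turns surjectivity of multiplication by such an element into injectivity.\<close>

locale graded_generic = graded_algebra T K h Tn pr r x
  for T :: "('t, 'm) ring_scheme" (structure) and K :: "('b, 'd) ring_scheme" (structure) and h Tn pr r x +
  fixes Gd :: "nat \<Rightarrow> 't set"
  assumes Gd_sub: "Gd n \<subseteq> Tn n"
    and Gd_zero: "\<zero>\<^bsub>T\<^esub> \<in> Gd n"
    and Gd_add: "\<lbrakk>t \<in> Gd n; u \<in> Gd n\<rbrakk> \<Longrightarrow> t \<oplus>\<^bsub>T\<^esub> u \<in> Gd n"
    and Gd_mult: "\<lbrakk>t \<in> Gd n; u \<in> Gd m\<rbrakk> \<Longrightarrow> t \<otimes>\<^bsub>T\<^esub> u \<in> Gd (n + m)"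
    and Gd_nonvanishing: "\<chi> \<in> nzchars \<Longrightarrow> \<exists>g\<in>Gd 1. \<chi> g \<noteq> \<zero>\<^bsub>K\<^esub>"
    and injective_mult: "\<And>y d i0 i t. \<lbrakk>y \<in> Gd d; \<And>i t. \<lbrakk>i0 \<le> i; t \<in> Tn (i + d)\<rbrakk> \<Longrightarrow> \<exists>u\<in>Tn i. t = y \<otimes>\<^bsub>T\<^esub> u;
        i0 \<le> i; t \<in> Tn i; y \<otimes>\<^bsub>T\<^esub> t = \<zero>\<^bsub>T\<^esub>\<rbrakk> \<Longrightarrow> t = \<zero>\<^bsub>T\<^esub>"
    and red: "Proj_reduced T Tn"
    and generic: "generic_position K r tangent_lines"
    and nontrivial: "\<one>\<^bsub>T\<^esub> \<noteq> \<zero>\<^bsub>T\<^esub>"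
begin

interpretation eT: mpoly_evaluation K r T h x by (rule mpoly_evaluation_T)

lemma Gd_pow:
  assumes y: "y \<in> Gd d" and k: "0 < k"
  shows "y [^]\<^bsub>T\<^esub> (k::nat) \<in> Gd (d * k)"
  using k
proof (induction k rule: nat_induct_non_zero)
  case 1
  have "y \<in> carrier T" using y Gd_sub Tn_carr by blast
  then show ?case using y by simp
next
  case (Suc k)
  then show ?case using Gd_mult[of "y [^]\<^bsub>T\<^esub> k" "d * k" y d] y by (simp add: add.commute)
qed

text \<open>Prime avoidance over a field that need not be infinite. In a minimal counterexample every
  proper subset is avoided by some \<open>F\<^sub>\<chi>\<close>, which then vanishes at the omitted point \<open>\<chi>\<close>; a sum of
  powers of one \<open>F\<close> and of a product of the others has the same degree and vanishes nowhere.\<close>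

lemma avoidance:
  assumes "finite S" "S \<subseteq> nzchars"
  shows "\<exists>d>0. \<exists>y\<in>Gd d. \<forall>\<chi>\<in>S. \<chi> y \<noteq> \<zero>\<^bsub>K\<^esub>"
  using assms
proof (induction S rule: finite_psubset_induct)
  case (psubset S)
  have sub: "\<exists>d>0. \<exists>y\<in>Gd d. \<forall>\<chi>\<in>S - {a}. \<chi> y \<noteq> \<zero>\<^bsub>K\<^esub>" if "a \<in> S" for a
    using that psubset.prems by (intro psubset.IH) auto
  have GT: "y \<in> carrier T" if "y \<in> Gd d" for y d using that Gd_sub Tn_carr by blast
  show ?case
  proof (rule ccontr)
    assume no: "\<not> ?case"
    have vanish: "\<exists>d>0. \<exists>y\<in>Gd d. \<chi> y = \<zero>\<^bsub>K\<^esub> \<and> (\<forall>\<chi>'\<in>S - {\<chi>}. \<chi>' y \<noteq> \<zero>\<^bsub>K\<^esub>)" if chi: "\<chi> \<in> S" for \<chi>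
    proof -
      obtain d y where dy: "d > 0" "y \<in> Gd d" "\<forall>\<chi>'\<in>S - {\<chi>}. \<chi>' y \<noteq> \<zero>\<^bsub>K\<^esub>" using sub[OF chi] by blast
      then have "\<chi> y = \<zero>\<^bsub>K\<^esub>" using no chi by blast
      then show ?thesis using dy by blast
    qed
    \<comment> \<open>For empty S any element qualifies, for instance zero in degree 1.\<close>
    have "S \<noteq> {}" using no Gd_zero[of 1] by auto
    then obtain a where a: "a \<in> S" by blast
    have ac: "a \<in> chars" using a psubset.prems nzcharsD by blast
    obtain d F where F: "d > 0" "F \<in> Gd d" "a F = \<zero>\<^bsub>K\<^esub>" "\<And>\<chi>. \<chi> \<in> S - {a} \<Longrightarrow> \<chi> F \<noteq> \<zero>\<^bsub>K\<^esub>"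
      using vanish[OF a] by blast
    have "\<exists>e>0. \<exists>P\<in>Gd e. a P \<noteq> \<zero>\<^bsub>K\<^esub> \<and> (\<forall>\<chi>\<in>W. \<chi> P = \<zero>\<^bsub>K\<^esub>)" if "finite W" "W \<subseteq> S - {a}" for W
      using that
    proof (induction W rule: finite_induct)
      \<comment> \<open>The product of no factors would be 1; an element of degree one that is
        nonzero at a takes its place, so that the degree is positive.\<close>
      case empty
      have "a \<in> nzchars" using a psubset.prems by blast
      then obtain g where "g \<in> Gd 1" "a g \<noteq> \<zero>\<^bsub>K\<^esub>" using Gd_nonvanishing by blast
      then show ?case by (intro exI[of _ 1]) auto
    next
      case (insert b W)
      obtain e P where P: "e > 0" "P \<in> Gd e" "a P \<noteq> \<zero>\<^bsub>K\<^esub>" "\<forall>\<chi>\<in>W. \<chi> P = \<zero>\<^bsub>K\<^esub>"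
        using insert.IH insert.prems by blast
      obtain e' F' where F': "e' > 0" "F' \<in> Gd e'" "b F' = \<zero>\<^bsub>K\<^esub>" "\<forall>\<chi>'\<in>S - {b}. \<chi>' F' \<noteq> \<zero>\<^bsub>K\<^esub>"
        using vanish[of b] insert.prems by blast
      have mult: "\<chi> (P \<otimes>\<^bsub>T\<^esub> F') = \<chi> P \<otimes>\<^bsub>K\<^esub> \<chi> F'" "\<chi> P \<in> carrier K" "\<chi> F' \<in> carrier K" if "\<chi> \<in> S" for \<chi>
      proof -
        have hom: "\<chi> \<in> ring_hom T K" using that psubset.prems nzcharsD charsD(1) by blast
        show "\<chi> (P \<otimes>\<^bsub>T\<^esub> F') = \<chi> P \<otimes>\<^bsub>K\<^esub> \<chi> F'" by (rule ring_hom_mult[OF hom GT[OF P(2)] GT[OF F'(2)]])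
        show "\<chi> P \<in> carrier K" "\<chi> F' \<in> carrier K"
          using ring_hom_closed[OF hom GT[OF P(2)]] ring_hom_closed[OF hom GT[OF F'(2)]] .
      qed
      have "a F' \<noteq> \<zero>\<^bsub>K\<^esub>" using F'(4) a insert.prems by blast
      then have "a (P \<otimes>\<^bsub>T\<^esub> F') \<noteq> \<zero>\<^bsub>K\<^esub>"
        using mult(1)[OF a] P(3) K.integral[OF _ mult(2,3)[OF a]] by metis
      moreover have "\<chi> (P \<otimes>\<^bsub>T\<^esub> F') = \<zero>\<^bsub>K\<^esub>" if "\<chi> \<in> insert b W" for \<chi>
      proof -
        have "\<chi> \<in> S" using that insert.prems by blast
        moreover have "\<chi> P = \<zero>\<^bsub>K\<^esub> \<or> \<chi> F' = \<zero>\<^bsub>K\<^esub>" using that P(4) F'(3) by blast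
        ultimately show ?thesis using mult[of \<chi>] K.l_null K.r_null by metis
      qed
      moreover have "P \<otimes>\<^bsub>T\<^esub> F' \<in> Gd (e + e')" by (rule Gd_mult[OF P(2) F'(2)])
      moreover have "0 < e + e'" using P(1) by simp
      ultimately show ?case by blast
    qed
    from this[of "S - {a}"] obtain e P where P: "e > 0" "P \<in> Gd e" "a P \<noteq> \<zero>\<^bsub>K\<^esub>" "\<And>\<chi>. \<chi> \<in> S - {a} \<Longrightarrow> \<chi> P = \<zero>\<^bsub>K\<^esub>"
      using psubset.hyps by blast
    let ?y = "F [^]\<^bsub>T\<^esub> e \<oplus>\<^bsub>T\<^esub> P [^]\<^bsub>T\<^esub> d"
    have "F [^]\<^bsub>T\<^esub> e \<in> Gd (d * e)" "P [^]\<^bsub>T\<^esub> d \<in> Gd (d * e)"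
      using Gd_pow[OF F(2) P(1)] Gd_pow[OF P(2) F(1)] by (simp_all add: mult.commute)
    then have y: "?y \<in> Gd (d * e)" by (rule Gd_add)
    have val: "\<chi> ?y = \<chi> F [^]\<^bsub>K\<^esub> e \<oplus>\<^bsub>K\<^esub> \<chi> P [^]\<^bsub>K\<^esub> d" "\<chi> F \<in> carrier K" "\<chi> P \<in> carrier K" if "\<chi> \<in> S" for \<chi>
    proof -
      have "\<chi> \<in> chars" using that psubset.prems nzcharsD by blast
      then interpret chi: ring_hom_cring T K \<chi> by (rule char_hom)
      show "\<chi> ?y = \<chi> F [^]\<^bsub>K\<^esub> e \<oplus>\<^bsub>K\<^esub> \<chi> P [^]\<^bsub>K\<^esub> d" "\<chi> F \<in> carrier K" "\<chi> P \<in> carrier K"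
        using GT[OF F(2)] GT[OF P(2)] by simp_all
    qed
    have zp: "\<zero>\<^bsub>K\<^esub> [^]\<^bsub>K\<^esub> (k::nat) = \<zero>\<^bsub>K\<^esub>" if "k > 0" for k using that K.nat_pow_zero by simp
    have "\<chi> ?y \<noteq> \<zero>\<^bsub>K\<^esub>" if chi: "\<chi> \<in> S" for \<chi>
    proof (cases "\<chi> = a")
      case True
      then have "\<chi> ?y = \<chi> P [^]\<^bsub>K\<^esub> d" using val[OF chi] F(3) zp[OF P(1)] by simp
      then show ?thesis using K.nat_pow_nonzero[of "\<chi> P" d] val(3)[OF chi] P(3) True by simp
    next
      case False
      then have "\<chi> ?y = \<chi> F [^]\<^bsub>K\<^esub> e" using val[OF chi] P(4)[of \<chi>] chi zp[OF F(1)] by simp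
      then show ?thesis using K.nat_pow_nonzero[of "\<chi> F" e] val(2)[OF chi] F(4)[of \<chi>] chi False by simp
    qed
    then show False using no y F(1) P(1) by (meson nat_0_less_mult_iff)
  qed
qed

text \<open>Avoidance at one representative per line suffices, as scaling multiplies the value of a
  homogeneous element by a nonzero factor.\<close>

lemma exists_nonvanishing: "\<exists>d>0. \<exists>y\<in>Gd d. \<forall>\<chi>\<in>nzchars. \<chi> y \<noteq> \<zero>\<^bsub>K\<^esub>"
proof -
  have "finite tangent_lines" using generic by (simp add: generic_position_def)
  from finite_representatives[OF this] obtain reps where reps: "finite reps" "reps \<subseteq> nzchars"
    "\<forall>\<chi>\<in>nzchars. \<exists>\<chi>'\<in>reps. \<exists>c\<in>carrier K. c \<noteq> \<zero>\<^bsub>K\<^esub> \<and> (\<forall>n. \<forall>t\<in>Tn n. \<chi> t = c [^]\<^bsub>K\<^esub> n \<otimes>\<^bsub>K\<^esub> \<chi>' t)"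
    by blast
  obtain d y where dy: "d > 0" "y \<in> Gd d" "\<forall>\<chi>\<in>reps. \<chi> y \<noteq> \<zero>\<^bsub>K\<^esub>" using avoidance[OF reps(1,2)] by blast
  have yT: "y \<in> Tn d" using dy(2) Gd_sub by blast
  have "\<chi> y \<noteq> \<zero>\<^bsub>K\<^esub>" if chi: "\<chi> \<in> nzchars" for \<chi>
  proof -
    obtain \<chi>' c where c': "\<chi>' \<in> reps" "c \<in> carrier K" "c \<noteq> \<zero>\<^bsub>K\<^esub>"
      "\<forall>n. \<forall>t\<in>Tn n. \<chi> t = c [^]\<^bsub>K\<^esub> n \<otimes>\<^bsub>K\<^esub> \<chi>' t"
      using bspec[OF reps(3) chi] by (elim bexE conjE)
    have c: "\<chi>' \<in> reps" "c \<in> carrier K" "c \<noteq> \<zero>\<^bsub>K\<^esub>" "\<chi> y = c [^]\<^bsub>K\<^esub> d \<otimes>\<^bsub>K\<^esub> \<chi>' y"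
      by (rule c' bspec[OF spec[OF c'(4)] yT])+
    have "\<chi>' \<in> chars" using c(1) reps(2) nzcharsD by blast
    then have cc: "\<chi>' y \<in> carrier K" by (rule ring_hom_closed[OF charsD(1) Tn_carr[OF yT]])
    show ?thesis
    proof
      assume "\<chi> y = \<zero>\<^bsub>K\<^esub>"
      then have "c [^]\<^bsub>K\<^esub> d \<otimes>\<^bsub>K\<^esub> \<chi>' y = \<zero>\<^bsub>K\<^esub>" using c(4) by (simp only:)
      from K.integral[OF this K.nat_pow_closed[OF c(2)] cc] K.nat_pow_nonzero[OF c(2,3)] bspec[OF dy(3) c(1)]
      show False by blast
    qed
  qed
  then show ?thesis using dy by blast
qed

text \<open>A homogeneous ideal without zeros away from the vertex contains a power of each
  coordinate by the graded Nullstellensatz, hence every monomial of large degree.\<close>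

lemma high_degree_in_ideal:
  assumes Q: "ideal Q T" and gr: "\<And>q i. q \<in> Q \<Longrightarrow> pr i q \<in> Q"
    and no: "\<And>\<chi>. \<lbrakk>\<chi> \<in> nzchars; \<And>q. q \<in> Q \<Longrightarrow> \<chi> q = \<zero>\<^bsub>K\<^esub>\<rbrakk> \<Longrightarrow> False"
  shows "\<exists>n1. \<forall>n\<ge>n1. Tn n \<subseteq> Q"
proof -
  interpret Q: ideal Q T by fact
  have "\<exists>k::nat. x i [^]\<^bsub>T\<^esub> k \<in> Q" if i: "i \<le> r" for i
  proof (rule ccontr)
    assume "\<nexists>k::nat. x i [^]\<^bsub>T\<^esub> k \<in> Q"
    then obtain \<chi> where "\<chi> \<in> chars" "\<chi> (x i) = \<one>\<^bsub>K\<^esub>" "\<And>q. q \<in> Q \<Longrightarrow> \<chi> q = \<zero>\<^bsub>K\<^esub>"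
      using graded_nullstellensatz[OF Q gr x_T1[OF i]] by (metis zero_less_one)
    moreover from this have "\<chi> \<in> nzchars" using i K.one_not_zero by (force simp: nzchars_def)
    ultimately show False using no by blast
  qed
  then obtain k :: "nat \<Rightarrow> nat" where k: "\<And>i. i \<le> r \<Longrightarrow> x i [^]\<^bsub>T\<^esub> k i \<in> Q" by metis
  \<comment> \<open>The sum serves as a common upper bound for the exponents k i.\<close>
  define M where "M = (\<Sum>i\<le>r. k i)"
  have kM: "k i \<le> M" if "i \<le> r" for i unfolding M_def using that by (intro member_le_sum) auto
  have xM: "x i [^]\<^bsub>T\<^esub> m \<in> Q" if "i \<le> r" "M \<le> m" for i m
  proof -
    have "x i [^]\<^bsub>T\<^esub> m = x i [^]\<^bsub>T\<^esub> (m - k i) \<otimes>\<^bsub>T\<^esub> x i [^]\<^bsub>T\<^esub> k i"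
      using T.nat_pow_mult[OF x_carr[OF that(1)], of "m - k i" "k i"] kM[OF that(1)] that(2) by simp
    then show ?thesis using Q.I_l_closed[OF k[OF that(1)] T.nat_pow_closed[OF x_carr[OF that(1)]]] by simp
  qed
  have "Tn n \<subseteq> Q" if n: "Suc r * M < n" for n
  proof
    fix t assume "t \<in> Tn n"
    then obtain f where f: "f \<in> forms K r n" "evT f = t" using Tn_forms by blast
    have "evT f \<in> Q" using f(1)
    proof (induction rule: eT.forms_induct)
      case (single \<mu> c)
      \<comment> \<open>Pigeonhole: if all r + 1 exponents were below M, the degree would be at most
        (r + 1) M.\<close>
      have "\<exists>i\<le>r. M \<le> \<mu> i"
      proof (rule ccontr)
        assume "\<not> ?thesis"
        then have "(\<Sum>i\<le>r. \<mu> i) \<le> (\<Sum>i\<le>r. M)" by (intro sum_mono) auto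
        then show False using single(3) n by simp
      qed
      then obtain i where i: "i \<le> r" "M \<le> \<mu> i" by blast
      have ins: "{..r} = insert i ({..r} - {i})" using i(1) by auto
      let ?rest = "finprod T (\<lambda>j. x j [^]\<^bsub>T\<^esub> \<mu> j) ({..r} - {i})"
      have cl: "(\<lambda>j. x j [^]\<^bsub>T\<^esub> \<mu> j) \<in> {..r} - {i} \<rightarrow> carrier T" using x_carr by (simp add: Pi_iff)
      have "monomial_value T r x \<mu> = finprod T (\<lambda>j. x j [^]\<^bsub>T\<^esub> \<mu> j) (insert i ({..r} - {i}))"
        unfolding monomial_value_def using ins by simp
      also have "\<dots> = x i [^]\<^bsub>T\<^esub> \<mu> i \<otimes>\<^bsub>T\<^esub> ?rest"
        by (rule T.finprod_insert[OF _ _ cl]) (use x_carr[OF i(1)] in simp_all)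
      also have "\<dots> \<in> Q" by (rule Q.I_r_closed[OF xM[OF i] T.finprod_closed[OF cl]])
      finally have "monomial_value T r x \<mu> \<in> Q" .
      then show ?case using Q.I_l_closed[OF _ h_carr[OF single(2)]] eT.ev_single[OF single(1,2)] by simp
    next
      case (add f g)
      then show ?case using evT_mem(3)[OF eT.forms_carr[OF add(1)] eT.forms_carr[OF add(2)]] by simp
    qed
    then show "t \<in> Q" using f by simp
  qed
  then show ?thesis by (intro exI[of _ "Suc (Suc r * M)"]) auto
qed

text \<open>The ideal (y) has no zeros among the tangents, so it contains all elements of large
  degree; taking components makes the cofactor homogeneous.\<close>

lemma mult_surjective:
  assumes y: "y \<in> Tn d" and nz: "\<And>\<chi>. \<chi> \<in> nzchars \<Longrightarrow> \<chi> y \<noteq> \<zero>\<^bsub>K\<^esub>"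
  shows "\<exists>n1. \<forall>i\<ge>n1. \<forall>t\<in>Tn (i + d). \<exists>u\<in>Tn i. t = y \<otimes>\<^bsub>T\<^esub> u"
proof -
  note yc = Tn_carr[OF y]
  let ?Q = "PIdl\<^bsub>T\<^esub> y"
  have Q: "ideal ?Q T" by (rule T.cgenideal_ideal[OF yc])
  have gr: "pr i q \<in> ?Q" if q: "q \<in> ?Q" for q i
  proof -
    obtain u where u: "u \<in> carrier T" "q = u \<otimes>\<^bsub>T\<^esub> y" using q by (auto simp: cgenideal_def)
    then have "q = y \<otimes>\<^bsub>T\<^esub> u" using T.m_comm yc by simp
    then have "pr i q = (if d \<le> i then y \<otimes>\<^bsub>T\<^esub> pr (i - d) u else \<zero>\<^bsub>T\<^esub>)" using pr_mult_homog[OF y u(1)] by simp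
    also have "\<dots> = (if d \<le> i then pr (i - d) u else \<zero>\<^bsub>T\<^esub>) \<otimes>\<^bsub>T\<^esub> y" using yc u(1) by (simp add: T.m_comm)
    finally show ?thesis using u(1) unfolding cgenideal_def by auto
  qed
  have "y \<in> ?Q" by (rule T.cgenideal_self[OF yc])
  then obtain n1 where n1: "\<And>n. n1 \<le> n \<Longrightarrow> Tn n \<subseteq> ?Q"
    using high_degree_in_ideal[OF Q gr] nz by blast
  have "\<exists>u\<in>Tn i. t = y \<otimes>\<^bsub>T\<^esub> u" if i: "n1 \<le> i" and t: "t \<in> Tn (i + d)" for i t
  proof -
    have "t \<in> ?Q" using n1[of "i + d"] i t by auto
    then obtain u where u: "u \<in> carrier T" "t = u \<otimes>\<^bsub>T\<^esub> y" by (auto simp: cgenideal_def)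
    then have t2: "t = y \<otimes>\<^bsub>T\<^esub> u" using T.m_comm yc by simp
    have "t = pr (i + d) t" using t by (simp add: Tn_iff)
    also have "\<dots> = y \<otimes>\<^bsub>T\<^esub> pr i u" unfolding t2 using pr_mult_homog[OF y u(1), of "i + d"] by simp
    finally show ?thesis using pr_in[OF u(1), of i] by blast
  qed
  then show ?thesis by blast
qed

text \<open>Without tangents T would vanish in all degrees from n1 on. The zero element, placed in
  degree n1, would then multiply every \<open>T_i\<close> onto \<open>T_(i+n1) = 0\<close>, and
  \<open>injective_mult\<close> would make multiplication by 0 injective, so that 1 = 0.\<close>

lemma nzchars_nonempty: "nzchars \<noteq> {}"
proof
  assume e: "nzchars = {}"
  obtain n1 where n1: "\<And>n. n1 \<le> n \<Longrightarrow> Tn n \<subseteq> {\<zero>\<^bsub>T\<^esub>}"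
    using high_degree_in_ideal[OF T.zeroideal] e pr_zero by blast
  have "\<one>\<^bsub>T\<^esub> = \<zero>\<^bsub>T\<^esub>"
  proof (rule injective_mult[OF Gd_zero[of n1], of 0])
    show "\<exists>u\<in>Tn i. t = \<zero>\<^bsub>T\<^esub> \<otimes>\<^bsub>T\<^esub> u" if "t \<in> Tn (i + n1)" for i t
      using n1[of "i + n1"] that by (intro bexI[of _ "\<zero>\<^bsub>T\<^esub>"]) auto
  qed (use T_one in auto)
  then show False using nontrivial by simp
qed

text \<open>A vanishing element of positive degree is nilpotent by the graded Nullstellensatz, so a
  power of y kills it because Proj T is reduced. Multiplication by y is injective in large degrees,
  and the power is cancelled factor by factor.\<close>

lemma vanishing_high_degree:
  "\<exists>N0. \<forall>N\<ge>N0. \<forall>t\<in>Tn N. vanishes t \<longrightarrow> t = \<zero>\<^bsub>T\<^esub>"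
proof -
  obtain d y where d: "d > 0" and y: "y \<in> Gd d" "\<And>\<chi>. \<chi> \<in> nzchars \<Longrightarrow> \<chi> y \<noteq> \<zero>\<^bsub>K\<^esub>"
    using exists_nonvanishing by blast
  have yT: "y \<in> Tn d" using y(1) Gd_sub by blast
  obtain n1 where n1: "\<And>i t. \<lbrakk>n1 \<le> i; t \<in> Tn (i + d)\<rbrakk> \<Longrightarrow> \<exists>u\<in>Tn i. t = y \<otimes>\<^bsub>T\<^esub> u"
  proof -
    have "\<exists>n1. \<forall>i\<ge>n1. \<forall>t\<in>Tn (i + d). \<exists>u\<in>Tn i. t = y \<otimes>\<^bsub>T\<^esub> u"
      by (rule mult_surjective[OF yT]) (rule y(2))
    then show thesis using that by blast
  qed
  have inj: "t = \<zero>\<^bsub>T\<^esub>" if "n1 \<le> i" "t \<in> Tn i" "y \<otimes>\<^bsub>T\<^esub> t = \<zero>\<^bsub>T\<^esub>" for i t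
    using injective_mult[OF y(1) n1 that] by blast
  \<comment> \<open>The successor ensures positive degree, as the graded Nullstellensatz
    requires.\<close>
  have "t = \<zero>\<^bsub>T\<^esub>" if N: "Suc n1 \<le> N" and t: "t \<in> Tn N" and v: "vanishes t" for N t
  proof -
    have N0: "0 < N" using N by simp
    have "\<exists>k::nat. t [^]\<^bsub>T\<^esub> k = \<zero>\<^bsub>T\<^esub>"
    proof (rule ccontr)
      assume "\<nexists>k::nat. t [^]\<^bsub>T\<^esub> k = \<zero>\<^bsub>T\<^esub>"
      then have "\<And>k::nat. t [^]\<^bsub>T\<^esub> k \<notin> {\<zero>\<^bsub>T\<^esub>}" by simp
      then obtain \<chi> where chi: "\<chi> \<in> chars" "\<chi> t = \<one>\<^bsub>K\<^esub>"
        using graded_nullstellensatz[OF T.zeroideal _ t N0] pr_zero by (metis singletonD singletonI)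
      have tn: "\<chi> t \<noteq> \<zero>\<^bsub>K\<^esub>" using chi(2) K.one_not_zero by simp
      obtain i where "i \<le> r" "\<chi> (x i) \<noteq> \<zero>\<^bsub>K\<^esub>" by (rule char_nonzero_on_variable[OF chi(1) t N0 tn])
      then have "\<chi> \<in> nzchars" using chi(1) by (auto simp: nzchars_def)
      then show False using v tn by (simp add: vanishes_def)
    qed
    then obtain k :: nat where "t [^]\<^bsub>T\<^esub> k = \<zero>\<^bsub>T\<^esub>" by blast
    from Proj_reduced_torsion[OF red t this yT d] obtain M :: nat where M: "y [^]\<^bsub>T\<^esub> M \<otimes>\<^bsub>T\<^esub> t = \<zero>\<^bsub>T\<^esub>" by blast
    have "y [^]\<^bsub>T\<^esub> m \<otimes>\<^bsub>T\<^esub> u = \<zero>\<^bsub>T\<^esub> \<Longrightarrow> n1 \<le> i \<Longrightarrow> u \<in> Tn i \<Longrightarrow> u = \<zero>\<^bsub>T\<^esub>" for m :: nat and u i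
    proof (induction m arbitrary: u i)
      case 0
      then show ?case using Tn_carr[OF 0(3)] by simp
    next
      case (Suc m)
      have uc: "u \<in> carrier T" using Suc.prems Tn_carr by blast
      have "y [^]\<^bsub>T\<^esub> m \<otimes>\<^bsub>T\<^esub> (y \<otimes>\<^bsub>T\<^esub> u) = \<zero>\<^bsub>T\<^esub>"
        using Suc.prems(1) uc Tn_carr[OF yT] by (simp add: T.m_assoc)
      moreover have "y \<otimes>\<^bsub>T\<^esub> u \<in> Tn (d + i)" by (rule Tn_mult[OF yT Suc.prems(3)])
      ultimately have "y \<otimes>\<^bsub>T\<^esub> u = \<zero>\<^bsub>T\<^esub>" using Suc.IH[of "y \<otimes>\<^bsub>T\<^esub> u" "d + i"] Suc.prems(2) by simp
      then show ?case using inj[OF Suc.prems(2,3)] by simp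
    qed
    from this[OF M _ t] show ?thesis using N by simp
  qed
  then show ?thesis by blast
qed

section \<open>The coordinate ring of the tangents\<close>

abbreviation "C \<equiv> coord_ring K r tangent_lines"
abbreviation "cp \<equiv> coord_proj K r tangent_lines"
abbreviation "KC \<equiv> cp ` mpoly_const K ` carrier K"
abbreviation "Cn n \<equiv> cp ` forms K r n"

interpretation VI: ideal VI "mpoly_ring K r" by (rule VI_ideal)
interpretation C: cring C unfolding coord_ring_def by (rule VI.quotient_is_cring[OF eT.P.is_cring])

lemma cp_hom: "cp \<in> ring_hom (mpoly_ring K r) C"
  using VI.rcos_ring_hom by (simp add: coord_proj_def[abs_def] coord_ring_def)

lemmas cp_mem = ring_hom_memE[OF cp_hom]

lemma cp_eq_iff: "\<lbrakk>f \<in> carrier (mpoly_ring K r); g \<in> carrier (mpoly_ring K r)\<rbrakk>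
    \<Longrightarrow> cp f = cp g \<longleftrightarrow> f \<ominus>\<^bsub>mpoly_ring K r\<^esub> g \<in> VI"
  unfolding coord_proj_def using eT.P.quotient_eq_iff_same_a_r_cos[OF VI_ideal] by blast

lemma cp_zero_iff: "f \<in> carrier (mpoly_ring K r) \<Longrightarrow> cp f = \<zero>\<^bsub>C\<^esub> \<longleftrightarrow> f \<in> VI"
  using cp_eq_iff[of f "\<zero>\<^bsub>mpoly_ring K r\<^esub>"] ring_hom_zero[OF cp_hom eT.P.ring_axioms C.ring_axioms]
  by (simp add: a_minus_def)

lemma const_closed: "c \<in> carrier K \<Longrightarrow> mpoly_const K c \<in> carrier (mpoly_ring K r)"
  unfolding eT.mpoly_const_eq by (rule eT.single_closed) auto

text \<open>Constants survive in the coordinate ring because there is at least one point, at which 1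
  does not vanish.\<close>

lemma KC_subfield: "subfield KC C"
proof -
  have m: "(\<lambda>i. 0) \<in> carrier (exponents r)" by simp
  have one_notin: "\<one>\<^bsub>mpoly_ring K r\<^esub> \<notin> VI"
  proof
    assume "\<one>\<^bsub>mpoly_ring K r\<^esub> \<in> VI"
    then have "vanishes \<one>\<^bsub>T\<^esub>" using VI_vanishes evT_mem(4) by metis
    moreover obtain \<chi> where "\<chi> \<in> nzchars" using nzchars_nonempty by blast
    ultimately show False using ring_hom_one[OF charsD(1)[OF nzcharsD]] K.one_not_zero by (metis vanishes_def)
  qed
  have hom: "cp \<circ> mpoly_const K \<in> ring_hom K C"
  proof (rule ring_hom_trans[OF _ cp_hom], rule ring_hom_memI)
    fix a assume a: "a \<in> carrier K"
    show "mpoly_const K a \<in> carrier (mpoly_ring K r)" by (rule const_closed[OF a])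
    fix b assume b: "b \<in> carrier K"
    show "mpoly_const K (a \<otimes>\<^bsub>K\<^esub> b) = mpoly_const K a \<otimes>\<^bsub>mpoly_ring K r\<^esub> mpoly_const K b"
      unfolding eT.mpoly_const_eq using eT.single_mult[OF m m a b] by simp
    show "mpoly_const K (a \<oplus>\<^bsub>K\<^esub> b) = mpoly_const K a \<oplus>\<^bsub>mpoly_ring K r\<^esub> mpoly_const K b"
      unfolding eT.RM_simps by (rule ext) (simp add: mpoly_const_def)
  next
    show "mpoly_const K \<one>\<^bsub>K\<^esub> = \<one>\<^bsub>mpoly_ring K r\<^esub>" unfolding eT.mpoly_const_eq eT.RM_simps by simp
  qed
  interpret hc: ring_hom_ring K C "cp \<circ> mpoly_const K"
    by (rule ring_hom_ringI2[OF K.ring_axioms C.ring_axioms hom])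
  have "\<one>\<^bsub>C\<^esub> \<noteq> \<zero>\<^bsub>C\<^esub>" using cp_zero_iff[OF eT.P.one_closed] cp_mem(4) one_notin by simp
  then have "subfield ((cp \<circ> mpoly_const K) ` carrier K) C"
    by (rule hc.img_is_subfield(2)[OF K.carrier_is_subfield])
  then show ?thesis by (simp add: image_comp)
qed

lemma Cn_dim: "C.dimension (min (card tangent_lines) ((n + r) choose r)) KC (Cn n)"
  using generic by (simp add: generic_position_def)

text \<open>If all monomials are independent modulo the vanishing ideal, no form vanishes on all points.\<close>

lemma vanishing_low_degree:
  assumes le: "(n + r) choose r \<le> card tangent_lines" and t: "t \<in> Tn n" "vanishes t"
  shows "t = \<zero>\<^bsub>T\<^esub>"
proof (rule ccontr)
  assume tn: "t \<noteq> \<zero>\<^bsub>T\<^esub>"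
  obtain f where f: "f \<in> forms K r n" "evT f = t" using Tn_forms[OF t(1)] by blast
  have fV: "f \<in> VI" using form_in_VI[OF f(1)] f(2) t(2) by simp
  note fc = eT.forms_carr[OF f(1)]
  have "f \<noteq> \<zero>\<^bsub>mpoly_ring K r\<^esub>"
    using tn f(2) ring_hom_zero[OF evT_hom eT.P.ring_axioms T.ring_axioms] by auto
  \<comment> \<open>A monomial occurring in f. Modulo the vanishing ideal the relation f = 0
    expresses it by the other monomials of degree n, which are then too few to span a space of the
    given dimension.\<close>
  then obtain \<mu>0 where m0: "f \<mu>0 \<noteq> \<zero>\<^bsub>K\<^esub>" unfolding eT.RM_simps by blast
  let ?E = "{\<mu>. (\<forall>i>r. \<mu> i = 0) \<and> (\<Sum>i\<le>r. \<mu> i) = n}"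
  have Efin: "finite ?E" "card ?E \<le> (n + r) choose r" using card_exponents_le[of r n] by auto
  have m0E: "\<mu>0 \<in> ?E" using m0 f(1) eT.RM_carrierD(2)[OF fc m0] by (simp add: forms_def)
  have m0c: "\<mu>0 \<in> carrier (exponents r)" using m0E by simp
  let ?e = "\<lambda>\<mu>. single K \<mu> \<one>\<^bsub>K\<^esub>"
  have ec: "?e \<mu> \<in> carrier (mpoly_ring K r)" if "\<mu> \<in> carrier (exponents r)" for \<mu>
    by (rule eT.single_closed[OF that K.one_closed])
  obtain ms where ms: "set ms = ?E - {\<mu>0}" "distinct ms"
    using finite_distinct_list[of "?E - {\<mu>0}"] Efin(1) by auto
  have len: "length ms < (n + r) choose r"
  proof -
    have "length ms = card ?E - 1" using distinct_card[OF ms(2)] ms(1) m0E Efin(1) by simp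
    moreover have "card ?E > 0" using m0E Efin(1) card_gt_0_iff by blast
    ultimately show ?thesis using Efin(2) by simp
  qed
  let ?Us = "map (\<lambda>\<mu>. cp (?e \<mu>)) ms"
  have Us: "set ?Us \<subseteq> carrier C" using ms(1) cp_mem(1)[OF ec] by auto
  note SP = C.Span_subgroup_props[OF KC_subfield Us] and SS = C.Span_smult_closed[OF KC_subfield Us]
  let ?S = "C.Span KC ?Us"
  have eS: "cp (?e \<mu>) \<in> ?S" if "\<mu> \<in> ?E - {\<mu>0}" for \<mu>
    using C.Span_base_incl[OF KC_subfield Us] that ms(1) by auto
  have cs: "cp (single K \<mu> c) = cp (mpoly_const K c) \<otimes>\<^bsub>C\<^esub> cp (?e \<mu>)"
    if "\<mu> \<in> carrier (exponents r)" "c \<in> carrier K" for \<mu> c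
  proof -
    have m: "(\<lambda>i. 0) \<in> carrier (exponents r)" by simp
    have "mpoly_const K c \<otimes>\<^bsub>mpoly_ring K r\<^esub> ?e \<mu> = single K \<mu> c"
      unfolding eT.mpoly_const_eq using eT.single_mult[OF m that(1) that(2) K.one_closed] that(2) by simp
    then show ?thesis using cp_mem(2)[OF const_closed[OF that(2)] ec[OF that(1)]] by simp
  qed
  have KCI: "cp (mpoly_const K c) \<in> KC" if "c \<in> carrier K" for c using that by blast
  \<comment> \<open>Modulo the ideal, every form of degree n splits into a combination of the other
    monomials and its \<mu>0 term.\<close>
  let ?dec = "\<lambda>g. \<exists>s\<in>?S. cp g = s \<oplus>\<^bsub>C\<^esub> cp (mpoly_const K (g \<mu>0)) \<otimes>\<^bsub>C\<^esub> cp (?e \<mu>0)"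
  have e0: "cp (?e \<mu>0) \<in> carrier C" by (rule cp_mem(1)[OF ec[OF m0c]])
  have kc: "cp (mpoly_const K c) \<in> carrier C" if "c \<in> carrier K" for c by (rule cp_mem(1)[OF const_closed[OF that]])
  have cp0: "cp (mpoly_const K \<zero>\<^bsub>K\<^esub>) = \<zero>\<^bsub>C\<^esub>"
  proof -
    have "mpoly_const K \<zero>\<^bsub>K\<^esub> = \<zero>\<^bsub>mpoly_ring K r\<^esub>" unfolding eT.RM_simps by (simp add: mpoly_const_def)
    then show ?thesis using ring_hom_zero[OF cp_hom eT.P.ring_axioms C.ring_axioms] by simp
  qed
  have dec: "?dec g" if "g \<in> forms K r n" for g
    using that
  proof (induction rule: eT.forms_induct)
    case (single \<mu> c)
    show ?case
    proof (cases "\<mu> = \<mu>0")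
      case True
      then have "cp (single K \<mu> c) = \<zero>\<^bsub>C\<^esub> \<oplus>\<^bsub>C\<^esub> cp (mpoly_const K (single K \<mu> c \<mu>0)) \<otimes>\<^bsub>C\<^esub> cp (?e \<mu>0)"
        using cs[OF single(1,2)] e0 kc[OF single(2)] by (simp add: single_def[of K \<mu>0 c])
      then show ?thesis using SP(2) by blast
    next
      case False
      then have "cp (?e \<mu>) \<in> ?S" using single(1,3) by (intro eS) simp
      then have "cp (single K \<mu> c) \<in> ?S" using cs[OF single(1,2)] SS[OF KCI[OF single(2)]] by simp
      moreover have "single K \<mu> c \<mu>0 = \<zero>\<^bsub>K\<^esub>" using False by (simp add: single_def)
      moreover have "cp (single K \<mu> c) \<in> carrier C" by (rule cp_mem(1)[OF eT.single_closed[OF single(1,2)]])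
      ultimately show ?thesis using e0 cp0 by (intro bexI[of _ "cp (single K \<mu> c)"]) simp_all
    qed
  next
    case (add g g')
    then obtain s s' where s: "s \<in> ?S" "cp g = s \<oplus>\<^bsub>C\<^esub> cp (mpoly_const K (g \<mu>0)) \<otimes>\<^bsub>C\<^esub> cp (?e \<mu>0)"
      "s' \<in> ?S" "cp g' = s' \<oplus>\<^bsub>C\<^esub> cp (mpoly_const K (g' \<mu>0)) \<otimes>\<^bsub>C\<^esub> cp (?e \<mu>0)" by blast
    note gc = eT.forms_carr[OF add(1)] eT.forms_carr[OF add(2)]
    note gk = eT.RM_carrierD(1)[OF gc(1), of \<mu>0] eT.RM_carrierD(1)[OF gc(2), of \<mu>0]
    have "mpoly_const K ((g \<oplus>\<^bsub>mpoly_ring K r\<^esub> g') \<mu>0) = mpoly_const K (g \<mu>0) \<oplus>\<^bsub>mpoly_ring K r\<^esub> mpoly_const K (g' \<mu>0)"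
      unfolding eT.RM_simps by (rule ext) (simp add: mpoly_const_def)
    then have cc: "cp (mpoly_const K ((g \<oplus>\<^bsub>mpoly_ring K r\<^esub> g') \<mu>0)) = cp (mpoly_const K (g \<mu>0)) \<oplus>\<^bsub>C\<^esub> cp (mpoly_const K (g' \<mu>0))"
      using cp_mem(3)[OF const_closed[OF gk(1)] const_closed[OF gk(2)]] by simp
    have sc: "s \<in> carrier C" "s' \<in> carrier C" using s(1,3) SP(1) by blast+
    have "cp (g \<oplus>\<^bsub>mpoly_ring K r\<^esub> g') = (s \<oplus>\<^bsub>C\<^esub> s') \<oplus>\<^bsub>C\<^esub> cp (mpoly_const K ((g \<oplus>\<^bsub>mpoly_ring K r\<^esub> g') \<mu>0)) \<otimes>\<^bsub>C\<^esub> cp (?e \<mu>0)"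
      unfolding cp_mem(3)[OF gc] s(2) s(4) cc using sc e0 kc[OF gk(1)] kc[OF gk(2)]
      by (simp add: C.l_distr C.a_ac)
    then show ?case using SP(3)[OF s(1,3)] by blast
  qed
  have "cp (?e \<mu>0) \<in> ?S"
  proof -
    obtain s where s: "s \<in> ?S" "cp f = s \<oplus>\<^bsub>C\<^esub> cp (mpoly_const K (f \<mu>0)) \<otimes>\<^bsub>C\<^esub> cp (?e \<mu>0)" using dec[OF f(1)] by blast
    have fk: "f \<mu>0 \<in> carrier K" by (rule eT.RM_carrierD(1)[OF fc])
    let ?k = "cp (mpoly_const K (f \<mu>0))"
    have sc: "s \<in> carrier C" using s(1) SP(1) by blast
    have k: "?k \<in> carrier C" by (rule kc[OF fk])
    have "s \<oplus>\<^bsub>C\<^esub> ?k \<otimes>\<^bsub>C\<^esub> cp (?e \<mu>0) = \<zero>\<^bsub>C\<^esub>" using s(2) cp_zero_iff[OF fc] fV by simp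
    then have "?k \<otimes>\<^bsub>C\<^esub> cp (?e \<mu>0) = \<ominus>\<^bsub>C\<^esub> s"
      using sc k e0 C.minus_equality[of "?k \<otimes>\<^bsub>C\<^esub> cp (?e \<mu>0)" s] by (simp add: C.a_comm)
    then have ke: "?k \<otimes>\<^bsub>C\<^esub> cp (?e \<mu>0) \<in> ?S" using SP(4)[OF s(1)] by simp
    have inv: "inv\<^bsub>K\<^esub> (f \<mu>0) \<in> carrier K" "inv\<^bsub>K\<^esub> (f \<mu>0) \<otimes>\<^bsub>K\<^esub> f \<mu>0 = \<one>\<^bsub>K\<^esub>"
      using K.field_Units fk m0 by auto
    let ?k' = "cp (mpoly_const K (inv\<^bsub>K\<^esub> (f \<mu>0)))"
    have "?k' \<otimes>\<^bsub>C\<^esub> ?k = \<one>\<^bsub>C\<^esub>"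
    proof -
      have m: "(\<lambda>i. 0) \<in> carrier (exponents r)" by simp
      have "mpoly_const K (inv\<^bsub>K\<^esub> (f \<mu>0)) \<otimes>\<^bsub>mpoly_ring K r\<^esub> mpoly_const K (f \<mu>0) = \<one>\<^bsub>mpoly_ring K r\<^esub>"
        unfolding eT.mpoly_const_eq eT.RM_simps using eT.single_mult[OF m m inv(1) fk] inv(2) by simp
      then show ?thesis using cp_mem(2)[OF const_closed[OF inv(1)] const_closed[OF fk]] cp_mem(4) by simp
    qed
    then have "?k' \<otimes>\<^bsub>C\<^esub> (?k \<otimes>\<^bsub>C\<^esub> cp (?e \<mu>0)) = cp (?e \<mu>0)"
      using k e0 kc[OF inv(1)] by (simp add: C.m_assoc[symmetric])
    then show ?thesis using SS[OF KCI[OF inv(1)] ke] by simp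
  qed
  have "Cn n \<subseteq> ?S"
  proof
    fix w assume "w \<in> Cn n"
    then obtain g where g: "g \<in> forms K r n" "w = cp g" by blast
    then obtain s where s: "s \<in> ?S" "cp g = s \<oplus>\<^bsub>C\<^esub> cp (mpoly_const K (g \<mu>0)) \<otimes>\<^bsub>C\<^esub> cp (?e \<mu>0)" using dec by blast
    have "g \<mu>0 \<in> carrier K" by (rule eT.RM_carrierD(1)[OF eT.forms_carr[OF g(1)]])
    then show "w \<in> ?S" unfolding g(2) s(2) using SP(3)[OF s(1) SS[OF KCI \<open>cp (?e \<mu>0) \<in> ?S\<close>]] by blast
  qed
  then have "min (card tangent_lines) ((n + r) choose r) \<le> length ?Us"
    by (rule C.dimension_le_spanning[OF KC_subfield Us Cn_dim])
  then show False using len le by simp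
qed

text \<open>When all coordinate spaces involved have the same dimension, multiplication by an element
  without zeros is an isomorphism between them.\<close>

lemma vanishing_zero:
  assumes t: "t \<in> Tn n" "vanishes t"
  shows "t = \<zero>\<^bsub>T\<^esub>"
proof (cases "(n + r) choose r \<le> card tangent_lines")
  case True
  then show ?thesis using vanishing_low_degree t by blast
next
  case False
  let ?s = "card tangent_lines"
  \<comment> \<open>Here s is smaller than (n+r choose r), and these binomials increase with the
    degree, so the minimum is s in all degrees from n on.\<close>
  have dim: "C.dimension ?s KC (Cn i)" if "n \<le> i" for i
  proof -
    have "(n + r) choose r \<le> (i + r) choose r" using that by (intro binomial_right_mono) simp
    then show ?thesis using Cn_dim[of i] False by (simp add: min_def)
  qed
  obtain N0 where N0: "\<And>N t. \<lbrakk>N0 \<le> N; t \<in> Tn N; vanishes t\<rbrakk> \<Longrightarrow> t = \<zero>\<^bsub>T\<^esub>" using vanishing_high_degree by blast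
  obtain d y where d: "d > 0" and y: "y \<in> Gd d" "\<And>\<chi>. \<chi> \<in> nzchars \<Longrightarrow> \<chi> y \<noteq> \<zero>\<^bsub>K\<^esub>"
    using exists_nonvanishing by blast
  \<comment> \<open>Passing from y to its power with exponent N0 + 1 raises the degree to D \<ge>
    N0, so that vanishing elements of degree i + D are zero.\<close>
  define D where "D = d * Suc N0"
  define Y where "Y = y [^]\<^bsub>T\<^esub> Suc N0"
  have YG: "Y \<in> Gd D" unfolding Y_def D_def by (rule Gd_pow[OF y(1)]) simp
  have DN: "N0 \<le> D" unfolding D_def using d mult_le_mono[of 1 d "N0" "Suc N0"] by linarith
  have YT: "Y \<in> Tn D" using YG Gd_sub by blast
  note Yc = Tn_carr[OF YT]
  have yc: "y \<in> carrier T" using y(1) Gd_sub Tn_carr by blast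
  have Ynz: "\<chi> Y \<noteq> \<zero>\<^bsub>K\<^esub>" if chi: "\<chi> \<in> nzchars" for \<chi>
  proof -
    interpret chi: ring_hom_cring T K \<chi> by (rule char_hom[OF nzcharsD[OF chi]])
    have "\<chi> Y = \<chi> y [^]\<^bsub>K\<^esub> Suc N0" unfolding Y_def by (rule chi.hom_pow[OF yc])
    then show ?thesis using K.nat_pow_nonzero[OF chi.hom_closed[OF yc] y(2)[OF chi], of "Suc N0"] by (rule ssubst)
  qed
  obtain F where F: "F \<in> forms K r D" "evT F = Y" using Tn_forms[OF YT] by blast
  note Fc = eT.forms_carr[OF F(1)]
  note cF = cp_mem(1)[OF Fc]
  have surj: "\<exists>u\<in>Tn i. t = Y \<otimes>\<^bsub>T\<^esub> u" if i: "n \<le> i" and t: "t \<in> Tn (i + D)" for i t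
  proof -
    obtain Us where Us: "set Us \<subseteq> carrier C" "C.independent KC Us" "length Us = ?s" "C.Span KC Us = Cn i"
      using C.exists_base[OF KC_subfield dim[OF i]] by blast
    have KCc: "KC \<subseteq> carrier C" using const_closed cp_mem(1) by blast
    let ?Vs = "map (\<lambda>u. u \<otimes>\<^bsub>C\<^esub> cp F) Us"
    \<comment> \<open>F vanishes at no point, so a form that vanishes everywhere after
      multiplication by F vanished before.\<close>
    have cF_inj: "w = \<zero>\<^bsub>C\<^esub>" if w: "w \<in> Cn i" "w \<otimes>\<^bsub>C\<^esub> cp F = \<zero>\<^bsub>C\<^esub>" for w
    proof -
      obtain g where g: "g \<in> forms K r i" "w = cp g" using w(1) by blast
      note gc = eT.forms_carr[OF g(1)]
      have "g \<otimes>\<^bsub>mpoly_ring K r\<^esub> F \<in> VI"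
        using w(2) g(2) cp_mem(2)[OF gc Fc] cp_zero_iff[OF eT.P.m_closed[OF gc Fc]] by simp
      then have v: "vanishes (evT g \<otimes>\<^bsub>T\<^esub> Y)" using VI_vanishes[of "g \<otimes>\<^bsub>mpoly_ring K r\<^esub> F"] evT_mem(2)[OF gc Fc] F(2) by simp
      have "\<chi> (evT g) = \<zero>\<^bsub>K\<^esub>" if chi: "\<chi> \<in> nzchars" for \<chi>
      proof -
        interpret chi: ring_hom_cring T K \<chi> by (rule char_hom[OF nzcharsD[OF chi]])
        have "\<chi> (evT g) \<otimes>\<^bsub>K\<^esub> \<chi> Y = \<zero>\<^bsub>K\<^esub>"
          using v chi chi.hom_mult[OF evT_mem(1)[OF gc] Yc] by (simp add: vanishes_def)
        then show ?thesis
          using K.integral[OF _ chi.hom_closed[OF evT_mem(1)[OF gc]] chi.hom_closed[OF Yc]] Ynz[OF chi] by blast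
      qed
      then have "g \<in> VI" by (intro form_in_VI[OF g(1)]) (simp add: vanishes_def)
      then show ?thesis using cp_zero_iff[OF gc] g(2) by simp
    qed
    have Vsc: "set ?Vs \<subseteq> carrier C" using Us(1) cF by auto
    have ind: "C.independent KC ?Vs"
    proof (rule C.trivial_combine_imp_independent[OF KC_subfield Vsc])
      fix Ks assume Ks: "set Ks \<subseteq> KC" "C.combine Ks ?Vs = \<zero>\<^bsub>C\<^esub>"
      have "C.combine Ks Us \<in> C.Span KC Us" using C.Span_eq_combine_set[OF KC_subfield Us(1)] Ks(1) by blast
      moreover have "C.combine Ks Us \<otimes>\<^bsub>C\<^esub> cp F = \<zero>\<^bsub>C\<^esub>"
        using C.combine_l_distr[OF _ Us(1) cF, of Ks] Ks KCc by auto
      ultimately have "C.combine Ks Us = \<zero>\<^bsub>C\<^esub>" using cF_inj Us(4) by simp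
      then show "set (take (length ?Vs) Ks) \<subseteq> {\<zero>\<^bsub>C\<^esub>}"
        using C.independent_imp_trivial_combine[OF KC_subfield Us(2) Ks(1)] by simp
    qed
    have sub: "set ?Vs \<subseteq> Cn (i + D)"
    proof
      fix w assume "w \<in> set ?Vs"
      then obtain u where u: "u \<in> set Us" "w = u \<otimes>\<^bsub>C\<^esub> cp F" by auto
      then have "u \<in> Cn i" using C.Span_base_incl[OF KC_subfield Us(1)] Us(4) by blast
      then obtain g where g: "g \<in> forms K r i" "u = cp g" by blast
      then show "w \<in> Cn (i + D)"
        unfolding u(2) g(2) using cp_mem(2)[OF eT.forms_carr[OF g(1)] Fc] eT.forms_mult[OF g(1) F(1)] by blast
    qed
    have "n \<le> i + D" using i by simp
    \<comment> \<open>The s products of a basis with the class of F are independent and lie in a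
      space of dimension s.\<close>
    then have span: "C.Span KC ?Vs = Cn (i + D)"
      using C.independent_length_eq_dimension[OF KC_subfield dim ind sub] Us(3) by simp
    obtain g where g: "g \<in> forms K r (i + D)" "evT g = t" using Tn_forms[OF t] by blast
    note gc = eT.forms_carr[OF g(1)]
    have "cp g \<in> {C.combine Ks ?Vs | Ks. set Ks \<subseteq> KC}"
      unfolding C.Span_eq_combine_set[OF KC_subfield Vsc, symmetric] span by (rule imageI[OF g(1)])
    then obtain Ks where Ks: "cp g = C.combine Ks ?Vs" "set Ks \<subseteq> KC" by blast
    have cg: "cp g = C.combine Ks Us \<otimes>\<^bsub>C\<^esub> cp F"
      unfolding C.combine_l_distr[OF subset_trans[OF Ks(2) KCc] Us(1) cF] by (rule Ks(1))
    have "C.combine Ks Us \<in> {C.combine Ks Us | Ks. set Ks \<subseteq> KC}" using Ks(2) by blast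
    then have "C.combine Ks Us \<in> Cn i"
      unfolding C.Span_eq_combine_set[OF KC_subfield Us(1), symmetric] Us(4) .
    then obtain f where f: "C.combine Ks Us = cp f" "f \<in> forms K r i" by (rule imageE)
    note fc = eT.forms_carr[OF f(2)]
    have "cp g = cp (f \<otimes>\<^bsub>mpoly_ring K r\<^esub> F)" unfolding cp_mem(2)[OF fc Fc] f(1)[symmetric] by (rule cg)
    then have "g \<ominus>\<^bsub>mpoly_ring K r\<^esub> f \<otimes>\<^bsub>mpoly_ring K r\<^esub> F \<in> VI" using cp_eq_iff[OF gc eT.P.m_closed[OF fc Fc]] by simp
    then have v: "vanishes (evT (g \<ominus>\<^bsub>mpoly_ring K r\<^esub> f \<otimes>\<^bsub>mpoly_ring K r\<^esub> F))" by (rule VI_vanishes)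
    interpret hT: ring_hom_ring "mpoly_ring K r" T evT
      by (rule ring_hom_ringI2[OF eT.P.ring_axioms T.ring_axioms evT_hom])
    have fT: "evT f \<in> Tn i" by (rule evT_forms[OF f(2)])
    have "evT (g \<ominus>\<^bsub>mpoly_ring K r\<^esub> f \<otimes>\<^bsub>mpoly_ring K r\<^esub> F) = t \<ominus>\<^bsub>T\<^esub> evT f \<otimes>\<^bsub>T\<^esub> Y"
      using gc fc Fc F(2) g(2) by (simp add: a_minus_def)
    then have v: "vanishes (t \<ominus>\<^bsub>T\<^esub> evT f \<otimes>\<^bsub>T\<^esub> Y)" using v by simp
    \<comment> \<open>Equality in the coordinate ring only says that this difference vanishes at the
      points; its degree is at least N0, so it is zero in T itself.\<close>
    have "t \<ominus>\<^bsub>T\<^esub> evT f \<otimes>\<^bsub>T\<^esub> Y \<in> Tn (i + D)" by (rule Tn_diff[OF t Tn_mult[OF fT YT]])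
    then have "t \<ominus>\<^bsub>T\<^esub> evT f \<otimes>\<^bsub>T\<^esub> Y = \<zero>\<^bsub>T\<^esub>" using N0[of "i + D"] v DN by simp
    then have "t = Y \<otimes>\<^bsub>T\<^esub> evT f" using Tn_carr[OF t] Tn_carr[OF fT] Yc by (simp add: T.m_comm)
    then show ?thesis using fT by blast
  qed
  have "Y \<otimes>\<^bsub>T\<^esub> t \<in> Tn (D + n)" by (rule Tn_mult[OF YT t(1)])
  moreover have "vanishes (Y \<otimes>\<^bsub>T\<^esub> t)"
    unfolding vanishes_def
  proof
    fix \<chi> assume chi: "\<chi> \<in> nzchars"
    interpret chi: ring_hom_cring T K \<chi> by (rule char_hom[OF nzcharsD[OF chi]])
    show "\<chi> (Y \<otimes>\<^bsub>T\<^esub> t) = \<zero>\<^bsub>K\<^esub>" using bspec[OF t(2)[unfolded vanishes_def] chi] chi.hom_mult[OF Yc Tn_carr[OF t(1)]] chi.hom_closed[OF Yc] by simp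
  qed
  ultimately have "Y \<otimes>\<^bsub>T\<^esub> t = \<zero>\<^bsub>T\<^esub>" using N0[of "D + n"] DN by simp
  then show ?thesis using injective_mult[OF YG surj order_refl t(1)] by blast
qed

text \<open>The homogeneous kernels are prime and so contain every nilpotent element. By their
  definition its components then vanish at all tangents, and vanishing components are zero.\<close>

theorem reduced: "reduced_ring T"
  unfolding reduced_ring_def
proof (intro ballI allI impI)
  fix t and k :: nat assume t: "t \<in> carrier T" "t [^]\<^bsub>T\<^esub> k = \<zero>\<^bsub>T\<^esub>"
  have "pr n t = \<zero>\<^bsub>T\<^esub>" for n
  proof (rule vanishing_zero[OF pr_in[OF t(1)]])
    show "vanishes (pr n t)"
      using nilpotent_in_homog_kernel[OF nzcharsD t] by (simp add: vanishes_def homog_kernel_def)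
  qed
  then show "t = \<zero>\<^bsub>T\<^esub>" by (rule zero_if_components_zero[OF t(1)])
qed

end

section \<open>Extension of linear maps\<close>

text \<open>Partial linear maps are encoded as graphs, so that Zorn's lemma applies to inclusion and
  the upper bound of a chain is its union. Scalars act through \<phi> on R and through \<theta> on
  B.\<close>

definition linear_graph ::
    "('k, 'e) ring_scheme \<Rightarrow> ('a, 'c) ring_scheme \<Rightarrow> ('k \<Rightarrow> 'a) \<Rightarrow> ('b, 'd) ring_scheme \<Rightarrow> ('k \<Rightarrow> 'b) \<Rightarrow> ('a \<times> 'b) set \<Rightarrow> bool" where
  "linear_graph k R \<phi> B \<theta> \<Gamma> \<longleftrightarrow> \<Gamma> \<subseteq> carrier R \<times> carrier B \<and>
     (\<forall>a m a' m'. (a, m) \<in> \<Gamma> \<longrightarrow> (a', m') \<in> \<Gamma> \<longrightarrow> (a \<oplus>\<^bsub>R\<^esub> a', m \<oplus>\<^bsub>B\<^esub> m') \<in> \<Gamma>) \<and>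
     (\<forall>c\<in>carrier k. \<forall>a m. (a, m) \<in> \<Gamma> \<longrightarrow> (\<phi> c \<otimes>\<^bsub>R\<^esub> a, \<theta> c \<otimes>\<^bsub>B\<^esub> m) \<in> \<Gamma>) \<and>
     (\<forall>a m m'. (a, m) \<in> \<Gamma> \<longrightarrow> (a, m') \<in> \<Gamma> \<longrightarrow> m = m')"

lemma linear_graphD:
  assumes "linear_graph k R \<phi> B \<theta> \<Gamma>"
  shows "\<Gamma> \<subseteq> carrier R \<times> carrier B"
    "\<And>a m a' m'. \<lbrakk>(a, m) \<in> \<Gamma>; (a', m') \<in> \<Gamma>\<rbrakk> \<Longrightarrow> (a \<oplus>\<^bsub>R\<^esub> a', m \<oplus>\<^bsub>B\<^esub> m') \<in> \<Gamma>"
    "\<And>c a m. \<lbrakk>c \<in> carrier k; (a, m) \<in> \<Gamma>\<rbrakk> \<Longrightarrow> (\<phi> c \<otimes>\<^bsub>R\<^esub> a, \<theta> c \<otimes>\<^bsub>B\<^esub> m) \<in> \<Gamma>"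
    "\<And>a m m'. \<lbrakk>(a, m) \<in> \<Gamma>; (a, m') \<in> \<Gamma>\<rbrakk> \<Longrightarrow> m = m'"
  using assms unfolding linear_graph_def by simp_all

text \<open>Linear maps on a subspace extend to the whole space; R and B are rings viewed as vector
  spaces over k.\<close>

lemma linear_extension:
  assumes k: "field k" and R: "cring R" and B: "cring B"
    and phi: "\<phi> \<in> ring_hom k R" and theta: "\<theta> \<in> ring_hom k B"
    and G0: "linear_graph k R \<phi> B \<theta> \<Gamma>0"
  obtains f where "\<And>a. a \<in> carrier R \<Longrightarrow> f a \<in> carrier B"
    "\<And>a b. \<lbrakk>a \<in> carrier R; b \<in> carrier R\<rbrakk> \<Longrightarrow> f (a \<oplus>\<^bsub>R\<^esub> b) = f a \<oplus>\<^bsub>B\<^esub> f b"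
    "\<And>c a. \<lbrakk>c \<in> carrier k; a \<in> carrier R\<rbrakk> \<Longrightarrow> f (\<phi> c \<otimes>\<^bsub>R\<^esub> a) = \<theta> c \<otimes>\<^bsub>B\<^esub> f a"
    "\<And>a m. (a, m) \<in> \<Gamma>0 \<Longrightarrow> f a = m"
proof -
  interpret k: field k by fact
  interpret R: cring R by fact
  interpret B: cring B by fact
  interpret p: ring_hom_ring k R \<phi> by (rule ring_hom_ringI2[OF k.ring_axioms R.ring_axioms phi])
  interpret q: ring_hom_ring k B \<theta> by (rule ring_hom_ringI2[OF k.ring_axioms B.ring_axioms theta])
  let ?L = "linear_graph k R \<phi> B \<theta>"
  note LD = linear_graphD[where k = k and R = R and \<phi> = \<phi> and B = B and \<theta> = \<theta>]
  let ?A = "{\<Gamma>. ?L \<Gamma> \<and> \<Gamma>0 \<subseteq> \<Gamma>}"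
  have "\<exists>M\<in>?A. \<forall>\<Gamma>\<in>?A. M \<subseteq> \<Gamma> \<longrightarrow> \<Gamma> = M"
  proof (rule subset_Zorn_nonempty)
    show "?A \<noteq> {}" using G0 by blast
    fix C assume C: "C \<noteq> {}" "subset.chain ?A C"
    then have CA: "C \<subseteq> ?A" and tot: "\<And>U V. \<lbrakk>U \<in> C; V \<in> C\<rbrakk> \<Longrightarrow> U \<subseteq> V \<or> V \<subseteq> U"
      unfolding pred_on.chain_def by blast+
    have CL: "?L U" if "U \<in> C" for U using that CA by blast
    have common: "\<exists>U\<in>C. p \<in> U \<and> p' \<in> U" if pp: "p \<in> \<Union>C" "p' \<in> \<Union>C" for p p'
    proof -
      obtain U V where "U \<in> C" "p \<in> U" "V \<in> C" "p' \<in> V" using pp by blast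
      then show ?thesis using tot[of U V] by blast
    qed
    have "?L (\<Union>C)"
      unfolding linear_graph_def
    proof (intro conjI allI impI ballI)
      show "\<Union>C \<subseteq> carrier R \<times> carrier B" using LD(1)[OF CL] by blast
      fix a m a' m' assume am: "(a, m) \<in> \<Union>C" "(a', m') \<in> \<Union>C"
      obtain U where "U \<in> C" "(a, m) \<in> U" "(a', m') \<in> U" using common[OF am] by blast
      then show "(a \<oplus>\<^bsub>R\<^esub> a', m \<oplus>\<^bsub>B\<^esub> m') \<in> \<Union>C" using LD(2)[OF CL] by blast
    next
      fix c a m assume "c \<in> carrier k" "(a, m) \<in> \<Union>C"
      then show "(\<phi> c \<otimes>\<^bsub>R\<^esub> a, \<theta> c \<otimes>\<^bsub>B\<^esub> m) \<in> \<Union>C" using LD(3)[OF CL] by blast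
    next
      fix a m m' assume am: "(a, m) \<in> \<Union>C" "(a, m') \<in> \<Union>C"
      obtain U where "U \<in> C" "(a, m) \<in> U" "(a, m') \<in> U" using common[OF am] by blast
      then show "m = m'" using LD(4)[OF CL] by blast
    qed
    moreover have "\<Gamma>0 \<subseteq> \<Union>C" using C(1) CA by blast
    ultimately show "\<Union>C \<in> ?A" by blast
  qed
  then obtain M where M': "M \<in> ?A" "\<forall>\<Gamma>\<in>?A. M \<subseteq> \<Gamma> \<longrightarrow> \<Gamma> = M" by (rule bexE)
  have M: "?L M" "\<Gamma>0 \<subseteq> M" using M'(1) by simp_all
  have M_max: "\<Gamma> = M" if "?L \<Gamma>" "M \<subseteq> \<Gamma>" for \<Gamma>
    using bspec[OF M'(2), of \<Gamma>] that M(2) by simp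
  note MD = LD[OF M(1)]
  have zero_graph: "?L (insert (\<zero>\<^bsub>R\<^esub>, \<zero>\<^bsub>B\<^esub>) M)"
  proof -
    have z: "m = \<zero>\<^bsub>B\<^esub>" if "(\<zero>\<^bsub>R\<^esub>, m) \<in> M" for m
    proof -
      have mc: "m \<in> carrier B" using MD(1) that by blast
      have "(\<zero>\<^bsub>R\<^esub> \<oplus>\<^bsub>R\<^esub> \<zero>\<^bsub>R\<^esub>, m \<oplus>\<^bsub>B\<^esub> m) \<in> M" by (rule MD(2)[OF that that])
      then have "(\<zero>\<^bsub>R\<^esub>, m \<oplus>\<^bsub>B\<^esub> m) \<in> M" by simp
      then have "m \<oplus>\<^bsub>B\<^esub> m = m" by (rule MD(4)[OF _ that])
      then show ?thesis using mc by simp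
    qed
    have c1: "a \<in> carrier R" "m \<in> carrier B" if "(a, m) \<in> M" for a m using subsetD[OF MD(1) that] by simp_all
    show ?thesis
      unfolding linear_graph_def
    proof (intro conjI allI impI ballI)
      show "insert (\<zero>\<^bsub>R\<^esub>, \<zero>\<^bsub>B\<^esub>) M \<subseteq> carrier R \<times> carrier B" using MD(1) by simp
      fix a m a' m' assume "(a, m) \<in> insert (\<zero>\<^bsub>R\<^esub>, \<zero>\<^bsub>B\<^esub>) M" "(a', m') \<in> insert (\<zero>\<^bsub>R\<^esub>, \<zero>\<^bsub>B\<^esub>) M"
      then show "(a \<oplus>\<^bsub>R\<^esub> a', m \<oplus>\<^bsub>B\<^esub> m') \<in> insert (\<zero>\<^bsub>R\<^esub>, \<zero>\<^bsub>B\<^esub>) M"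
        using MD(2)[of a m a' m'] c1[of a m] c1[of a' m'] by (elim insertE) simp_all
    next
      fix c a m assume "c \<in> carrier k" "(a, m) \<in> insert (\<zero>\<^bsub>R\<^esub>, \<zero>\<^bsub>B\<^esub>) M"
      then show "(\<phi> c \<otimes>\<^bsub>R\<^esub> a, \<theta> c \<otimes>\<^bsub>B\<^esub> m) \<in> insert (\<zero>\<^bsub>R\<^esub>, \<zero>\<^bsub>B\<^esub>) M"
        using MD(3)[of c a m] by (elim insertE) simp_all
    next
      fix a m m' assume am: "(a, m) \<in> insert (\<zero>\<^bsub>R\<^esub>, \<zero>\<^bsub>B\<^esub>) M" "(a, m') \<in> insert (\<zero>\<^bsub>R\<^esub>, \<zero>\<^bsub>B\<^esub>) M"
      show "m = m'"
      proof (cases "a = \<zero>\<^bsub>R\<^esub>")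
        case True
        have "m = \<zero>\<^bsub>B\<^esub>" "m' = \<zero>\<^bsub>B\<^esub>" using am z unfolding True by blast+
        then show ?thesis by simp
      next
        case False
        then have "(a, m) \<in> M" "(a, m') \<in> M" using am by simp_all
        then show ?thesis by (rule MD(4))
      qed
    qed
  qed
  have M0: "(\<zero>\<^bsub>R\<^esub>, \<zero>\<^bsub>B\<^esub>) \<in> M" using M_max[OF zero_graph subset_insertI] by (rule subst) (rule insertI1)
  have minus: "(\<ominus>\<^bsub>R\<^esub> a, \<ominus>\<^bsub>B\<^esub> m) \<in> M" if am: "(a, m) \<in> M" for a m
  proof -
    have c: "a \<in> carrier R" "m \<in> carrier B" using subsetD[OF MD(1) am] by simp_all
    have "(\<phi> (\<ominus>\<^bsub>k\<^esub> \<one>\<^bsub>k\<^esub>) \<otimes>\<^bsub>R\<^esub> a, \<theta> (\<ominus>\<^bsub>k\<^esub> \<one>\<^bsub>k\<^esub>) \<otimes>\<^bsub>B\<^esub> m) \<in> M"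
      by (rule MD(3)[OF k.a_inv_closed[OF k.one_closed] am])
    then show ?thesis using c by (simp add: R.l_minus B.l_minus)
  qed
  have total: "\<exists>m. (v, m) \<in> M" if v: "v \<in> carrier R" for v
  proof (rule ccontr)
    assume nv: "\<nexists>m. (v, m) \<in> M"
    \<comment> \<open>The extension of M by v \<mapsto> 0.\<close>
    define M' where "M' = {(w \<oplus>\<^bsub>R\<^esub> \<phi> c \<otimes>\<^bsub>R\<^esub> v, m) | w m c. (w, m) \<in> M \<and> c \<in> carrier k}"
    have pc: "\<phi> c \<in> carrier R" "\<theta> c \<in> carrier B" if "c \<in> carrier k" for c using that by simp_all
    have c1: "a \<in> carrier R" "m \<in> carrier B" if "(a, m) \<in> M" for a m using subsetD[OF MD(1) that] by simp_all
    have coeff: "c = c'" if e: "w \<oplus>\<^bsub>R\<^esub> \<phi> c \<otimes>\<^bsub>R\<^esub> v = w' \<oplus>\<^bsub>R\<^esub> \<phi> c' \<otimes>\<^bsub>R\<^esub> v"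
      and w: "(w, m) \<in> M" "(w', m') \<in> M" and c: "c \<in> carrier k" "c' \<in> carrier k" for w c w' c' m m'
    proof (rule ccontr)
      assume ne: "c \<noteq> c'"
      let ?d = "c \<ominus>\<^bsub>k\<^esub> c'"
      have d: "?d \<in> carrier k" "?d \<noteq> \<zero>\<^bsub>k\<^esub>" using c ne by simp_all
      have inv: "inv\<^bsub>k\<^esub> ?d \<in> carrier k" "inv\<^bsub>k\<^esub> ?d \<otimes>\<^bsub>k\<^esub> ?d = \<one>\<^bsub>k\<^esub>" using k.field_Units d by auto
      note wc = c1[OF w(1)] c1[OF w(2)]
      have "\<phi> ?d \<otimes>\<^bsub>R\<^esub> v = \<phi> c \<otimes>\<^bsub>R\<^esub> v \<ominus>\<^bsub>R\<^esub> \<phi> c' \<otimes>\<^bsub>R\<^esub> v"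
        using c v by (simp add: a_minus_def R.l_distr R.l_minus)
      also have "\<phi> c \<otimes>\<^bsub>R\<^esub> v = \<ominus>\<^bsub>R\<^esub> w \<oplus>\<^bsub>R\<^esub> (w \<oplus>\<^bsub>R\<^esub> \<phi> c \<otimes>\<^bsub>R\<^esub> v)"
        using c v wc by (simp add: R.r_neg1)
      also have "\<dots> = \<ominus>\<^bsub>R\<^esub> w \<oplus>\<^bsub>R\<^esub> (w' \<oplus>\<^bsub>R\<^esub> \<phi> c' \<otimes>\<^bsub>R\<^esub> v)" by (simp only: e)
      also have "\<dots> \<ominus>\<^bsub>R\<^esub> \<phi> c' \<otimes>\<^bsub>R\<^esub> v = \<ominus>\<^bsub>R\<^esub> w \<oplus>\<^bsub>R\<^esub> w'"
        using c v wc by (simp add: a_minus_def R.a_assoc R.r_neg)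
      finally have "\<phi> ?d \<otimes>\<^bsub>R\<^esub> v = \<ominus>\<^bsub>R\<^esub> w \<oplus>\<^bsub>R\<^esub> w'" .
      moreover have "\<exists>n. (\<ominus>\<^bsub>R\<^esub> w \<oplus>\<^bsub>R\<^esub> w', n) \<in> M" using MD(2)[OF minus[OF w(1)] w(2)] by blast
      ultimately obtain n where "(\<phi> ?d \<otimes>\<^bsub>R\<^esub> v, n) \<in> M" by auto
      from MD(3)[OF inv(1) this] have "(\<phi> (inv\<^bsub>k\<^esub> ?d) \<otimes>\<^bsub>R\<^esub> (\<phi> ?d \<otimes>\<^bsub>R\<^esub> v), \<theta> (inv\<^bsub>k\<^esub> ?d) \<otimes>\<^bsub>B\<^esub> n) \<in> M" .
      moreover have "\<phi> (inv\<^bsub>k\<^esub> ?d) \<otimes>\<^bsub>R\<^esub> (\<phi> ?d \<otimes>\<^bsub>R\<^esub> v) = v"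
      proof -
        have "\<phi> (inv\<^bsub>k\<^esub> ?d) \<otimes>\<^bsub>R\<^esub> (\<phi> ?d \<otimes>\<^bsub>R\<^esub> v) = \<phi> (inv\<^bsub>k\<^esub> ?d \<otimes>\<^bsub>k\<^esub> ?d) \<otimes>\<^bsub>R\<^esub> v"
          unfolding p.hom_mult[OF inv(1) d(1)] by (rule R.m_assoc[symmetric]) (use pc[OF inv(1)] pc[OF d(1)] v in simp_all)
        then show ?thesis unfolding inv(2) using v by simp
      qed
      ultimately show False using nv by auto
    qed
    have "?L M'"
      unfolding linear_graph_def
    proof (intro conjI allI impI ballI)
      show "M' \<subseteq> carrier R \<times> carrier B" unfolding M'_def using c1 pc v by (clarsimp simp del: insert_subset)
      fix a m a' m' assume "(a, m) \<in> M'" "(a', m') \<in> M'"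
      then obtain w c w' c' where w: "(w, m) \<in> M" "c \<in> carrier k" "a = w \<oplus>\<^bsub>R\<^esub> \<phi> c \<otimes>\<^bsub>R\<^esub> v"
        "(w', m') \<in> M" "c' \<in> carrier k" "a' = w' \<oplus>\<^bsub>R\<^esub> \<phi> c' \<otimes>\<^bsub>R\<^esub> v" unfolding M'_def by blast
      have "a \<oplus>\<^bsub>R\<^esub> a' = (w \<oplus>\<^bsub>R\<^esub> w') \<oplus>\<^bsub>R\<^esub> \<phi> (c \<oplus>\<^bsub>k\<^esub> c') \<otimes>\<^bsub>R\<^esub> v"
        using w(2,3,5,6) v c1[OF w(1)] c1[OF w(4)] by (simp add: R.l_distr R.a_ac)
      then show "(a \<oplus>\<^bsub>R\<^esub> a', m \<oplus>\<^bsub>B\<^esub> m') \<in> M'"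
        unfolding M'_def using MD(2)[OF w(1,4)] k.add.m_closed[OF w(2,5)] by blast
    next
      fix c a m assume c: "c \<in> carrier k" and "(a, m) \<in> M'"
      then obtain w c' where w: "(w, m) \<in> M" "c' \<in> carrier k" "a = w \<oplus>\<^bsub>R\<^esub> \<phi> c' \<otimes>\<^bsub>R\<^esub> v" unfolding M'_def by blast
      have "\<phi> c \<otimes>\<^bsub>R\<^esub> a = \<phi> c \<otimes>\<^bsub>R\<^esub> w \<oplus>\<^bsub>R\<^esub> \<phi> (c \<otimes>\<^bsub>k\<^esub> c') \<otimes>\<^bsub>R\<^esub> v"
        using w v c c1[OF w(1)] by (simp add: R.r_distr R.m_assoc)
      then show "(\<phi> c \<otimes>\<^bsub>R\<^esub> a, \<theta> c \<otimes>\<^bsub>B\<^esub> m) \<in> M'"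
        unfolding M'_def using MD(3)[OF c w(1)] k.m_closed[OF c w(2)] by blast
    next
      fix a m m' assume "(a, m) \<in> M'" "(a, m') \<in> M'"
      then obtain w c w' c' where w: "(w, m) \<in> M" "c \<in> carrier k" "a = w \<oplus>\<^bsub>R\<^esub> \<phi> c \<otimes>\<^bsub>R\<^esub> v"
        "(w', m') \<in> M" "c' \<in> carrier k" "a = w' \<oplus>\<^bsub>R\<^esub> \<phi> c' \<otimes>\<^bsub>R\<^esub> v" unfolding M'_def by blast
      have e: "w \<oplus>\<^bsub>R\<^esub> \<phi> c \<otimes>\<^bsub>R\<^esub> v = w' \<oplus>\<^bsub>R\<^esub> \<phi> c' \<otimes>\<^bsub>R\<^esub> v" using w(3,6) by simp
      have "c = c'" by (rule coeff[OF e w(1,4,2,5)])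
      then have "w = w'" using e R.add.r_cancel c1[OF w(1)] c1[OF w(4)] pc[OF w(2)] v by simp
      then show "m = m'" using MD(4)[OF w(1)] w(4) by simp
    qed
    moreover have "M \<subseteq> M'"
    proof
      fix p assume pM: "p \<in> M"
      obtain w m where p: "p = (w, m)" by (cases p)
      have "w = w \<oplus>\<^bsub>R\<^esub> \<phi> \<zero>\<^bsub>k\<^esub> \<otimes>\<^bsub>R\<^esub> v" using c1[of w m] pM p v by simp
      then show "p \<in> M'" unfolding M'_def p using pM p k.zero_closed by blast
    qed
    ultimately have "M' = M" by (rule M_max)
    moreover have "(v, \<zero>\<^bsub>B\<^esub>) \<in> M'"
    proof -
      have "v = \<zero>\<^bsub>R\<^esub> \<oplus>\<^bsub>R\<^esub> \<phi> \<one>\<^bsub>k\<^esub> \<otimes>\<^bsub>R\<^esub> v" using v by simp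
      then show ?thesis unfolding M'_def using M0 k.one_closed by blast
    qed
    ultimately show False using nv by blast
  qed
  define f where "f a = (THE m. (a, m) \<in> M)" for a
  have L: "f a = m" if "(a, m) \<in> M" for a m
    unfolding f_def using that MD(4) by (intro the_equality) blast+
  have LM: "(a, f a) \<in> M" if "a \<in> carrier R" for a using total[OF that] L by blast
  show thesis
  proof (rule that[of f])
    show "f a \<in> carrier B" if "a \<in> carrier R" for a using LM[OF that] MD(1) by blast
    show "f (a \<oplus>\<^bsub>R\<^esub> b) = f a \<oplus>\<^bsub>B\<^esub> f b" if "a \<in> carrier R" "b \<in> carrier R" for a b
      by (rule L[OF MD(2)[OF LM[OF that(1)] LM[OF that(2)]]])
    show "f (\<phi> c \<otimes>\<^bsub>R\<^esub> a) = \<theta> c \<otimes>\<^bsub>B\<^esub> f a" if "c \<in> carrier k" "a \<in> carrier R" for c a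
      by (rule L[OF MD(3)[OF that(1) LM[OF that(2)]]])
    show "f a = m" if "(a, m) \<in> \<Gamma>0" for a m using L that M(2) by blast
  qed
qed

section \<open>Local rings\<close>

lemma (in cring) nilradical_ideal: "ideal (nilradical R) R"
proof (rule idealI[OF ring_axioms])
  have pow: "a [^] k = \<zero>" if "a [^] n = \<zero>" "n \<le> k" "a \<in> carrier R" for a and n k :: nat
    using nat_pow_mult[OF that(3), of n "k - n"] that by simp
  \<comment> \<open>The prefactors \<open>a^i b^j\<close> let the induction on k go through by
    distributivity alone, in place of the binomial theorem.\<close>
  have sum: "a [^] (i::nat) \<otimes> b [^] (j::nat) \<otimes> (a \<oplus> b) [^] (k::nat) = \<zero>"
    if ab: "a \<in> carrier R" "b \<in> carrier R" "a [^] (n::nat) = \<zero>" "b [^] (m::nat) = \<zero>" and le: "n + m \<le> i + j + k"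
    for a b i j k n m
    using le
  proof (induction k arbitrary: i j)
    case 0
    then consider "n \<le> i" | "m \<le> j" by linarith
    then show ?case
    proof cases
      case 1
      then show ?thesis using pow[OF ab(3) 1 ab(1)] ab(1,2) by simp
    next
      case 2
      then show ?thesis using pow[OF ab(4) 2 ab(2)] ab(1,2) by simp
    qed
  next
    case (Suc k)
    have c: "a [^] i \<in> carrier R" "b [^] j \<in> carrier R" "(a \<oplus> b) [^] k \<in> carrier R" using ab by simp_all
    have "a [^] i \<otimes> b [^] j \<otimes> (a \<oplus> b) [^] Suc k
        = a [^] Suc i \<otimes> b [^] j \<otimes> (a \<oplus> b) [^] k \<oplus> a [^] i \<otimes> b [^] Suc j \<otimes> (a \<oplus> b) [^] k"
      using c ab(1,2) by (simp add: l_distr r_distr m_ac)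
    then show ?case using Suc.IH[of "Suc i" j] Suc.IH[of i "Suc j"] Suc.prems by simp
  qed
  have mult: "(x \<otimes> a) [^] (n::nat) = \<zero>" if "x \<in> carrier R" "a \<in> carrier R" "a [^] n = \<zero>" for x a n
    using nat_pow_distrib[OF that(1,2), of n] that by simp
  have mem: "x \<otimes> a \<in> nilradical R" if "x \<in> carrier R" "a \<in> nilradical R" for x a
    using mult that unfolding nilradical_def by blast
  show "subgroup (nilradical R) (add_monoid R)"
  proof (rule add.subgroupI)
    show "nilradical R \<subseteq> carrier R" by (auto simp: nilradical_def)
    have "\<zero> [^] (1::nat) = \<zero>" by simp
    then show "nilradical R \<noteq> {}" unfolding nilradical_def by blast
    show "\<ominus> a \<in> nilradical R" if "a \<in> nilradical R" for a
      using mem[of "\<ominus> \<one>" a] that by (simp add: nilradical_def l_minus)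
    show "a \<oplus> b \<in> nilradical R" if a: "a \<in> nilradical R" and b: "b \<in> nilradical R" for a b
    proof -
      obtain n m :: nat where nm: "a \<in> carrier R" "b \<in> carrier R" "a [^] n = \<zero>" "b [^] m = \<zero>"
        using a b unfolding nilradical_def by blast
      have "(a \<oplus> b) [^] (n + m) = \<zero>" using sum[OF nm, of 0 0 "n + m"] nm(1,2) by simp
      then show ?thesis using nm(1,2) unfolding nilradical_def by blast
    qed
  qed
  fix a x assume a: "a \<in> nilradical R" and x: "x \<in> carrier R"
  show "x \<otimes> a \<in> nilradical R" by (rule mem[OF x a])
  then show "a \<otimes> x \<in> nilradical R" using a x by (simp add: nilradical_def m_comm)
qed

locale noetherian_local = adic_filtration A \<mm> for A (structure) and \<mm> +
  assumes local: "noetherian_local_ring A \<mm>"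
begin

lemma maximal: "maximalideal \<mm> A"
  using local by (simp add: noetherian_local_ring_def)

text \<open>A non-unit generates a proper ideal, which lies in the only maximal ideal.\<close>

lemma unit_if_notin:
  assumes "u \<in> carrier A" "u \<notin> \<mm>"
  shows "u \<in> Units A"
proof (rule ccontr)
  assume nu: "u \<notin> Units A"
  have "\<one> \<notin> PIdl u"
  proof
    assume "\<one> \<in> PIdl u"
    then obtain v where "v \<in> carrier A" "\<one> = v \<otimes> u" by (auto simp: cgenideal_def)
    then show False using nu assms(1) A.m_comm unfolding Units_def by auto
  qed
  then obtain J where "maximalideal J A" "PIdl u \<subseteq> J"
    using A.exists_maximalideal_superset[OF A.cgenideal_ideal[OF assms(1)]] by blast
  then have "u \<in> \<mm>" using local A.cgenideal_self[OF assms(1)] unfolding noetherian_local_ring_def by blast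
  then show False using assms(2) by simp
qed

text \<open>Instead of generators the proof uses an ideal M that is maximal among those containing L
  and properly contained in I; it exists because A is noetherian. Any a in I outside M then
  satisfies M + (a) = I.\<close>

lemma nakayama:
  assumes I: "ideal I A" and L: "ideal L A" "L \<subseteq> I" and sub: "\<And>a. a \<in> I \<Longrightarrow> \<exists>l\<in>L. a \<ominus> l \<in> ideal_prod A I \<mm>"
  shows "I \<subseteq> L"
proof (rule ccontr)
  assume nsub: "\<not> I \<subseteq> L"
  interpret noetherian_ring A using local by (simp add: noetherian_local_ring_def)
  interpret I: ideal I A by fact
  let ?F = "{J. ideal J A \<and> L \<subseteq> J \<and> J \<subset> I}"
  have "\<exists>M\<in>?F. \<forall>J\<in>?F. M \<subseteq> J \<longrightarrow> J = M"
  proof (rule subset_Zorn_nonempty)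
    show "?F \<noteq> {}" using L nsub by blast
    fix C assume C: "C \<noteq> {}" "subset.chain ?F C"
    have CF: "C \<subseteq> ?F" using C(2) unfolding pred_on.chain_def by (rule conjunct1)
    have "subset.chain {J. ideal J A} C"
      by (rule subset_chain_def[THEN iffD2]) (use C(2) CF in \<open>simp add: subset_chain_def subset_iff\<close>)
    then have "\<Union>C \<in> C" by (rule ideal_chain_is_trivial[OF C(1)])
    then show "\<Union>C \<in> ?F" by (rule subsetD[OF CF])
  qed
  then obtain M where M': "M \<in> ?F" "\<forall>J\<in>?F. M \<subseteq> J \<longrightarrow> J = M" by (rule bexE)
  have M: "ideal M A" "L \<subseteq> M" "M \<subset> I" using M'(1) by simp_all
  have max: "J = M" if "ideal J A" "M \<subseteq> J" "J \<subset> I" for J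
  proof -
    have "J \<in> ?F" using that M(2) by simp
    then show ?thesis using M'(2) that(2) by simp
  qed
  interpret M: ideal M A by (rule M(1))
  obtain a where a: "a \<in> I" "a \<notin> M" using M(3) by blast
  note ac = I.Icarr[OF a(1)]
  have sum: "u \<oplus> v \<in> M <+>\<^bsub>A\<^esub> J" if "u \<in> M" "v \<in> J" for u v J
    unfolding set_add_def' by (rule UN_I[OF that(1)], rule UN_I[OF that(2)]) (rule singletonI)
  have Msub: "M \<subseteq> M <+>\<^bsub>A\<^esub> J" if "ideal J A" for J
  proof
    fix u assume u: "u \<in> M"
    show "u \<in> M <+>\<^bsub>A\<^esub> J"
      using sum[OF u additive_subgroup.zero_closed[OF ideal.axioms(1)[OF that]]] M.Icarr[OF u] by simp
  qed
  have subI: "M <+>\<^bsub>A\<^esub> J \<subseteq> I" if "J \<subseteq> I" for J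
  proof
    fix z assume "z \<in> M <+>\<^bsub>A\<^esub> J"
    then obtain u v where uv: "u \<in> M" "v \<in> J" "z = u \<oplus> v" unfolding set_add_def' by blast
    have "u \<in> I" using uv(1) M(3) by blast
    then show "z \<in> I" unfolding uv(3) by (rule I.a_closed) (rule subsetD[OF that uv(2)])
  qed
  have P: "ideal (PIdl a) A" by (rule A.cgenideal_ideal[OF ac])
  have "M <+>\<^bsub>A\<^esub> PIdl a = I"
  proof (rule ccontr)
    assume "M <+>\<^bsub>A\<^esub> PIdl a \<noteq> I"
    then have "M <+>\<^bsub>A\<^esub> PIdl a = M"
      using max[OF A.add_ideals[OF M(1) P] Msub[OF P]] subI[OF A.cgenideal_minimal[OF I a(1)]] by blast
    then have "a \<in> M" using sum[OF M.zero_closed A.cgenideal_self[OF ac]] ac by simp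
    then show False using a(2) by simp
  qed
  have Pm: "ideal (ideal_prod A (PIdl a) \<mm>) A" by (rule A.ideal_prod_is_ideal[OF P ideal_axioms])
  have PmI: "ideal_prod A (PIdl a) \<mm> \<subseteq> I"
    using A.ideal_prod_inter[OF P ideal_axioms] A.cgenideal_minimal[OF I a(1)] by blast
  have Pm_mem: "\<exists>\<mu>\<in>\<mm>. z = \<mu> \<otimes> a" if "z \<in> ideal_prod A (PIdl a) \<mm>" for z
    using that
  proof (induction z rule: ideal_prod.induct)
    case (prod u v)
    then obtain w where w: "w \<in> carrier A" "u = w \<otimes> a" by (auto simp: cgenideal_def)
    then have "u \<otimes> v = (w \<otimes> v) \<otimes> a" using ac Icarr[OF prod(2)] by (simp add: A.m_ac)
    then show ?case using I_l_closed[OF prod(2) w(1)] by blast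
  next
    case (sum u v)
    then obtain \<mu> \<nu> where m: "\<mu> \<in> \<mm>" "u = \<mu> \<otimes> a" "\<nu> \<in> \<mm>" "v = \<nu> \<otimes> a" by blast
    then have "u \<oplus> v = (\<mu> \<oplus> \<nu>) \<otimes> a" using ac Icarr by (simp add: A.l_distr)
    then show ?case using a_closed[OF m(1,3)] by blast
  qed
  \<comment> \<open>Otherwise a = l + \<mu> a with l in M and \<mu> in \<mm>, and the unit 1 - \<mu>
    would put a into M. By maximality M then absorbs a \<mm>, hence I \<mm>, and the hypothesis
    yields I \<subseteq> M.\<close>
  have "M <+>\<^bsub>A\<^esub> ideal_prod A (PIdl a) \<mm> \<noteq> I"
  proof
    assume "M <+>\<^bsub>A\<^esub> ideal_prod A (PIdl a) \<mm> = I"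
    then obtain l z where l: "l \<in> M" "z \<in> ideal_prod A (PIdl a) \<mm>" "a = l \<oplus> z"
      using a(1) unfolding set_add_def' by blast
    obtain \<mu> where m: "\<mu> \<in> \<mm>" "z = \<mu> \<otimes> a" using Pm_mem[OF l(2)] by blast
    note c = ac M.Icarr[OF l(1)] Icarr[OF m(1)]
    have la: "(\<one> \<ominus> \<mu>) \<otimes> a = l"
    proof -
      have "(\<one> \<ominus> \<mu>) \<otimes> a = a \<ominus> z" unfolding m(2) using c by (simp add: a_minus_def A.l_distr A.l_minus)
      also have "\<dots> = (l \<oplus> z) \<ominus> z" by (simp only: l(3)[symmetric])
      also have "\<dots> = l" using c m(2) by (simp add: a_minus_def A.a_assoc A.r_neg)
      finally show ?thesis .
    qed
    have "\<one> \<ominus> \<mu> \<notin> \<mm>"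
    proof
      assume "\<one> \<ominus> \<mu> \<in> \<mm>"
      then have "(\<one> \<ominus> \<mu>) \<oplus> \<mu> \<in> \<mm>" using m(1) by simp
      then have "\<one> \<in> \<mm>" using c by (simp add: a_minus_def A.a_assoc A.l_neg)
      then show False using one_imp_carrier maximalideal.I_notcarr[OF maximal] by simp
    qed
    then have u: "\<one> \<ominus> \<mu> \<in> Units A" using c by (intro unit_if_notin) simp_all
    have "inv (\<one> \<ominus> \<mu>) \<otimes> ((\<one> \<ominus> \<mu>) \<otimes> a) = a" using u c by (simp add: A.m_assoc[symmetric])
    then have "a \<in> M" using la M.I_l_closed[OF l(1) A.Units_inv_closed[OF u]] by simp
    then show False using a(2) by simp
  qed
  then have eqM: "M <+>\<^bsub>A\<^esub> ideal_prod A (PIdl a) \<mm> = M"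
    using max[OF A.add_ideals[OF M(1) Pm] Msub[OF Pm]] subI[OF PmI] by blast
  have maM: "a \<otimes> \<mu> \<in> M" if m: "\<mu> \<in> \<mm>" for \<mu>
  proof -
    have "a \<otimes> \<mu> \<in> ideal_prod A (PIdl a) \<mm>" by (rule ideal_prod.prod[OF A.cgenideal_self[OF ac] m])
    then have "\<zero> \<oplus> a \<otimes> \<mu> \<in> M" using sum[OF M.zero_closed] eqM by blast
    then show ?thesis using ac Icarr[OF m] by simp
  qed
  have prodM: "z \<in> M" if "z \<in> ideal_prod A I \<mm>" for z
    using that
  proof (induction z rule: ideal_prod.induct)
    case (prod u \<mu>)
    then obtain l w where l: "l \<in> M" "w \<in> PIdl a" "u = l \<oplus> w"
      using \<open>M <+>\<^bsub>A\<^esub> PIdl a = I\<close> unfolding set_add_def' by blast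
    then obtain v where v: "v \<in> carrier A" "w = v \<otimes> a" by (auto simp: cgenideal_def)
    note c = ac M.Icarr[OF l(1)] Icarr[OF prod(2)] v(1)
    have "u \<otimes> \<mu> = l \<otimes> \<mu> \<oplus> v \<otimes> (a \<otimes> \<mu>)" unfolding l(3) v(2) using c by (simp add: A.l_distr A.m_assoc)
    then show ?case using M.I_r_closed[OF l(1) c(3)] M.I_l_closed[OF maM[OF prod(2)] v(1)] by simp
  qed simp
  have "I \<subseteq> M"
  proof
    fix z assume z: "z \<in> I"
    obtain l where l: "l \<in> L" "z \<ominus> l \<in> ideal_prod A I \<mm>" using sub[OF z] by blast
    have "(z \<ominus> l) \<oplus> l \<in> M" using prodM[OF l(2)] l(1) M(2) by blast
    moreover have "(z \<ominus> l) \<oplus> l = z"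
    proof -
      have "l \<in> M" using l(1) M(2) by blast
      then have "z \<in> carrier A" "l \<in> carrier A" using I.Icarr[OF z] M.Icarr by blast+
      then show ?thesis by (simp add: a_minus_def A.a_assoc A.l_neg)
    qed
    ultimately show "z \<in> M" by simp
  qed
  then show False using M(3) by blast
qed

end

section \<open>The tangent cone of a reduced local ring\<close>

locale tangent_cone = noetherian_local A \<mm> + K: algebraically_closed K
  for A :: "('a, 'c) ring_scheme" (structure) and \<mm> and K :: "('b, 'd) ring_scheme" +
  fixes \<iota> :: "'a set \<Rightarrow> 'b" and r :: nat and x :: "nat \<Rightarrow> ((nat \<Rightarrow> 'a set) \<times> 'b \<Rightarrow> int) set"
  assumes reduced: "reduced_ring A"
    and iota: "\<iota> \<in> ring_hom (A Quot \<mm>) K"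
    and coordinates: "tangent_coordinates A \<mm> K \<iota> r x"
begin

abbreviation "k \<equiv> A Quot \<mm>"
abbreviation "\<kappa> \<equiv> gr_const A \<mm>"
abbreviation "Gn \<equiv> gr_part A \<mm>"
abbreviation "T \<equiv> gr_ext A \<mm> K \<iota>"
abbreviation "pt \<equiv> gr_ext_tensor A \<mm> K \<iota>"
abbreviation "h \<equiv> gr_ext_const A \<mm> K \<iota>"
abbreviation "Tn \<equiv> gr_ext_part A \<mm> K \<iota>"

lemma k_field: "field k"
  by (rule maximalideal.quotient_is_field[OF maximal A.is_cring])

interpretation k: field k by (rule k_field)

lemma kappa_closed: "c \<in> carrier k \<Longrightarrow> \<kappa> c \<in> carrier G"
  by (rule ring_hom_closed[OF gr_const_hom])

lemma iota_closed: "c \<in> carrier k \<Longrightarrow> \<iota> c \<in> carrier K"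
  by (rule ring_hom_closed[OF iota])

lemma tensor: "tensor k G \<kappa> K \<iota>"
  by (intro tensor.intro tensor_axioms.intro G_cring K.is_cring kappa_closed iota_closed)

lemmas pt_defs = gr_ext_tensor_def gr_ext_def
lemmas T_cring = tensor.T_cring[OF tensor, folded pt_defs]
  and pt_closed = tensor.pt_closed[OF tensor, folded pt_defs]
  and pt_mult = tensor.pt_mult[OF tensor, folded pt_defs]
  and pt_one = tensor.pt_one[OF tensor, folded pt_defs]
  and pt_add_left = tensor.pt_add_left[OF tensor, folded pt_defs]
  and pt_add_right = tensor.pt_add_right[OF tensor, folded pt_defs]
  and pt_balanced = tensor.pt_balanced[OF tensor, folded pt_defs]
  and pt_zero_left = tensor.pt_zero_left[OF tensor, folded pt_defs]
  and pt_zero_right = tensor.pt_zero_right[OF tensor, folded pt_defs]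
  and T_induct [consumes 1, case_names pure add] = tensor.T_induct[OF tensor, folded pt_defs]

lemma lift:
  assumes "abelian_group B"
    and "\<And>a b. \<lbrakk>a \<in> carrier G; b \<in> carrier K\<rbrakk> \<Longrightarrow> \<beta> a b \<in> carrier B"
    and "\<And>a a' b. \<lbrakk>a \<in> carrier G; a' \<in> carrier G; b \<in> carrier K\<rbrakk>
        \<Longrightarrow> \<beta> (a \<oplus>\<^bsub>G\<^esub> a') b = \<beta> a b \<oplus>\<^bsub>B\<^esub> \<beta> a' b"
    and "\<And>a b b'. \<lbrakk>a \<in> carrier G; b \<in> carrier K; b' \<in> carrier K\<rbrakk>
        \<Longrightarrow> \<beta> a (b \<oplus>\<^bsub>K\<^esub> b') = \<beta> a b \<oplus>\<^bsub>B\<^esub> \<beta> a b'"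
    and "\<And>a b c. \<lbrakk>a \<in> carrier G; b \<in> carrier K; c \<in> carrier k\<rbrakk>
        \<Longrightarrow> \<beta> (\<kappa> c \<otimes>\<^bsub>G\<^esub> a) b = \<beta> a (\<iota> c \<otimes>\<^bsub>K\<^esub> b)"
  shows "\<exists>\<Phi>. (\<forall>t\<in>carrier T. \<Phi> t \<in> carrier B) \<and>
    (\<forall>t\<in>carrier T. \<forall>u\<in>carrier T. \<Phi> (t \<oplus>\<^bsub>T\<^esub> u) = \<Phi> t \<oplus>\<^bsub>B\<^esub> \<Phi> u) \<and>
    (\<forall>a\<in>carrier G. \<forall>b\<in>carrier K. \<Phi> (pt a b) = \<beta> a b)"
  unfolding pt_defs
proof (rule tensor.lift_exists[OF tensor assms(1), where \<beta> = \<beta>])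
  fix \<Phi>
  assume F: "\<And>t. t \<in> carrier (tensor_ring k G \<kappa> K \<iota>) \<Longrightarrow> \<Phi> t \<in> carrier B"
    "\<And>t u. \<lbrakk>t \<in> carrier (tensor_ring k G \<kappa> K \<iota>); u \<in> carrier (tensor_ring k G \<kappa> K \<iota>)\<rbrakk>
      \<Longrightarrow> \<Phi> (t \<oplus>\<^bsub>tensor_ring k G \<kappa> K \<iota>\<^esub> u) = \<Phi> t \<oplus>\<^bsub>B\<^esub> \<Phi> u"
    "\<And>a b. \<lbrakk>a \<in> carrier G; b \<in> carrier K\<rbrakk> \<Longrightarrow> \<Phi> (pure_tensor k G \<kappa> K \<iota> a b) = \<beta> a b"
  show "\<exists>\<Phi>. (\<forall>t\<in>carrier (tensor_ring k G \<kappa> K \<iota>). \<Phi> t \<in> carrier B) \<and>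
    (\<forall>t\<in>carrier (tensor_ring k G \<kappa> K \<iota>). \<forall>u\<in>carrier (tensor_ring k G \<kappa> K \<iota>).
      \<Phi> (t \<oplus>\<^bsub>tensor_ring k G \<kappa> K \<iota>\<^esub> u) = \<Phi> t \<oplus>\<^bsub>B\<^esub> \<Phi> u) \<and>
    (\<forall>a\<in>carrier G. \<forall>b\<in>carrier K. \<Phi> (pure_tensor k G \<kappa> K \<iota> a b) = \<beta> a b)"
    by (intro exI[of _ \<Phi>] conjI ballI F)
qed (fact assms)+

sublocale T: cring T by (rule T_cring)

declare pt_closed [simp]

lemma h_eq: "h c = pt \<one>\<^bsub>G\<^esub> c"
  by (simp add: gr_ext_const_def)

lemma h_closed: "c \<in> carrier K \<Longrightarrow> h c \<in> carrier T"
  unfolding h_eq by simp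

lemma h_hom: "h \<in> ring_hom K T"
proof (rule ring_hom_memI)
  fix a b assume ab: "a \<in> carrier K" "b \<in> carrier K"
  show "h (a \<otimes>\<^bsub>K\<^esub> b) = h a \<otimes>\<^bsub>T\<^esub> h b"
    unfolding h_eq pt_mult[OF G.one_closed ab(1) G.one_closed ab(2)] by simp
  show "h (a \<oplus>\<^bsub>K\<^esub> b) = h a \<oplus>\<^bsub>T\<^esub> h b" unfolding h_eq by (rule pt_add_right[OF G.one_closed ab])
next
  show "h \<one>\<^bsub>K\<^esub> = \<one>\<^bsub>T\<^esub>" unfolding h_eq by (rule pt_one)
qed (rule h_closed)

lemma pt_eq:
  assumes "g \<in> carrier G" "c \<in> carrier K"
  shows "pt g c = pt g \<one>\<^bsub>K\<^esub> \<otimes>\<^bsub>T\<^esub> h c"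
  unfolding h_eq pt_mult[OF assms(1) K.one_closed G.one_closed assms(2)] using assms by simp

lemma pt_kappa:
  assumes "g \<in> carrier G" "c \<in> carrier k"
  shows "pt (\<kappa> c \<otimes>\<^bsub>G\<^esub> g) \<one>\<^bsub>K\<^esub> = h (\<iota> c) \<otimes>\<^bsub>T\<^esub> pt g \<one>\<^bsub>K\<^esub>"
proof -
  have "pt (\<kappa> c \<otimes>\<^bsub>G\<^esub> g) \<one>\<^bsub>K\<^esub> = pt g (\<iota> c)"
    using pt_balanced[OF assms(1) K.one_closed assms(2)] iota_closed[OF assms(2)] by simp
  also have "\<dots> = h (\<iota> c) \<otimes>\<^bsub>T\<^esub> pt g \<one>\<^bsub>K\<^esub>"
    unfolding pt_eq[OF assms(1) iota_closed[OF assms(2)]]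
    using assms h_closed[OF iota_closed[OF assms(2)]] by (intro T.m_comm) simp_all
  finally show ?thesis .
qed

lemma k_memE:
  assumes "c \<in> carrier k"
  obtains a where "a \<in> carrier A" "c = \<mm> +> a"
  using assms unfolding A_Quot_carrier by blast

lemma const_el:
  assumes "a \<in> carrier A" "b \<in> mp n"
  shows "el 0 a \<otimes>\<^bsub>G\<^esub> el n b = el n (a \<otimes> b)"
  using el_mult[of a 0 b n] assms by simp

section \<open>The grading of the tangent cone\<close>

lemma Gn_sub: "g \<in> Gn n \<Longrightarrow> g \<in> carrier G"
  unfolding gr_part_eq using el_closed by blast

lemma Gn_zero: "\<zero>\<^bsub>G\<^esub> \<in> Gn n"
proof -
  have "el n \<zero> = \<zero>\<^bsub>G\<^esub>" by (rule el_zero_iff[THEN iffD2]) simp_all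
  then show ?thesis unfolding gr_part_eq using mp_zero[of n] by (metis imageI)
qed

lemma Gn_add: "\<lbrakk>f \<in> Gn n; g \<in> Gn n\<rbrakk> \<Longrightarrow> f \<oplus>\<^bsub>G\<^esub> g \<in> Gn n"
proof -
  assume "f \<in> Gn n" "g \<in> Gn n"
  then obtain a b where ab: "f = el n a" "a \<in> mp n" "g = el n b" "b \<in> mp n" unfolding gr_part_eq by blast
  show ?thesis unfolding ab(1,3) el_add[OF ab(2,4), symmetric] gr_part_eq by (rule imageI[OF mp_add[OF ab(2,4)]])
qed

lemma Gn_mult: "\<lbrakk>f \<in> Gn n; g \<in> Gn m\<rbrakk> \<Longrightarrow> f \<otimes>\<^bsub>G\<^esub> g \<in> Gn (n + m)"
proof -
  assume "f \<in> Gn n" "g \<in> Gn m"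
  then obtain a b where ab: "f = el n a" "a \<in> mp n" "g = el m b" "b \<in> mp m" unfolding gr_part_eq by blast
  show ?thesis unfolding ab(1,3) el_mult[OF ab(2,4)] gr_part_eq by (rule imageI[OF mp_mult[OF ab(2,4)]])
qed

lemma kappa_Gn: "c \<in> carrier k \<Longrightarrow> \<kappa> c \<in> Gn 0"
proof -
  assume "c \<in> carrier k"
  then obtain a where a: "a \<in> carrier A" "c = \<mm> +> a" by (rule k_memE)
  show ?thesis unfolding a(2) gr_const_coset gr_part_eq by (rule imageI) (simp add: a(1))
qed

lemma pure_Tn: "\<lbrakk>g \<in> Gn n; c \<in> carrier K\<rbrakk> \<Longrightarrow> pt g c \<in> Tn n"
  unfolding gr_ext_part_def by (rule generate.incl) blast

lemma Tn_add: "\<lbrakk>t \<in> Tn n; u \<in> Tn n\<rbrakk> \<Longrightarrow> t \<oplus>\<^bsub>T\<^esub> u \<in> Tn n"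
  using generate.eng[of t "add_monoid T" _ u] unfolding gr_ext_part_def by simp

lemma pt_minus:
  assumes "g \<in> carrier G" "c \<in> carrier K"
  shows "\<ominus>\<^bsub>T\<^esub> pt g c = pt g (\<ominus>\<^bsub>K\<^esub> c)"
proof (rule T.minus_equality)
  show "pt g (\<ominus>\<^bsub>K\<^esub> c) \<oplus>\<^bsub>T\<^esub> pt g c = \<zero>\<^bsub>T\<^esub>"
    using pt_add_right[OF assms(1) K.a_inv_closed[OF assms(2)] assms(2)] pt_zero_right[OF assms(1)] assms(2)
    by (simp add: K.l_neg)
qed (use assms in simp_all)

text \<open>The generated subgroup allows inverses; these are absorbed in the second tensor
  factor.\<close>

lemma Tn_induct [consumes 1, case_names pure add]:
  assumes t: "t \<in> Tn n"
    and pure: "\<And>g c. \<lbrakk>g \<in> Gn n; c \<in> carrier K\<rbrakk> \<Longrightarrow> P (pt g c)"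
    and add: "\<And>t u. \<lbrakk>t \<in> Tn n; u \<in> Tn n; P t; P u\<rbrakk> \<Longrightarrow> P (t \<oplus>\<^bsub>T\<^esub> u)"
  shows "P t"
  using t unfolding gr_ext_part_def
proof (induction t rule: generate.induct)
  case one
  have "pt \<zero>\<^bsub>G\<^esub> \<zero>\<^bsub>K\<^esub> = \<one>\<^bsub>add_monoid T\<^esub>" using pt_zero_left[OF K.zero_closed] by simp
  then show ?case using pure[OF Gn_zero K.zero_closed] by (simp only:)
next
  case (incl t)
  then obtain g c where "t = pt g c" "g \<in> Gn n" "c \<in> carrier K" by blast
  then show ?case using pure by simp
next
  case (inv t)
  then obtain g c where gc: "t = pt g c" "g \<in> Gn n" "c \<in> carrier K" by blast
  have "inv\<^bsub>add_monoid T\<^esub> t = pt g (\<ominus>\<^bsub>K\<^esub> c)"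
    using pt_minus[OF Gn_sub[OF gc(2)] gc(3)] unfolding gc(1) a_inv_def .
  then show ?case using pure[OF gc(2) K.a_inv_closed[OF gc(3)]] by (simp only:)
next
  case (eng t u)
  then show ?case using add[of t u] unfolding gr_ext_part_def by simp
qed

lemma Tn_carr: "t \<in> Tn n \<Longrightarrow> t \<in> carrier T"
  by (induction t rule: Tn_induct) (simp_all add: Gn_sub)

lemma Tn_zero: "\<zero>\<^bsub>T\<^esub> \<in> Tn n"
  using pure_Tn[OF Gn_zero K.zero_closed] pt_zero_left[OF K.zero_closed] by simp

lemma Tn_mult: "\<lbrakk>t \<in> Tn i; u \<in> Tn j\<rbrakk> \<Longrightarrow> t \<otimes>\<^bsub>T\<^esub> u \<in> Tn (i + j)"
proof (induction t rule: Tn_induct)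
  case (pure g c)
  from pure(3) show ?case
  proof (induction u rule: Tn_induct)
    case (pure g' c')
    show ?case
      unfolding pt_mult[OF Gn_sub[OF \<open>g \<in> Gn i\<close>] \<open>c \<in> carrier K\<close> Gn_sub[OF \<open>g' \<in> Gn j\<close>] \<open>c' \<in> carrier K\<close>]
      by (rule pure_Tn[OF Gn_mult[OF \<open>g \<in> Gn i\<close> \<open>g' \<in> Gn j\<close>] K.m_closed[OF \<open>c \<in> carrier K\<close> \<open>c' \<in> carrier K\<close>]])
  next
    case (add u v)
    have "pt g c \<in> carrier T" using Gn_sub[OF \<open>g \<in> Gn i\<close>] \<open>c \<in> carrier K\<close> by simp
    then show ?case using Tn_add[OF add(3,4)] by (simp add: T.r_distr Tn_carr[OF add(1)] Tn_carr[OF add(2)])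
  qed
next
  case (add t t')
  then show ?case using Tn_add by (simp add: T.l_distr Tn_carr)
qed

text \<open>In degree zero G(A) is the residue field, so the first factor can be moved across the
  tensor sign.\<close>

lemma T0: "Tn 0 = h ` carrier K"
proof
  show "Tn 0 \<subseteq> h ` carrier K"
  proof
    fix t assume "t \<in> Tn 0"
    then show "t \<in> h ` carrier K"
    proof (induction t rule: Tn_induct)
      case (pure g c)
      then obtain a where a: "a \<in> carrier A" "g = el 0 a" unfolding gr_part_eq by (auto simp: ideal_power.simps(1))
      have ak: "\<mm> +> a \<in> carrier k" unfolding A_Quot_carrier using a(1) by blast
      have "g = \<kappa> (\<mm> +> a) \<otimes>\<^bsub>G\<^esub> \<one>\<^bsub>G\<^esub>"
        using Gn_sub[OF pure(1)] unfolding gr_const_coset a(2) by simp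
      then have "pt g c = h (\<iota> (\<mm> +> a) \<otimes>\<^bsub>K\<^esub> c)"
        unfolding h_eq using pt_balanced[OF G.one_closed pure(2) ak] by (simp only:)
      then show ?case using K.m_closed[OF iota_closed[OF ak] pure(2)] by (simp only: imageI)
    next
      case (add t u)
      then obtain a b where ab: "t = h a" "a \<in> carrier K" "u = h b" "b \<in> carrier K" by blast
      show ?case unfolding ab(1,3) ring_hom_add[OF h_hom ab(2,4), symmetric]
        by (rule imageI[OF K.a_closed[OF ab(2,4)]])
    qed
  qed
  have "\<one>\<^bsub>G\<^esub> \<in> Gn 0" unfolding G_one gr_part_eq by (rule imageI) simp
  then show "h ` carrier K \<subseteq> Tn 0" unfolding h_eq using pure_Tn by blast
qed

lemma homog_induct:
  assumes t: "t \<in> carrier T" and P: "\<And>n t. t \<in> Tn n \<Longrightarrow> P t"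
    and add: "\<And>t u. \<lbrakk>t \<in> carrier T; u \<in> carrier T; P t; P u\<rbrakk> \<Longrightarrow> P (t \<oplus>\<^bsub>T\<^esub> u)"
  shows "P t"
  using t
proof (induction t rule: T_induct)
  case (pure g c)
  then show ?case
  proof (induction g rule: G_induct)
    case (el n a)
    have "el n a \<in> Gn n" unfolding gr_part_eq by (rule imageI[OF el(1)])
    then show ?case using P pure_Tn el(2) by blast
  next
    case (add f g)
    show ?case
      unfolding pt_add_left[OF add(1,2) add(5)]
      by (rule assms(3)) (use add in simp_all)
  qed
qed (rule add)

lemma gr_comp_kappa:
  assumes "g \<in> carrier G" and c: "c \<in> carrier k"
  shows "gr_comp A \<mm> n (\<kappa> c \<otimes>\<^bsub>G\<^esub> g) = \<kappa> c \<otimes>\<^bsub>G\<^esub> gr_comp A \<mm> n g"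
proof -
  obtain a where a: "a \<in> carrier A" "c = \<mm> +> a" using c by (rule k_memE)
  have a0: "el 0 a \<in> carrier G" using a(1) by (intro el_closed) simp
  show ?thesis
    using assms(1) unfolding a(2) gr_const_coset
  proof (induction g rule: G_induct)
    case (el m b)
    then show ?case using a0 by (simp add: const_el[OF a(1)] gr_comp_el)
  next
    case (add f g)
    then show ?case using a0 by (simp add: G.r_distr gr_comp_add Gn_sub[OF gr_comp_closed])
  qed
qed

text \<open>The projection of G(A) to degree n, tensored with K. It comes from the universal
  property and is therefore picked by choice; additivity and the values on pure tensors determine it
  on T.\<close>

definition pr :: "nat \<Rightarrow> ((nat \<Rightarrow> 'a set) \<times> 'b \<Rightarrow> int) set \<Rightarrow> ((nat \<Rightarrow> 'a set) \<times> 'b \<Rightarrow> int) set" where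
  "pr n = (SOME \<Phi>. (\<forall>t\<in>carrier T. \<Phi> t \<in> carrier T) \<and>
    (\<forall>t\<in>carrier T. \<forall>u\<in>carrier T. \<Phi> (t \<oplus>\<^bsub>T\<^esub> u) = \<Phi> t \<oplus>\<^bsub>T\<^esub> \<Phi> u) \<and>
    (\<forall>a\<in>carrier G. \<forall>b\<in>carrier K. \<Phi> (pt a b) = pt (gr_comp A \<mm> n a) b))"

lemma pr_props:
  shows pr_add: "\<lbrakk>t \<in> carrier T; u \<in> carrier T\<rbrakk> \<Longrightarrow> pr n (t \<oplus>\<^bsub>T\<^esub> u) = pr n t \<oplus>\<^bsub>T\<^esub> pr n u"
    and pr_pt: "\<lbrakk>a \<in> carrier G; b \<in> carrier K\<rbrakk> \<Longrightarrow> pr n (pt a b) = pt (gr_comp A \<mm> n a) b"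
proof -
  have c: "gr_comp A \<mm> n a \<in> carrier G" if "a \<in> carrier G" for a by (rule Gn_sub[OF gr_comp_closed[OF that]])
  have "\<exists>\<Phi>. (\<forall>t\<in>carrier T. \<Phi> t \<in> carrier T) \<and>
    (\<forall>t\<in>carrier T. \<forall>u\<in>carrier T. \<Phi> (t \<oplus>\<^bsub>T\<^esub> u) = \<Phi> t \<oplus>\<^bsub>T\<^esub> \<Phi> u) \<and>
    (\<forall>a\<in>carrier G. \<forall>b\<in>carrier K. \<Phi> (pt a b) = pt (gr_comp A \<mm> n a) b)"
  proof (rule lift[OF T.abelian_group_axioms])
    show "pt (gr_comp A \<mm> n a) b \<in> carrier T" if "a \<in> carrier G" "b \<in> carrier K" for a b
      by (rule pt_closed[OF c[OF that(1)] that(2)])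
    show "pt (gr_comp A \<mm> n (a \<oplus>\<^bsub>G\<^esub> a')) b = pt (gr_comp A \<mm> n a) b \<oplus>\<^bsub>T\<^esub> pt (gr_comp A \<mm> n a') b"
      if "a \<in> carrier G" "a' \<in> carrier G" "b \<in> carrier K" for a a' b
      unfolding gr_comp_add by (rule pt_add_left[OF c[OF that(1)] c[OF that(2)] that(3)])
    show "pt (gr_comp A \<mm> n a) (b \<oplus>\<^bsub>K\<^esub> b') = pt (gr_comp A \<mm> n a) b \<oplus>\<^bsub>T\<^esub> pt (gr_comp A \<mm> n a) b'"
      if "a \<in> carrier G" "b \<in> carrier K" "b' \<in> carrier K" for a b b'
      by (rule pt_add_right[OF c[OF that(1)] that(2,3)])
    show "pt (gr_comp A \<mm> n (\<kappa> d \<otimes>\<^bsub>G\<^esub> a)) b = pt (gr_comp A \<mm> n a) (\<iota> d \<otimes>\<^bsub>K\<^esub> b)"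
      if "a \<in> carrier G" "b \<in> carrier K" "d \<in> carrier k" for a b d
      unfolding gr_comp_kappa[OF that(1,3)] by (rule pt_balanced[OF c[OF that(1)] that(2,3)])
  qed
  from someI_ex[OF this, folded pr_def]
  have p: "\<forall>t\<in>carrier T. \<forall>u\<in>carrier T. pr n (t \<oplus>\<^bsub>T\<^esub> u) = pr n t \<oplus>\<^bsub>T\<^esub> pr n u"
    "\<forall>a\<in>carrier G. \<forall>b\<in>carrier K. pr n (pt a b) = pt (gr_comp A \<mm> n a) b"
    by (rule conjunct2[THEN conjunct1], rule conjunct2[THEN conjunct2])
  show "\<lbrakk>t \<in> carrier T; u \<in> carrier T\<rbrakk> \<Longrightarrow> pr n (t \<oplus>\<^bsub>T\<^esub> u) = pr n t \<oplus>\<^bsub>T\<^esub> pr n u"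
    by (rule p(1)[rule_format])
  show "\<lbrakk>a \<in> carrier G; b \<in> carrier K\<rbrakk> \<Longrightarrow> pr n (pt a b) = pt (gr_comp A \<mm> n a) b"
    by (rule p(2)[rule_format])
qed

lemma pr_in: "t \<in> carrier T \<Longrightarrow> pr n t \<in> Tn n"
proof (induction t rule: T_induct)
  case (pure a b)
  show ?case unfolding pr_pt[OF pure] by (rule pure_Tn[OF gr_comp_closed[OF pure(1)] pure(2)])
next
  case (add t u)
  show ?case unfolding pr_add[OF add(1,2)] by (rule Tn_add[OF add(3,4)])
qed

lemma pr_Tn: "t \<in> Tn m \<Longrightarrow> pr n t = (if n = m then t else \<zero>\<^bsub>T\<^esub>)"
proof (induction t rule: Tn_induct)
  case (pure g c)
  then obtain a where a: "a \<in> mp m" "g = el m a" unfolding gr_part_eq by blast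
  show ?case
    unfolding pr_pt[OF Gn_sub[OF pure(1)] pure(2)] unfolding a(2) gr_comp_el
    using pt_zero_left[OF pure(2)] by simp
next
  case (add t u)
  then show ?case by (simp add: pr_add Tn_carr)
qed

text \<open>A concrete form of faithful flatness over the field k: an element g outside a k-subspace
  W of G(A) stays outside W \<otimes> K, which is witnessed by an additive map to K.\<close>

lemma functional:
  assumes W: "W \<subseteq> carrier G" "\<zero>\<^bsub>G\<^esub> \<in> W" "\<And>u v. \<lbrakk>u \<in> W; v \<in> W\<rbrakk> \<Longrightarrow> u \<oplus>\<^bsub>G\<^esub> v \<in> W"
      "\<And>c u. \<lbrakk>c \<in> carrier k; u \<in> W\<rbrakk> \<Longrightarrow> \<kappa> c \<otimes>\<^bsub>G\<^esub> u \<in> W"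
    and g: "g \<in> carrier G" "g \<notin> W"
  shows "\<exists>\<Phi>. (\<forall>t\<in>carrier T. \<Phi> t \<in> carrier K) \<and>
    (\<forall>t\<in>carrier T. \<forall>u\<in>carrier T. \<Phi> (t \<oplus>\<^bsub>T\<^esub> u) = \<Phi> t \<oplus>\<^bsub>K\<^esub> \<Phi> u) \<and>
    (\<forall>w\<in>W. \<forall>c\<in>carrier K. \<Phi> (pt w c) = \<zero>\<^bsub>K\<^esub>) \<and> \<Phi> (pt g \<one>\<^bsub>K\<^esub>) = \<one>\<^bsub>K\<^esub>"
proof -
  interpret p: ring_hom_ring k G \<kappa> by (rule ring_hom_ringI2[OF k.ring_axioms G.ring_axioms gr_const_hom])
  interpret q: ring_hom_ring k K \<iota> by (rule ring_hom_ringI2[OF k.ring_axioms K.ring_axioms iota])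
  have Wc: "u \<in> carrier G" if "u \<in> W" for u using W(1) that by blast
  \<comment> \<open>The functional on W + k g with value 0 on W and 1 on g. It is extended to a
    linear l on all of G(A) and then to T by a \<otimes> b \<mapsto> l(a) b.\<close>
  define \<Gamma> where "\<Gamma> = {(w \<oplus>\<^bsub>G\<^esub> \<kappa> c \<otimes>\<^bsub>G\<^esub> g, \<iota> c) | w c. w \<in> W \<and> c \<in> carrier k}"
  have coeff: "c = c'" if e: "w \<oplus>\<^bsub>G\<^esub> \<kappa> c \<otimes>\<^bsub>G\<^esub> g = w' \<oplus>\<^bsub>G\<^esub> \<kappa> c' \<otimes>\<^bsub>G\<^esub> g"
    and w: "w \<in> W" "w' \<in> W" and c: "c \<in> carrier k" "c' \<in> carrier k" for w c w' c'
  proof (rule ccontr)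
    assume ne: "c \<noteq> c'"
    let ?d = "c \<ominus>\<^bsub>k\<^esub> c'"
    have d: "?d \<in> carrier k" "?d \<noteq> \<zero>\<^bsub>k\<^esub>" using c ne by simp_all
    have inv: "inv\<^bsub>k\<^esub> ?d \<in> carrier k" "inv\<^bsub>k\<^esub> ?d \<otimes>\<^bsub>k\<^esub> ?d = \<one>\<^bsub>k\<^esub>" using k.field_Units d by simp_all
    note wc = Wc[OF w(1)] Wc[OF w(2)]
    have "\<kappa> ?d \<otimes>\<^bsub>G\<^esub> g = \<kappa> c \<otimes>\<^bsub>G\<^esub> g \<ominus>\<^bsub>G\<^esub> \<kappa> c' \<otimes>\<^bsub>G\<^esub> g"
      using c g(1) by (simp add: a_minus_def G.l_distr G.l_minus)
    also have "\<kappa> c \<otimes>\<^bsub>G\<^esub> g = \<ominus>\<^bsub>G\<^esub> w \<oplus>\<^bsub>G\<^esub> (w \<oplus>\<^bsub>G\<^esub> \<kappa> c \<otimes>\<^bsub>G\<^esub> g)" using c g(1) wc by (simp add: G.r_neg1)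
    also have "\<dots> = \<ominus>\<^bsub>G\<^esub> w \<oplus>\<^bsub>G\<^esub> (w' \<oplus>\<^bsub>G\<^esub> \<kappa> c' \<otimes>\<^bsub>G\<^esub> g)" by (simp only: e)
    also have "\<dots> \<ominus>\<^bsub>G\<^esub> \<kappa> c' \<otimes>\<^bsub>G\<^esub> g = \<ominus>\<^bsub>G\<^esub> w \<oplus>\<^bsub>G\<^esub> w'"
      using c g(1) wc by (simp add: a_minus_def G.a_assoc G.r_neg)
    also have "\<ominus>\<^bsub>G\<^esub> w = \<kappa> (\<ominus>\<^bsub>k\<^esub> \<one>\<^bsub>k\<^esub>) \<otimes>\<^bsub>G\<^esub> w" using wc by (simp add: G.l_minus)
    finally have "\<kappa> ?d \<otimes>\<^bsub>G\<^esub> g = \<kappa> (\<ominus>\<^bsub>k\<^esub> \<one>\<^bsub>k\<^esub>) \<otimes>\<^bsub>G\<^esub> w \<oplus>\<^bsub>G\<^esub> w'" .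
    moreover have "\<kappa> (\<ominus>\<^bsub>k\<^esub> \<one>\<^bsub>k\<^esub>) \<otimes>\<^bsub>G\<^esub> w \<oplus>\<^bsub>G\<^esub> w' \<in> W"
      by (rule W(3)[OF W(4)[OF k.a_inv_closed[OF k.one_closed] w(1)] w(2)])
    ultimately have "\<kappa> ?d \<otimes>\<^bsub>G\<^esub> g \<in> W" by (simp only:)
    from W(4)[OF inv(1) this] have "\<kappa> (inv\<^bsub>k\<^esub> ?d) \<otimes>\<^bsub>G\<^esub> (\<kappa> ?d \<otimes>\<^bsub>G\<^esub> g) \<in> W" .
    moreover have "\<kappa> (inv\<^bsub>k\<^esub> ?d) \<otimes>\<^bsub>G\<^esub> (\<kappa> ?d \<otimes>\<^bsub>G\<^esub> g) = g"
    proof -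
      have "\<kappa> (inv\<^bsub>k\<^esub> ?d) \<otimes>\<^bsub>G\<^esub> (\<kappa> ?d \<otimes>\<^bsub>G\<^esub> g) = \<kappa> (inv\<^bsub>k\<^esub> ?d \<otimes>\<^bsub>k\<^esub> ?d) \<otimes>\<^bsub>G\<^esub> g"
        unfolding p.hom_mult[OF inv(1) d(1)]
        by (rule G.m_assoc[symmetric, OF kappa_closed[OF inv(1)] kappa_closed[OF d(1)] g(1)])
      then show ?thesis unfolding inv(2) using g(1) by simp
    qed
    ultimately show False using g(2) by simp
  qed
  have graph: "linear_graph k G \<kappa> K \<iota> \<Gamma>"
    unfolding linear_graph_def
  proof (intro conjI allI impI ballI)
    show "\<Gamma> \<subseteq> carrier G \<times> carrier K"
    proof
      fix z assume "z \<in> \<Gamma>"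
      then obtain w c where "z = (w \<oplus>\<^bsub>G\<^esub> \<kappa> c \<otimes>\<^bsub>G\<^esub> g, \<iota> c)" "w \<in> W" "c \<in> carrier k" unfolding \<Gamma>_def by blast
      then show "z \<in> carrier G \<times> carrier K" using Wc g(1) by simp
    qed
    fix a m a' m' assume "(a, m) \<in> \<Gamma>" "(a', m') \<in> \<Gamma>"
    then obtain w c w' c' where w: "w \<in> W" "c \<in> carrier k" "a = w \<oplus>\<^bsub>G\<^esub> \<kappa> c \<otimes>\<^bsub>G\<^esub> g" "m = \<iota> c"
      "w' \<in> W" "c' \<in> carrier k" "a' = w' \<oplus>\<^bsub>G\<^esub> \<kappa> c' \<otimes>\<^bsub>G\<^esub> g" "m' = \<iota> c'" unfolding \<Gamma>_def by blast
    have "a \<oplus>\<^bsub>G\<^esub> a' = (w \<oplus>\<^bsub>G\<^esub> w') \<oplus>\<^bsub>G\<^esub> \<kappa> (c \<oplus>\<^bsub>k\<^esub> c') \<otimes>\<^bsub>G\<^esub> g"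
      unfolding w(3,7) using w(2,6) g(1) Wc[OF w(1)] Wc[OF w(5)] by (simp add: G.l_distr G.a_ac)
    moreover have "m \<oplus>\<^bsub>K\<^esub> m' = \<iota> (c \<oplus>\<^bsub>k\<^esub> c')" unfolding w(4,8) using w(2,6) by simp
    ultimately show "(a \<oplus>\<^bsub>G\<^esub> a', m \<oplus>\<^bsub>K\<^esub> m') \<in> \<Gamma>"
      unfolding \<Gamma>_def using W(3)[OF w(1,5)] k.a_closed[OF w(2,6)] by blast
  next
    fix d a m assume d: "d \<in> carrier k" and "(a, m) \<in> \<Gamma>"
    then obtain w c where w: "w \<in> W" "c \<in> carrier k" "a = w \<oplus>\<^bsub>G\<^esub> \<kappa> c \<otimes>\<^bsub>G\<^esub> g" "m = \<iota> c" unfolding \<Gamma>_def by blast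
    have "\<kappa> d \<otimes>\<^bsub>G\<^esub> a = \<kappa> d \<otimes>\<^bsub>G\<^esub> w \<oplus>\<^bsub>G\<^esub> \<kappa> (d \<otimes>\<^bsub>k\<^esub> c) \<otimes>\<^bsub>G\<^esub> g"
      unfolding w(3) using w(2) d g(1) Wc[OF w(1)] by (simp add: G.r_distr G.m_assoc)
    moreover have "\<iota> d \<otimes>\<^bsub>K\<^esub> m = \<iota> (d \<otimes>\<^bsub>k\<^esub> c)" unfolding w(4) using w(2) d by simp
    ultimately show "(\<kappa> d \<otimes>\<^bsub>G\<^esub> a, \<iota> d \<otimes>\<^bsub>K\<^esub> m) \<in> \<Gamma>"
      unfolding \<Gamma>_def using W(4)[OF d w(1)] k.m_closed[OF d w(2)] by blast
  next
    fix a m m' assume "(a, m) \<in> \<Gamma>" "(a, m') \<in> \<Gamma>"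
    then obtain w c w' c' where w: "w \<in> W" "c \<in> carrier k" "a = w \<oplus>\<^bsub>G\<^esub> \<kappa> c \<otimes>\<^bsub>G\<^esub> g" "m = \<iota> c"
      "w' \<in> W" "c' \<in> carrier k" "a = w' \<oplus>\<^bsub>G\<^esub> \<kappa> c' \<otimes>\<^bsub>G\<^esub> g" "m' = \<iota> c'" unfolding \<Gamma>_def by blast
    have "c = c'" by (rule coeff[OF _ w(1,5,2,6)]) (use w(3,7) in simp)
    then show "m = m'" unfolding w(4,8) by (rule arg_cong)
  qed
  obtain l where l: "\<And>a. a \<in> carrier G \<Longrightarrow> l a \<in> carrier K"
    "\<And>a b. \<lbrakk>a \<in> carrier G; b \<in> carrier G\<rbrakk> \<Longrightarrow> l (a \<oplus>\<^bsub>G\<^esub> b) = l a \<oplus>\<^bsub>K\<^esub> l b"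
    "\<And>c a. \<lbrakk>c \<in> carrier k; a \<in> carrier G\<rbrakk> \<Longrightarrow> l (\<kappa> c \<otimes>\<^bsub>G\<^esub> a) = \<iota> c \<otimes>\<^bsub>K\<^esub> l a"
    "\<And>a m. (a, m) \<in> \<Gamma> \<Longrightarrow> l a = m"
  proof (rule linear_extension[OF k_field G_cring K.is_cring gr_const_hom iota graph])
    fix f
    assume f: "\<And>a. a \<in> carrier G \<Longrightarrow> f a \<in> carrier K"
      "\<And>a b. \<lbrakk>a \<in> carrier G; b \<in> carrier G\<rbrakk> \<Longrightarrow> f (a \<oplus>\<^bsub>G\<^esub> b) = f a \<oplus>\<^bsub>K\<^esub> f b"
      "\<And>c a. \<lbrakk>c \<in> carrier k; a \<in> carrier G\<rbrakk> \<Longrightarrow> f (\<kappa> c \<otimes>\<^bsub>G\<^esub> a) = \<iota> c \<otimes>\<^bsub>K\<^esub> f a"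
      "\<And>a m. (a, m) \<in> \<Gamma> \<Longrightarrow> f a = m"
    show thesis by (rule that[of f]) (fact f)+
  qed
  have lW: "l w = \<zero>\<^bsub>K\<^esub>" if w: "w \<in> W" for w
  proof -
    have "w = w \<oplus>\<^bsub>G\<^esub> \<kappa> \<zero>\<^bsub>k\<^esub> \<otimes>\<^bsub>G\<^esub> g" using Wc[OF w] g(1) by simp
    then have "(w, \<iota> \<zero>\<^bsub>k\<^esub>) \<in> \<Gamma>" unfolding \<Gamma>_def using w k.zero_closed by blast
    then show ?thesis using l(4) by simp
  qed
  have lg: "l g = \<one>\<^bsub>K\<^esub>"
  proof -
    have "g = \<zero>\<^bsub>G\<^esub> \<oplus>\<^bsub>G\<^esub> \<kappa> \<one>\<^bsub>k\<^esub> \<otimes>\<^bsub>G\<^esub> g" using g(1) by simp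
    then have "(g, \<iota> \<one>\<^bsub>k\<^esub>) \<in> \<Gamma>" unfolding \<Gamma>_def using W(2) k.one_closed by blast
    then show ?thesis using l(4) by simp
  qed
  have "\<exists>\<Phi>. (\<forall>t\<in>carrier T. \<Phi> t \<in> carrier K) \<and>
    (\<forall>t\<in>carrier T. \<forall>u\<in>carrier T. \<Phi> (t \<oplus>\<^bsub>T\<^esub> u) = \<Phi> t \<oplus>\<^bsub>K\<^esub> \<Phi> u) \<and>
    (\<forall>a\<in>carrier G. \<forall>b\<in>carrier K. \<Phi> (pt a b) = l a \<otimes>\<^bsub>K\<^esub> b)"
  proof (rule lift[OF K.abelian_group_axioms])
    show "l a \<otimes>\<^bsub>K\<^esub> b \<in> carrier K" if "a \<in> carrier G" "b \<in> carrier K" for a b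
      by (rule K.m_closed[OF l(1)[OF that(1)] that(2)])
    show "l (a \<oplus>\<^bsub>G\<^esub> a') \<otimes>\<^bsub>K\<^esub> b = l a \<otimes>\<^bsub>K\<^esub> b \<oplus>\<^bsub>K\<^esub> l a' \<otimes>\<^bsub>K\<^esub> b"
      if "a \<in> carrier G" "a' \<in> carrier G" "b \<in> carrier K" for a a' b
      unfolding l(2)[OF that(1,2)] by (rule K.l_distr[OF l(1)[OF that(1)] l(1)[OF that(2)] that(3)])
    show "l a \<otimes>\<^bsub>K\<^esub> (b \<oplus>\<^bsub>K\<^esub> b') = l a \<otimes>\<^bsub>K\<^esub> b \<oplus>\<^bsub>K\<^esub> l a \<otimes>\<^bsub>K\<^esub> b'"
      if "a \<in> carrier G" "b \<in> carrier K" "b' \<in> carrier K" for a b b'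
      by (rule K.r_distr[OF that(2,3) l(1)[OF that(1)]])
    show "l (\<kappa> d \<otimes>\<^bsub>G\<^esub> a) \<otimes>\<^bsub>K\<^esub> b = l a \<otimes>\<^bsub>K\<^esub> (\<iota> d \<otimes>\<^bsub>K\<^esub> b)"
      if "a \<in> carrier G" "b \<in> carrier K" "d \<in> carrier k" for a b d
      unfolding l(3)[OF that(3,1)] using l(1)[OF that(1)] that(2) iota_closed[OF that(3)] by (simp add: K.m_ac)
  qed
  then obtain \<Phi> where F: "\<forall>t\<in>carrier T. \<Phi> t \<in> carrier K"
    "\<forall>t\<in>carrier T. \<forall>u\<in>carrier T. \<Phi> (t \<oplus>\<^bsub>T\<^esub> u) = \<Phi> t \<oplus>\<^bsub>K\<^esub> \<Phi> u"
    and pt: "\<forall>a\<in>carrier G. \<forall>b\<in>carrier K. \<Phi> (pt a b) = l a \<otimes>\<^bsub>K\<^esub> b" by blast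
  have pW: "\<forall>w\<in>W. \<forall>c\<in>carrier K. \<Phi> (pt w c) = \<zero>\<^bsub>K\<^esub>"
  proof (intro ballI)
    fix w c assume "w \<in> W" "c \<in> carrier K"
    then show "\<Phi> (pt w c) = \<zero>\<^bsub>K\<^esub>" using bspec[OF bspec[OF pt Wc]] lW by simp
  qed
  have pg: "\<Phi> (pt g \<one>\<^bsub>K\<^esub>) = \<one>\<^bsub>K\<^esub>" using bspec[OF bspec[OF pt g(1)] K.one_closed] lg by simp
  show ?thesis by (intro exI[of _ \<Phi>] conjI F pW pg)
qed

lemma additive_zero:
  assumes "\<forall>t\<in>carrier T. \<Phi> t \<in> carrier K" "\<forall>t\<in>carrier T. \<forall>u\<in>carrier T. \<Phi> (t \<oplus>\<^bsub>T\<^esub> u) = \<Phi> t \<oplus>\<^bsub>K\<^esub> \<Phi> u"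
  shows "\<Phi> \<zero>\<^bsub>T\<^esub> = \<zero>\<^bsub>K\<^esub>"
proof -
  have "\<Phi> \<zero>\<^bsub>T\<^esub> = \<Phi> \<zero>\<^bsub>T\<^esub> \<oplus>\<^bsub>K\<^esub> \<Phi> \<zero>\<^bsub>T\<^esub>" using bspec[OF bspec[OF assms(2) T.zero_closed] T.zero_closed] by simp
  then show ?thesis using bspec[OF assms(1) T.zero_closed] by (metis K.add.r_cancel_one')
qed

text \<open>The case W = 0 of \<open>functional\<close>: G(A) embeds in T.\<close>

lemma pt_nonzero:
  assumes "g \<in> carrier G" "g \<noteq> \<zero>\<^bsub>G\<^esub>"
  shows "pt g \<one>\<^bsub>K\<^esub> \<noteq> \<zero>\<^bsub>T\<^esub>"
proof
  assume z: "pt g \<one>\<^bsub>K\<^esub> = \<zero>\<^bsub>T\<^esub>"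
  have "\<exists>\<Phi>. (\<forall>t\<in>carrier T. \<Phi> t \<in> carrier K) \<and>
    (\<forall>t\<in>carrier T. \<forall>u\<in>carrier T. \<Phi> (t \<oplus>\<^bsub>T\<^esub> u) = \<Phi> t \<oplus>\<^bsub>K\<^esub> \<Phi> u) \<and>
    (\<forall>w\<in>{\<zero>\<^bsub>G\<^esub>}. \<forall>c\<in>carrier K. \<Phi> (pt w c) = \<zero>\<^bsub>K\<^esub>) \<and> \<Phi> (pt g \<one>\<^bsub>K\<^esub>) = \<one>\<^bsub>K\<^esub>"
    by (rule functional) (use assms kappa_closed in simp_all)
  then obtain \<Phi> where F: "\<forall>t\<in>carrier T. \<Phi> t \<in> carrier K"
    "\<forall>t\<in>carrier T. \<forall>u\<in>carrier T. \<Phi> (t \<oplus>\<^bsub>T\<^esub> u) = \<Phi> t \<oplus>\<^bsub>K\<^esub> \<Phi> u" "\<Phi> (pt g \<one>\<^bsub>K\<^esub>) = \<one>\<^bsub>K\<^esub>" by blast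
  show False using F(3) additive_zero[OF F(1,2)] z by simp
qed

section \<open>Coordinates and generation in degree one\<close>

lemma one_notin: "\<one> \<notin> \<mm>"
  using one_imp_carrier maximalideal.I_notcarr[OF maximal] by blast

lemma T_nontrivial: "\<one>\<^bsub>T\<^esub> \<noteq> \<zero>\<^bsub>T\<^esub>"
proof -
  have "\<one>\<^bsub>G\<^esub> \<noteq> \<zero>\<^bsub>G\<^esub>" unfolding G_one using el_zero_iff[of \<one> 0] one_notin mp_1 by simp
  then show ?thesis using pt_nonzero[OF G.one_closed] pt_one by simp
qed

lemma hK_subfield: "subfield (h ` carrier K) T"
proof -
  interpret hh: ring_hom_ring K T h by (rule ring_hom_ringI2[OF K.ring_axioms T.ring_axioms h_hom])
  show ?thesis by (rule hh.img_is_subfield(2)[OF K.carrier_is_subfield T_nontrivial])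
qed

lemma coords: "T.independent (h ` carrier K) (map x [0..<Suc r])"
    "T.Span (h ` carrier K) (map x [0..<Suc r]) = Tn 1"
  using coordinates unfolding tangent_coordinates_def by (rule conjunct1, rule conjunct2)

lemma x_T1: "i \<le> r \<Longrightarrow> x i \<in> Tn 1"
proof -
  assume "i \<le> r"
  then have "x i \<in> set (map x [0..<Suc r])" by (simp del: upt_Suc)
  then show ?thesis
    using T.Span_base_incl[OF hK_subfield T.independent_in_carrier[OF coords(1)]] unfolding coords(2) by blast
qed

text \<open>There is a first coordinate because r + 1 is positive. That it is nonzero excludes later
  that \<mm> vanishes.\<close>

lemma x0_nonzero: "x 0 \<noteq> \<zero>\<^bsub>T\<^esub>"
proof
  assume z: "x 0 = \<zero>\<^bsub>T\<^esub>"
  let ?U = "map x [Suc 0..<Suc r]"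
  have e: "map x [0..<Suc r] = x 0 # ?U" by (simp add: upt_conv_Cons del: upt_Suc)
  note I = coords(1)[unfolded e]
  have "\<zero>\<^bsub>T\<^esub> \<in> T.Span (h ` carrier K) ?U"
    by (rule T.Span_subgroup_props(2)[OF hK_subfield T.independent_in_carrier[OF T.independent_backwards(2)[OF I]]])
  then show False using T.independent_backwards(1)[OF I] z by simp
qed

text \<open>Holds because \<open>\<mm>^(n+1)\<close> is generated by products of elements of
  \<open>\<mm>^n\<close> and \<mm>, while the coordinates span
  \<open>\<mm>/\<mm>^2 \<otimes> K\<close>, the part of degree one.\<close>

lemma Tn_Suc_induct:
  assumes t: "t \<in> Tn (Suc n)"
    and var: "\<And>u i. \<lbrakk>u \<in> Tn n; i \<le> r\<rbrakk> \<Longrightarrow> P (u \<otimes>\<^bsub>T\<^esub> x i)"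
    and add: "\<And>t u. \<lbrakk>t \<in> Tn (Suc n); u \<in> Tn (Suc n); P t; P u\<rbrakk> \<Longrightarrow> P (t \<oplus>\<^bsub>T\<^esub> u)"
  shows "P t"
proof -
  \<comment> \<open>Membership is carried along because additivity of P is only granted inside the
    part of degree n + 1.\<close>
  define Q where "Q t \<longleftrightarrow> t \<in> Tn (Suc n) \<and> P t" for t
  have Qadd: "Q (t \<oplus>\<^bsub>T\<^esub> u)" if "Q t" "Q u" for t u
    using that add Tn_add unfolding Q_def by simp
  have Qvar: "Q (u \<otimes>\<^bsub>T\<^esub> x i)" if "u \<in> Tn n" "i \<le> r" for u i
    using var[OF that] Tn_mult[OF that(1) x_T1[OF that(2)]] unfolding Q_def by simp
  have span: "Q (u \<otimes>\<^bsub>T\<^esub> v)" if u: "u \<in> Tn n" and v: "v \<in> T.Span (h ` carrier K) Us" and Us: "set Us \<subseteq> x ` {..r}" for u v Us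
    using v Us
  proof (induction Us arbitrary: v)
    case Nil
    then have "v = \<zero>\<^bsub>T\<^esub>" by simp
    then have "u \<otimes>\<^bsub>T\<^esub> v = \<zero>\<^bsub>T\<^esub> \<otimes>\<^bsub>T\<^esub> x 0" using Tn_carr[OF u] Tn_carr[OF x_T1[of 0]] by simp
    then show ?case using Qvar[OF Tn_zero, of 0] by simp
  next
    case (Cons w Us)
    obtain i where i: "i \<le> r" "w = x i" using Cons.prems(2) by auto
    have "v \<in> T.line_extension (h ` carrier K) w (T.Span (h ` carrier K) Us)" using Cons.prems(1) by simp
    then obtain c v' where cv: "c \<in> carrier K" "v' \<in> T.Span (h ` carrier K) Us" "v = h c \<otimes>\<^bsub>T\<^esub> w \<oplus>\<^bsub>T\<^esub> v'"
      unfolding T.line_extension_mem_iff by blast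
    have Usc: "set Us \<subseteq> carrier T" using Cons.prems(2) Tn_carr[OF x_T1] by auto
    have v': "v' \<in> carrier T" using T.Span_subgroup_props(1)[OF hK_subfield Usc] cv(2) by blast
    note c = Tn_carr[OF u] Tn_carr[OF x_T1[OF i(1)]] h_closed[OF cv(1)] v'
    have uc: "u \<otimes>\<^bsub>T\<^esub> h c \<in> Tn n" using Tn_mult[OF u, of "h c" 0] cv(1) unfolding T0 by simp
    have "u \<otimes>\<^bsub>T\<^esub> v = (u \<otimes>\<^bsub>T\<^esub> h c) \<otimes>\<^bsub>T\<^esub> x i \<oplus>\<^bsub>T\<^esub> u \<otimes>\<^bsub>T\<^esub> v'"
      unfolding cv(3) i(2) using c by (simp add: T.r_distr T.m_assoc)
    moreover have "Q (u \<otimes>\<^bsub>T\<^esub> v')" using Cons.IH[OF cv(2)] Cons.prems(2) by simp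
    ultimately show ?case using Qadd[OF Qvar[OF uc i(1)]] by simp
  qed
  have Q1: "Q (u \<otimes>\<^bsub>T\<^esub> v)" if "u \<in> Tn n" "v \<in> Tn 1" for u v
    by (rule span[OF that(1) that(2)[folded coords(2)]]) (simp add: atLeast0LessThan lessThan_Suc_atMost del: upt_Suc)
  have Qel: "a \<in> mp (Suc n) \<and> Q (pt (el (Suc n) a) c)" if "a \<in> mp (Suc n)" and c: "c \<in> carrier K" for a c
    using that(1) unfolding ideal_power.simps(2)
  proof (induction a rule: ideal_prod.induct)
    case (prod b m)
    have m: "m \<in> mp 1" using prod(2) mp_1 by simp
    have bm: "b \<otimes> m \<in> mp (Suc n)" using mp_mult[OF prod(1) m] by simp
    have "el (Suc n) (b \<otimes> m) = el n b \<otimes>\<^bsub>G\<^esub> el 1 m" using el_mult[OF prod(1) m] by simp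
    then have "pt (el (Suc n) (b \<otimes> m)) c = pt (el n b) c \<otimes>\<^bsub>T\<^esub> pt (el 1 m) \<one>\<^bsub>K\<^esub>"
      using pt_mult[OF el_closed[OF prod(1)] c el_closed[OF m] K.one_closed] c by simp
    moreover have "pt (el n b) c \<in> Tn n" "pt (el 1 m) \<one>\<^bsub>K\<^esub> \<in> Tn 1"
      by (rule pure_Tn; use prod(1) m c in \<open>simp add: gr_part_eq\<close>)+
    ultimately show ?case using Q1 bm by (simp add: ideal_power.simps(2))
  next
    case (sum a b)
    have ab: "a \<in> mp (Suc n)" "b \<in> mp (Suc n)" using sum by (simp_all add: ideal_power.simps(2))
    have "pt (el (Suc n) (a \<oplus> b)) c = pt (el (Suc n) a) c \<oplus>\<^bsub>T\<^esub> pt (el (Suc n) b) c"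
      unfolding el_add[OF ab] by (rule pt_add_left[OF el_closed[OF ab(1)] el_closed[OF ab(2)] c])
    then show ?case using Qadd sum(3,4) mp_add[OF ab] by (simp add: ideal_power.simps(2))
  qed
  have "Q t"
    using t
  proof (induction t rule: Tn_induct)
    case (pure g c)
    then show ?case using Qel unfolding gr_part_eq by blast
  next
    case (add t u)
    then show ?case using Qadd by blast
  qed
  then show ?thesis unfolding Q_def by (rule conjunct2)
qed

lemma graded: "graded_algebra T K h Tn pr r x"
proof (intro graded_algebra.intro graded_algebra_axioms.intro)
  show "cring T" by (rule T_cring)
  show "algebraically_closed K" by (rule K.algebraically_closed_axioms)
  show "Tn n \<subseteq> carrier T" for n using Tn_carr by blast
qed (fact h_hom pr_in pr_add pr_Tn Tn_mult T0 x_T1 | (rule homog_induct; assumption) | (rule Tn_Suc_induct; assumption))+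

text \<open>The elements of T that come from G(A) and hence have a lift to A.\<close>

definition Gd :: "nat \<Rightarrow> ((nat \<Rightarrow> 'a set) \<times> 'b \<Rightarrow> int) set set" where
  "Gd n = {pt g \<one>\<^bsub>K\<^esub> | g. g \<in> Gn n}"

section \<open>From the tangent cone back to the local ring\<close>

lemma nilpotent_zero:
  assumes "a \<in> carrier A" "a [^] (n::nat) = \<zero>"
  shows "a = \<zero>"
  using reduced assms unfolding reduced_ring_def by blast

text \<open>Were g outside \<open>g0 G_i\<close>, some functional would kill
  \<open>g0 G_i \<otimes> K = y T_i\<close> but not g \<otimes> 1, where y = g0 \<otimes> 1. This
  contradicts \<open>T_(i+d) = y T_i\<close>.\<close>

lemma descent:
  assumes g0: "g0 \<in> Gn d" and surj: "\<And>t. t \<in> Tn (i + d) \<Longrightarrow> \<exists>u\<in>Tn i. t = pt g0 \<one>\<^bsub>K\<^esub> \<otimes>\<^bsub>T\<^esub> u"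
    and g: "g \<in> Gn (i + d)"
  shows "\<exists>g'\<in>Gn i. g = g0 \<otimes>\<^bsub>G\<^esub> g'"
proof (rule ccontr)
  assume n: "\<not> ?thesis"
  let ?W = "(\<lambda>g'. g0 \<otimes>\<^bsub>G\<^esub> g') ` Gn i"
  note g0c = Gn_sub[OF g0]
  have "\<exists>\<Phi>. (\<forall>t\<in>carrier T. \<Phi> t \<in> carrier K) \<and>
    (\<forall>t\<in>carrier T. \<forall>u\<in>carrier T. \<Phi> (t \<oplus>\<^bsub>T\<^esub> u) = \<Phi> t \<oplus>\<^bsub>K\<^esub> \<Phi> u) \<and>
    (\<forall>w\<in>?W. \<forall>c\<in>carrier K. \<Phi> (pt w c) = \<zero>\<^bsub>K\<^esub>) \<and> \<Phi> (pt g \<one>\<^bsub>K\<^esub>) = \<one>\<^bsub>K\<^esub>"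
  proof (rule functional)
    show "?W \<subseteq> carrier G" using Gn_sub g0c by (intro image_subsetI G.m_closed)
    show "\<zero>\<^bsub>G\<^esub> \<in> ?W" by (rule image_eqI[OF _ Gn_zero]) (use g0c in simp)
    show "g \<in> carrier G" by (rule Gn_sub[OF g])
    show "g \<notin> ?W" using n by blast
  next
    fix u v assume "u \<in> ?W" "v \<in> ?W"
    then obtain a b where ab: "u = g0 \<otimes>\<^bsub>G\<^esub> a" "a \<in> Gn i" "v = g0 \<otimes>\<^bsub>G\<^esub> b" "b \<in> Gn i" by blast
    show "u \<oplus>\<^bsub>G\<^esub> v \<in> ?W"
      unfolding ab(1,3) G.r_distr[OF Gn_sub[OF ab(2)] Gn_sub[OF ab(4)] g0c, symmetric]
      by (rule imageI[OF Gn_add[OF ab(2,4)]])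
  next
    fix c u assume c: "c \<in> carrier k" and "u \<in> ?W"
    then obtain a where a: "u = g0 \<otimes>\<^bsub>G\<^esub> a" "a \<in> Gn i" by blast
    have "\<kappa> c \<otimes>\<^bsub>G\<^esub> u = g0 \<otimes>\<^bsub>G\<^esub> (\<kappa> c \<otimes>\<^bsub>G\<^esub> a)"
      unfolding a(1) by (rule G.m_lcomm[OF kappa_closed[OF c] g0c Gn_sub[OF a(2)]])
    moreover have "\<kappa> c \<otimes>\<^bsub>G\<^esub> a \<in> Gn i" using Gn_mult[OF kappa_Gn[OF c] a(2)] by simp
    ultimately show "\<kappa> c \<otimes>\<^bsub>G\<^esub> u \<in> ?W" by (rule image_eqI)
  qed
  then obtain \<Phi> where F: "\<forall>t\<in>carrier T. \<Phi> t \<in> carrier K"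
    "\<forall>t\<in>carrier T. \<forall>u\<in>carrier T. \<Phi> (t \<oplus>\<^bsub>T\<^esub> u) = \<Phi> t \<oplus>\<^bsub>K\<^esub> \<Phi> u"
    "\<forall>w\<in>?W. \<forall>c\<in>carrier K. \<Phi> (pt w c) = \<zero>\<^bsub>K\<^esub>" "\<Phi> (pt g \<one>\<^bsub>K\<^esub>) = \<one>\<^bsub>K\<^esub>" by blast
  have y: "pt g0 \<one>\<^bsub>K\<^esub> \<in> carrier T" using g0c by simp
  have van: "\<Phi> (pt g0 \<one>\<^bsub>K\<^esub> \<otimes>\<^bsub>T\<^esub> u) = \<zero>\<^bsub>K\<^esub>" if "u \<in> Tn i" for u
    using that
  proof (induction u rule: Tn_induct)
    case (pure g' c)
    have "pt g0 \<one>\<^bsub>K\<^esub> \<otimes>\<^bsub>T\<^esub> pt g' c = pt (g0 \<otimes>\<^bsub>G\<^esub> g') c"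
      using pt_mult[OF g0c K.one_closed Gn_sub[OF pure(1)] pure(2)] pure(2) by simp
    then show ?case using F(3) pure by simp
  next
    case (add t u)
    note c = Tn_carr[OF add(1)] Tn_carr[OF add(2)]
    have "\<Phi> (pt g0 \<one>\<^bsub>K\<^esub> \<otimes>\<^bsub>T\<^esub> t \<oplus>\<^bsub>T\<^esub> pt g0 \<one>\<^bsub>K\<^esub> \<otimes>\<^bsub>T\<^esub> u) = \<zero>\<^bsub>K\<^esub> \<oplus>\<^bsub>K\<^esub> \<zero>\<^bsub>K\<^esub>"
      using bspec[OF bspec[OF F(2) T.m_closed[OF y c(1)]] T.m_closed[OF y c(2)]] add(3,4) by simp
    then show ?case using c y by (simp add: T.r_distr)
  qed
  obtain u where u: "u \<in> Tn i" "pt g \<one>\<^bsub>K\<^esub> = pt g0 \<one>\<^bsub>K\<^esub> \<otimes>\<^bsub>T\<^esub> u" using surj[OF pure_Tn[OF g K.one_closed]] by blast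
  show False using van[OF u(1)] F(4) unfolding u(2) by simp
qed

text \<open>Surjectivity in G(A) says that \<open>\<mm>^(i+d)\<close> equals
  \<open>a0 \<mm>^i\<close> up to elements of \<open>\<mm>^(i+d+1)\<close>, which is
  \<open>\<mm>^(i+d)\<close> times \<mm>; Nakayama's lemma removes the error.\<close>

lemma multiplication_onto:
  assumes a0: "a0 \<in> mp d" and desc: "\<And>g. g \<in> Gn (i + d) \<Longrightarrow> \<exists>g'\<in>Gn i. g = el d a0 \<otimes>\<^bsub>G\<^esub> g'"
    and a: "a \<in> mp (i + d)"
  shows "\<exists>b\<in>mp i. a = a0 \<otimes> b"
proof -
  let ?L = "(\<lambda>b. a0 \<otimes> b) ` mp i"
  note a0c = mp_carr[OF a0]
  have "ideal ?L A"
  proof (rule idealI[OF A.ring_axioms])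
    show "subgroup ?L (add_monoid A)"
    proof (rule A.add.subgroupI)
      show "?L \<subseteq> carrier A" using a0c mp_carr by (intro image_subsetI A.m_closed)
      show "?L \<noteq> {}" using mp_zero[of i] by blast
    next
      fix u assume "u \<in> ?L"
      then obtain b where b: "u = a0 \<otimes> b" "b \<in> mp i" by blast
      have "\<ominus> u = a0 \<otimes> \<ominus> b" unfolding b(1) using A.r_minus[OF a0c mp_carr[OF b(2)]] by (rule sym)
      then show "\<ominus> u \<in> ?L" using mp_minus[OF b(2)] by (rule image_eqI)
    next
      fix u v assume "u \<in> ?L" "v \<in> ?L"
      then obtain b c where bc: "u = a0 \<otimes> b" "b \<in> mp i" "v = a0 \<otimes> c" "c \<in> mp i" by blast
      show "u \<oplus> v \<in> ?L"
        unfolding bc(1,3) A.r_distr[OF mp_carr[OF bc(2)] mp_carr[OF bc(4)] a0c, symmetric]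
        by (rule imageI[OF mp_add[OF bc(2,4)]])
    qed
  next
    fix u z assume "u \<in> ?L" and z: "z \<in> carrier A"
    then obtain b where b: "u = a0 \<otimes> b" "b \<in> mp i" by blast
    have uc: "u \<in> carrier A" unfolding b(1) using a0c mp_carr[OF b(2)] by simp
    have "z \<otimes> u = a0 \<otimes> (z \<otimes> b)" unfolding b(1) by (rule A.m_lcomm[OF z a0c mp_carr[OF b(2)]])
    then show "z \<otimes> u \<in> ?L" using mp_lmult[OF z b(2)] by (rule image_eqI)
    then show "u \<otimes> z \<in> ?L" using A.m_comm[OF uc z] by simp
  qed
  moreover have "?L \<subseteq> mp (i + d)"
  proof
    fix u assume "u \<in> ?L"
    then obtain b where b: "u = a0 \<otimes> b" "b \<in> mp i" by blast
    then show "u \<in> mp (i + d)" using mp_mult[OF a0 b(2)] by (simp add: add.commute)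
  qed
  moreover have "\<exists>l\<in>?L. a \<ominus> l \<in> ideal_prod A (mp (i + d)) \<mm>" if a: "a \<in> mp (i + d)" for a
  proof -
    have "el (i + d) a \<in> Gn (i + d)" unfolding gr_part_eq by (rule imageI[OF a])
    then obtain g' where g': "g' \<in> Gn i" "el (i + d) a = el d a0 \<otimes>\<^bsub>G\<^esub> g'" using desc by blast
    obtain b where b: "b \<in> mp i" "g' = el i b" using g'(1) unfolding gr_part_eq by blast
    have "el (i + d) a = el (i + d) (a0 \<otimes> b)"
      using g'(2) el_mult[OF a0 b(1)] unfolding b(2) by (simp add: add.commute)
    then have "a \<ominus> a0 \<otimes> b \<in> mp (Suc (i + d))"
      using el_eq_iff[OF mp_carr[OF a] A.m_closed[OF a0c mp_carr[OF b(1)]]] by blast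
    then show ?thesis unfolding ideal_power.simps(2) by (intro bexI[OF _ imageI[OF b(1)]])
  qed
  ultimately have "mp (i + d) \<subseteq> ?L" by (rule nakayama[OF mp_ideal])
  then show ?thesis using a by blast
qed

text \<open>An element b with a0 b = 0 kills \<open>\<mm>^q\<close>. If b lies in \<mm>, then
  \<open>b^(q+1) = 0\<close>, and b = 0 as A is reduced. If b is a unit, the q-th powers of elements
  of \<mm> are zero, hence \<mm> = 0 by reducedness, and all coordinates of T would be zero.\<close>

lemma nonzerodivisor:
  assumes a0: "a0 \<in> mp d" and onto: "\<And>a. a \<in> mp q \<Longrightarrow> \<exists>c\<in>carrier A. a = a0 \<otimes> c"
    and b: "b \<in> carrier A" "a0 \<otimes> b = \<zero>"
  shows "b = \<zero>"
proof -
  have ann: "a \<otimes> b = \<zero>" if a: "a \<in> mp q" for a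
  proof -
    obtain c where c: "c \<in> carrier A" "a = a0 \<otimes> c" using onto[OF a] by blast
    have "a \<otimes> b = c \<otimes> (a0 \<otimes> b)" unfolding c(2) using c(1) b(1) mp_carr[OF a0] by (simp add: A.m_ac)
    then show ?thesis using b(2) c(1) by simp
  qed
  have pow: "m [^] q \<in> mp q" if "m \<in> \<mm>" for m using mp_pow[of m 1 q] that mp_1 by simp
  show ?thesis
  proof (cases "b \<in> \<mm>")
    case True
    have "b [^] Suc q = \<zero>" using ann[OF pow[OF True]] by simp
    then show ?thesis by (rule nilpotent_zero[OF b(1)])
  next
    case False
    have u: "b \<in> Units A" by (rule unit_if_notin[OF b(1) False])
    have mz: "m = \<zero>" if m: "m \<in> \<mm>" for m
    proof -
      have mq: "m [^] q \<in> carrier A" by (rule mp_carr[OF pow[OF m]])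
      have "m [^] q = (m [^] q \<otimes> b) \<otimes> inv b" using mq b(1) u by (simp add: A.m_assoc)
      then have "m [^] q = \<zero>" using ann[OF pow[OF m]] u by simp
      then show ?thesis by (rule nilpotent_zero[OF Icarr[OF m]])
    qed
    have "t = \<zero>\<^bsub>T\<^esub>" if "t \<in> Tn 1" for t
      using that
    proof (induction t rule: Tn_induct)
      case (pure g c)
      then obtain a where a: "a \<in> mp 1" "g = el 1 a" unfolding gr_part_eq by blast
      have "a = \<zero>" using mz a(1) mp_1 by simp
      then have "g = \<zero>\<^bsub>G\<^esub>" unfolding a(2) using el_zero_iff[OF A.zero_closed] by simp
      then show ?case using pt_zero_left[OF pure(2)] by simp
    qed simp
    then show ?thesis using x0_nonzero x_T1[of 0] by simp
  qed
qed

text \<open>Surjectivity descends from T to G(A) and lifts to A, where a0 is not a zero divisor.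
  Injectivity then returns to G(A), and to T because an injective linear map over a field has a left
  inverse, which survives tensoring with K.\<close>

lemma injective_mult:
  assumes y: "y \<in> Gd d" and surj: "\<And>i t. \<lbrakk>i0 \<le> i; t \<in> Tn (i + d)\<rbrakk> \<Longrightarrow> \<exists>u\<in>Tn i. t = y \<otimes>\<^bsub>T\<^esub> u"
    and i: "i0 \<le> i" and t: "t \<in> Tn i" "y \<otimes>\<^bsub>T\<^esub> t = \<zero>\<^bsub>T\<^esub>"
  shows "t = \<zero>\<^bsub>T\<^esub>"
proof -
  obtain g0 where g0: "g0 \<in> Gn d" "y = pt g0 \<one>\<^bsub>K\<^esub>" using y unfolding Gd_def by blast
  obtain a0 where a0: "a0 \<in> mp d" "g0 = el d a0" using g0(1) unfolding gr_part_eq by blast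
  note g0c = Gn_sub[OF g0(1)]
  note a0c = mp_carr[OF a0(1)]
  have desc: "\<exists>g'\<in>Gn j. g = g0 \<otimes>\<^bsub>G\<^esub> g'" if "i0 \<le> j" "g \<in> Gn (j + d)" for j g
  proof (rule descent[OF g0(1) _ that(2)])
    fix t assume "t \<in> Tn (j + d)"
    then show "\<exists>u\<in>Tn j. t = pt g0 \<one>\<^bsub>K\<^esub> \<otimes>\<^bsub>T\<^esub> u" unfolding g0(2)[symmetric] by (rule surj[OF that(1)])
  qed
  have onto: "\<exists>b\<in>mp j. a = a0 \<otimes> b" if "i0 \<le> j" "a \<in> mp (j + d)" for j a
  proof (rule multiplication_onto[OF a0(1) _ that(2)])
    fix g assume "g \<in> Gn (j + d)"
    then show "\<exists>g'\<in>Gn j. g = el d a0 \<otimes>\<^bsub>G\<^esub> g'" unfolding a0(2)[symmetric] by (rule desc[OF that(1)])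
  qed
  have nzd: "b = \<zero>" if "b \<in> carrier A" "a0 \<otimes> b = \<zero>" for b
  proof (rule nonzerodivisor[OF a0(1) _ that, where q = "i0 + d"])
    fix a assume "a \<in> mp (i0 + d)"
    then have "\<exists>c\<in>mp i0. a = a0 \<otimes> c" by (rule onto[OF order_refl])
    then show "\<exists>c\<in>carrier A. a = a0 \<otimes> c" using mp_carr by blast
  qed
  \<comment> \<open>If \<open>a0 b\<close> lies one step deeper in the filtration, surjectivity in
    degree i + 1 writes it as \<open>a0 b'\<close> with b' in \<open>\<mm>^(i+1)\<close>. Cancelling
    a0 gives b = b', whose class in degree i is zero.\<close>
  have inj: "g' = \<zero>\<^bsub>G\<^esub>" if g': "g' \<in> Gn i" "g0 \<otimes>\<^bsub>G\<^esub> g' = \<zero>\<^bsub>G\<^esub>" for g'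
  proof -
    obtain b where b: "b \<in> mp i" "g' = el i b" using g'(1) unfolding gr_part_eq by blast
    note bc = mp_carr[OF b(1)]
    have "el (d + i) (a0 \<otimes> b) = \<zero>\<^bsub>G\<^esub>" using g'(2) unfolding a0(2) b(2) el_mult[OF a0(1) b(1)] .
    then have "a0 \<otimes> b \<in> mp (Suc i + d)"
      using el_zero_iff[OF A.m_closed[OF a0c bc]] by (simp add: add.commute)
    then have "\<exists>b'\<in>mp (Suc i). a0 \<otimes> b = a0 \<otimes> b'" by (rule onto[OF le_SucI[OF i]])
    then obtain b' where b': "b' \<in> mp (Suc i)" "a0 \<otimes> b = a0 \<otimes> b'" by blast
    note b'c = mp_carr[OF b'(1)]
    have "a0 \<otimes> (b \<ominus> b') = a0 \<otimes> b \<ominus> a0 \<otimes> b'"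
      using a0c bc b'c by (simp add: a_minus_def A.r_distr A.r_minus)
    also have "\<dots> = \<zero>" unfolding b'(2) using a0c b'c by simp
    finally have "b \<ominus> b' = \<zero>" by (rule nzd[OF A.minus_closed[OF bc b'c]])
    then have "b = b'" using bc b'c by simp
    then show ?thesis unfolding b(2) using el_zero_iff[OF bc] b'(1) by simp
  qed
  \<comment> \<open>The partial inverse \<open>g0 g' \<mapsto> g' \<otimes> 1\<close> of
    multiplication by g0. Extended to G(A) and then to T, it becomes a left inverse of
    multiplication by y on \<open>T_i\<close>; this is flatness of K over k made explicit.\<close>
  define \<Gamma> where "\<Gamma> = {(g0 \<otimes>\<^bsub>G\<^esub> g', pt g' \<one>\<^bsub>K\<^esub>) | g'. g' \<in> Gn i}"
  have minus: "\<kappa> (\<ominus>\<^bsub>k\<^esub> \<one>\<^bsub>k\<^esub>) \<otimes>\<^bsub>G\<^esub> g = \<ominus>\<^bsub>G\<^esub> g" if "g \<in> carrier G" for g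
  proof -
    interpret p: ring_hom_ring k G \<kappa> by (rule ring_hom_ringI2[OF k.ring_axioms G.ring_axioms gr_const_hom])
    show ?thesis using that by (simp add: G.l_minus)
  qed
  have graph: "linear_graph k G \<kappa> T (h \<circ> \<iota>) \<Gamma>"
    unfolding linear_graph_def
  proof (intro conjI allI impI ballI)
    show "\<Gamma> \<subseteq> carrier G \<times> carrier T"
    proof
      fix z assume "z \<in> \<Gamma>"
      then obtain g' where "z = (g0 \<otimes>\<^bsub>G\<^esub> g', pt g' \<one>\<^bsub>K\<^esub>)" "g' \<in> Gn i" unfolding \<Gamma>_def by blast
      then show "z \<in> carrier G \<times> carrier T" using Gn_sub g0c by simp
    qed
    fix a m a' m' assume "(a, m) \<in> \<Gamma>" "(a', m') \<in> \<Gamma>"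
    then obtain u u' where u: "u \<in> Gn i" "a = g0 \<otimes>\<^bsub>G\<^esub> u" "m = pt u \<one>\<^bsub>K\<^esub>"
      "u' \<in> Gn i" "a' = g0 \<otimes>\<^bsub>G\<^esub> u'" "m' = pt u' \<one>\<^bsub>K\<^esub>" unfolding \<Gamma>_def by blast
    have "a \<oplus>\<^bsub>G\<^esub> a' = g0 \<otimes>\<^bsub>G\<^esub> (u \<oplus>\<^bsub>G\<^esub> u')"
      unfolding u(2,5) by (rule G.r_distr[OF Gn_sub[OF u(1)] Gn_sub[OF u(4)] g0c, symmetric])
    moreover have "m \<oplus>\<^bsub>T\<^esub> m' = pt (u \<oplus>\<^bsub>G\<^esub> u') \<one>\<^bsub>K\<^esub>"
      unfolding u(3,6) by (rule pt_add_left[OF Gn_sub[OF u(1)] Gn_sub[OF u(4)] K.one_closed, symmetric])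
    ultimately show "(a \<oplus>\<^bsub>G\<^esub> a', m \<oplus>\<^bsub>T\<^esub> m') \<in> \<Gamma>" unfolding \<Gamma>_def using Gn_add[OF u(1,4)] by blast
  next
    fix c a m assume c: "c \<in> carrier k" and "(a, m) \<in> \<Gamma>"
    then obtain u where u: "u \<in> Gn i" "a = g0 \<otimes>\<^bsub>G\<^esub> u" "m = pt u \<one>\<^bsub>K\<^esub>" unfolding \<Gamma>_def by blast
    have "\<kappa> c \<otimes>\<^bsub>G\<^esub> a = g0 \<otimes>\<^bsub>G\<^esub> (\<kappa> c \<otimes>\<^bsub>G\<^esub> u)"
      unfolding u(2) by (rule G.m_lcomm[OF kappa_closed[OF c] g0c Gn_sub[OF u(1)]])
    moreover have "(h \<circ> \<iota>) c \<otimes>\<^bsub>T\<^esub> m = pt (\<kappa> c \<otimes>\<^bsub>G\<^esub> u) \<one>\<^bsub>K\<^esub>"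
      unfolding u(3) comp_apply by (rule pt_kappa[OF Gn_sub[OF u(1)] c, symmetric])
    moreover have "\<kappa> c \<otimes>\<^bsub>G\<^esub> u \<in> Gn i" using Gn_mult[OF kappa_Gn[OF c] u(1)] by simp
    ultimately show "(\<kappa> c \<otimes>\<^bsub>G\<^esub> a, (h \<circ> \<iota>) c \<otimes>\<^bsub>T\<^esub> m) \<in> \<Gamma>" unfolding \<Gamma>_def by blast
  next
    fix a m m' assume "(a, m) \<in> \<Gamma>" "(a, m') \<in> \<Gamma>"
    then obtain u u' where u: "u \<in> Gn i" "a = g0 \<otimes>\<^bsub>G\<^esub> u" "m = pt u \<one>\<^bsub>K\<^esub>"
      "u' \<in> Gn i" "a = g0 \<otimes>\<^bsub>G\<^esub> u'" "m' = pt u' \<one>\<^bsub>K\<^esub>" unfolding \<Gamma>_def by blast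
    note uc = Gn_sub[OF u(1)] Gn_sub[OF u(4)]
    have "\<ominus>\<^bsub>G\<^esub> u' \<in> Gn i"
      using Gn_mult[OF kappa_Gn[OF k.a_inv_closed[OF k.one_closed]] u(4)] unfolding minus[OF uc(2)] by simp
    then have d: "u \<ominus>\<^bsub>G\<^esub> u' \<in> Gn i" unfolding a_minus_def by (rule Gn_add[OF u(1)])
    have "g0 \<otimes>\<^bsub>G\<^esub> (u \<ominus>\<^bsub>G\<^esub> u') = g0 \<otimes>\<^bsub>G\<^esub> u \<ominus>\<^bsub>G\<^esub> g0 \<otimes>\<^bsub>G\<^esub> u'"
      using g0c uc by (simp add: a_minus_def G.r_distr G.r_minus)
    also have "\<dots> = \<zero>\<^bsub>G\<^esub>" unfolding u(2)[symmetric] u(5)[symmetric] unfolding u(2) using g0c uc by simp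
    finally have "u \<ominus>\<^bsub>G\<^esub> u' = \<zero>\<^bsub>G\<^esub>" by (rule inj[OF d])
    then have "u = u'" using uc by simp
    then show "m = m'" unfolding u(3,6) by simp
  qed
  have hi: "h \<circ> \<iota> \<in> ring_hom k T" by (rule ring_hom_trans[OF iota h_hom])
  obtain l where l: "\<And>a. a \<in> carrier G \<Longrightarrow> l a \<in> carrier T"
    "\<And>a b. \<lbrakk>a \<in> carrier G; b \<in> carrier G\<rbrakk> \<Longrightarrow> l (a \<oplus>\<^bsub>G\<^esub> b) = l a \<oplus>\<^bsub>T\<^esub> l b"
    "\<And>c a. \<lbrakk>c \<in> carrier k; a \<in> carrier G\<rbrakk> \<Longrightarrow> l (\<kappa> c \<otimes>\<^bsub>G\<^esub> a) = (h \<circ> \<iota>) c \<otimes>\<^bsub>T\<^esub> l a"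
    "\<And>a m. (a, m) \<in> \<Gamma> \<Longrightarrow> l a = m"
  proof (rule linear_extension[OF k_field G_cring T_cring gr_const_hom hi graph])
    fix f
    assume f: "\<And>a. a \<in> carrier G \<Longrightarrow> f a \<in> carrier T"
      "\<And>a b. \<lbrakk>a \<in> carrier G; b \<in> carrier G\<rbrakk> \<Longrightarrow> f (a \<oplus>\<^bsub>G\<^esub> b) = f a \<oplus>\<^bsub>T\<^esub> f b"
      "\<And>c a. \<lbrakk>c \<in> carrier k; a \<in> carrier G\<rbrakk> \<Longrightarrow> f (\<kappa> c \<otimes>\<^bsub>G\<^esub> a) = (h \<circ> \<iota>) c \<otimes>\<^bsub>T\<^esub> f a"
      "\<And>a m. (a, m) \<in> \<Gamma> \<Longrightarrow> f a = m"
    show thesis by (rule that[of f]) (fact f)+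
  qed
  have "\<exists>\<Phi>. (\<forall>t\<in>carrier T. \<Phi> t \<in> carrier T) \<and>
    (\<forall>t\<in>carrier T. \<forall>u\<in>carrier T. \<Phi> (t \<oplus>\<^bsub>T\<^esub> u) = \<Phi> t \<oplus>\<^bsub>T\<^esub> \<Phi> u) \<and>
    (\<forall>a\<in>carrier G. \<forall>b\<in>carrier K. \<Phi> (pt a b) = l a \<otimes>\<^bsub>T\<^esub> h b)"
  proof (rule lift[OF T.abelian_group_axioms])
    show "l a \<otimes>\<^bsub>T\<^esub> h b \<in> carrier T" if "a \<in> carrier G" "b \<in> carrier K" for a b
      by (rule T.m_closed[OF l(1)[OF that(1)] h_closed[OF that(2)]])
    show "l (a \<oplus>\<^bsub>G\<^esub> a') \<otimes>\<^bsub>T\<^esub> h b = l a \<otimes>\<^bsub>T\<^esub> h b \<oplus>\<^bsub>T\<^esub> l a' \<otimes>\<^bsub>T\<^esub> h b"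
      if "a \<in> carrier G" "a' \<in> carrier G" "b \<in> carrier K" for a a' b
      unfolding l(2)[OF that(1,2)] by (rule T.l_distr[OF l(1)[OF that(1)] l(1)[OF that(2)] h_closed[OF that(3)]])
    show "l a \<otimes>\<^bsub>T\<^esub> h (b \<oplus>\<^bsub>K\<^esub> b') = l a \<otimes>\<^bsub>T\<^esub> h b \<oplus>\<^bsub>T\<^esub> l a \<otimes>\<^bsub>T\<^esub> h b'"
      if "a \<in> carrier G" "b \<in> carrier K" "b' \<in> carrier K" for a b b'
      unfolding ring_hom_add[OF h_hom that(2,3)]
      by (rule T.r_distr[OF h_closed[OF that(2)] h_closed[OF that(3)] l(1)[OF that(1)]])
    show "l (\<kappa> e \<otimes>\<^bsub>G\<^esub> a) \<otimes>\<^bsub>T\<^esub> h b = l a \<otimes>\<^bsub>T\<^esub> h (\<iota> e \<otimes>\<^bsub>K\<^esub> b)"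
      if "a \<in> carrier G" "b \<in> carrier K" "e \<in> carrier k" for a b e
      unfolding l(3)[OF that(3,1)] ring_hom_mult[OF h_hom iota_closed[OF that(3)] that(2)] comp_apply
      using l(1)[OF that(1)] h_closed[OF that(2)] h_closed[OF iota_closed[OF that(3)]] by (simp add: T.m_ac)
  qed
  then obtain \<Phi> where F: "\<forall>t\<in>carrier T. \<forall>u\<in>carrier T. \<Phi> (t \<oplus>\<^bsub>T\<^esub> u) = \<Phi> t \<oplus>\<^bsub>T\<^esub> \<Phi> u"
    "\<forall>t\<in>carrier T. \<Phi> t \<in> carrier T"
    and pt: "\<forall>a\<in>carrier G. \<forall>b\<in>carrier K. \<Phi> (pt a b) = l a \<otimes>\<^bsub>T\<^esub> h b" by blast
  have yc: "y \<in> carrier T" unfolding g0(2) using g0c by simp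
  have left_inv: "\<Phi> (y \<otimes>\<^bsub>T\<^esub> u) = u" if "u \<in> Tn i" for u
    using that
  proof (induction u rule: Tn_induct)
    case (pure g' c)
    note gc = Gn_sub[OF pure(1)]
    have "(g0 \<otimes>\<^bsub>G\<^esub> g', pt g' \<one>\<^bsub>K\<^esub>) \<in> \<Gamma>" unfolding \<Gamma>_def using pure(1) by blast
    then have lg: "l (g0 \<otimes>\<^bsub>G\<^esub> g') = pt g' \<one>\<^bsub>K\<^esub>" by (rule l(4))
    have "y \<otimes>\<^bsub>T\<^esub> pt g' c = pt (g0 \<otimes>\<^bsub>G\<^esub> g') c"
      unfolding g0(2) using pt_mult[OF g0c K.one_closed gc pure(2)] pure(2) by simp
    then show ?case
      using bspec[OF bspec[OF pt G.m_closed[OF g0c gc]] pure(2)] unfolding lg by (simp add: pt_eq[OF gc pure(2), symmetric])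
  next
    case (add t u)
    note c = Tn_carr[OF add(1)] Tn_carr[OF add(2)]
    have "\<Phi> (y \<otimes>\<^bsub>T\<^esub> t \<oplus>\<^bsub>T\<^esub> y \<otimes>\<^bsub>T\<^esub> u) = t \<oplus>\<^bsub>T\<^esub> u"
      using bspec[OF bspec[OF F(1) T.m_closed[OF yc c(1)]] T.m_closed[OF yc c(2)]] unfolding add(3,4) .
    then show ?case using c yc by (simp add: T.r_distr)
  qed
  have "t = \<Phi> \<zero>\<^bsub>T\<^esub>" using left_inv[OF t(1)] t(2) by simp
  moreover have "\<zero>\<^bsub>T\<^esub> = \<Phi> \<zero>\<^bsub>T\<^esub>" using left_inv[OF Tn_zero] yc by simp
  ultimately show ?thesis by (simp only:)
qed

text \<open>A class in the reduced ring is zero exactly for nilpotent representatives, so the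
  tangent ideal consists of the polynomials whose value in T is nilpotent.\<close>

lemma geometric_tangents_eq:
  "geometric_tangents A \<mm> K \<iota> r x = graded_algebra.tangent_lines T K h r x"
proof -
  interpret gr: graded_algebra T K h Tn pr r x by (rule graded)
  interpret N: ideal "nilradical T" T by (rule T.nilradical_ideal)
  let ?\<pi> = "\<lambda>y. nilradical T +>\<^bsub>T\<^esub> y"
  have "mpoly_eval K r (red T) (\<lambda>c. ?\<pi> (h c)) (\<lambda>i. ?\<pi> (x i)) f = \<zero>\<^bsub>red T\<^esub> \<longleftrightarrow>
      (\<exists>n::nat. mpoly_eval K r T h x f [^]\<^bsub>T\<^esub> n = \<zero>\<^bsub>T\<^esub>)" if f: "f \<in> carrier (mpoly_ring K r)" for f
  proof -
    have c: "mpoly_eval K r T h x f \<in> carrier T" by (rule gr.evT_mem(1)[OF f])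
    have "?\<pi> (mpoly_eval K r T h x f) = mpoly_eval K r (T Quot nilradical T) (\<lambda>c. ?\<pi> (h c)) (\<lambda>i. ?\<pi> (x i)) f"
      by (rule mpoly_eval_hom[OF gr.mpoly_evaluation_T N.quotient_is_cring[OF T_cring] N.rcos_ring_hom f])
    then have "mpoly_eval K r (red T) (\<lambda>c. ?\<pi> (h c)) (\<lambda>i. ?\<pi> (x i)) f = \<zero>\<^bsub>red T\<^esub> \<longleftrightarrow>
        ?\<pi> (mpoly_eval K r T h x f) = nilradical T"
      unfolding red_def FactRing_zero by (simp only:)
    also have "\<dots> \<longleftrightarrow> mpoly_eval K r T h x f \<in> nilradical T"
      by (rule iffI[OF N.rcos_const_imp_mem[OF c] T.a_rcos_zero[OF T.nilradical_ideal]])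
    also have "\<dots> \<longleftrightarrow> (\<exists>n::nat. mpoly_eval K r T h x f [^]\<^bsub>T\<^esub> n = \<zero>\<^bsub>T\<^esub>)" 
      unfolding nilradical_def mem_Collect_eq by (rule iffI, erule conjunct2, rule conjI[OF c])
    finally show ?thesis .
  qed
  then have "tangent_ideal A \<mm> K \<iota> r x
      = {f \<in> carrier (mpoly_ring K r). \<exists>n::nat. mpoly_eval K r T h x f [^]\<^bsub>T\<^esub> n = \<zero>\<^bsub>T\<^esub>}"
    unfolding tangent_ideal_def Let_def by blast
  then show ?thesis unfolding geometric_tangents_def gr.tangent_lines_def by blast
qed

lemma reduced_T:
  assumes "Proj_reduced T Tn" "generic_position K r (geometric_tangents A \<mm> K \<iota> r x)"
  shows "reduced_ring T"
proof -
  interpret gr: graded_algebra T K h Tn pr r x by (rule graded)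
  have "graded_generic T K h Tn pr r x Gd"
  proof (intro graded_generic.intro graded_generic_axioms.intro graded)
    show "Gd n \<subseteq> Tn n" for n unfolding Gd_def using pure_Tn[OF _ K.one_closed] by blast
    show "\<zero>\<^bsub>T\<^esub> \<in> Gd n" for n
      unfolding Gd_def pt_zero_left[OF K.one_closed, symmetric] using Gn_zero by blast
    show "t \<oplus>\<^bsub>T\<^esub> u \<in> Gd n" if tu: "t \<in> Gd n" "u \<in> Gd n" for t u n
    proof -
      obtain a b where ab: "t = pt a \<one>\<^bsub>K\<^esub>" "a \<in> Gn n" "u = pt b \<one>\<^bsub>K\<^esub>" "b \<in> Gn n"
        using tu unfolding Gd_def by blast
      show ?thesis
        unfolding ab(1,3) pt_add_left[OF Gn_sub[OF ab(2)] Gn_sub[OF ab(4)] K.one_closed, symmetric] Gd_def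
        using Gn_add[OF ab(2,4)] by blast
    qed
    show "t \<otimes>\<^bsub>T\<^esub> u \<in> Gd (n + m)" if tu: "t \<in> Gd n" "u \<in> Gd m" for t u n m
    proof -
      obtain a b where ab: "t = pt a \<one>\<^bsub>K\<^esub>" "a \<in> Gn n" "u = pt b \<one>\<^bsub>K\<^esub>" "b \<in> Gn m"
        using tu unfolding Gd_def by blast
      have "t \<otimes>\<^bsub>T\<^esub> u = pt (a \<otimes>\<^bsub>G\<^esub> b) \<one>\<^bsub>K\<^esub>"
        unfolding ab(1,3) pt_mult[OF Gn_sub[OF ab(2)] K.one_closed Gn_sub[OF ab(4)] K.one_closed] by simp
      then show ?thesis unfolding Gd_def using Gn_mult[OF ab(2,4)] by blast
    qed
    \<comment> \<open>The part of degree one is spanned over K by the g \<otimes> 1, so a character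
      killing all of these kills every coordinate.\<close>
    show "\<exists>g\<in>Gd 1. \<chi> g \<noteq> \<zero>\<^bsub>K\<^esub>" if chi: "\<chi> \<in> gr.nzchars" for \<chi>
    proof (rule ccontr)
      assume n: "\<not> ?thesis"
      have c: "\<chi> \<in> gr.chars" using chi unfolding gr.nzchars_def by simp
      interpret chi: ring_hom_cring T K \<chi> by (rule gr.char_hom[OF c])
      have z: "\<chi> t = \<zero>\<^bsub>K\<^esub>" if "t \<in> Tn 1" for t
        using that
      proof (induction t rule: Tn_induct)
        case (pure g d)
        note gc = Gn_sub[OF pure(1)]
        have "\<chi> (pt g \<one>\<^bsub>K\<^esub>) = \<zero>\<^bsub>K\<^esub>" using n pure(1) unfolding Gd_def by blast
        then show ?case
          unfolding pt_eq[OF gc pure(2)] using chi.hom_mult[OF pt_closed[OF gc K.one_closed] h_closed[OF pure(2)]]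
            chi.hom_closed[OF h_closed[OF pure(2)]] by simp
      next
        case (add t u)
        then show ?case using chi.hom_add[OF Tn_carr[OF add(1)] Tn_carr[OF add(2)]] by simp
      qed
      obtain i where "i \<le> r" "\<chi> (x i) \<noteq> \<zero>\<^bsub>K\<^esub>" using chi unfolding gr.nzchars_def by blast
      then show False using z[OF x_T1] by simp
    qed
    show "t = \<zero>\<^bsub>T\<^esub>"
      if "y \<in> Gd d" "\<And>i t. \<lbrakk>i0 \<le> i; t \<in> Tn (i + d)\<rbrakk> \<Longrightarrow> \<exists>u\<in>Tn i. t = y \<otimes>\<^bsub>T\<^esub> u"
        "i0 \<le> i" "t \<in> Tn i" "y \<otimes>\<^bsub>T\<^esub> t = \<zero>\<^bsub>T\<^esub>" for y d i0 i t
      by (rule injective_mult[OF that(1) _ that(3,4,5)]) (rule that(2))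
    show "Proj_reduced T Tn" by (rule assms(1))
    show "generic_position K r gr.tangent_lines" using assms(2) unfolding geometric_tangents_eq .
    show "\<one>\<^bsub>T\<^esub> \<noteq> \<zero>\<^bsub>T\<^esub>" by (rule T_nontrivial)
  qed
  then show ?thesis by (rule graded_generic.reduced)
qed

text \<open>Nilpotents of G(A) become nilpotents of T under the injective map g \<mapsto> g
  \<otimes> 1.\<close>

lemma reduced_G:
  assumes "reduced_ring T"
  shows "reduced_ring G"
  unfolding reduced_ring_def
proof (intro ballI allI impI)
  fix g and n :: nat assume g: "g \<in> carrier G" "g [^]\<^bsub>G\<^esub> n = \<zero>\<^bsub>G\<^esub>"
  have "pt g \<one>\<^bsub>K\<^esub> [^]\<^bsub>T\<^esub> m = pt (g [^]\<^bsub>G\<^esub> m) \<one>\<^bsub>K\<^esub>" for m :: nat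
  proof (induction m)
    case 0
    show ?case by (simp add: pt_one)
  next
    case (Suc m)
    show ?case
      using pt_mult[OF G.nat_pow_closed[OF g(1)] K.one_closed g(1) K.one_closed, of m] Suc by simp
  qed
  then have "pt g \<one>\<^bsub>K\<^esub> [^]\<^bsub>T\<^esub> n = \<zero>\<^bsub>T\<^esub>" using g(2) pt_zero_left[OF K.one_closed] by simp
  then have "pt g \<one>\<^bsub>K\<^esub> = \<zero>\<^bsub>T\<^esub>"
    using assms pt_closed[OF g(1) K.one_closed] unfolding reduced_ring_def by blast
  then show "g = \<zero>\<^bsub>G\<^esub>" using pt_nonzero[OF g(1)] by blast
qed

end

theorem theorem2p12:
  fixes A :: "('a, 'c) ring_scheme" and \<mm> :: "'a set"
    and K :: "('b, 'd) ring_scheme" and \<iota> :: "'a set \<Rightarrow> 'b"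
    and r :: nat and x :: "nat \<Rightarrow> ((nat \<Rightarrow> 'a set) \<times> 'b \<Rightarrow> int) set"
  assumes "noetherian_local_ring A \<mm>"
    and "reduced_ring A"
    and "krull_dim A = 1"
    and "\<iota> \<in> ring_hom (A Quot \<mm>) K"
    and "algebraic_closure K (\<iota> ` carrier (A Quot \<mm>))"
    and "emdim A \<mm> (r + 1)"
    and "closed_point_ordinary A \<mm> K \<iota>"
    and "tangent_coordinates A \<mm> K \<iota> r x"
    and "generic_position K r (geometric_tangents A \<mm> K \<iota> r x)"
  shows "reduced_ring (gr_ext A \<mm> K \<iota>) \<and> reduced_ring (gr A \<mm>)"
proof -
  interpret K: algebraic_closure K "\<iota> ` carrier (A Quot \<mm>)" by fact
  have A: "cring A" "maximalideal \<mm> A" using assms(1) unfolding noetherian_local_ring_def by blast+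
  interpret tangent_cone A \<mm> K \<iota> r x
    by (intro tangent_cone.intro noetherian_local.intro adic_filtration.intro noetherian_local_axioms.intro
        tangent_cone_axioms.intro A maximalideal.axioms(1)[OF A(2)] K.algebraically_closed_axioms assms)
  have "reduced_ring T" by (rule reduced_T[OF assms(7)[unfolded closed_point_ordinary_def] assms(9)])
  then show ?thesis using reduced_G by blast
qed

end
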